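(* Let $d\in\mathbb N$, $z>0$. Let $a:\mathbb R^d\to[0,\infty]$ and $b:\mathbb R^d\to[0,\infty]$ be measurable and even functions with $a,b\in L^1(\mathbb R^d,dx)$ and $\operatorname{ess\,sup}_{x\in\mathbb R^d}b(x)<\infty$. Additionally assume that $b(x)\to0$ as $|x|\to\infty$. For $\varepsilon>0$ let $L_\varepsilon$ be the generator of the dynamics of binary jumps with $$q_\varepsilon(x,h_1,h_2):=\varepsilon^{2d}a(\varepsilon h_1)a(\varepsilon h_2)\big(b(x)+b(x+h_2-h_1)\big).$$ Then, for each $\varphi\in C_0(\mathbb R^d)$ and $F=e^{\langle\varphi,\cdot\rangle}$, $$L_\varepsilon F\to L_0F\quad\text{in }L^2(\Gamma,\pi_z)\text{ as }\varepsilon\to0,$$ where $$\begin{aligned}(L_0F)(\gamma):=\langle a\rangle^2\Big[&\sum_{\{x_1,x_2\}\subset\gamma}b(x_2-x_1)\big(F(\gamma\setminus\{x_1,x_2\})-F(\gamma)\big)\\&+\frac12\int_{\mathbb R^d}z\,dx_1\int_{\mathbb R^d}z\,dx_2\,b(x_2-x_1)\big(F(\gamma\cup\{x_1,x_2\})-F(\gamma)\big)\\&+z\langle b\rangle\sum_{x\in\gamma}\big(F(\gamma\setminus\{x\})-F(\gamma)\big)+z\langle b\rangle\int_{\mathbb R^d}z\,dx\,\big(F(\gamma\cup\{x\})-F(\gamma)\big)\Big].\end{aligned}$$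
   Context: $\Gamma$ is the set of all locally finite subsets $\gamma\subset\mathbb R^d$, identified with the Radon measures $\sum_{x\in\gamma}\delta_x$ and equipped with the relative vague topology; $\langle\varphi,\gamma\rangle:=\sum_{x\in\gamma}\varphi(x)$, and for $f\in L^1(\mathbb R^d,dx)$, $\langle f\rangle:=\int_{\mathbb R^d}f(x)\,dx$. $C_0(\mathbb R^d)$ is the space of continuous real functions on $\mathbb R^d$ with compact support. $\pi_z$ is the Poisson measure on $(\Gamma,\mathcal B(\Gamma))$ with intensity measure $z\,dx$. The operator $L_\varepsilon$ is defined on functions $F(\gamma)=g(\langle\varphi_1,\gamma\rangle,\dots,\langle\varphi_N,\gamma\rangle)$ ($N\in\mathbb N$, $\varphi_i\in C_0(\mathbb R^d)$, $g$ bounded continuous on $\mathbb R^N$) by $$\begin{aligned}(L_\varepsilon F)(\gamma)&=\sum_{\{x_1,x_2\}\subset\gamma}\int_{\mathbb R^d}dh_1\int_{\mathbb R^d}dh_2\,q_\varepsilon(x_2-x_1,h_1,h_2)\big(F(\gamma\setminus\{x_1,x_2\}\cup\{x_1+h_1,x_2+h_2\})-F(\gamma)\big)\\&=\sum_{\{x_1,x_2\}\subset\gamma}\int_{\mathbb R^d}dh_1\int_{\mathbb R^d}dh_2\,a(h_1)a(h_2)\big(b(x_2-x_1)+b(x_2-x_1+(h_2-h_1)/\varepsilon)\big)\\&\qquad\times\big(F(\gamma\setminus\{x_1,x_2\}\cup\{x_1+h_1/\varepsilon,x_2+h_2/\varepsilon\})-F(\gamma)\big),\end{aligned}$$ and $(-L_\varepsilon,D(L_\varepsilon))$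 is its Friedrichs extension in $L^2(\Gamma,\pi_z)$ (which coincides with its closure). For $\varphi\in C_0(\mathbb R^d)$ one has $e^{\langle\varphi,\cdot\rangle}\in D(L_\varepsilon)$ and the action of $L_\varepsilon$ on $F=e^{\langle\varphi,\cdot\rangle}$ is given by the same formula. *)

theory Defs
  imports "HOL-Probability.Probability" "HOL-Probability.Essential_Supremum"
begin

section \<open>Configuration space and Poisson measure\<close>

definition configurations :: "'a::euclidean_space set set" where
  "configurations = {\<gamma>. \<forall>K. compact K \<longrightarrow> finite (\<gamma> \<inter> K)}"

definition continuous_compact_support :: "('a::euclidean_space \<Rightarrow> real) set" where
  "continuous_compact_support =
     {\<phi>. continuous_on UNIV \<phi> \<and> compact (closure {x. \<phi> x \<noteq> 0})}"

definition pairing :: "('a \<Rightarrow> real) \<Rightarrow> 'a set \<Rightarrow> real" where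
  "pairing \<phi> \<gamma> = (\<Sum>\<^sub>\<infinity>x\<in>\<gamma>. \<phi> x)"

definition vague_topology :: "'a::euclidean_space set topology" where
  "vague_topology = topology_generated_by
     {{\<gamma> \<in> configurations. pairing \<phi> \<gamma> \<in> U} |\<phi> U.
        \<phi> \<in> continuous_compact_support \<and> open U}"

definition configuration_borel :: "'a::euclidean_space set measure" where
  "configuration_borel = sigma configurations {U. openin vague_topology U}"

definition is_poisson_measure :: "real \<Rightarrow> 'a::euclidean_space set measure \<Rightarrow> bool" where
  "is_poisson_measure z M \<longleftrightarrow>
     prob_space M \<and> sets M = sets configuration_borel \<and>
     (\<forall>A k. A \<in> sets borel \<longrightarrow> bounded A \<longrightarrow>
        measure M {\<gamma> \<in> space M. card (\<gamma> \<inter> A) = k} =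
          (z * measure lborel A) ^ k / fact k * exp (- (z * measure lborel A))) \<and>
     (\<forall>(I :: nat set) A. finite I \<longrightarrow> disjoint_family_on A I \<longrightarrow>
        (\<forall>i\<in>I. A i \<in> sets borel \<and> bounded (A i)) \<longrightarrow>
        prob_space.indep_vars M (\<lambda>_. count_space UNIV) (\<lambda>i \<gamma>. card (\<gamma> \<inter> A i)) I)"


section \<open>Real square-integrable functions and the Friedrichs extension\<close>

definition in_L2 :: "'b measure \<Rightarrow> ('b \<Rightarrow> real) \<Rightarrow> bool" where
  "in_L2 M f \<longleftrightarrow> f \<in> borel_measurable M \<and> integrable M (\<lambda>x. (f x)\<^sup>2)"

definition L2_norm :: "'b measure \<Rightarrow> ('b \<Rightarrow> real) \<Rightarrow> real" where
  "L2_norm M f = sqrt (\<integral>x. (f x)\<^sup>2 \<partial>M)"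

text \<open>
  Operators are given by their graphs, whose elements are pairs of representatives of classes
  modulo equality almost everywhere. For a non-negative symmetric operator \<open>T\<close> with dense
  domain \<open>D\<close>, the Friedrichs extension is the restriction of the adjoint of \<open>T\<close> to those
  functions which belong to the domain of the closure of the quadratic form
  \<open>v \<mapsto> \<integral> T v * v\<close> on \<open>D\<close>.
\<close>

definition friedrichs_extension ::
  "'b measure \<Rightarrow> ('b \<Rightarrow> real) set \<Rightarrow> (('b \<Rightarrow> real) \<Rightarrow> 'b \<Rightarrow> real) \<Rightarrow>
     (('b \<Rightarrow> real) \<times> ('b \<Rightarrow> real)) set" where
  "friedrichs_extension M D T =
     {(u, w). in_L2 M u \<and> in_L2 M w \<and>
        (\<forall>v\<in>D. (\<integral>x. u x * T v x \<partial>M) = (\<integral>x. w x * v x \<partial>M)) \<and>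
        (\<exists>s :: nat \<Rightarrow> 'b \<Rightarrow> real. (\<forall>n. s n \<in> D) \<and>
           (\<lambda>n. L2_norm M (\<lambda>x. s n x - u x)) \<longlonglongrightarrow> 0 \<and>
           (\<forall>e>0. \<exists>N. \<forall>m\<ge>N. \<forall>n\<ge>N.
              (\<integral>x. T (\<lambda>y. s m y - s n y) x * (s m x - s n x) \<partial>M) < e))}"


section \<open>Binary jumps\<close>

text \<open>
  Points of \<open>\<real>\<^sup>N\<close> are the functions in \<open>{..<N} \<rightarrow>\<^sub>E UNIV\<close>.
\<close>

definition cylinder_functions :: "('a::euclidean_space set \<Rightarrow> real) set" where
  "cylinder_functions =
     {F. \<exists>(N::nat) \<phi> (g :: (nat \<Rightarrow> real) \<Rightarrow> real).
        (\<forall>i<N. \<phi> i \<in> continuous_compact_support) \<and>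
        continuous_map (product_topology (\<lambda>_. euclideanreal) {..<N}) euclideanreal g \<and>
        bounded (g ` ({..<N} \<rightarrow>\<^sub>E UNIV)) \<and>
        F = (\<lambda>\<gamma>. g (\<lambda>i\<in>{..<N}. pairing (\<phi> i) \<gamma>))}"

text \<open>
  The sum over unordered pairs of distinct points of \<open>\<gamma>\<close>, for \<open>f\<close> symmetric in its two
  arguments; each pair occurs twice on the right-hand side.
\<close>

definition pair_sum :: "'a set \<Rightarrow> ('a \<Rightarrow> 'a \<Rightarrow> real) \<Rightarrow> real" where
  "pair_sum \<gamma> f = (1/2) * (\<Sum>\<^sub>\<infinity>(x, y)\<in>{(x, y). x \<in> \<gamma> \<and> y \<in> \<gamma> \<and> x \<noteq> y}. f x y)"

text \<open>
  Infinite values of the rates are replaced by 0 by \<open>enn2real\<close>. For the rates below these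
  occur only on Lebesgue null sets, and affect the operators only on null sets of the Poisson
  measure; the same holds for the configurations for which a sum over pairs does not converge.
\<close>

definition binary_jump_operator ::
  "('a \<Rightarrow> 'a \<Rightarrow> 'a \<Rightarrow> ennreal) \<Rightarrow> ('a::euclidean_space set \<Rightarrow> real) \<Rightarrow> 'a set \<Rightarrow> real" where
  "binary_jump_operator q F \<gamma> =
     pair_sum \<gamma> (\<lambda>x\<^sub>1 x\<^sub>2. \<integral>h\<^sub>1. (\<integral>h\<^sub>2. enn2real (q (x\<^sub>2 - x\<^sub>1) h\<^sub>1 h\<^sub>2) *
        (F (\<gamma> - {x\<^sub>1, x\<^sub>2} \<union> {x\<^sub>1 + h\<^sub>1, x\<^sub>2 + h\<^sub>2}) - F \<gamma>) \<partial>lborel) \<partial>lborel)"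

definition binary_jump_generator ::
  "'a::euclidean_space set measure \<Rightarrow> ('a \<Rightarrow> 'a \<Rightarrow> 'a \<Rightarrow> ennreal) \<Rightarrow>
     (('a set \<Rightarrow> real) \<times> ('a set \<Rightarrow> real)) set" where
  "binary_jump_generator M q =
     {(u, w). (u, \<lambda>\<gamma>. - w \<gamma>) \<in>
        friedrichs_extension M cylinder_functions (\<lambda>F \<gamma>. - binary_jump_operator q F \<gamma>)}"

definition scaled_rate ::
  "('a \<Rightarrow> ennreal) \<Rightarrow> ('a \<Rightarrow> ennreal) \<Rightarrow> real \<Rightarrow> 'a::euclidean_space \<Rightarrow> 'a \<Rightarrow> 'a \<Rightarrow> ennreal" where
  "scaled_rate a b \<epsilon> x h\<^sub>1 h\<^sub>2 =
     ennreal (\<epsilon> ^ (2 * DIM('a))) * a (\<epsilon> *\<^sub>R h\<^sub>1) * a (\<epsilon> *\<^sub>R h\<^sub>2) * (b x + b (x + h\<^sub>2 - h\<^sub>1))"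

definition total_mass :: "('a::euclidean_space \<Rightarrow> ennreal) \<Rightarrow> real" where
  "total_mass f = enn2real (\<integral>\<^sup>+x. f x \<partial>lborel)"

definition limit_operator ::
  "real \<Rightarrow> ('a \<Rightarrow> ennreal) \<Rightarrow> ('a \<Rightarrow> ennreal) \<Rightarrow>
     ('a::euclidean_space set \<Rightarrow> real) \<Rightarrow> 'a set \<Rightarrow> real" where
  "limit_operator z a b F \<gamma> = (total_mass a)\<^sup>2 *
     (pair_sum \<gamma> (\<lambda>x\<^sub>1 x\<^sub>2. enn2real (b (x\<^sub>2 - x\<^sub>1)) * (F (\<gamma> - {x\<^sub>1, x\<^sub>2}) - F \<gamma>))
      + 1/2 * (\<integral>x\<^sub>1. z * (\<integral>x\<^sub>2. z *
          (enn2real (b (x\<^sub>2 - x\<^sub>1)) * (F (\<gamma> \<union> {x\<^sub>1, x\<^sub>2}) - F \<gamma>)) \<partial>lborel) \<partial>lborel)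
      + z * total_mass b * (\<Sum>\<^sub>\<infinity>x\<in>\<gamma>. F (\<gamma> - {x}) - F \<gamma>)
      + z * total_mass b * (\<integral>x. z * (F (\<gamma> \<union> {x}) - F \<gamma>) \<partial>lborel))"

end

theory Submission
  imports Defs
begin

text \<open>
  Moving, adding or deleting points multiplies \<open>F = exp \<langle>\<phi>, \<cdot>\<rangle>\<close> by an explicit factor.
  Hence the jump operator acts on \<open>F\<close> as multiplication by a pair functional
  \<open>1/2 * \<Sum>G\<^sub>\<epsilon>(x, y)\<close>, and the limit operator as multiplication by a pair sum plus a sum over
  single points plus a constant (\<open>Lop_decomposition\<close>, \<open>limit_operator_eq\<close>). The difference is
  \<open>F * X\<close> with \<open>X = \<Sum>H(x, y) - \<Sum>g(x) - c\<close>, so the claim says that the second moment of \<open>X\<close>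
  under the tilted measure \<open>F\<^sup>2 \<pi>\<^sub>z\<close> tends to zero. This measure satisfies a Mecke formula with
  intensity \<open>z exp(2\<phi>) dx\<close>, and applying the formula repeatedly expresses the second moment by
  the mean of \<open>X\<close>, the \<open>L\<^sup>2\<close> norm of the one-point kernel \<open>2h - g\<close>, where \<open>h\<close> is the marginal
  of \<open>H\<close>, and the \<open>L\<^sup>2\<close> norm of \<open>H\<close> (\<open>second_moment\<close>).

  All three vanish for the same reason. Under the scaling the jump density keeps its mass but
  spreads out, so for every bounded integrable \<open>f\<close> the probability-like quantity
  \<open>\<integral>a\<^sub>\<epsilon>(h) f(x + h) dh\<close> tends to zero uniformly in \<open>x\<close> (\<open>dilated_convolution_small\<close>). The
  kernels that involve the target positions keep a bounded integral while their supremum tends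
  to zero, and so they disappear in \<open>L\<^sup>2\<close>; there remains the death of a pair both points of
  which jump far away. The integrals of these kernels, however, persist: pairs that arrive from
  far away act as a creation, and the interaction of a particle near the support of \<open>\<phi>\<close> with
  a distant partner acts as the birth or death of a single particle. These are the terms
  \<open>g\<close> and \<open>c\<close> of the limit. The bounds for the three contributions are
  \<open>constant_term\<close>, \<open>hK_square\<close> and \<open>K2_square\<close>.

  It remains to see that the formula gives the action of the Friedrichs extension on the
  unbounded function \<open>F\<close>. Detailed balance and the Mecke formula for pairs yield the Dirichlet
  form (\<open>dirichlet_form\<close>). The truncations of \<open>F\<close> are cylinder functions that converge in the
  form norm, and the value of the adjoint is determined almost everywhere since cylinder
  functions separate integrable functions (\<open>exp_in_friedrichs\<close>,
  \<open>cylinder_functions_separate\<close>). The Mecke formula itself is derived from the law of the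
  counts in disjoint boxes (\<open>campbell_eq\<close>).
\<close>

section \<open>Counting events generate the Borel sets of the configuration space\<close>

lemma space_configuration_borel [simp]: "space configuration_borel = configurations"
  by (simp add: configuration_borel_def space_measure_of_conv)

lemma openin_vague_subset: "openin vague_topology U \<Longrightarrow> U \<subseteq> configurations"
  using openin_subset[of vague_topology U]
  unfolding vague_topology_def topology_generated_by_topspace by blast

lemma sets_configuration_borel:
  "sets configuration_borel = sigma_sets configurations {U. openin vague_topology U}"
  unfolding configuration_borel_def
  by (rule sets_measure_of) (auto dest: openin_vague_subset)

lemma finite_configuration_bounded:
  assumes "\<gamma> \<in> configurations" "bounded A" shows "finite (\<gamma> \<inter> A)"
proof -
  have "finite (\<gamma> \<inter> closure A)" using assms by (auto simp: configurations_def)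
  then show ?thesis by (rule finite_subset[rotated]) (use closure_subset in auto)
qed

lemma continuous_compact_support_bounded:
  "\<phi> \<in> continuous_compact_support \<Longrightarrow> bounded {x. \<phi> x \<noteq> 0}"
  unfolding continuous_compact_support_def
  by (auto dest!: compact_imp_bounded intro: bounded_subset[OF _ closure_subset])

lemma pairing_eq_sum:
  assumes "\<gamma> \<in> configurations" "bounded K" "\<And>x. x \<notin> K \<Longrightarrow> \<phi> x = 0"
  shows "pairing \<phi> \<gamma> = (\<Sum>x\<in>\<gamma> \<inter> K. \<phi> x)"
proof -
  have "pairing \<phi> \<gamma> = (\<Sum>\<^sub>\<infinity>x\<in>\<gamma> \<inter> K. \<phi> x)"
    unfolding pairing_def by (rule infsum_cong_neutral) (use assms in auto)
  then show ?thesis using finite_configuration_bounded[OF assms(1,2)] by simp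
qed

lemma pairing_measurable:
  assumes "\<phi> \<in> continuous_compact_support"
  shows "pairing \<phi> \<in> borel_measurable configuration_borel"
proof (rule borel_measurableI)
  fix S :: "real set" assume "open S"
  have "pairing \<phi> -` S \<inter> space configuration_borel = {\<gamma> \<in> configurations. pairing \<phi> \<gamma> \<in> S}"
    by auto
  moreover have "openin vague_topology {\<gamma> \<in> configurations. pairing \<phi> \<gamma> \<in> S}"
    unfolding vague_topology_def
    by (rule topology_generated_by_Basis) (use assms \<open>open S\<close> in blast)
  ultimately show "pairing \<phi> -` S \<inter> space configuration_borel \<in> sets configuration_borel"
    unfolding sets_configuration_borel by (simp add: sigma_sets.Basic)
qed

text \<open>
  Compactly supported continuous functions that increase to the indicator of \<open>U\<close>.
  Evaluated along a fixed configuration they reach the limit after finitely many steps, since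
  only finitely many points lie in \<open>U\<close>.
\<close>

definition bump :: "'a::euclidean_space set \<Rightarrow> nat \<Rightarrow> 'a \<Rightarrow> real" where
  "bump U j x = min 1 (real j * infdist x (- U))"

lemma bump_support:
  assumes "open U" "bounded U"
  shows "bump U j \<in> continuous_compact_support" "x \<notin> U \<Longrightarrow> bump U j x = 0"
proof -
  show 0: "bump U j x = 0" if "x \<notin> U" for x using that by (simp add: bump_def)
  have "{x. bump U j x \<noteq> 0} \<subseteq> U" using 0 by auto
  then have "bounded {x. bump U j x \<noteq> 0}" using assms(2) bounded_subset by blast
  then have "compact (closure {x. bump U j x \<noteq> 0})" by simp
  moreover have "continuous_on UNIV (bump U j)"
    unfolding bump_def[abs_def] by (intro continuous_intros)
  ultimately show "bump U j \<in> continuous_compact_support"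
    by (simp add: continuous_compact_support_def)
qed

lemma eventually_bump_eq_1:
  assumes "open U" "bounded U" "x \<in> U"
  shows "eventually (\<lambda>j. bump U j x = 1) sequentially"
proof -
  have "U \<noteq> UNIV" using assms(2) not_bounded_UNIV by metis
  then have "- U \<noteq> {}" by auto
  then have "infdist x (- U) > 0"
    using assms in_closed_iff_infdist_zero[of "- U" x] infdist_nonneg[of x "- U"]
    by (auto simp: closed_def order_less_le)
  then obtain n where n: "1 < real n * infdist x (- U)" using reals_Archimedean3 by blast
  have "bump U j x = 1" if "j \<ge> n" for j
  proof -
    have "real n * infdist x (- U) \<le> real j * infdist x (- U)"
      using that by (intro mult_right_mono) (auto simp: infdist_nonneg)
    then show ?thesis using n by (simp add: bump_def)
  qed
  then show ?thesis by (auto simp: eventually_sequentially)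
qed

lemma eventually_pairing_bump:
  assumes "\<gamma> \<in> configurations" "open U" "bounded U"
  shows "eventually (\<lambda>j. pairing (bump U j) \<gamma> = real (card (\<gamma> \<inter> U))) sequentially"
proof -
  have "finite (\<gamma> \<inter> U)" using assms finite_configuration_bounded by blast
  then have "eventually (\<lambda>j. \<forall>x\<in>\<gamma> \<inter> U. bump U j x = 1) sequentially"
    using eventually_bump_eq_1[OF assms(2,3)] by (subst eventually_ball_finite_distrib) auto
  then show ?thesis
  proof eventually_elim
    case (elim j)
    have "pairing (bump U j) \<gamma> = (\<Sum>x\<in>\<gamma> \<inter> U. bump U j x)"
      by (rule pairing_eq_sum) (use assms bump_support in auto)
    then show ?case using elim by simp
  qed
qed

definition count_event :: "('a::euclidean_space set \<times> nat) set \<Rightarrow> 'a set set" where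
  "count_event P = {\<gamma> \<in> configurations. \<forall>(B, k)\<in>P. card (\<gamma> \<inter> B) = k}"

definition open_count_events :: "'a::euclidean_space set set set" where
  "open_count_events = count_event ` {P. finite P \<and> (\<forall>(B, k)\<in>P. open B \<and> bounded B)}"

lemma count_event_Un: "count_event (P \<union> Q) = count_event P \<inter> count_event Q"
  unfolding count_event_def ball_Un by auto

lemma Int_stable_open_count_events: "Int_stable open_count_events"
proof (rule Int_stableI)
  fix S T :: "'a set set" assume "S \<in> open_count_events" "T \<in> open_count_events"
  then obtain P Q where "S = count_event P" "T = count_event Q"
    "finite P \<and> (\<forall>(B, k)\<in>P. open B \<and> bounded B)"  "finite Q \<and> (\<forall>(B, k)\<in>Q. open B \<and> bounded B)"
    by (auto simp: open_count_events_def)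
  then show "S \<inter> T \<in> open_count_events"
    unfolding open_count_events_def by (auto intro!: image_eqI[of _ _ "P \<union> Q"] simp: count_event_Un)
qed

text \<open>
  A configuration near \<open>\<gamma>\<^sub>0\<close> is pinned down by counts: exactly one
  point in a small neighbourhood of each point of \<open>\<gamma>\<^sub>0\<close> in a ball
  around the support, and no further points in that ball. On these neighbourhoods
  \<open>\<phi>\<close> hardly varies, so the pairing changes little. Drawing the neighbourhoods
  from a countable basis leaves only countably many counting events.
\<close>

lemma vague_neighbourhood_count_event:
  fixes \<phi> :: "'a::euclidean_space \<Rightarrow> real"
  assumes basis: "topological_basis \<B>" and \<phi>: "\<phi> \<in> continuous_compact_support"
    and "open S" and \<gamma>\<^sub>0: "\<gamma>\<^sub>0 \<in> configurations" "pairing \<phi> \<gamma>\<^sub>0 \<in> S"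
  shows "\<exists>P. finite P \<and> P \<subseteq> ({B \<in> \<B>. bounded B} \<union> range (\<lambda>n::nat. ball 0 (real n))) \<times> UNIV \<and>
    \<gamma>\<^sub>0 \<in> count_event P \<and> count_event P \<subseteq> {\<gamma> \<in> configurations. pairing \<phi> \<gamma> \<in> S}"
proof -
  obtain e where e: "e > 0" "ball (pairing \<phi> \<gamma>\<^sub>0) e \<subseteq> S"
    using \<open>open S\<close> \<gamma>\<^sub>0 by (auto simp: open_contains_ball)
  obtain r where "{x. \<phi> x \<noteq> 0} \<subseteq> ball 0 r"
    using continuous_compact_support_bounded[OF \<phi>] bounded_subset_ballD by blast
  moreover obtain n :: nat where "r \<le> real n" using real_arch_simple by blast
  ultimately have supp: "\<And>x. x \<notin> ball 0 (real n) \<Longrightarrow> \<phi> x = 0" by force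
  define X where "X = \<gamma>\<^sub>0 \<inter> ball 0 (real n)"
  have finX: "finite X" unfolding X_def using \<gamma>\<^sub>0 finite_configuration_bounded by blast
  define \<delta> where "\<delta> = e / (real (card X) + 1)"
  have \<delta>: "\<delta> > 0" using e by (simp add: \<delta>_def)
  \<comment> \<open>The Voronoi cell of x is cut out as well, so that distinct points have
    disjoint neighbourhoods.\<close>
  define V where "V x = ball 0 (real n) \<inter> {y. \<bar>\<phi> y - \<phi> x\<bar> < \<delta>} \<inter>
      (\<Inter>x'\<in>X - {x}. {y. dist y x < dist y x'})" for x
  have cont: "continuous_on UNIV \<phi>" using \<phi> by (simp add: continuous_compact_support_def)
  have "open (V x)" for x
    unfolding V_def using finX
    by (intro open_Int open_INT open_ball ballI open_Collect_less continuous_intros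
        continuous_on_subset[OF cont]) auto
  moreover have "x \<in> V x" if "x \<in> X" for x using that \<delta> by (auto simp: V_def X_def)
  ultimately have "\<forall>x\<in>X. \<exists>B\<in>\<B>. x \<in> B \<and> B \<subseteq> V x"
    using topological_basisE[OF basis] by metis
  then obtain B where B: "\<And>x. x \<in> X \<Longrightarrow> B x \<in> \<B>" "\<And>x. x \<in> X \<Longrightarrow> x \<in> B x"
      "\<And>x. x \<in> X \<Longrightarrow> B x \<subseteq> V x" by metis
  have bddB: "bounded (B x)" if "x \<in> X" for x
    using B(3)[OF that] bounded_ball by (auto simp: V_def intro: bounded_subset)
  define P where "P = insert (ball 0 (real n), card X) ((\<lambda>x. (B x, 1)) ` X)"
  have 1: "finite P" using finX by (simp add: P_def)
  have 2: "P \<subseteq> ({B \<in> \<B>. bounded B} \<union> range (\<lambda>n::nat. ball 0 (real n))) \<times> UNIV"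
    using B bddB by (auto simp: P_def)
  have "\<gamma>\<^sub>0 \<inter> B x = {x}" if x: "x \<in> X" for x
  proof -
    have "y = x" if "y \<in> \<gamma>\<^sub>0" "y \<in> B x" for y
    proof (rule ccontr)
      assume "y \<noteq> x"
      have "y \<in> V x" using that B(3) x by auto
      then have "y \<in> X" using that by (auto simp: X_def V_def)
      then have "dist y x < dist y y" using \<open>y \<in> V x\<close> \<open>y \<noteq> x\<close> unfolding V_def by blast
      then show False by simp
    qed
    then show ?thesis using B(2)[OF x] x by (auto simp: X_def)
  qed
  then have 3: "\<gamma>\<^sub>0 \<in> count_event P"
    using \<gamma>\<^sub>0 by (auto simp: count_event_def P_def X_def)
  have 4: "pairing \<phi> \<gamma> \<in> S" if \<gamma>: "\<gamma> \<in> count_event P" for \<gamma>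
  proof -
    have conf: "\<gamma> \<in> configurations" and card: "card (\<gamma> \<inter> ball 0 (real n)) = card X"
      and one: "\<And>x. x \<in> X \<Longrightarrow> card (\<gamma> \<inter> B x) = 1"
      using \<gamma> by (auto simp: count_event_def P_def)
    have "\<forall>x\<in>X. \<exists>y. \<gamma> \<inter> B x = {y}" using one by (metis card_1_singletonE)
    then obtain y where y: "\<And>x. x \<in> X \<Longrightarrow> \<gamma> \<inter> B x = {y x}" by metis
    have yV: "y x \<in> V x" if "x \<in> X" for x using y[OF that] B(3)[OF that] by auto
    have inj: "inj_on y X"
    proof (rule inj_onI, rule ccontr)
      fix x x' assume x: "x \<in> X" "x' \<in> X" "y x = y x'" "x \<noteq> x'"
      then have "dist (y x) x < dist (y x) x'" "dist (y x') x' < dist (y x') x"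
        using yV[of x] yV[of x'] by (auto simp: V_def)
      then show False using x by simp
    qed
    have "y ` X = \<gamma> \<inter> ball 0 (real n)"
    proof (rule card_subset_eq)
      show "finite (\<gamma> \<inter> ball 0 (real n))" using conf finite_configuration_bounded by blast
      show "y ` X \<subseteq> \<gamma> \<inter> ball 0 (real n)" using y yV by (auto simp: V_def)
      show "card (y ` X) = card (\<gamma> \<inter> ball 0 (real n))" using card card_image[OF inj] by simp
    qed
    then have "pairing \<phi> \<gamma> = (\<Sum>x\<in>X. \<phi> (y x))"
      using pairing_eq_sum[of \<gamma> "ball 0 (real n)" \<phi>, OF conf bounded_ball supp] sum.reindex[OF inj, of \<phi>] by simp
    moreover have "pairing \<phi> \<gamma>\<^sub>0 = (\<Sum>x\<in>X. \<phi> x)"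
      using pairing_eq_sum[of \<gamma>\<^sub>0 "ball 0 (real n)" \<phi>, OF \<gamma>\<^sub>0(1) bounded_ball supp] by (simp add: X_def)
    ultimately have "\<bar>pairing \<phi> \<gamma> - pairing \<phi> \<gamma>\<^sub>0\<bar> = \<bar>\<Sum>x\<in>X. \<phi> (y x) - \<phi> x\<bar>"
      by (simp add: sum_subtractf)
    also have "\<dots> \<le> (\<Sum>x\<in>X. \<bar>\<phi> (y x) - \<phi> x\<bar>)" by (rule sum_abs)
    also have "\<dots> \<le> (\<Sum>x\<in>X. \<delta>)" using yV by (intro sum_mono) (force simp: V_def)
    also have "\<dots> < e" using e by (simp add: \<delta>_def field_simps)
    finally show ?thesis using e by (auto simp: dist_real_def subset_iff)
  qed
  show ?thesis using 1 2 3 4 by (intro exI[of _ P]) (auto simp: count_event_def)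
qed

text \<open>
  The vague topology is an uncountable union of generators, but every vaguely open set is a
  union of counting events from a countable family.
\<close>

theorem sets_configuration_borel_subset:
  "sets (configuration_borel :: 'a::euclidean_space set measure) \<subseteq>
     sigma_sets configurations open_count_events"
proof -
  obtain \<B> :: "'a set set" where \<B>: "countable \<B>" "topological_basis \<B>"
    using ex_countable_basis by blast
  define \<C> where "\<C> = ({B \<in> \<B>. bounded B} \<union> range (\<lambda>n::nat. ball (0::'a) (real n))) \<times> (UNIV :: nat set)"
  have "countable {B \<in> \<B>. bounded B}" using \<B>(1) by (rule countable_subset[rotated]) auto
  then have "countable \<C>" unfolding \<C>_def by (intro countable_SIGMA countable_Un) auto
  then have cP: "countable {P. finite P \<and> P \<subseteq> \<C>}" using countable_Collect_finite_subset[of \<C>] by (simp add: conj_commute)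
  have opC: "open B \<and> bounded B" if "(B, k) \<in> \<C>" for B k
    using that topological_basis_open[OF \<B>(2)] by (auto simp: \<C>_def)
  have ev: "count_event P \<in> open_count_events" if "finite P" "P \<subseteq> \<C>" for P
    using that opC unfolding open_count_events_def by blast
  have local: "\<exists>P. finite P \<and> P \<subseteq> \<C> \<and> \<gamma> \<in> count_event P \<and> count_event P \<subseteq> U"
    if "openin vague_topology U" "\<gamma> \<in> U" for U and \<gamma> :: "'a set"
    using that unfolding vague_topology_def openin_topology_generated_by_iff
  proof (induction arbitrary: \<gamma>)
    case Empty then show ?case by simp
  next
    case (Int a b)
    then obtain P Q where "finite P \<and> P \<subseteq> \<C> \<and> \<gamma> \<in> count_event P \<and> count_event P \<subseteq> a"
      "finite Q \<and> Q \<subseteq> \<C> \<and> \<gamma> \<in> count_event Q \<and> count_event Q \<subseteq> b" by (meson IntD1 IntD2)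
    then show ?case by (intro exI[of _ "P \<union> Q"]) (auto simp: count_event_Un)
  next
    case (UN K) then show ?case by (meson Sup_upper UnionE order_trans)
  next
    case (Basis s)
    then obtain \<phi> S where "\<phi> \<in> continuous_compact_support" "open S"
      "s = {\<gamma> \<in> configurations. pairing \<phi> \<gamma> \<in> S}" by auto
    then show ?case
      using vague_neighbourhood_count_event[OF \<B>(2), of \<phi> S \<gamma>] Basis.prems unfolding \<C>_def by blast
  qed
  have "U \<in> sigma_sets configurations open_count_events" if U: "openin vague_topology U" for U :: "'a set set"
  proof -
    let ?I = "{P. finite P \<and> P \<subseteq> \<C> \<and> count_event P \<subseteq> U}"
    have "U = \<Union>(count_event ` ?I)" using local[OF U] by blast
    moreover have "countable ?I" using cP by (rule countable_subset[rotated]) auto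
    moreover have "(\<Union>P\<in>?I. count_event P) \<in> sigma_sets configurations open_count_events"
      by (rule sigma_sets_UNION) (use ev \<open>countable ?I\<close> in \<open>auto intro: sigma_sets.Basic\<close>)
    ultimately show ?thesis by metis
  qed
  then show ?thesis
    unfolding sets_configuration_borel by (intro sigma_sets_mono) auto
qed

lemma card_Int_open_measurable:
  assumes "open U" "bounded U"
  shows "(\<lambda>\<gamma>. real (card (\<gamma> \<inter> U))) \<in> borel_measurable configuration_borel"
proof (rule borel_measurable_LIMSEQ_real[where u = "\<lambda>j. pairing (bump U j)"])
  show "pairing (bump U j) \<in> borel_measurable configuration_borel" for j
    by (intro pairing_measurable bump_support assms)
  show "(\<lambda>j. pairing (bump U j) \<gamma>) \<longlonglongrightarrow> real (card (\<gamma> \<inter> U))" if "\<gamma> \<in> space configuration_borel" for \<gamma>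
    using eventually_pairing_bump[of \<gamma> U] assms that by (intro tendsto_eventually) auto
qed

lemma open_count_events_sets: "open_count_events \<subseteq> sets configuration_borel"
proof
  fix S :: "'a set set" assume "S \<in> open_count_events"
  then obtain P where P: "S = count_event P" "finite P" "\<forall>(B, k)\<in>P. open B \<and> bounded B"
    by (auto simp: open_count_events_def)
  have "{\<gamma> \<in> space configuration_borel. \<forall>p\<in>P. real (card (\<gamma> \<inter> fst p)) = real (snd p)} \<in> sets configuration_borel"
  proof (intro sets.sets_Collect_finite_All P(2))
    fix p assume "p \<in> P"
    then have [measurable]: "(\<lambda>\<gamma>. real (card (\<gamma> \<inter> fst p))) \<in> borel_measurable configuration_borel"
      using P(3) by (intro card_Int_open_measurable) auto
    show "{\<gamma> \<in> space configuration_borel. real (card (\<gamma> \<inter> fst p)) = real (snd p)} \<in> sets configuration_borel"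
      by measurable
  qed
  also have "{\<gamma> \<in> space configuration_borel. \<forall>p\<in>P. real (card (\<gamma> \<inter> fst p)) = real (snd p)} = S"
    by (auto simp: P(1) count_event_def case_prod_beta)
  finally show "S \<in> sets configuration_borel" .
qed

lemma sets_configuration_borel_eq:
  "sets configuration_borel = sigma_sets configurations open_count_events"
  using sets_configuration_borel_subset sets.sigma_sets_subset[OF open_count_events_sets]
  by auto

section \<open>Cylinder functions separate integrable functions\<close>

lemma AE_eq_0_if_integral_indicator_0:
  fixes w :: "'b \<Rightarrow> real"
  assumes w: "integrable M w" and 0: "\<And>S. S \<in> sets M \<Longrightarrow> (\<integral>x. w x * indicator S x \<partial>M) = 0"
  shows "AE x in M. w x = 0"
proof -
  have [measurable]: "w \<in> borel_measurable M" using w by auto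
  have *: "AE x in M. u x \<le> 0" if u: "integrable M u" "\<And>S. S \<in> sets M \<Longrightarrow> (\<integral>x. u x * indicator S x \<partial>M) = 0"
    for u :: "'b \<Rightarrow> real"
  proof -
    have [measurable]: "u \<in> borel_measurable M" using u by auto
    let ?S = "{x \<in> space M. u x > 0}"
    have "(\<integral>x. u x * indicator ?S x \<partial>M) = 0" by (rule u(2)) measurable
    moreover have "integrable M (\<lambda>x. u x * indicator ?S x)"
      by (rule integrable_real_mult_indicator[OF _ u(1)]) measurable
    ultimately have "AE x in M. u x * indicator ?S x = 0"
      by (subst (asm) integral_nonneg_eq_0_iff_AE) (auto simp: indicator_def)
    then show ?thesis using AE_space by eventually_elim (auto simp: indicator_def split: if_splits)
  qed
  have "AE x in M. w x \<le> 0" by (rule *) (use assms in auto)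
  moreover have "AE x in M. - w x \<le> 0" by (rule *) (use assms in auto)
  ultimately show ?thesis by eventually_elim auto
qed

text \<open>
  A bounded continuous function of finitely many pairings that approximates the indicator of a
  counting event: counts are integers, so the tent function of width one at \<open>k\<close>
  tests for equality with \<open>k\<close>.
\<close>

lemma count_cylinder:
  fixes P :: "('a::euclidean_space set \<times> nat) set"
  assumes "finite P" "\<forall>(B, k)\<in>P. open B \<and> bounded B"
  shows "(\<lambda>\<gamma>. \<Prod>p\<in>P. max 0 (1 - \<bar>pairing (bump (fst p) j) \<gamma> - real (snd p)\<bar>)) \<in> cylinder_functions"
proof -
  obtain e where e: "bij_betw e {0..<card P} P" using ex_bij_betw_nat_finite[OF assms(1)] by blast
  let ?n = "card P"
  define g :: "(nat \<Rightarrow> real) \<Rightarrow> real" where "g y = (\<Prod>i<?n. max 0 (1 - \<bar>y i - real (snd (e i))\<bar>))" for y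
  have e': "e i \<in> P" if "i < ?n" for i using that e by (auto simp: bij_betw_def)
  have g1: "\<bar>g y\<bar> \<le> 1" for y
    unfolding g_def abs_prod by (intro prod_le_1) auto
  have "(\<Prod>p\<in>P. max 0 (1 - \<bar>pairing (bump (fst p) j) \<gamma> - real (snd p)\<bar>)) =
      g (\<lambda>i\<in>{..<?n}. pairing (bump (fst (e i)) j) \<gamma>)" for \<gamma>
    unfolding g_def using prod.reindex_bij_betw[OF e, symmetric]
    by (auto simp: atLeast0LessThan intro!: prod.cong)
  moreover have "\<forall>i<?n. bump (fst (e i)) j \<in> continuous_compact_support"
    using assms(2) e' by (intro allI impI bump_support(1)) (auto simp: case_prod_beta)
  moreover have "continuous_map (product_topology (\<lambda>_. euclideanreal) {..<?n}) euclideanreal g"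
    unfolding g_def[abs_def]
    by (intro continuous_map_prod continuous_map_real_max continuous_map_diff continuous_map_real_abs
        continuous_map_canonical_const continuous_map_product_projection) auto
  moreover have "bounded (g ` ({..<?n} \<rightarrow>\<^sub>E UNIV))"
    using g1 by (auto intro!: boundedI[of _ 1])
  ultimately show ?thesis unfolding cylinder_functions_def
    by (intro CollectI exI[of _ "card P"] exI[of _ "\<lambda>i. bump (fst (e i)) j"] exI[of _ g] conjI ext) auto
qed

text \<open>
  This replaces density of the cylinder functions in \<open>L\<^sup>2\<close>. Indicators of
  counting events are bounded limits of cylinder functions, and Dynkin's theorem passes from
  these events to all measurable sets. It makes the action of an adjoint well defined almost
  everywhere.
\<close>

theorem cylinder_functions_separate:
  fixes w :: "'a::euclidean_space set \<Rightarrow> real"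
  assumes M: "sets M = sets configuration_borel" and w: "integrable M w"
    and orth: "\<And>v. v \<in> cylinder_functions \<Longrightarrow> (\<integral>x. w x * v x \<partial>M) = 0"
  shows "AE x in M. w x = 0"
proof (rule AE_eq_0_if_integral_indicator_0[OF w])
  have sp: "space M = configurations" using sets_eq_imp_space_eq[OF M] by simp
  have [measurable]: "w \<in> borel_measurable M" using w by auto
  have base: "(\<integral>x. w x * indicator S x \<partial>M) = 0" if S: "S \<in> open_count_events" for S
  proof -
    obtain P where P: "S = count_event P" "finite P" "\<forall>(B, k)\<in>P. open B \<and> bounded B"
      using S by (auto simp: open_count_events_def)
    define v where "v j \<gamma> = (\<Prod>p\<in>P. max 0 (1 - \<bar>pairing (bump (fst p) j) \<gamma> - real (snd p)\<bar>))" for j \<gamma>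
    have [measurable]: "v j \<in> borel_measurable M" for j
    proof -
      have "(\<lambda>\<gamma>. max 0 (1 - \<bar>pairing (bump (fst p) j) \<gamma> - real (snd p)\<bar>)) \<in> borel_measurable M" if "p \<in> P" for p
      proof -
        have [measurable]: "pairing (bump (fst p) j) \<in> borel_measurable M"
          unfolding measurable_cong_sets[OF M refl]
          using that P(3) by (intro pairing_measurable bump_support) auto
        show ?thesis by measurable
      qed
      then show ?thesis unfolding v_def[abs_def] by (rule borel_measurable_prod)
    qed
    have [measurable]: "S \<in> sets M" using S open_count_events_sets M by auto
    have v1: "\<bar>v j \<gamma>\<bar> \<le> 1" for j \<gamma> unfolding v_def abs_prod by (intro prod_le_1) auto
    have "(\<lambda>j. \<integral>x. w x * v j x \<partial>M) \<longlonglongrightarrow> (\<integral>x. w x * indicator S x \<partial>M)"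
    proof (rule integral_dominated_convergence[where w = "\<lambda>x. \<bar>w x\<bar>"])
      show "AE x in M. (\<lambda>j. w x * v j x) \<longlonglongrightarrow> w x * indicator S x"
      proof (rule AE_I2, intro tendsto_mult_left tendsto_eventually)
        fix \<gamma> assume "\<gamma> \<in> space M"
        then have \<gamma>: "\<gamma> \<in> configurations" using sp by simp
        have "eventually (\<lambda>j. \<forall>p\<in>P. pairing (bump (fst p) j) \<gamma> = real (card (\<gamma> \<inter> fst p))) sequentially"
          using P eventually_pairing_bump[OF \<gamma>] by (subst eventually_ball_finite_distrib) auto
        then show "eventually (\<lambda>j. v j \<gamma> = indicator S \<gamma>) sequentially"
        proof eventually_elim
          case (elim j)
          show ?case
          proof (cases "\<gamma> \<in> S")
            case True
            then show ?thesis using elim by (force simp: v_def P(1) count_event_def intro!: prod.neutral)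
          next
            case False
            then obtain p where p: "p \<in> P" "card (\<gamma> \<inter> fst p) \<noteq> snd p"
              using \<gamma> by (auto simp: P(1) count_event_def)
            then have "\<bar>real (card (\<gamma> \<inter> fst p)) - real (snd p)\<bar> \<ge> 1" by linarith
            then have "max 0 (1 - \<bar>pairing (bump (fst p) j) \<gamma> - real (snd p)\<bar>) = 0"
              using elim p by auto
            then have "v j \<gamma> = 0" unfolding v_def using P(2) p(1) by (intro prod_zero) auto
            then show ?thesis using False by simp
          qed
        qed
      qed
      show "AE x in M. norm (w x * v j x) \<le> \<bar>w x\<bar>" for j
        using v1 by (auto simp: abs_mult intro!: mult_left_le)
      show "integrable M (\<lambda>x. \<bar>w x\<bar>)" using w by simp
    qed measurable
    moreover have "(\<integral>x. w x * v j x \<partial>M) = 0" for j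
      using orth count_cylinder[OF P(2,3)] unfolding v_def[abs_def] by blast
    ultimately show ?thesis by (simp add: LIMSEQ_const_iff)
  qed
  fix S assume "S \<in> sets M"
  then have S: "S \<in> sigma_sets configurations open_count_events"
    using M sets_configuration_borel_eq by auto
  have "open_count_events \<subseteq> Pow (configurations :: 'a set set)"
    by (auto simp: open_count_events_def count_event_def)
  from Int_stable_open_count_events this S
  show "(\<integral>x. w x * indicator S x \<partial>M) = 0"
  proof (induction rule: sigma_sets_induct_disjoint)
    case (basic A) then show ?case by (rule base)
  next
    case empty then show ?case by simp
  next
    case (compl A)
    have A: "A \<in> sets M" using compl M sets_configuration_borel_eq by auto
    have "configurations = (count_event {} :: 'a set set)" by (auto simp: count_event_def)
    moreover have "count_event {} \<in> open_count_events" unfolding open_count_events_def by auto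
    ultimately have "configurations \<in> (open_count_events :: 'a set set set)" by metis
    from base[OF this] have "(\<integral>x. w x \<partial>M) = 0"
      using Bochner_Integration.integral_cong[of M M "\<lambda>x. w x * indicator configurations x" w] sp
      by auto
    moreover have "(\<integral>x. w x * indicator (configurations - A) x \<partial>M) = (\<integral>x. w x - w x * indicator A x \<partial>M)"
      using sp by (intro Bochner_Integration.integral_cong) (auto simp: indicator_def)
    moreover have "integrable M (\<lambda>x. w x * indicator A x)"
      using A w by (rule integrable_real_mult_indicator)
    ultimately show ?case using compl w by (simp add: Bochner_Integration.integral_diff)
  next
    case (union A)
    have A: "A i \<in> sets M" for i using union M sets_configuration_borel_eq by auto
    then have UA: "(\<Union>i. A i) \<in> sets M" by auto
    have "set_integrable M (\<Union>i. A i) w"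
      using integrable_mult_indicator[OF UA w] by (simp add: set_integrable_def)
    then have "(LINT x:(\<Union>i. A i)|M. w x) = (\<Sum>i. (LINT x:(A i)|M. w x))"
      using union(1) A by (intro lebesgue_integral_countable_add) (auto simp: disjoint_family_on_def)
    also have "\<dots> = 0" using union(3) by (simp add: set_lebesgue_integral_def mult.commute)
    finally show ?case by (simp add: set_lebesgue_integral_def mult.commute)
  qed
qed

section \<open>Measurability of sums over the points of a configuration\<close>

abbreviation CB :: "'a::euclidean_space set measure" where "CB \<equiv> configuration_borel"

lemma countable_configuration: "\<gamma> \<in> configurations \<Longrightarrow> countable \<gamma>"
proof -
  assume \<gamma>: "\<gamma> \<in> configurations"
  have "\<gamma> = (\<Union>n::nat. \<gamma> \<inter> ball 0 (real n))" using reals_Archimedean2 by auto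
  moreover have "countable (\<Union>n::nat. \<gamma> \<inter> ball 0 (real n))"
    using finite_configuration_bounded[OF \<gamma> bounded_ball] by (intro countable_UN) (auto intro: countable_finite)
  ultimately show ?thesis by simp
qed

lemma configuration_subset: "\<gamma> \<in> configurations \<Longrightarrow> \<gamma>' \<subseteq> \<gamma> \<Longrightarrow> \<gamma>' \<in> configurations"
  unfolding configurations_def by (auto intro: finite_subset[OF Int_mono])

lemma configuration_insert: "\<gamma> \<in> configurations \<Longrightarrow> insert x \<gamma> \<in> configurations"
  unfolding configurations_def by (auto simp: Int_insert_left)

lemma card_Int_measurable_aux:
  assumes g: "g \<in> N \<rightarrow>\<^sub>M CB" and "open U" "bounded U"
  shows "(\<lambda>w. real (card (g w \<inter> U))) \<in> borel_measurable N"
  using measurable_compose[OF g card_Int_open_measurable[OF assms(2,3)]] .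

lemma config_in: "g \<in> N \<rightarrow>\<^sub>M CB \<Longrightarrow> w \<in> space N \<Longrightarrow> g w \<in> configurations"
  by (metis measurable_space space_configuration_borel)

text \<open>
  The points in a bounded window form a random finite counting measure. Dividing it by one plus
  its mass gives a sub-probability kernel, for which measurability of integrals with parameters
  is known; the factor is multiplied back in at the end.
\<close>

lemma measurable_nn_sum_window:
  fixes g :: "'w \<Rightarrow> 'a::euclidean_space set"
  assumes g: "g \<in> N \<rightarrow>\<^sub>M CB" and f: "(\<lambda>(w, x). f w x) \<in> borel_measurable (N \<Otimes>\<^sub>M borel)"
  shows "(\<lambda>w. \<integral>\<^sup>+x. f w x \<partial>count_space (g w \<inter> ball 0 (real n))) \<in> borel_measurable N"
proof -
  let ?U = "ball (0::'a) (real n)"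
  let ?c = "\<lambda>w. ennreal (1 / (1 + real (card (g w \<inter> ?U))))"
  define \<kappa> where "\<kappa> w = scale_measure (?c w) (distr (count_space (g w \<inter> ?U)) borel (\<lambda>x. x))" for w
  have fin: "finite (g w \<inter> ?U)" if "w \<in> space N" for w
    using config_in[OF g that] finite_configuration_bounded bounded_ball by blast
  have sets[simp]: "sets (\<kappa> w) = sets borel" "space (\<kappa> w) = UNIV" for w
    by (auto simp: \<kappa>_def space_scale_measure)
  have em: "emeasure (\<kappa> w) A = ?c w * ennreal (real (card (g w \<inter> (?U \<inter> A))))"
    if "w \<in> space N" "A \<in> sets borel" for w A
  proof -
    have "finite (g w \<inter> ?U \<inter> A)" using fin[OF that(1)] by blast
    moreover have "A \<inter> (g w \<inter> ?U) = g w \<inter> ?U \<inter> A" by blast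
    ultimately have "emeasure (distr (count_space (g w \<inter> ?U)) borel (\<lambda>x. x)) A = of_nat (card (g w \<inter> ?U \<inter> A))"
      using that by (subst emeasure_distr) (simp_all add: emeasure_count_space_finite[OF Int_lower1])
    then show ?thesis by (simp add: \<kappa>_def Int_assoc ennreal_of_nat_eq_real_of_nat)
  qed
  have \<kappa>: "\<kappa> \<in> N \<rightarrow>\<^sub>M subprob_algebra borel"
  proof (rule measurable_subprob_algebra_generated[where \<Omega> = UNIV and G = "{S. open S}"])
    show "sets (borel :: 'a measure) = sigma_sets UNIV {S. open S}" by (simp add: borel_def)
    show "Int_stable {S. open (S :: 'a set)}" by (auto simp: Int_stable_def)
    show "subprob_space (\<kappa> w)" if "w \<in> space N" for w
    proof (rule subprob_spaceI)
      have "emeasure (\<kappa> w) UNIV \<le> 1"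
        using em[OF that, of UNIV] by (simp add: ennreal_mult[symmetric])
      then show "emeasure (\<kappa> w) (space (\<kappa> w)) \<le> 1" by simp
    qed simp
    have [measurable]: "(\<lambda>w. real (card (g w \<inter> ?U))) \<in> borel_measurable N"
      by (intro card_Int_measurable_aux g) auto
    show *: "(\<lambda>w. emeasure (\<kappa> w) A) \<in> borel_measurable N" if "A \<in> {S. open S}" for A
    proof -
      have [measurable]: "(\<lambda>w. real (card (g w \<inter> (?U \<inter> A)))) \<in> borel_measurable N"
        using that by (intro card_Int_measurable_aux g) (auto intro: bounded_subset[OF bounded_ball])
      have "A \<in> sets borel" using that by auto
      then show ?thesis by (subst measurable_cong[OF em]) (auto, measurable)
    qed
    show "(\<lambda>w. emeasure (\<kappa> w) UNIV) \<in> borel_measurable N" by (rule *) auto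
  qed auto
  have [measurable]: "(\<lambda>w. \<integral>\<^sup>+x. f w x \<partial>\<kappa> w) \<in> borel_measurable N"
    by (rule nn_integral_measurable_subprob_algebra2[OF f \<kappa>])
  have [measurable]: "(\<lambda>w. real (card (g w \<inter> ?U))) \<in> borel_measurable N"
    by (intro card_Int_measurable_aux g) auto
  have eq: "(\<integral>\<^sup>+x. f w x \<partial>count_space (g w \<inter> ?U)) =
      ennreal (1 + real (card (g w \<inter> ?U))) * (\<integral>\<^sup>+x. f w x \<partial>\<kappa> w)" if w: "w \<in> space N" for w
  proof -
    have [measurable]: "f w \<in> borel_measurable borel" using measurable_compose_Pair1[OF w f] by simp
    have "(\<integral>\<^sup>+x. f w x \<partial>\<kappa> w) = ?c w * (\<integral>\<^sup>+x. f w x \<partial>count_space (g w \<inter> ?U))"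
      unfolding \<kappa>_def by (subst nn_integral_scale_measure) (auto simp: nn_integral_distr)
    moreover have "ennreal (1 + real (card (g w \<inter> ?U))) * ?c w = 1"
      by (subst ennreal_mult[symmetric]) auto
    ultimately show ?thesis by (simp add: mult.assoc[symmetric])
  qed
  show ?thesis by (subst measurable_cong[OF eq]) (assumption, measurable)
qed

lemma measurable_nn_sum:
  fixes g :: "'w \<Rightarrow> 'a::euclidean_space set"
  assumes g: "g \<in> N \<rightarrow>\<^sub>M CB" and f: "(\<lambda>(w, x). f w x) \<in> borel_measurable (N \<Otimes>\<^sub>M borel)"
  shows "(\<lambda>w. \<integral>\<^sup>+x. f w x \<partial>count_space (g w)) \<in> borel_measurable N"
proof -
  have "(\<integral>\<^sup>+x. f w x \<partial>count_space (g w)) =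
     (SUP n. \<integral>\<^sup>+x. f w x \<partial>count_space (g w \<inter> ball 0 (real n)))" for w
  proof -
    let ?h = "\<lambda>n x. f w x * indicator (g w \<inter> ball 0 (real n)) x"
    have "(SUP n. ?h n x) = f w x * indicator (g w) x" for x
    proof -
      obtain m where m: "norm x < real m" using reals_Archimedean2 by blast
      show ?thesis
      proof (rule antisym)
        show "(SUP n. ?h n x) \<le> f w x * indicator (g w) x"
          by (intro SUP_least) (auto simp: indicator_def)
        show "f w x * indicator (g w) x \<le> (SUP n. ?h n x)"
          by (rule SUP_upper2[of m]) (use m in \<open>auto simp: indicator_def\<close>)
      qed
    qed
    moreover have "incseq ?h"
      by (auto simp: incseq_def le_fun_def indicator_def intro: less_le_trans)
    ultimately show ?thesis
      by (simp add: nn_integral_count_space_indicator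
          nn_integral_monotone_convergence_SUP[symmetric])
  qed
  then show ?thesis using measurable_nn_sum_window[OF assms] by simp
qed

lemma card_Int_eq_nn_sum:
  assumes "\<gamma> \<in> configurations" "bounded A"
  shows "(\<integral>\<^sup>+x. indicator A x \<partial>count_space \<gamma>) = of_nat (card (\<gamma> \<inter> A))"
proof -
  have "finite (\<gamma> \<inter> A)" using assms finite_configuration_bounded by blast
  moreover have "(\<integral>\<^sup>+x. indicator A x \<partial>count_space \<gamma>) = (\<integral>\<^sup>+x. indicator (\<gamma> \<inter> A) x \<partial>count_space UNIV)"
    by (subst nn_integral_count_space_indicator)
       (auto intro!: nn_integral_cong simp: indicator_def simp del: nn_integral_indicator)
  ultimately show ?thesis by (simp add: emeasure_count_space_finite)
qed

lemma measurable_mem_configuration: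
  assumes g: "g \<in> N \<rightarrow>\<^sub>M CB" and h[measurable]: "h \<in> N \<rightarrow>\<^sub>M borel"
  shows "Measurable.pred N (\<lambda>w. h w \<in> g w)"
proof -
  have "(\<integral>\<^sup>+x. indicator {h w} x \<partial>count_space (g w)) = (if h w \<in> g w then 1 else 0)"
    if "w \<in> space N" for w
    using card_Int_eq_nn_sum[OF config_in[OF g that], of "{h w}"] by auto
  moreover have [measurable]: "(\<lambda>w. \<integral>\<^sup>+x. indicator {h w} x \<partial>count_space (g w)) \<in> borel_measurable N"
    by (rule measurable_nn_sum[OF g]) (simp add: indicator_def, measurable)
  ultimately have [measurable]: "(\<lambda>w. if h w \<in> g w then 1 else (0::ennreal)) \<in> borel_measurable N"
    by (simp cong: measurable_cong)
  have "{w \<in> space N. (if h w \<in> g w then 1 else (0::ennreal)) = 1} \<in> sets N"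
    by measurable
  moreover have "{w \<in> space N. (if h w \<in> g w then 1 else (0::ennreal)) = 1} = {w \<in> space N. h w \<in> g w}"
    by auto
  ultimately show ?thesis by (simp add: pred_def)
qed

lemma measurable_configurationI:
  fixes f :: "'w \<Rightarrow> 'a::euclidean_space set"
  assumes "\<And>w. w \<in> space N \<Longrightarrow> f w \<in> configurations"
    and "\<And>U. open U \<Longrightarrow> bounded U \<Longrightarrow> (\<lambda>w. real (card (f w \<inter> U))) \<in> borel_measurable N"
  shows "f \<in> N \<rightarrow>\<^sub>M CB"
proof (rule measurable_sigma_sets[OF sets_configuration_borel_eq])
  show "open_count_events \<subseteq> Pow configurations"
    by (auto simp: open_count_events_def count_event_def)
  fix S :: "'a set set" assume "S \<in> open_count_events"
  then obtain P where P: "S = count_event P" "finite P" "\<forall>(B, k)\<in>P. open B \<and> bounded B"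
    by (auto simp: open_count_events_def)
  have "{w \<in> space N. \<forall>p\<in>P. real (card (f w \<inter> fst p)) = real (snd p)} \<in> sets N"
  proof (intro sets.sets_Collect_finite_All P(2))
    fix p assume "p \<in> P"
    then have [measurable]: "(\<lambda>w. real (card (f w \<inter> fst p))) \<in> borel_measurable N"
      using P(3) by (intro assms(2)) auto
    show "{w \<in> space N. real (card (f w \<inter> fst p)) = real (snd p)} \<in> sets N" by measurable
  qed
  also have "{w \<in> space N. \<forall>p\<in>P. real (card (f w \<inter> fst p)) = real (snd p)} = f -` S \<inter> space N"
    using assms(1) by (auto simp: P(1) count_event_def case_prod_beta)
  finally show "f -` S \<inter> space N \<in> sets N" .
qed (use assms(1) in auto)

lemma measurable_insert_configuration:
  assumes g: "g \<in> N \<rightarrow>\<^sub>M CB" and h[measurable]: "h \<in> N \<rightarrow>\<^sub>M borel"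
  shows "(\<lambda>w. insert (h w) (g w)) \<in> N \<rightarrow>\<^sub>M CB"
proof (rule measurable_configurationI)
  fix U :: "'b set" assume U: "open U" "bounded U"
  have [measurable]: "Measurable.pred N (\<lambda>w. h w \<in> g w)" by (rule measurable_mem_configuration[OF g h])
  have [measurable]: "(\<lambda>w. real (card (g w \<inter> U))) \<in> borel_measurable N"
    by (intro card_Int_measurable_aux g U)
  have [measurable]: "U \<in> sets borel" using U by auto
  have "real (card (insert (h w) (g w) \<inter> U)) =
      real (card (g w \<inter> U)) + (if h w \<in> U \<and> h w \<notin> g w then 1 else 0)" if "w \<in> space N" for w
    using finite_configuration_bounded[OF config_in[OF g that] U(2)]
    by (auto simp: Int_insert_left card_insert_if)
  then show "(\<lambda>w. real (card (insert (h w) (g w) \<inter> U))) \<in> borel_measurable N"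
    by (subst measurable_cong) (assumption, measurable)
qed (use config_in[OF g] configuration_insert in auto)

lemma measurable_remove_configuration:
  assumes g: "g \<in> N \<rightarrow>\<^sub>M CB" and h[measurable]: "h \<in> N \<rightarrow>\<^sub>M borel"
  shows "(\<lambda>w. g w - {h w}) \<in> N \<rightarrow>\<^sub>M CB"
proof (rule measurable_configurationI)
  fix U :: "'b set" assume U: "open U" "bounded U"
  have [measurable]: "Measurable.pred N (\<lambda>w. h w \<in> g w)" by (rule measurable_mem_configuration[OF g h])
  have [measurable]: "(\<lambda>w. real (card (g w \<inter> U))) \<in> borel_measurable N"
    by (intro card_Int_measurable_aux g U)
  have [measurable]: "U \<in> sets borel" using U by auto
  have "real (card ((g w - {h w}) \<inter> U)) =
      real (card (g w \<inter> U)) - (if h w \<in> U \<and> h w \<in> g w then 1 else 0)" if "w \<in> space N" for w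
  proof -
    have fin: "finite (g w \<inter> U)" by (rule finite_configuration_bounded[OF config_in[OF g that] U(2)])
    have "(g w - {h w}) \<inter> U = g w \<inter> U - {h w}" by blast
    moreover have "card (g w \<inter> U) \<noteq> 0" if "h w \<in> U" "h w \<in> g w" using fin that by auto
    ultimately show ?thesis using fin
      by (cases "h w \<in> g w \<inter> U")
         (auto simp: card_Diff_singleton of_nat_diff Suc_leI card_gt_0_iff)
  qed
  then show "(\<lambda>w. real (card ((g w - {h w}) \<inter> U))) \<in> borel_measurable N"
    by (subst measurable_cong) (assumption, measurable)
qed (use config_in[OF g] configuration_subset in blast)

lemma measurable_card_Int:
  assumes g: "g \<in> N \<rightarrow>\<^sub>M CB" and A[measurable]: "A \<in> sets borel" and bdd: "bounded A"
  shows "(\<lambda>w. card (g w \<inter> A)) \<in> N \<rightarrow>\<^sub>M count_space UNIV"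
proof -
  have [measurable]: "(\<lambda>w. \<integral>\<^sup>+x. indicator A x \<partial>count_space (g w)) \<in> borel_measurable N"
    by (rule measurable_nn_sum[OF g]) measurable
  have eq: "enn2real (\<integral>\<^sup>+x. indicator A x \<partial>count_space (g w)) = real (card (g w \<inter> A))" if "w \<in> space N" for w
    using card_Int_eq_nn_sum[OF config_in[OF g that] bdd] by simp
  have [measurable]: "(\<lambda>w. real (card (g w \<inter> A))) \<in> borel_measurable N"
    by (subst measurable_cong[OF eq[symmetric]]) (assumption, measurable)
  have "(\<lambda>w. nat \<lfloor>real (card (g w \<inter> A))\<rfloor>) \<in> N \<rightarrow>\<^sub>M count_space UNIV" by measurable
  then show ?thesis by simp
qed

definition offdiag :: "'a set \<Rightarrow> ('a \<times> 'a) set" where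
  "offdiag \<gamma> = {(x, y). x \<in> \<gamma> \<and> y \<in> \<gamma> \<and> x \<noteq> y}"

lemma nn_sum_offdiag:
  "(\<integral>\<^sup>+p. f p \<partial>count_space (offdiag \<gamma>)) =
     (\<integral>\<^sup>+x. \<integral>\<^sup>+y. f (x, y) * indicator {p. fst p \<noteq> snd p} (x, y) \<partial>count_space \<gamma> \<partial>count_space \<gamma>)"
proof -
  have "(\<integral>\<^sup>+p. f p \<partial>count_space (offdiag \<gamma>)) = (\<integral>\<^sup>+p. f p * indicator (offdiag \<gamma>) p \<partial>count_space UNIV)"
    by (rule nn_integral_count_space_indicator) simp
  also have "\<dots> = (\<integral>\<^sup>+x. \<integral>\<^sup>+y. f (x, y) * indicator (offdiag \<gamma>) (x, y) \<partial>count_space UNIV \<partial>count_space UNIV)"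
    by (rule nn_integral_fst_count_space[symmetric])
  also have "\<dots> = (\<integral>\<^sup>+x. \<integral>\<^sup>+y. f (x, y) * indicator {p. fst p \<noteq> snd p} (x, y) \<partial>count_space \<gamma> \<partial>count_space \<gamma>)"
    by (subst (1 2) nn_integral_count_space_indicator[of \<gamma>])
       (auto simp: offdiag_def indicator_def nn_integral_multc[symmetric] intro!: nn_integral_cong)
  finally show ?thesis .
qed

lemma measurable_nn_sum_offdiag:
  fixes g :: "'w \<Rightarrow> 'a::euclidean_space set"
  assumes g[measurable]: "g \<in> N \<rightarrow>\<^sub>M CB"
    and f[measurable]: "(\<lambda>(\<omega>, p). f \<omega> p) \<in> borel_measurable (N \<Otimes>\<^sub>M (borel \<Otimes>\<^sub>M borel))"
  shows "(\<lambda>\<omega>. \<integral>\<^sup>+p. f \<omega> p \<partial>count_space (offdiag (g \<omega>))) \<in> borel_measurable N"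
  unfolding nn_sum_offdiag
proof (rule measurable_nn_sum[OF g])
  have 1: "(\<lambda>w. g (fst w)) \<in> N \<Otimes>\<^sub>M borel \<rightarrow>\<^sub>M CB" by measurable
  have "(\<lambda>(w, y). f (fst w) (snd w, y) * indicator {p. fst p \<noteq> snd p} (snd w, y))
      \<in> borel_measurable ((N \<Otimes>\<^sub>M borel) \<Otimes>\<^sub>M borel)"
    unfolding case_prod_beta indicator_def by measurable
  from measurable_nn_sum[OF 1 this]
  show "(\<lambda>(\<omega>, x). \<integral>\<^sup>+y. f \<omega> (x, y) * indicator {p. fst p \<noteq> snd p} (x, y) \<partial>count_space (g \<omega>))
      \<in> borel_measurable (N \<Otimes>\<^sub>M borel)" by (simp add: case_prod_beta)
qed

text \<open>
  Unconditional, because both sides are zero for a family that is not absolutely summable.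
\<close>

lemma infsum_eq_integral_count_space:
  fixes f :: "'b \<Rightarrow> real"
  shows "(\<Sum>\<^sub>\<infinity>x\<in>A. f x) = (\<integral>x. f x \<partial>count_space A)"
proof (cases "f summable_on A")
  case True
  then have "Infinite_Set_Sum.abs_summable_on f A"
    using abs_summable_equivalent summable_on_iff_abs_summable_on_real by blast
  then show ?thesis using infsetsum_infsum[of f A] by (simp add: infsetsum_def)
next
  case False
  then have "\<not> integrable (count_space A) f"
    using abs_summable_equivalent[of f A] summable_on_iff_abs_summable_on_real[of f A]
    by (simp add: Infinite_Set_Sum.abs_summable_on_def)
  then show ?thesis using False by (simp add: infsum_not_exists not_integrable_integral_eq)
qed

lemma integral_eq_enn2real_diff:
  fixes f :: "'s \<Rightarrow> real"
  assumes "f \<in> borel_measurable K"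
  shows "(\<integral>s. f s \<partial>K) = (if (\<integral>\<^sup>+s. ennreal \<bar>f s\<bar> \<partial>K) < \<infinity>
     then enn2real (\<integral>\<^sup>+s. ennreal (f s) \<partial>K) - enn2real (\<integral>\<^sup>+s. ennreal (- f s) \<partial>K) else 0)"
  using assms by (auto simp: integrable_iff_bounded real_lebesgue_integral_def not_integrable_integral_eq)

lemma measurable_real_sum_offdiag:
  fixes g :: "'w \<Rightarrow> 'a::euclidean_space set"
  assumes g[measurable]: "g \<in> N \<rightarrow>\<^sub>M CB"
    and f[measurable]: "(\<lambda>(w, p). f w p :: real) \<in> borel_measurable (N \<Otimes>\<^sub>M (borel \<Otimes>\<^sub>M borel))"
  shows "(\<lambda>w. \<integral>p. f w p \<partial>count_space (offdiag (g w))) \<in> borel_measurable N"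
proof -
  have [measurable]: "(\<lambda>w. \<integral>\<^sup>+p. ennreal \<bar>f w p\<bar> \<partial>count_space (offdiag (g w))) \<in> borel_measurable N"
     "(\<lambda>w. \<integral>\<^sup>+p. ennreal (f w p) \<partial>count_space (offdiag (g w))) \<in> borel_measurable N"
     "(\<lambda>w. \<integral>\<^sup>+p. ennreal (- f w p) \<partial>count_space (offdiag (g w))) \<in> borel_measurable N"
    by (intro measurable_nn_sum_offdiag g; measurable)+
  show ?thesis by (subst integral_eq_enn2real_diff) (simp, measurable)
qed

lemma measurable_real_sum:
  fixes g :: "'w \<Rightarrow> 'a::euclidean_space set"
  assumes g[measurable]: "g \<in> N \<rightarrow>\<^sub>M CB"
    and f[measurable]: "(\<lambda>(w, x). f w x :: real) \<in> borel_measurable (N \<Otimes>\<^sub>M borel)"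
  shows "(\<lambda>w. \<integral>x. f w x \<partial>count_space (g w)) \<in> borel_measurable N"
proof -
  have [measurable]: "(\<lambda>w. \<integral>\<^sup>+p. ennreal \<bar>f w p\<bar> \<partial>count_space (g w)) \<in> borel_measurable N"
     "(\<lambda>w. \<integral>\<^sup>+p. ennreal (f w p) \<partial>count_space (g w)) \<in> borel_measurable N"
     "(\<lambda>w. \<integral>\<^sup>+p. ennreal (- f w p) \<partial>count_space (g w)) \<in> borel_measurable N"
    by (intro measurable_nn_sum g; measurable)+
  show ?thesis by (subst integral_eq_enn2real_diff) (simp, measurable)
qed

section \<open>Poisson counts and the Mecke formula\<close>

lemma nn_integral_distr_nat:
  fixes X :: "'w \<Rightarrow> nat"
  assumes X[measurable]: "X \<in> M \<rightarrow>\<^sub>M count_space UNIV"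
  shows "(\<integral>\<^sup>+k. f k \<partial>distr M (count_space UNIV) X) =
    (\<integral>\<^sup>+k. emeasure M {w \<in> space M. X w = k} * f k \<partial>count_space UNIV)"
proof -
  have "distr M (count_space UNIV) X = density (count_space UNIV) (\<lambda>k. emeasure M {w \<in> space M. X w = k})"
  proof (rule measure_eqI_countable[where A = UNIV])
    fix k :: nat
    have "X -` {k} \<inter> space M = {w \<in> space M. X w = k}" by auto
    then show "emeasure (distr M (count_space UNIV) X) {k} =
        emeasure (density (count_space UNIV) (\<lambda>k. emeasure M {w \<in> space M. X w = k})) {k}"
      by (simp add: emeasure_distr emeasure_density nn_integral_count_space_indicator[symmetric])
  qed auto
  then show ?thesis by (simp add: nn_integral_density)
qed

text \<open>
  The identity \<open>k * r^k / k! = r * r^(k-1) / (k-1)!\<close>, which is the Mecke formula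
  for a single box. At \<open>k = 0\<close> the truncated difference \<open>k - 1\<close> is
  harmless because of the factor \<open>k\<close>.
\<close>

lemma nn_integral_poisson_shift:
  fixes X :: "'w \<Rightarrow> nat"
  assumes X: "X \<in> M \<rightarrow>\<^sub>M count_space UNIV" and "r \<ge> 0"
    and law: "\<And>k. emeasure M {w \<in> space M. X w = k} = ennreal (r ^ k / fact k * exp (- r))"
  shows "(\<integral>\<^sup>+k. of_nat k * f (k - 1) \<partial>distr M (count_space UNIV) X) =
    ennreal r * (\<integral>\<^sup>+k. f k \<partial>distr M (count_space UNIV) X)"
proof -
  let ?p = "\<lambda>k. ennreal (r ^ k / fact k * exp (- r))"
  have "(\<integral>\<^sup>+k. of_nat k * f (k - 1) \<partial>distr M (count_space UNIV) X) =
      (\<integral>\<^sup>+k. ?p k * (of_nat k * f (k - 1)) \<partial>count_space UNIV)"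
    by (simp add: nn_integral_distr_nat[OF X] law)
  also have "\<dots> = (\<integral>\<^sup>+k. ?p k * (of_nat k * f (k - 1)) \<partial>count_space (range Suc))"
    by (rule nn_integral_count_space_eq) (auto simp: image_iff dest: not0_implies_Suc)
  also have "\<dots> = (\<integral>\<^sup>+k. ?p (Suc k) * (of_nat (Suc k) * f k) \<partial>count_space UNIV)"
    using nn_integral_bij_count_space[of Suc UNIV "range Suc" "\<lambda>k. ?p k * (of_nat k * f (k - 1))"]
    by (simp add: inj_on_imp_bij_betw)
  also have "\<dots> = (\<integral>\<^sup>+k. ennreal r * (?p k * f k) \<partial>count_space UNIV)"
  proof (rule nn_integral_cong)
    fix k :: nat
    have "?p (Suc k) * of_nat (Suc k) = ennreal r * ?p k"
      using \<open>r \<ge> 0\<close> unfolding ennreal_of_nat_eq_real_of_nat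
      by (simp add: ennreal_mult[symmetric] field_simps del: of_nat_Suc)
    then show "?p (Suc k) * (of_nat (Suc k) * f k) = ennreal r * (?p k * f k)"
      by (metis mult.assoc)
  qed
  finally show ?thesis by (simp add: nn_integral_distr_nat[OF X] law nn_integral_cmult)
qed

lemma (in prob_space) indep_poisson_shift:
  fixes X :: "nat \<Rightarrow> 'a \<Rightarrow> nat"
  assumes I: "finite I" "i \<in> I" and X: "\<And>j. X j \<in> M \<rightarrow>\<^sub>M count_space UNIV"
    and indep: "indep_vars (\<lambda>_. count_space UNIV) X I" and "r \<ge> 0"
    and law: "\<And>k. emeasure M {w \<in> space M. X i w = k} = ennreal (r ^ k / fact k * exp (- r))"
    and h[measurable]: "h \<in> borel_measurable (\<Pi>\<^sub>M j\<in>I. count_space UNIV)"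
  shows "(\<integral>\<^sup>+w. of_nat (X i w) * h ((\<lambda>j\<in>I. X j w)(i := X i w - 1)) \<partial>M) =
    ennreal r * (\<integral>\<^sup>+w. h (\<lambda>j\<in>I. X j w) \<partial>M)"
proof -
  let ?C = "count_space UNIV :: nat measure"
  define D where "D j = distr M ?C (X j)" for j
  interpret D: product_prob_space D
    by (rule product_prob_spaceI) (simp add: D_def prob_space_distr X)
  have setsD: "sets (D j) = sets ?C" for j by (simp add: D_def)
  have setsPi: "sets (Pi\<^sub>M I D) = sets (\<Pi>\<^sub>M j\<in>I. ?C)"
    by (rule sets_PiM_cong) (auto simp: setsD)
  have "distr M (\<Pi>\<^sub>M j\<in>I. ?C) (\<lambda>w. \<lambda>j\<in>I. X j w) = Pi\<^sub>M I D"
    unfolding D_def using I X indep by (subst indep_vars_iff_distr_eq_PiM'[symmetric]) auto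
  note PiD = this[symmetric]
  have via: "(\<integral>\<^sup>+w. g (\<lambda>j\<in>I. X j w) \<partial>M) = (\<integral>\<^sup>+x. g x \<partial>Pi\<^sub>M I D)"
    if "g \<in> borel_measurable (\<Pi>\<^sub>M j\<in>I. ?C)" for g
    unfolding PiD using that X
    by (intro nn_integral_distr[symmetric] measurable_restrict) auto
  have comp[measurable]: "(\<lambda>x. x i) \<in> (\<Pi>\<^sub>M j\<in>I. ?C) \<rightarrow>\<^sub>M ?C" using I by measurable
  have upd: "(\<lambda>x. x(i := x i - 1)) \<in> (\<Pi>\<^sub>M j\<in>I. ?C) \<rightarrow>\<^sub>M (\<Pi>\<^sub>M j\<in>I. ?C)"
    using I by (intro measurable_fun_upd[where J = I]) (auto intro!: measurable_compose[OF comp])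
  have gm[measurable]: "(\<lambda>x. of_nat (x i) * h (x(i := x i - 1))) \<in> borel_measurable (\<Pi>\<^sub>M j\<in>I. ?C)"
    using measurable_compose[OF upd h] measurable_compose[OF comp, of of_nat "borel :: ennreal measure"]
    by (intro borel_measurable_times_ennreal) auto
  obtain J where J: "I = insert i J" "i \<notin> J" "finite J" using I by (metis finite_insert mk_disjoint_insert)
  have "(\<integral>\<^sup>+w. of_nat (X i w) * h ((\<lambda>j\<in>I. X j w)(i := X i w - 1)) \<partial>M) =
      (\<integral>\<^sup>+x. of_nat (x i) * h (x(i := x i - 1)) \<partial>Pi\<^sub>M I D)"
    using via[OF gm] I by simp
  also have "\<dots> = (\<integral>\<^sup>+x. (\<integral>\<^sup>+y. of_nat y * h (x(i := y - 1)) \<partial>D i) \<partial>Pi\<^sub>M J D)"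
    using D.product_nn_integral_insert[OF J(3,2), folded J(1), of "\<lambda>x. of_nat (x i) * h (x(i := x i - 1))"]
      gm[folded measurable_cong_sets[OF setsPi refl]] by simp
  also have "\<dots> = (\<integral>\<^sup>+x. ennreal r * (\<integral>\<^sup>+y. h (x(i := y)) \<partial>D i) \<partial>Pi\<^sub>M J D)"
    unfolding D_def using nn_integral_poisson_shift[OF X \<open>r \<ge> 0\<close> law] by (intro nn_integral_cong) auto
  also have "\<dots> = ennreal r * (\<integral>\<^sup>+x. (\<integral>\<^sup>+y. h (x(i := y)) \<partial>D i) \<partial>Pi\<^sub>M J D)"
  proof (rule nn_integral_cmult)
    have "(\<lambda>(x, y). h (x(i := y))) \<in> borel_measurable (Pi\<^sub>M J D \<Otimes>\<^sub>M D i)"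
      using measurable_compose[OF measurable_add_dim[of i J D, folded J(1)]
          h[folded measurable_cong_sets[OF setsPi refl]]]
      by (simp add: case_prod_beta')
    then show "(\<lambda>x. \<integral>\<^sup>+y. h (x(i := y)) \<partial>D i) \<in> borel_measurable (Pi\<^sub>M J D)"
      by (rule sigma_finite_measure.borel_measurable_nn_integral[rotated])
         (simp add: D_def prob_space_imp_sigma_finite prob_space_distr X)
  qed
  also have "(\<integral>\<^sup>+x. (\<integral>\<^sup>+y. h (x(i := y)) \<partial>D i) \<partial>Pi\<^sub>M J D) = (\<integral>\<^sup>+x. h x \<partial>Pi\<^sub>M I D)"
    using D.product_nn_integral_insert[OF J(3,2), folded J(1), of h]
      h[folded measurable_cong_sets[OF setsPi refl]] by simp
  also have "\<dots> = (\<integral>\<^sup>+w. h (\<lambda>j\<in>I. X j w) \<partial>M)" using via[OF h] by simp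
  finally show ?thesis .
qed

locale poisson_configuration =
  fixes z :: real and M :: "'a::euclidean_space set measure"
  assumes z_pos: "z > 0" and poisson: "is_poisson_measure z M"
begin

sublocale prob_space M using poisson by (simp add: is_poisson_measure_def)

lemma sets_M [simp, measurable_cong]: "sets M = sets CB"
  using poisson by (simp add: is_poisson_measure_def)

lemma space_M [simp]: "space M = configurations"
  using sets_eq_imp_space_eq[OF sets_M] by simp

lemma emeasure_bounded: "bounded A \<Longrightarrow> emeasure lborel A < \<infinity>"
  using emeasure_bounded_finite by simp

lemma measurable_count:
  "A \<in> sets borel \<Longrightarrow> bounded A \<Longrightarrow> (\<lambda>\<gamma>. card (\<gamma> \<inter> A)) \<in> M \<rightarrow>\<^sub>M count_space UNIV"
  by (rule measurable_card_Int) auto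

lemma count_law:
  assumes "A \<in> sets borel" "bounded A"
  shows "emeasure M {\<gamma> \<in> space M. card (\<gamma> \<inter> A) = k} =
    ennreal ((z * measure lborel A) ^ k / fact k * exp (- (z * measure lborel A)))"
  using poisson assms by (auto simp: is_poisson_measure_def emeasure_eq_measure)

lemma count_indep:
  assumes "finite (I :: nat set)" "disjoint_family_on A I" "\<And>i. i \<in> I \<Longrightarrow> A i \<in> sets borel \<and> bounded (A i)"
  shows "indep_vars (\<lambda>_. count_space UNIV) (\<lambda>i \<gamma>. card (\<gamma> \<inter> A i)) I"
  using poisson assms unfolding is_poisson_measure_def by blast

text \<open>
  Removing a point of the box \<open>C i\<close> lowers the count of this box by one and changes
  no other count; there are as many choices as the count itself.
\<close>

lemma mecke_atoms:
  fixes C :: "nat \<Rightarrow> 'a set"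
  assumes I: "finite I" "i \<in> I" and dis: "disjoint_family_on C I"
    and C: "\<And>j. C j \<in> sets borel \<and> bounded (C j)"
    and h: "h \<in> borel_measurable (\<Pi>\<^sub>M j\<in>I. count_space UNIV)"
  shows "(\<integral>\<^sup>+\<gamma>. \<integral>\<^sup>+x. indicator (C i) x * h (\<lambda>j\<in>I. card ((\<gamma> - {x}) \<inter> C j)) \<partial>count_space \<gamma> \<partial>M) =
    ennreal z * emeasure lborel (C i) * (\<integral>\<^sup>+\<gamma>. h (\<lambda>j\<in>I. card (\<gamma> \<inter> C j)) \<partial>M)"
proof -
  have "(\<integral>\<^sup>+x. indicator (C i) x * h (\<lambda>j\<in>I. card ((\<gamma> - {x}) \<inter> C j)) \<partial>count_space \<gamma>) =
      of_nat (card (\<gamma> \<inter> C i)) * h ((\<lambda>j\<in>I. card (\<gamma> \<inter> C j))(i := card (\<gamma> \<inter> C i) - 1))"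
    if \<gamma>: "\<gamma> \<in> configurations" for \<gamma>
  proof -
    have fin: "finite (\<gamma> \<inter> C i)" using \<gamma> C finite_configuration_bounded by blast
    have "(\<lambda>j\<in>I. card ((\<gamma> - {x}) \<inter> C j)) = (\<lambda>j\<in>I. card (\<gamma> \<inter> C j))(i := card (\<gamma> \<inter> C i) - 1)"
      if x: "x \<in> C i" "x \<in> \<gamma>" for x
    proof
      fix j
      have "(\<gamma> - {x}) \<inter> C i = \<gamma> \<inter> C i - {x}" by blast
      then have 1: "card ((\<gamma> - {x}) \<inter> C i) = card (\<gamma> \<inter> C i) - 1" using x fin by (simp add: card_Diff_singleton)
      have "(\<gamma> - {x}) \<inter> C j = \<gamma> \<inter> C j" if "j \<in> I" "j \<noteq> i"
        using x I dis that by (auto simp: disjoint_family_on_def)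
      then show "(\<lambda>j\<in>I. card ((\<gamma> - {x}) \<inter> C j)) j = ((\<lambda>j\<in>I. card (\<gamma> \<inter> C j))(i := card (\<gamma> \<inter> C i) - 1)) j"
        using 1 I by (auto simp: restrict_def)
    qed
    then have "(\<integral>\<^sup>+x. indicator (C i) x * h (\<lambda>j\<in>I. card ((\<gamma> - {x}) \<inter> C j)) \<partial>count_space \<gamma>) =
        (\<integral>\<^sup>+x. indicator (C i) x * h ((\<lambda>j\<in>I. card (\<gamma> \<inter> C j))(i := card (\<gamma> \<inter> C i) - 1)) \<partial>count_space \<gamma>)"
      by (intro nn_integral_cong) (auto simp: indicator_def)
    then show ?thesis using card_Int_eq_nn_sum[OF \<gamma>, of "C i"] C by (simp add: nn_integral_multc)
  qed
  then have "(\<integral>\<^sup>+\<gamma>. \<integral>\<^sup>+x. indicator (C i) x * h (\<lambda>j\<in>I. card ((\<gamma> - {x}) \<inter> C j)) \<partial>count_space \<gamma> \<partial>M) =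
      (\<integral>\<^sup>+\<gamma>. of_nat (card (\<gamma> \<inter> C i)) * h ((\<lambda>j\<in>I. card (\<gamma> \<inter> C j))(i := card (\<gamma> \<inter> C i) - 1)) \<partial>M)"
    by (intro nn_integral_cong) simp
  also have "\<dots> = ennreal (z * measure lborel (C i)) * (\<integral>\<^sup>+\<gamma>. h (\<lambda>j\<in>I. card (\<gamma> \<inter> C j)) \<partial>M)"
    by (rule indep_poisson_shift[OF I _ count_indep])
       (use I dis C h z_pos measurable_count count_law in auto)
  also have "ennreal (z * measure lborel (C i)) = ennreal z * emeasure lborel (C i)"
    using z_pos emeasure_bounded[of "C i"] C
    by (simp add: ennreal_mult emeasure_eq_ennreal_measure)
  finally show ?thesis .
qed

text \<open>
  The windows of a counting event may overlap. They and \<open>A\<close> are cut into the atoms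
  of the finite algebra that they generate; the counts of the atoms are independent and
  determine all the others.
\<close>

lemma mecke_generator:
  assumes A: "A \<in> sets borel" "bounded A" and S: "S \<in> open_count_events"
  shows "(\<integral>\<^sup>+\<gamma>. \<integral>\<^sup>+x. indicator A x * indicator S (\<gamma> - {x}) \<partial>count_space \<gamma> \<partial>M) =
    ennreal z * emeasure lborel A * emeasure M S"
proof -
  obtain P where P: "S = count_event P" "finite P" "\<forall>(B, k)\<in>P. open B \<and> bounded B"
    using S by (auto simp: open_count_events_def)
  define \<B> where "\<B> = insert A (fst ` P)"
  have \<B>: "finite \<B>" "\<And>B. B \<in> \<B> \<Longrightarrow> B \<in> sets borel \<and> bounded B" using P A by (auto simp: \<B>_def)
  have "finite (Pow \<B> - {{}})" using \<B> by simp
  then obtain e where e: "bij_betw e {0..<card (Pow \<B> - {{}})} (Pow \<B> - {{}})"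
    using ex_bij_betw_nat_finite by blast
  define I where "I = {0..<card (Pow \<B> - {{}})}"
  \<comment> \<open>e enumerates the non-empty sets of windows; C i consists of the points
    that lie in precisely the windows of e i.\<close>
  define C where "C i = (if i \<in> I then {x. \<forall>B\<in>\<B>. x \<in> B \<longleftrightarrow> B \<in> e i} else {})" for i
  have finI: "finite I" by (simp add: I_def)
  have eI: "e i \<subseteq> \<B>" "e i \<noteq> {}" if "i \<in> I" for i
    using bij_betwE[OF e] that unfolding I_def by blast+
  have C: "C i \<in> sets borel \<and> bounded (C i)" for i
  proof (cases "i \<in> I")
    case True
    obtain B where B: "B \<in> e i" using eI[OF True] by blast
    then have "C i \<subseteq> B" using eI[OF True] True by (auto simp: C_def)
    then have "bounded (C i)" using \<B>(2)[of B] B eI[OF True] bounded_subset by blast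
    moreover have "{x \<in> space borel. \<forall>B\<in>\<B>. x \<in> B \<longleftrightarrow> B \<in> e i} \<in> sets borel"
    proof (rule sets.sets_Collect_finite_All[OF _ \<B>(1)])
      fix B assume "B \<in> \<B>"
      then have [measurable]: "B \<in> sets borel" using \<B>(2) by blast
      show "{x \<in> space borel. (x \<in> B) = (B \<in> e i)} \<in> sets borel" by measurable
    qed
    ultimately show ?thesis using True by (simp add: C_def)
  qed (simp add: C_def)
  have dis: "disjoint_family_on C I"
    unfolding disjoint_family_on_def
  proof (intro ballI impI)
    fix i j assume ij: "i \<in> I" "j \<in> I" "i \<noteq> j"
    have "e i \<noteq> e j" using inj_onD[OF bij_betw_imp_inj_on[OF e]] ij unfolding I_def by blast
    then obtain B where "B \<in> \<B>" "(B \<in> e i) \<noteq> (B \<in> e j)" using eI ij by blast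
    then show "C i \<inter> C j = {}" using ij by (auto simp: C_def)
  qed
  define J where "J B = {i \<in> I. B \<in> e i}" for B
  have finJ: "finite (J B)" for B using finI by (simp add: J_def)
  have JI: "J B \<subseteq> I" for B by (auto simp: J_def)
  have UJ: "B = (\<Union>i\<in>J B. C i)" if B: "B \<in> \<B>" for B
  proof
    show "(\<Union>i\<in>J B. C i) \<subseteq> B" using B by (auto simp: J_def C_def split: if_splits)
    show "B \<subseteq> (\<Union>i\<in>J B. C i)"
    proof
      fix x assume x: "x \<in> B"
      then have "{B' \<in> \<B>. x \<in> B'} \<in> e ` I"
        unfolding I_def bij_betw_imp_surj_on[OF e] using B by auto
      then obtain i where i: "i \<in> I" "{B' \<in> \<B>. x \<in> B'} = e i" by (elim imageE) simp
      then have "x \<in> C i" "i \<in> J B" using x B unfolding C_def J_def by (simp_all flip: i(2))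
      then show "x \<in> (\<Union>i\<in>J B. C i)" by blast
    qed
  qed
  have cardB: "card (\<gamma> \<inter> B) = (\<Sum>i\<in>J B. card (\<gamma> \<inter> C i))" if "\<gamma> \<in> configurations" "B \<in> \<B>" for \<gamma> B
  proof -
    have "\<gamma> \<inter> B = (\<Union>i\<in>J B. \<gamma> \<inter> C i)" using UJ[OF that(2)] by blast
    moreover have "card (\<Union>i\<in>J B. \<gamma> \<inter> C i) = (\<Sum>i\<in>J B. card (\<gamma> \<inter> C i))"
    proof (rule card_UN_disjoint[OF finJ])
      show "\<forall>i\<in>J B. finite (\<gamma> \<inter> C i)" using that(1) C finite_configuration_bounded by blast
      show "\<forall>i\<in>J B. \<forall>j\<in>J B. i \<noteq> j \<longrightarrow> (\<gamma> \<inter> C i) \<inter> (\<gamma> \<inter> C j) = {}"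
        using dis JI[of B] unfolding disjoint_family_on_def by blast
    qed
    ultimately show ?thesis by simp
  qed
  define h :: "(nat \<Rightarrow> nat) \<Rightarrow> ennreal"
    where "h y = (if \<forall>p\<in>P. (\<Sum>i\<in>J (fst p). y i) = snd p then 1 else 0)" for y
  have h[measurable]: "h \<in> borel_measurable (\<Pi>\<^sub>M j\<in>I. count_space UNIV)"
    by (subst count_space_PiM_finite[OF finI]) auto
  have hS: "h (\<lambda>j\<in>I. card (\<gamma> \<inter> C j)) = indicator S \<gamma>" if \<gamma>: "\<gamma> \<in> configurations" for \<gamma>
  proof -
    have "(\<Sum>i\<in>J (fst p). (\<lambda>j\<in>I. card (\<gamma> \<inter> C j)) i) = card (\<gamma> \<inter> fst p)" if "p \<in> P" for p
      using cardB[OF \<gamma>, of "fst p"] that JI[of "fst p"]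
      by (auto simp: \<B>_def restrict_def intro!: sum.cong)
    then show ?thesis using \<gamma> by (auto simp: h_def P(1) count_event_def indicator_def case_prod_beta)
  qed
  have meas: "(\<lambda>\<gamma>. \<integral>\<^sup>+x. indicator (C i) x * h (\<lambda>j\<in>I. card ((\<gamma> - {x}) \<inter> C j)) \<partial>count_space \<gamma>) \<in> borel_measurable M" for i
  proof (rule measurable_nn_sum)
    have "(\<lambda>w. fst w - {snd w}) \<in> M \<Otimes>\<^sub>M borel \<rightarrow>\<^sub>M CB"
      by (rule measurable_remove_configuration) measurable
    then have [measurable]: "(\<lambda>w. card ((fst w - {snd w}) \<inter> C j)) \<in> M \<Otimes>\<^sub>M borel \<rightarrow>\<^sub>M count_space UNIV" for j
      using C by (intro measurable_card_Int) auto
    have [measurable]: "C i \<in> sets borel" using C by auto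
    have "(\<lambda>w. \<lambda>j\<in>I. card ((fst w - {snd w}) \<inter> C j)) \<in> M \<Otimes>\<^sub>M borel \<rightarrow>\<^sub>M (\<Pi>\<^sub>M j\<in>I. count_space UNIV)"
      by (rule measurable_restrict) measurable
    from measurable_compose[OF this h]
    show "(\<lambda>(\<gamma>, x). indicator (C i) x * h (\<lambda>j\<in>I. card ((\<gamma> - {x}) \<inter> C j))) \<in> borel_measurable (M \<Otimes>\<^sub>M borel)"
      unfolding case_prod_beta by measurable
  qed measurable
  have indA: "indicator A x = (\<Sum>i\<in>J A. indicator (C i) x :: ennreal)" for x
  proof -
    have "disjoint_family_on C (J A)" using dis JI disjoint_family_on_mono by blast
    moreover have "A = (\<Union>i\<in>J A. C i)" by (rule UJ) (simp add: \<B>_def)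
    ultimately show ?thesis using indicator_UN_disjoint[OF finJ, of C A x] by metis
  qed
  have "(\<integral>\<^sup>+\<gamma>. \<integral>\<^sup>+x. indicator A x * indicator S (\<gamma> - {x}) \<partial>count_space \<gamma> \<partial>M) =
      (\<integral>\<^sup>+\<gamma>. (\<Sum>i\<in>J A. \<integral>\<^sup>+x. indicator (C i) x * h (\<lambda>j\<in>I. card ((\<gamma> - {x}) \<inter> C j)) \<partial>count_space \<gamma>) \<partial>M)"
    using hS[OF configuration_subset]
    by (intro nn_integral_cong, subst nn_integral_sum[symmetric])
       (auto intro!: nn_integral_cong simp: indA sum_distrib_right)
  also have "\<dots> = (\<Sum>i\<in>J A. \<integral>\<^sup>+\<gamma>. \<integral>\<^sup>+x. indicator (C i) x * h (\<lambda>j\<in>I. card ((\<gamma> - {x}) \<inter> C j)) \<partial>count_space \<gamma> \<partial>M)"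
    by (rule nn_integral_sum[OF meas])
  also have "\<dots> = (\<Sum>i\<in>J A. ennreal z * emeasure lborel (C i) * (\<integral>\<^sup>+\<gamma>. h (\<lambda>j\<in>I. card (\<gamma> \<inter> C j)) \<partial>M))"
    using JI[of A] by (intro sum.cong refl mecke_atoms finI dis C h) auto
  also have "(\<integral>\<^sup>+\<gamma>. h (\<lambda>j\<in>I. card (\<gamma> \<inter> C j)) \<partial>M) = (\<integral>\<^sup>+\<gamma>. indicator S \<gamma> \<partial>M)"
    using hS by (intro nn_integral_cong) simp
  also have "\<dots> = emeasure M S" using S open_count_events_sets by (intro nn_integral_indicator) auto
  also have "(\<Sum>i\<in>J A. ennreal z * emeasure lborel (C i) * emeasure M S) =
      ennreal z * (\<Sum>i\<in>J A. emeasure lborel (C i)) * emeasure M S"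
    by (simp add: sum_distrib_left sum_distrib_right)
  also have "(\<Sum>i\<in>J A. emeasure lborel (C i)) = emeasure lborel (\<Union>i\<in>J A. C i)"
    using C dis JI[of A] finJ by (intro sum_emeasure) (auto simp: disjoint_family_on_def subset_iff)
  also have "(\<Union>i\<in>J A. C i) = A" using UJ[of A] by (simp add: \<B>_def)
  finally show ?thesis .
qed

end

lemma nn_sum_Un:
  assumes "A \<inter> B = {}"
  shows "(\<integral>\<^sup>+x. f x \<partial>count_space (A \<union> B)) = (\<integral>\<^sup>+x. f x \<partial>count_space A) + (\<integral>\<^sup>+x. f x \<partial>count_space B)"
proof -
  have "(\<integral>\<^sup>+x. f x \<partial>count_space (A \<union> B)) = (\<integral>\<^sup>+x. f x * indicator (A \<union> B) x \<partial>count_space UNIV)"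
    by (rule nn_integral_count_space_indicator) simp
  also have "\<dots> = (\<integral>\<^sup>+x. f x * indicator A x + f x * indicator B x \<partial>count_space UNIV)"
    using assms by (intro nn_integral_cong) (auto simp: indicator_def)
  also have "\<dots> = (\<integral>\<^sup>+x. f x * indicator A x \<partial>count_space UNIV) + (\<integral>\<^sup>+x. f x * indicator B x \<partial>count_space UNIV)"
    by (rule nn_integral_add) auto
  also have "\<dots> = (\<integral>\<^sup>+x. f x \<partial>count_space A) + (\<integral>\<^sup>+x. f x \<partial>count_space B)"
    by (simp add: nn_integral_count_space_indicator[of A] nn_integral_count_space_indicator[of B])
  finally show ?thesis .
qed

lemma nn_sum_singleton: "(\<integral>\<^sup>+x. f x \<partial>count_space {a}) = f a"
  by (subst nn_integral_count_space_finite) auto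

lemma nn_sum_insert:
  "x \<notin> \<gamma> \<Longrightarrow> (\<integral>\<^sup>+y. f y \<partial>count_space (insert x \<gamma>)) = f x + (\<integral>\<^sup>+y. f y \<partial>count_space \<gamma>)"
  using nn_sum_Un[of "{x}" \<gamma> f] by (simp add: nn_sum_singleton)

context poisson_configuration
begin

text \<open>
  The reduced Campbell measure, whose identification with the product of intensity and law is
  the Mecke formula.
\<close>

definition campbell :: "('a \<times> 'a set) measure" where
  "campbell = measure_of (space (borel \<Otimes>\<^sub>M M)) (sets (borel \<Otimes>\<^sub>M M))
     (\<lambda>S. \<integral>\<^sup>+\<gamma>. \<integral>\<^sup>+x. indicator S (x, \<gamma> - {x}) \<partial>count_space \<gamma> \<partial>M)"

lemma sets_campbell [simp, measurable_cong]: "sets campbell = sets (borel \<Otimes>\<^sub>M M)"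
  unfolding campbell_def by (rule sets.sets_measure_of_eq)

lemma measurable_remove_pair:
  "(\<lambda>w. (snd w, fst w - {snd w})) \<in> M \<Otimes>\<^sub>M borel \<rightarrow>\<^sub>M borel \<Otimes>\<^sub>M M"
proof -
  have "(\<lambda>w. fst w - {snd w}) \<in> M \<Otimes>\<^sub>M borel \<rightarrow>\<^sub>M CB"
    by (rule measurable_remove_configuration) measurable
  then have [measurable]: "(\<lambda>w. fst w - {snd w}) \<in> M \<Otimes>\<^sub>M borel \<rightarrow>\<^sub>M M"
    by (simp cong: measurable_cong_sets)
  show ?thesis by measurable
qed

lemma measurable_campbell_sum:
  assumes f: "f \<in> borel_measurable (borel \<Otimes>\<^sub>M M)"
  shows "(\<lambda>\<gamma>. \<integral>\<^sup>+x. f (x, \<gamma> - {x}) \<partial>count_space \<gamma>) \<in> borel_measurable M"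
proof (rule measurable_nn_sum)
  show "(\<lambda>(\<gamma>, x). f (x, \<gamma> - {x})) \<in> borel_measurable (M \<Otimes>\<^sub>M borel)"
    using measurable_compose[OF measurable_remove_pair f] by (simp add: case_prod_beta')
qed measurable

lemma emeasure_campbell:
  assumes "S \<in> sets (borel \<Otimes>\<^sub>M M)"
  shows "emeasure campbell S = (\<integral>\<^sup>+\<gamma>. \<integral>\<^sup>+x. indicator S (x, \<gamma> - {x}) \<partial>count_space \<gamma> \<partial>M)"
  unfolding campbell_def
proof (rule emeasure_measure_of_sigma)
  show "sigma_algebra (space (borel \<Otimes>\<^sub>M M)) (sets (borel \<Otimes>\<^sub>M M))" by (rule sets.sigma_algebra_axioms)
  show "positive (sets (borel \<Otimes>\<^sub>M M)) (\<lambda>S. \<integral>\<^sup>+\<gamma>. \<integral>\<^sup>+x. indicator S (x, \<gamma> - {x}) \<partial>count_space \<gamma> \<partial>M)"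
    by (simp add: positive_def)
  show "countably_additive (sets (borel \<Otimes>\<^sub>M M)) (\<lambda>S. \<integral>\<^sup>+\<gamma>. \<integral>\<^sup>+x. indicator S (x, \<gamma> - {x}) \<partial>count_space \<gamma> \<partial>M)"
  proof (rule countably_additiveI)
    fix A :: "nat \<Rightarrow> ('a \<times> 'a set) set"
    assume A: "range A \<subseteq> sets (borel \<Otimes>\<^sub>M M)" "disjoint_family A"
    have "(\<Sum>i. \<integral>\<^sup>+\<gamma>. \<integral>\<^sup>+x. indicator (A i) (x, \<gamma> - {x}) \<partial>count_space \<gamma> \<partial>M) =
        (\<integral>\<^sup>+\<gamma>. (\<Sum>i. \<integral>\<^sup>+x. indicator (A i) (x, \<gamma> - {x}) \<partial>count_space \<gamma>) \<partial>M)"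
      using A by (intro nn_integral_suminf[symmetric] measurable_campbell_sum) auto
    also have "\<dots> = (\<integral>\<^sup>+\<gamma>. \<integral>\<^sup>+x. (\<Sum>i. indicator (A i) (x, \<gamma> - {x})) \<partial>count_space \<gamma> \<partial>M)"
      by (intro nn_integral_cong nn_integral_suminf[symmetric]) auto
    also have "\<dots> = (\<integral>\<^sup>+\<gamma>. \<integral>\<^sup>+x. indicator (\<Union>i. A i) (x, \<gamma> - {x}) \<partial>count_space \<gamma> \<partial>M)"
      using suminf_indicator[OF A(2)] by simp
    finally show "(\<Sum>i. \<integral>\<^sup>+\<gamma>. \<integral>\<^sup>+x. indicator (A i) (x, \<gamma> - {x}) \<partial>count_space \<gamma> \<partial>M) =
      (\<integral>\<^sup>+\<gamma>. \<integral>\<^sup>+x. indicator (\<Union>i. A i) (x, \<gamma> - {x}) \<partial>count_space \<gamma> \<partial>M)" .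
  qed
qed (rule assms)

lemma nn_integral_campbell:
  assumes "f \<in> borel_measurable (borel \<Otimes>\<^sub>M M)"
  shows "(\<integral>\<^sup>+w. f w \<partial>campbell) = (\<integral>\<^sup>+\<gamma>. \<integral>\<^sup>+x. f (x, \<gamma> - {x}) \<partial>count_space \<gamma> \<partial>M)"
  using assms
proof (induction rule: borel_measurable_induct)
  case (cong f g)
  have "(x, \<gamma> - {x}) \<in> space (borel \<Otimes>\<^sub>M M)" if "\<gamma> \<in> configurations" for x :: 'a and \<gamma>
    using that configuration_subset[OF that, of "\<gamma> - {x}"] by (auto simp: space_pair_measure)
  then have "(\<integral>\<^sup>+\<gamma>. \<integral>\<^sup>+x. f (x, \<gamma> - {x}) \<partial>count_space \<gamma> \<partial>M) = (\<integral>\<^sup>+\<gamma>. \<integral>\<^sup>+x. g (x, \<gamma> - {x}) \<partial>count_space \<gamma> \<partial>M)"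
    using cong(3) by (intro nn_integral_cong) auto
  moreover have "(\<integral>\<^sup>+w. f w \<partial>campbell) = (\<integral>\<^sup>+w. g w \<partial>campbell)"
    using cong(3) sets_eq_imp_space_eq[OF sets_campbell] by (intro nn_integral_cong) auto
  ultimately show ?case using cong(4) by metis
next
  case (set A) then show ?case by (simp add: emeasure_campbell)
next
  case (mult u c) then show ?case
    by (simp add: nn_integral_cmult measurable_campbell_sum)
next
  case (add u v) then show ?case
    by (simp add: nn_integral_add measurable_campbell_sum)
next
  case (seq U)
  have "incseq (\<lambda>i \<gamma>. \<integral>\<^sup>+x. U i (x, \<gamma> - {x}) \<partial>count_space \<gamma>)"
    using seq(3) by (auto simp: incseq_def le_fun_def intro!: nn_integral_mono)
  moreover have "incseq (\<lambda>i x. U i (x, \<gamma> - {x}))" for \<gamma>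
    using seq(3) by (auto simp: incseq_def le_fun_def)
  ultimately show ?case using seq
    by (simp add: nn_integral_monotone_convergence_SUP measurable_campbell_sum image_comp)
qed

lemma sigma_finite_intensity: "sigma_finite_measure (density lborel (\<lambda>_::'a. ennreal z))"
  by (subst sigma_finite_measure.sigma_finite_iff_density_finite[OF sigma_finite_lborel]) auto

lemma sigma_sets_bounded_borel: "sigma_sets UNIV {A \<in> sets borel. bounded A} = sets (borel :: 'a measure)"
proof
  show "sigma_sets UNIV {A \<in> sets borel. bounded A} \<subseteq> sets (borel :: 'a measure)"
    using sets.sigma_sets_subset[of "{A \<in> sets borel. bounded A}" "borel :: 'a measure"] by auto
  show "sets borel \<subseteq> sigma_sets UNIV {A \<in> sets borel. bounded (A :: 'a set)}"
  proof
    fix A :: "'a set" assume A: "A \<in> sets borel"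
    have "A = (\<Union>n::nat. A \<inter> ball 0 (real n))" using reals_Archimedean2 by auto
    moreover have "(\<Union>n::nat. A \<inter> ball 0 (real n)) \<in> sigma_sets UNIV {A \<in> sets borel. bounded A}"
      using A by (intro sigma_sets.Union sigma_sets.Basic) auto
    ultimately show "A \<in> sigma_sets UNIV {A \<in> sets borel. bounded A}" by simp
  qed
qed

text \<open>
  Both measures agree on products of bounded Borel sets and counting events, which form a
  generator stable under intersections and are finite there.
\<close>

lemma campbell_eq: "campbell = density lborel (\<lambda>_. ennreal z) \<Otimes>\<^sub>M M"
proof -
  let ?\<mu> = "density lborel (\<lambda>_::'a. ennreal z)"
  note times = emeasure_pair_measure_Times
  interpret \<mu>: sigma_finite_measure ?\<mu> by (rule sigma_finite_intensity)
  interpret pair_sigma_finite ?\<mu> M ..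
  define Ea where "Ea = {A \<in> sets borel. bounded (A :: 'a set)}"
  define E where "E = {a \<times> b | a b. a \<in> Ea \<and> b \<in> (open_count_events :: 'a set set set)}"
  have full: "configurations \<in> open_count_events"
  proof -
    have "configurations = count_event {}" by (auto simp: count_event_def)
    then show ?thesis unfolding open_count_events_def by blast
  qed
  have sub: "open_count_events \<subseteq> Pow configurations" by (auto simp: open_count_events_def count_event_def)
  have "sets (borel \<Otimes>\<^sub>M M) = sets (sigma (space borel \<times> space M) {a \<times> b | a b. a \<in> Ea \<and> b \<in> open_count_events})"
  proof (rule sets_pair_eq)
    show "sets borel = sigma_sets (space borel) Ea" by (simp add: Ea_def sigma_sets_bounded_borel)
    show "sets M = sigma_sets (space M) open_count_events" by (simp add: sets_configuration_borel_eq)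
    show "countable (range (\<lambda>n::nat. ball (0::'a) (real n)))" by simp
    show "range (\<lambda>n::nat. ball (0::'a) (real n)) \<subseteq> Ea" by (auto simp: Ea_def)
    show "\<Union>(range (\<lambda>n::nat. ball (0::'a) (real n))) = space borel" using reals_Archimedean2 by auto
    show "countable {configurations :: 'a set set}" by simp
  qed (use sub full in auto)
  also have "\<dots> = sigma_sets (UNIV \<times> configurations) E"
    unfolding E_def space_M space_borel using sub by (intro sets_measure_of) blast
  finally have gen: "sets (borel \<Otimes>\<^sub>M M) = sigma_sets (UNIV \<times> configurations) E" .
  have eqE: "emeasure campbell X = emeasure (?\<mu> \<Otimes>\<^sub>M M) X" if XE: "X \<in> E" for X
  proof -
    obtain A S where X: "X = A \<times> S" "A \<in> sets borel" "bounded A" "S \<in> open_count_events"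
      using XE unfolding E_def Ea_def by blast
    have S: "S \<in> sets M" using X open_count_events_sets by auto
    have "emeasure campbell X = (\<integral>\<^sup>+\<gamma>. \<integral>\<^sup>+x. indicator A x * indicator S (\<gamma> - {x}) \<partial>count_space \<gamma> \<partial>M)"
      unfolding X(1) using X S by (subst emeasure_campbell) (auto simp: indicator_times)
    also have "\<dots> = emeasure ?\<mu> A * emeasure M S"
      using X by (simp add: mecke_generator emeasure_density_const)
    also have "\<dots> = emeasure (?\<mu> \<Otimes>\<^sub>M M) X"
      unfolding X(1) using X S by (intro times[symmetric]) auto
    finally show ?thesis .
  qed
  show ?thesis
  proof (rule measure_eqI_generator_eq[where E = E and \<Omega> = "UNIV \<times> configurations"
        and A = "\<lambda>n. ball 0 (real n) \<times> configurations"])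
    show "Int_stable E"
    proof (rule Int_stableI)
      fix X Y assume "X \<in> E" "Y \<in> E"
      then obtain a b a' b' where "X = a \<times> b" "Y = a' \<times> b'" "a \<in> Ea" "a' \<in> Ea"
        "b \<in> open_count_events" "b' \<in> open_count_events" by (auto simp: E_def)
      moreover from this have "a \<inter> a' \<in> Ea" "b \<inter> b' \<in> open_count_events"
        using Int_stable_open_count_events by (auto simp: Ea_def Int_stable_def)
      ultimately show "X \<inter> Y \<in> E" unfolding E_def by (auto simp: Times_Int_Times)
    qed
    show "E \<subseteq> Pow (UNIV \<times> configurations)" using sub by (auto simp: E_def)
    show "sets campbell = sigma_sets (UNIV \<times> configurations) E" using gen by simp
    have "sets (?\<mu> \<Otimes>\<^sub>M M) = sets (borel \<Otimes>\<^sub>M M)" by (intro sets_pair_measure_cong) auto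
    then show "sets (?\<mu> \<Otimes>\<^sub>M M) = sigma_sets (UNIV \<times> configurations) E" using gen by simp
    show "range (\<lambda>n. ball 0 (real n) \<times> configurations) \<subseteq> E"
      using full unfolding E_def Ea_def by (intro image_subsetI CollectI exI conjI refl) auto
    show "(\<Union>n. ball (0::'a) (real n) \<times> configurations) = UNIV \<times> configurations"
      using reals_Archimedean2 by auto
    show "emeasure campbell (ball 0 (real n) \<times> configurations) \<noteq> \<infinity>" for n
    proof -
      have "ball 0 (real n) \<times> configurations \<in> E"
        using full unfolding E_def Ea_def by (intro CollectI exI conjI refl) auto
      then have "emeasure campbell (ball 0 (real n) \<times> configurations) =
          emeasure ?\<mu> (ball 0 (real n)) * emeasure M (space M)"
        using eqE times[of "ball 0 (real n)" ?\<mu> "space M"] sets.top[of M] by simp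
      also have "\<dots> = ennreal z * emeasure lborel (ball (0::'a) (real n))"
        by (simp add: emeasure_density_const emeasure_space_1 del: space_M)
      also have "\<dots> < \<infinity>" using emeasure_bounded[of "ball (0::'a) (real n)"] by (simp add: ennreal_mult_less_top)
      finally show ?thesis by simp
    qed
  qed (rule eqE)
qed

end

text \<open>
  Only the Mecke formula is used in the moment computations. They therefore apply both to the
  Poisson measure and to its exponential tilt, which has finite but not unit mass.
\<close>

locale mecke_measure = finite_measure \<nu> + mu: sigma_finite_measure \<mu>
  for \<nu> :: "'a::euclidean_space set measure" and \<mu> :: "'a measure" +
  assumes sets_nu [simp, measurable_cong]: "sets \<nu> = sets CB"
    and sets_mu [simp, measurable_cong]: "sets \<mu> = sets borel"
    and diffuse: "\<And>x. emeasure \<mu> {x} = 0"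
    and mecke: "\<And>f. f \<in> borel_measurable (\<mu> \<Otimes>\<^sub>M \<nu>) \<Longrightarrow>
      (\<integral>\<^sup>+\<gamma>. \<integral>\<^sup>+x. f (x, \<gamma>) \<partial>count_space \<gamma> \<partial>\<nu>) = (\<integral>\<^sup>+(x, \<gamma>). f (x, insert x \<gamma>) \<partial>(\<mu> \<Otimes>\<^sub>M \<nu>))"

context poisson_configuration
begin

lemma measurable_insert_pair:
  "(\<lambda>w. (fst w, insert (fst w) (snd w))) \<in> borel \<Otimes>\<^sub>M M \<rightarrow>\<^sub>M borel \<Otimes>\<^sub>M M"
proof -
  have "(\<lambda>w. insert (fst w) (snd w)) \<in> borel \<Otimes>\<^sub>M M \<rightarrow>\<^sub>M CB"
    by (rule measurable_insert_configuration) measurable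
  then have [measurable]: "(\<lambda>w. insert (fst w) (snd w)) \<in> borel \<Otimes>\<^sub>M M \<rightarrow>\<^sub>M M"
    by (simp cong: measurable_cong_sets)
  show ?thesis by measurable
qed

sublocale mecke_measure M "density lborel (\<lambda>_. ennreal z)"
proof (intro mecke_measure.intro mecke_measure_axioms.intro)
  show "finite_measure M" by unfold_locales
  show "sigma_finite_measure (density lborel (\<lambda>_::'a. ennreal z))" by (rule sigma_finite_intensity)
  show "emeasure (density lborel (\<lambda>_. ennreal z)) {x} = 0" for x :: 'a
    by (simp add: emeasure_density_const)
  fix f :: "'a \<times> 'a set \<Rightarrow> ennreal"
  have s: "sets (density lborel (\<lambda>_. ennreal z) \<Otimes>\<^sub>M M) = sets (borel \<Otimes>\<^sub>M M)"
    by (intro sets_pair_measure_cong) auto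
  assume "f \<in> borel_measurable (density lborel (\<lambda>_. ennreal z) \<Otimes>\<^sub>M M)"
  then have f: "f \<in> borel_measurable (borel \<Otimes>\<^sub>M M)" using measurable_cong_sets[OF s refl] by blast
  have "(\<lambda>w. f (fst w, insert (fst w) (snd w))) \<in> borel_measurable (borel \<Otimes>\<^sub>M M)"
    using measurable_compose[OF measurable_insert_pair f] .
  from nn_integral_campbell[OF this]
  have "(\<integral>\<^sup>+w. f (fst w, insert (fst w) (snd w)) \<partial>campbell) =
     (\<integral>\<^sup>+\<gamma>. \<integral>\<^sup>+x. f (x, insert x (\<gamma> - {x})) \<partial>count_space \<gamma> \<partial>M)" by simp
  also have "\<dots> = (\<integral>\<^sup>+\<gamma>. \<integral>\<^sup>+x. f (x, \<gamma>) \<partial>count_space \<gamma> \<partial>M)"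
    by (intro nn_integral_cong) (simp add: insert_absorb)
  finally show "(\<integral>\<^sup>+\<gamma>. \<integral>\<^sup>+x. f (x, \<gamma>) \<partial>count_space \<gamma> \<partial>M) =
      (\<integral>\<^sup>+(x, \<gamma>). f (x, insert x \<gamma>) \<partial>(density lborel (\<lambda>_. ennreal z) \<Otimes>\<^sub>M M))"
    by (simp add: campbell_eq case_prod_beta')
qed auto

end

section \<open>Consequences of the Mecke formula\<close>

context mecke_measure
begin

abbreviation \<mu>2 where "\<mu>2 \<equiv> \<mu> \<Otimes>\<^sub>M \<mu>"

lemma space_nu [simp]: "space \<nu> = configurations"
  using sets_eq_imp_space_eq[OF sets_nu] by simp

lemma space_mu [simp]: "space \<mu> = UNIV"
  using sets_eq_imp_space_eq[OF sets_mu] by simp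

sublocale mm: pair_sigma_finite \<mu> \<mu> ..

sublocale mn: pair_sigma_finite \<mu> \<nu> ..
sublocale mmn: pair_sigma_finite "\<mu>2" \<nu> ..

lemma measurable_insert' [measurable (raw)]:
  "g \<in> N \<rightarrow>\<^sub>M \<nu> \<Longrightarrow> h \<in> N \<rightarrow>\<^sub>M borel \<Longrightarrow> (\<lambda>w. insert (h w) (g w)) \<in> N \<rightarrow>\<^sub>M \<nu>"
  using measurable_insert_configuration[of g N h] by (simp cong: measurable_cong_sets)

lemma pred_mem' [measurable (raw)]:
  "g \<in> N \<rightarrow>\<^sub>M \<nu> \<Longrightarrow> h \<in> N \<rightarrow>\<^sub>M borel \<Longrightarrow> Measurable.pred N (\<lambda>w. h w \<in> g w)"
  using measurable_mem_configuration[of g N h] by (simp cong: measurable_cong_sets)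

lemma AE_not_in: "countable A \<Longrightarrow> AE x in \<mu>. x \<notin> A"
proof -
  assume A: "countable A"
  have "A \<in> null_sets \<mu>"
    using A null_sets_UN'[of A "\<lambda>x. {x}" \<mu>] diffuse by (auto simp: null_sets_def)
  then show ?thesis by (rule AE_not_in)
qed

lemma AE_diff: "AE p in \<mu>2. fst p \<noteq> snd p"
proof (rule mm.AE_pair_measure)
  show "{p \<in> space \<mu>2. fst p \<noteq> snd p} \<in> sets \<mu>2" by measurable
  show "AE x in \<mu>. AE y in \<mu>. fst (x, y) \<noteq> snd (x, y)"
  proof (rule AE_I2)
    fix x
    have "AE y in \<mu>. y \<notin> {x}" by (rule AE_not_in) simp
    then show "AE y in \<mu>. fst (x, y) \<noteq> snd (x, y)" by eventually_elim auto
  qed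
qed

lemma AE_new1: "AE w in \<mu> \<Otimes>\<^sub>M \<nu>. fst w \<notin> snd w"
proof -
  have "AE \<gamma> in \<nu>. AE x in \<mu>. x \<notin> \<gamma>"
    by (rule AE_I2) (auto intro!: AE_not_in countable_configuration)
  moreover have "{w \<in> space (\<mu> \<Otimes>\<^sub>M \<nu>). fst w \<notin> snd w} \<in> sets (\<mu> \<Otimes>\<^sub>M \<nu>)" by measurable
  ultimately show ?thesis using mn.AE_commute[of "\<lambda>x \<gamma>. x \<notin> \<gamma>"] by (intro mn.AE_pair_measure) auto
qed

lemma AE_new2: "AE w in \<mu>2 \<Otimes>\<^sub>M \<nu>.
    fst (fst w) \<notin> snd w \<and> snd (fst w) \<notin> snd w \<and> fst (fst w) \<noteq> snd (fst w)"
proof -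
  have "AE \<gamma> in \<nu>. AE p in \<mu>2. fst p \<notin> \<gamma> \<and> snd p \<notin> \<gamma> \<and> fst p \<noteq> snd p"
  proof (rule AE_I2)
    fix \<gamma> assume "\<gamma> \<in> space \<nu>"
    then have c: "countable \<gamma>" using countable_configuration by simp
    have [measurable]: "\<gamma> \<in> sets borel" by (rule sets.countable[OF _ c]) simp
    have "{p \<in> space \<mu>2. fst p \<notin> \<gamma>} \<in> sets \<mu>2"
      "{p \<in> space \<mu>2. snd p \<notin> \<gamma>} \<in> sets \<mu>2"
    proof -
      have "{p \<in> space \<mu>2. fst p \<notin> \<gamma>} = (- \<gamma>) \<times> UNIV"
        "{p \<in> space \<mu>2. snd p \<notin> \<gamma>} = UNIV \<times> (- \<gamma>)"
        by (auto simp: space_pair_measure)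
      then show "{p \<in> space \<mu>2. fst p \<notin> \<gamma>} \<in> sets \<mu>2"
        "{p \<in> space \<mu>2. snd p \<notin> \<gamma>} \<in> sets \<mu>2"
        by (auto intro!: pair_measureI)
    qed
    moreover have "AE x in \<mu>. AE y in \<mu>. fst (x, y) \<notin> \<gamma>" "AE x in \<mu>. AE y in \<mu>. snd (x, y) \<notin> \<gamma>"
      using AE_not_in[OF c] by (auto elim: eventually_mono)
    ultimately have "AE p in \<mu>2. fst p \<notin> \<gamma>" "AE p in \<mu>2. snd p \<notin> \<gamma>"
      by (blast intro: mm.AE_pair_measure)+
    then show "AE p in \<mu>2. fst p \<notin> \<gamma> \<and> snd p \<notin> \<gamma> \<and> fst p \<noteq> snd p"
      using AE_diff by eventually_elim auto
  qed
  moreover have m: "{w \<in> space (\<mu>2 \<Otimes>\<^sub>M \<nu>).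
      fst (fst w) \<notin> snd w \<and> snd (fst w) \<notin> snd w \<and> fst (fst w) \<noteq> snd (fst w)} \<in> sets (\<mu>2 \<Otimes>\<^sub>M \<nu>)"
    by measurable
  ultimately have "AE p in \<mu>2. AE \<gamma> in \<nu>. fst p \<notin> \<gamma> \<and> snd p \<notin> \<gamma> \<and> fst p \<noteq> snd p"
    by (subst mmn.AE_commute)
  then show ?thesis by (intro mmn.AE_pair_measure m) simp
qed

text \<open>
  The formula for ordered pairs of distinct points, obtained by two applications of the formula
  for single points.
\<close>

lemma mecke2:
  assumes f[measurable]: "f \<in> borel_measurable (\<mu>2 \<Otimes>\<^sub>M \<nu>)"
  shows "(\<integral>\<^sup>+\<gamma>. \<integral>\<^sup>+p. f (p, \<gamma>) \<partial>count_space (offdiag \<gamma>) \<partial>\<nu>) =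
    (\<integral>\<^sup>+(p, \<gamma>). f (p, insert (fst p) (insert (snd p) \<gamma>)) \<partial>(\<mu>2 \<Otimes>\<^sub>M \<nu>))"
proof -
  let ?i = "\<lambda>x y. indicator {p. fst p \<noteq> snd p} (x, y) :: ennreal"
  have sum1: "(\<lambda>w. \<integral>\<^sup>+y. f ((fst w, y), g w) * ?i (fst w) y \<partial>count_space (snd w)) \<in> borel_measurable (\<mu> \<Otimes>\<^sub>M \<nu>)"
    if [measurable]: "g \<in> \<mu> \<Otimes>\<^sub>M \<nu> \<rightarrow>\<^sub>M \<nu>" for g
    by (rule measurable_nn_sum) (unfold indicator_def, measurable)
  have [measurable]: "(\<lambda>w. insert (fst w) (snd w)) \<in> \<mu> \<Otimes>\<^sub>M \<nu> \<rightarrow>\<^sub>M \<nu>" by measurable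
  have "(\<integral>\<^sup>+\<gamma>. \<integral>\<^sup>+p. f (p, \<gamma>) \<partial>count_space (offdiag \<gamma>) \<partial>\<nu>) =
      (\<integral>\<^sup>+\<gamma>. \<integral>\<^sup>+x. (\<integral>\<^sup>+y. f ((x, y), \<gamma>) * ?i x y \<partial>count_space \<gamma>) \<partial>count_space \<gamma> \<partial>\<nu>)"
    by (simp only: nn_sum_offdiag)
  also have "\<dots> = (\<integral>\<^sup>+(x, \<gamma>). (\<integral>\<^sup>+y. f ((x, y), insert x \<gamma>) * ?i x y \<partial>count_space (insert x \<gamma>)) \<partial>(\<mu> \<Otimes>\<^sub>M \<nu>))"
    using mecke[OF sum1[of snd]] by simp
  also have "\<dots> = (\<integral>\<^sup>+(x, \<gamma>). (\<integral>\<^sup>+y. f ((x, y), insert x \<gamma>) * ?i x y \<partial>count_space \<gamma>) \<partial>(\<mu> \<Otimes>\<^sub>M \<nu>))"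
  proof (intro nn_integral_cong, clarify)
    fix x and \<gamma> :: "'a set"
    show "(\<integral>\<^sup>+y. f ((x, y), insert x \<gamma>) * ?i x y \<partial>count_space (insert x \<gamma>)) =
        (\<integral>\<^sup>+y. f ((x, y), insert x \<gamma>) * ?i x y \<partial>count_space \<gamma>)"
      by (cases "x \<in> \<gamma>") (simp_all add: insert_absorb nn_sum_insert)
  qed
  also have "\<dots> = (\<integral>\<^sup>+x. \<integral>\<^sup>+\<gamma>. (\<integral>\<^sup>+y. f ((x, y), insert x \<gamma>) * ?i x y \<partial>count_space \<gamma>) \<partial>\<nu> \<partial>\<mu>)"
    using nn_integral_fst[OF sum1[of "\<lambda>w. insert (fst w) (snd w)"], symmetric]
    by (simp add: case_prod_beta')
  also have "\<dots> = (\<integral>\<^sup>+x. \<integral>\<^sup>+(y, \<gamma>). f ((x, y), insert x (insert y \<gamma>)) * ?i x y \<partial>(\<mu> \<Otimes>\<^sub>M \<nu>) \<partial>\<mu>)"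
  proof (rule nn_integral_cong)
    fix x
    have "(\<lambda>w. f ((x, fst w), insert x (snd w)) * ?i x (fst w)) \<in> borel_measurable (\<mu> \<Otimes>\<^sub>M \<nu>)"
      unfolding indicator_def by measurable
    from mecke[OF this]
    show "(\<integral>\<^sup>+\<gamma>. (\<integral>\<^sup>+y. f ((x, y), insert x \<gamma>) * ?i x y \<partial>count_space \<gamma>) \<partial>\<nu>) =
        (\<integral>\<^sup>+(y, \<gamma>). f ((x, y), insert x (insert y \<gamma>)) * ?i x y \<partial>(\<mu> \<Otimes>\<^sub>M \<nu>))"
      by (simp add: case_prod_beta')
  qed
  also have "\<dots> = (\<integral>\<^sup>+x. \<integral>\<^sup>+y. \<integral>\<^sup>+\<gamma>. f ((x, y), insert x (insert y \<gamma>)) * ?i x y \<partial>\<nu> \<partial>\<mu> \<partial>\<mu>)"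
  proof (rule nn_integral_cong)
    fix x
    have "(\<lambda>w. f ((x, fst w), insert x (insert (fst w) (snd w))) * (if x \<noteq> fst w then 1 else 0)) \<in> borel_measurable (\<mu> \<Otimes>\<^sub>M \<nu>)"
      by measurable
    from nn_integral_fst[OF this]
    show "(\<integral>\<^sup>+(y, \<gamma>). f ((x, y), insert x (insert y \<gamma>)) * ?i x y \<partial>(\<mu> \<Otimes>\<^sub>M \<nu>)) =
        (\<integral>\<^sup>+y. \<integral>\<^sup>+\<gamma>. f ((x, y), insert x (insert y \<gamma>)) * ?i x y \<partial>\<nu> \<partial>\<mu>)"
      by (simp add: case_prod_beta' indicator_def of_bool_def)
  qed
  also have "\<dots> = (\<integral>\<^sup>+p. \<integral>\<^sup>+\<gamma>. f (p, insert (fst p) (insert (snd p) \<gamma>)) * ?i (fst p) (snd p) \<partial>\<nu> \<partial>\<mu>2)"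
  proof -
    have "(\<lambda>w. f (fst w, insert (fst (fst w)) (insert (snd (fst w)) (snd w))) * (if fst (fst w) \<noteq> snd (fst w) then 1 else 0))
        \<in> borel_measurable (\<mu>2 \<Otimes>\<^sub>M \<nu>)" by measurable
    from borel_measurable_nn_integral_fst[OF this, THEN mu.nn_integral_fst]
    show ?thesis by (simp add: indicator_def of_bool_def)
  qed
  also have "\<dots> = (\<integral>\<^sup>+p. \<integral>\<^sup>+\<gamma>. f (p, insert (fst p) (insert (snd p) \<gamma>)) \<partial>\<nu> \<partial>\<mu>2)"
    by (rule nn_integral_cong_AE) (use AE_diff in eventually_elim, simp)
  also have "\<dots> = (\<integral>\<^sup>+w. f (fst w, insert (fst (fst w)) (insert (snd (fst w)) (snd w))) \<partial>(\<mu>2 \<Otimes>\<^sub>M \<nu>))"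
  proof -
    have "(\<lambda>w. f (fst w, insert (fst (fst w)) (insert (snd (fst w)) (snd w))))
        \<in> borel_measurable (\<mu>2 \<Otimes>\<^sub>M \<nu>)" by measurable
    from nn_integral_fst[OF this] show ?thesis by simp
  qed
  finally show ?thesis by (simp add: case_prod_beta')
qed

end

lemma integral_enn2real:
  assumes [measurable]: "P \<in> borel_measurable N" and fin: "(\<integral>\<^sup>+x. P x \<partial>N) < \<infinity>"
  shows "integrable N (\<lambda>x. enn2real (P x))" "(\<integral>x. enn2real (P x) \<partial>N) = enn2real (\<integral>\<^sup>+x. P x \<partial>N)" (is ?P)
proof -
  have "AE x in N. P x \<noteq> \<infinity>" using fin by (intro nn_integral_noteq_infinite) auto
  then have "AE x in N. ennreal (enn2real (P x)) = P x" by eventually_elim (simp add: less_top)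
  then have eq: "(\<integral>\<^sup>+x. ennreal (enn2real (P x)) \<partial>N) = (\<integral>\<^sup>+x. P x \<partial>N)" by (rule nn_integral_cong_AE)
  then show "integrable N (\<lambda>x. enn2real (P x))"
    using fin by (simp add: integrable_iff_bounded)
  show ?P
    by (subst integral_eq_nn_integral) (auto simp: eq)
qed

text \<open>
  Carries an identity of Mecke type from non-negative to integrable functions, uniformly for
  sums over points and over pairs.
\<close>

lemma real_sum_from_nn:
  fixes A :: "'g \<Rightarrow> 's set" and \<Phi> :: "'r \<Rightarrow> 's \<times> 'g" and f :: "'s \<times> 'g \<Rightarrow> real"
  assumes nn: "\<And>f :: 's \<times> 'g \<Rightarrow> ennreal. f \<in> borel_measurable T \<Longrightarrow>
      (\<integral>\<^sup>+\<gamma>. \<integral>\<^sup>+s. f (s, \<gamma>) \<partial>count_space (A \<gamma>) \<partial>N) = (\<integral>\<^sup>+r. f (\<Phi> r) \<partial>R)"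
    and meas: "\<And>f :: 's \<times> 'g \<Rightarrow> ennreal. f \<in> borel_measurable T \<Longrightarrow>
      (\<lambda>\<gamma>. \<integral>\<^sup>+s. f (s, \<gamma>) \<partial>count_space (A \<gamma>)) \<in> borel_measurable N"
    and f[measurable]: "f \<in> borel_measurable T" and int: "integrable R (\<lambda>r. f (\<Phi> r))"
  shows "AE \<gamma> in N. integrable (count_space (A \<gamma>)) (\<lambda>s. f (s, \<gamma>))"
    and "integrable N (\<lambda>\<gamma>. \<integral>s. f (s, \<gamma>) \<partial>count_space (A \<gamma>))" (is ?Q)
    and "(\<integral>\<gamma>. \<integral>s. f (s, \<gamma>) \<partial>count_space (A \<gamma>) \<partial>N) = (\<integral>r. f (\<Phi> r) \<partial>R)" (is ?P)
proof -
  define P where "P = (\<lambda>\<gamma>. \<integral>\<^sup>+s. ennreal (f (s, \<gamma>)) \<partial>count_space (A \<gamma>))"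
  define Q where "Q = (\<lambda>\<gamma>. \<integral>\<^sup>+s. ennreal (- f (s, \<gamma>)) \<partial>count_space (A \<gamma>))"
  define W where "W = (\<lambda>\<gamma>. \<integral>\<^sup>+s. ennreal \<bar>f (s, \<gamma>)\<bar> \<partial>count_space (A \<gamma>))"
  have [measurable]: "P \<in> borel_measurable N" "Q \<in> borel_measurable N" "W \<in> borel_measurable N"
    unfolding P_def Q_def W_def by (rule meas, measurable)+
  have Pi: "(\<integral>\<^sup>+\<gamma>. P \<gamma> \<partial>N) = (\<integral>\<^sup>+r. ennreal (f (\<Phi> r)) \<partial>R)"
    unfolding P_def using nn[of "\<lambda>w. ennreal (f w)"] by simp
  have Qi: "(\<integral>\<^sup>+\<gamma>. Q \<gamma> \<partial>N) = (\<integral>\<^sup>+r. ennreal (- f (\<Phi> r)) \<partial>R)"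
    unfolding Q_def using nn[of "\<lambda>w. ennreal (- f w)"] by simp
  have Wi: "(\<integral>\<^sup>+\<gamma>. W \<gamma> \<partial>N) = (\<integral>\<^sup>+r. ennreal \<bar>f (\<Phi> r)\<bar> \<partial>R)"
    unfolding W_def using nn[of "\<lambda>w. ennreal \<bar>f w\<bar>"] by simp
  have fin: "(\<integral>\<^sup>+\<gamma>. P \<gamma> \<partial>N) < \<infinity>" "(\<integral>\<^sup>+\<gamma>. Q \<gamma> \<partial>N) < \<infinity>" "(\<integral>\<^sup>+\<gamma>. W \<gamma> \<partial>N) < \<infinity>"
    using int unfolding Pi Qi Wi real_integrable_def
    by (auto simp: top.not_eq_extremum) (use int in \<open>auto simp: integrable_iff_bounded\<close>)
  have AEfin: "AE \<gamma> in N. P \<gamma> < \<infinity> \<and> Q \<gamma> < \<infinity> \<and> W \<gamma> < \<infinity>"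
    using fin nn_integral_noteq_infinite[of P N] nn_integral_noteq_infinite[of Q N] nn_integral_noteq_infinite[of W N]
    by (auto simp: less_top)
  show 1: "AE \<gamma> in N. integrable (count_space (A \<gamma>)) (\<lambda>s. f (s, \<gamma>))"
    using AEfin by eventually_elim (auto simp: integrable_iff_bounded W_def)
  have eq: "AE \<gamma> in N. (\<integral>s. f (s, \<gamma>) \<partial>count_space (A \<gamma>)) = enn2real (P \<gamma>) - enn2real (Q \<gamma>)"
    using 1 by eventually_elim (simp add: real_lebesgue_integral_def P_def Q_def)
  have m: "(\<lambda>\<gamma>. \<integral>s. f (s, \<gamma>) \<partial>count_space (A \<gamma>)) \<in> borel_measurable N"
  proof -
    have "(\<lambda>\<gamma>. if W \<gamma> < \<infinity> then enn2real (P \<gamma>) - enn2real (Q \<gamma>) else 0) \<in> borel_measurable N"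
      by measurable
    then show ?thesis unfolding P_def Q_def W_def
      by (subst integral_eq_enn2real_diff) (simp, assumption)
  qed
  have "integrable N (\<lambda>\<gamma>. enn2real (P \<gamma>))" "integrable N (\<lambda>\<gamma>. enn2real (Q \<gamma>))"
    using fin by (auto intro!: integral_enn2real)
  then have I: "integrable N (\<lambda>\<gamma>. enn2real (P \<gamma>) - enn2real (Q \<gamma>))"
    and val: "(\<integral>\<gamma>. enn2real (P \<gamma>) - enn2real (Q \<gamma>) \<partial>N) = (\<integral>\<gamma>. enn2real (P \<gamma>) \<partial>N) - (\<integral>\<gamma>. enn2real (Q \<gamma>) \<partial>N)"
    by auto
  show ?Q
    using I m eq integrable_cong_AE[OF m _ eq] by simp
  have "(\<integral>\<gamma>. \<integral>s. f (s, \<gamma>) \<partial>count_space (A \<gamma>) \<partial>N) = (\<integral>\<gamma>. enn2real (P \<gamma>) - enn2real (Q \<gamma>) \<partial>N)"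
    using m eq by (intro integral_cong_AE) auto
  also note val
  also have "(\<integral>\<gamma>. enn2real (P \<gamma>) \<partial>N) = enn2real (\<integral>\<^sup>+\<gamma>. P \<gamma> \<partial>N)"
    using fin by (auto intro!: integral_enn2real)
  also have "(\<integral>\<gamma>. enn2real (Q \<gamma>) \<partial>N) = enn2real (\<integral>\<^sup>+\<gamma>. Q \<gamma> \<partial>N)"
    using fin by (auto intro!: integral_enn2real)
  finally show ?P
    using int by (simp add: real_lebesgue_integral_def Pi Qi)
qed

context mecke_measure
begin

lemma mecke_real:
  assumes f[measurable]: "f \<in> borel_measurable (\<mu> \<Otimes>\<^sub>M \<nu>)"
    and int: "integrable (\<mu> \<Otimes>\<^sub>M \<nu>) (\<lambda>w. f (fst w, insert (fst w) (snd w)) :: real)"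
  shows "AE \<gamma> in \<nu>. integrable (count_space \<gamma>) (\<lambda>x. f (x, \<gamma>))" (is ?R)
    and "integrable \<nu> (\<lambda>\<gamma>. \<integral>x. f (x, \<gamma>) \<partial>count_space \<gamma>)" (is ?Q)
    and "(\<integral>\<gamma>. \<integral>x. f (x, \<gamma>) \<partial>count_space \<gamma> \<partial>\<nu>) = (\<integral>w. f (fst w, insert (fst w) (snd w)) \<partial>(\<mu> \<Otimes>\<^sub>M \<nu>))" (is ?P)
proof -
  have 1: "(\<integral>\<^sup>+\<gamma>. \<integral>\<^sup>+s. f (s, \<gamma>) \<partial>count_space \<gamma> \<partial>\<nu>) = (\<integral>\<^sup>+r. f (fst r, insert (fst r) (snd r)) \<partial>(\<mu> \<Otimes>\<^sub>M \<nu>))"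
    if "f \<in> borel_measurable (\<mu> \<Otimes>\<^sub>M \<nu>)" for f :: "'a \<times> 'a set \<Rightarrow> ennreal"
    using mecke[OF that] by (simp add: case_prod_beta')
  have 2: "(\<lambda>\<gamma>. \<integral>\<^sup>+s. f (s, \<gamma>) \<partial>count_space \<gamma>) \<in> borel_measurable \<nu>"
    if [measurable]: "f \<in> borel_measurable (\<mu> \<Otimes>\<^sub>M \<nu>)" for f :: "'a \<times> 'a set \<Rightarrow> ennreal"
    by (rule measurable_nn_sum) measurable
  note * = real_sum_from_nn[where \<Phi> = "\<lambda>w. (fst w, insert (fst w) (snd w))" and A = "\<lambda>\<gamma>. \<gamma>", OF 1 2 f int]
  show ?R by (rule *(1))
  show ?Q by (rule *(2))
  show ?P
    by (rule *(3))
qed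

lemma mecke2_real:
  assumes f[measurable]: "f \<in> borel_measurable (\<mu>2 \<Otimes>\<^sub>M \<nu>)"
    and int: "integrable (\<mu>2 \<Otimes>\<^sub>M \<nu>) (\<lambda>w. f (fst w, insert (fst (fst w)) (insert (snd (fst w)) (snd w))) :: real)"
  shows "AE \<gamma> in \<nu>. integrable (count_space (offdiag \<gamma>)) (\<lambda>p. f (p, \<gamma>))" (is ?R)
    and "integrable \<nu> (\<lambda>\<gamma>. \<integral>p. f (p, \<gamma>) \<partial>count_space (offdiag \<gamma>))" (is ?Q)
    and "(\<integral>\<gamma>. \<integral>p. f (p, \<gamma>) \<partial>count_space (offdiag \<gamma>) \<partial>\<nu>) =
      (\<integral>w. f (fst w, insert (fst (fst w)) (insert (snd (fst w)) (snd w))) \<partial>(\<mu>2 \<Otimes>\<^sub>M \<nu>))" (is ?P)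
proof -
  have 1: "(\<integral>\<^sup>+\<gamma>. \<integral>\<^sup>+p. f (p, \<gamma>) \<partial>count_space (offdiag \<gamma>) \<partial>\<nu>) =
     (\<integral>\<^sup>+w. f (fst w, insert (fst (fst w)) (insert (snd (fst w)) (snd w))) \<partial>(\<mu>2 \<Otimes>\<^sub>M \<nu>))"
    if "f \<in> borel_measurable (\<mu>2 \<Otimes>\<^sub>M \<nu>)" for f :: "('a \<times> 'a) \<times> 'a set \<Rightarrow> ennreal"
    using mecke2[OF that] by (simp add: case_prod_beta')
  have 2: "(\<lambda>\<gamma>. \<integral>\<^sup>+p. f (p, \<gamma>) \<partial>count_space (offdiag \<gamma>)) \<in> borel_measurable \<nu>"
    if [measurable]: "f \<in> borel_measurable (\<mu>2 \<Otimes>\<^sub>M \<nu>)" for f :: "('a \<times> 'a) \<times> 'a set \<Rightarrow> ennreal"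
    by (rule measurable_nn_sum_offdiag) measurable
  note * = real_sum_from_nn[where \<Phi> = "\<lambda>w. (fst w, insert (fst (fst w)) (insert (snd (fst w)) (snd w)))"
      and A = offdiag, OF 1 2 f int]
  show ?R by (rule *(1))
  show ?Q by (rule *(2))
  show ?P
    by (rule *(3))
qed

end

section \<open>Second moments of quadratic functionals\<close>

lemma ennreal_mult_le_squares: "(u::ennreal) * v \<le> u * u + v * v"
proof (cases "u \<le> v")
  case True
  then have "u * v \<le> v * v" by (rule mult_right_mono) simp
  then show ?thesis by (rule order_trans) simp
next
  case False
  then have "u * v \<le> u * u" by (intro mult_left_mono) auto
  then show ?thesis by (rule order_trans) simp
qed

lemma nn_integral_mult_finite:
  assumes [measurable]: "u \<in> borel_measurable N" "v \<in> borel_measurable N"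
    and "(\<integral>\<^sup>+x. u x * u x \<partial>N) < \<infinity>" "(\<integral>\<^sup>+x. v x * v x \<partial>N) < \<infinity>"
  shows "(\<integral>\<^sup>+x. u x * v x \<partial>N) < \<infinity>"
proof -
  have "(\<integral>\<^sup>+x. u x * v x \<partial>N) \<le> (\<integral>\<^sup>+x. u x * u x + v x * v x \<partial>N)"
    by (intro nn_integral_mono ennreal_mult_le_squares)
  also have "\<dots> = (\<integral>\<^sup>+x. u x * u x \<partial>N) + (\<integral>\<^sup>+x. v x * v x \<partial>N)" by (rule nn_integral_add) auto
  also have "\<dots> < \<infinity>" using assms(3,4) by simp
  finally show ?thesis .
qed

lemma nn_integral_add_square_finite:
  assumes [measurable]: "u \<in> borel_measurable N" "v \<in> borel_measurable N"
    and f: "(\<integral>\<^sup>+x. u x * u x \<partial>N) < \<infinity>" "(\<integral>\<^sup>+x. v x * v x \<partial>N) < \<infinity>"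
  shows "(\<integral>\<^sup>+x. (u x + v x) * (u x + v x) \<partial>N) < \<infinity>"
proof -
  have "(\<integral>\<^sup>+x. (u x + v x) * (u x + v x) \<partial>N) = (\<integral>\<^sup>+x. u x * u x + v x * u x + (u x * v x + v x * v x) \<partial>N)"
    by (intro nn_integral_cong) (simp add: distrib_left distrib_right)
  also have "\<dots> = (\<integral>\<^sup>+x. u x * u x \<partial>N) + (\<integral>\<^sup>+x. v x * u x \<partial>N) + ((\<integral>\<^sup>+x. u x * v x \<partial>N) + (\<integral>\<^sup>+x. v x * v x \<partial>N))"
    by (simp add: nn_integral_add)
  also have "\<dots> < \<infinity>"
    using f nn_integral_mult_finite[of u N v] nn_integral_mult_finite[of v N u] by simp
  finally show ?thesis .
qed

lemma ennreal_abs_integral_le: "ennreal \<bar>\<integral>x. f x \<partial>N\<bar> \<le> (\<integral>\<^sup>+x. ennreal \<bar>f x\<bar> \<partial>N)" for f :: "'b \<Rightarrow> real"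
proof (cases "integrable N f")
  case True then show ?thesis using integral_norm_bound_ennreal[OF True] by simp
qed (simp add: not_integrable_integral_eq)

lemma integral_count_space_Un:
  fixes f :: "'b \<Rightarrow> real"
  assumes "integrable (count_space A) f" "integrable (count_space B) f" "A \<inter> B = {}"
  shows "integrable (count_space (A \<union> B)) f"
    and "(\<integral>x. f x \<partial>count_space (A \<union> B)) = (\<integral>x. f x \<partial>count_space A) + (\<integral>x. f x \<partial>count_space B)"
  using assms abs_summable_on_union[of f A B] infsetsum_Un_disjoint[of f A B]
  by (simp_all add: Infinite_Set_Sum.abs_summable_on_def infsetsum_def)

lemma integral_count_space_image:
  fixes f :: "'b \<Rightarrow> real"
  assumes "inj_on h A"
  shows "integrable (count_space (h ` A)) f \<longleftrightarrow> integrable (count_space A) (\<lambda>x. f (h x))" (is ?Q)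
    and "(\<integral>x. f x \<partial>count_space (h ` A)) = (\<integral>x. f (h x) \<partial>count_space A)" (is ?P)
proof -
  have *: "count_space (h ` A) = distr (count_space A) (count_space (h ` A)) h"
    using assms by (simp add: distr_bij_count_space inj_on_imp_bij_betw)
  show ?Q
    by (subst *, subst integrable_distr_eq) auto
  show ?P
    by (subst *, subst integral_distr) auto
qed

lemma integral_count_space_insert:
  fixes f :: "'b \<Rightarrow> real"
  assumes "integrable (count_space \<gamma>) f" "x \<notin> \<gamma>"
  shows "integrable (count_space (insert x \<gamma>)) f"
    and "(\<integral>y. f y \<partial>count_space (insert x \<gamma>)) = f x + (\<integral>y. f y \<partial>count_space \<gamma>)"
  using integral_count_space_Un[of "{x}" f \<gamma>] assms
  by (simp_all add: integrable_count_space lebesgue_integral_count_space_finite)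

lemma offdiag_insert:
  "x \<notin> \<gamma> \<Longrightarrow> offdiag (insert x \<gamma>) = offdiag \<gamma> \<union> (Pair x ` \<gamma> \<union> (\<lambda>y. (y, x)) ` \<gamma>)"
  by (auto simp: offdiag_def)

lemma nn_sum_offdiag_insert:
  assumes x: "x \<notin> \<gamma>" and sym: "\<And>x y. H (x, y) = H (y, x)"
  shows "(\<integral>\<^sup>+p. H p \<partial>count_space (offdiag (insert x \<gamma>))) =
    (\<integral>\<^sup>+p. H p \<partial>count_space (offdiag \<gamma>)) + 2 * (\<integral>\<^sup>+y. H (x, y) \<partial>count_space \<gamma>)"
proof -
  have 1: "(\<integral>\<^sup>+p. H p \<partial>count_space (Pair x ` \<gamma>)) = (\<integral>\<^sup>+y. H (x, y) \<partial>count_space \<gamma>)"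
    by (rule nn_integral_bij_count_space[symmetric]) (auto simp: bij_betw_def inj_on_def)
  have 2: "(\<integral>\<^sup>+p. H p \<partial>count_space ((\<lambda>y. (y, x)) ` \<gamma>)) = (\<integral>\<^sup>+y. H (y, x) \<partial>count_space \<gamma>)"
    by (rule nn_integral_bij_count_space[symmetric]) (auto simp: bij_betw_def inj_on_def)
  have 3: "(\<integral>\<^sup>+y. H (y, x) \<partial>count_space \<gamma>) = (\<integral>\<^sup>+y. H (x, y) \<partial>count_space \<gamma>)"
    using sym[of _ x] by simp
  have d: "offdiag \<gamma> \<inter> (Pair x ` \<gamma> \<union> (\<lambda>y. (y, x)) ` \<gamma>) = {}" "Pair x ` \<gamma> \<inter> (\<lambda>y. (y, x)) ` \<gamma> = {}"
    using x by (auto simp: offdiag_def)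
  show ?thesis
    unfolding offdiag_insert[OF x] nn_sum_Un[OF d(1)] nn_sum_Un[OF d(2)] 1 2 3 by (simp add: mult_2)
qed

lemma real_sum_offdiag_insert:
  fixes H :: "'b \<times> 'b \<Rightarrow> real"
  assumes x: "x \<notin> \<gamma>" and sym: "\<And>x y. H (x, y) = H (y, x)"
    and i: "integrable (count_space (offdiag \<gamma>)) H" "integrable (count_space \<gamma>) (\<lambda>y. H (x, y))"
  shows "integrable (count_space (offdiag (insert x \<gamma>))) H" (is ?Q)
    and "(\<integral>p. H p \<partial>count_space (offdiag (insert x \<gamma>))) =
      (\<integral>p. H p \<partial>count_space (offdiag \<gamma>)) + 2 * (\<integral>y. H (x, y) \<partial>count_space \<gamma>)" (is ?P)
proof -
  have inj: "inj_on (Pair x) \<gamma>" "inj_on (\<lambda>y. (y, x)) \<gamma>" by (auto simp: inj_on_def)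
  have 3: "(\<lambda>y. H (y, x)) = (\<lambda>y. H (x, y))" using sym[of _ x] by auto
  have d: "offdiag \<gamma> \<inter> (Pair x ` \<gamma> \<union> (\<lambda>y. (y, x)) ` \<gamma>) = {}" "Pair x ` \<gamma> \<inter> (\<lambda>y. (y, x)) ` \<gamma> = {}"
    using x by (auto simp: offdiag_def)
  have I: "integrable (count_space (Pair x ` \<gamma>)) H" "integrable (count_space ((\<lambda>y. (y, x)) ` \<gamma>)) H"
    using i(2) by (simp_all add: integral_count_space_image(1)[OF inj(1)] integral_count_space_image(1)[OF inj(2)] 3)
  note U = integral_count_space_Un[OF I d(2)]
  show ?Q
    unfolding offdiag_insert[OF x] by (rule integral_count_space_Un(1)[OF i(1) U(1) d(1)])
  show ?P
    unfolding offdiag_insert[OF x] integral_count_space_Un(2)[OF i(1) U(1) d(1)] U(2)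
    by (simp add: integral_count_space_image(2)[OF inj(1)] integral_count_space_image(2)[OF inj(2)] 3)
qed

lemma (in pair_sigma_finite) AE_pair_fst:
  assumes "AE x in M1. P x" shows "AE w in M1 \<Otimes>\<^sub>M M2. P (fst w)"
proof -
  obtain N where N: "N \<in> null_sets M1" "{x \<in> space M1. \<not> P x} \<subseteq> N"
    using assms by (auto simp: eventually_ae_filter)
  have "emeasure (M1 \<Otimes>\<^sub>M M2) (N \<times> space M2) = 0"
    using N by (subst M2.emeasure_pair_measure_Times) auto
  then have "N \<times> space M2 \<in> null_sets (M1 \<Otimes>\<^sub>M M2)" using N by (auto simp: null_sets_def)
  then show ?thesis by (rule AE_I') (use N in \<open>auto simp: space_pair_measure\<close>)
qed

lemma (in pair_sigma_finite) AE_pair_snd: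
  assumes "AE y in M2. P y" shows "AE w in M1 \<Otimes>\<^sub>M M2. P (snd w)"
proof -
  obtain N where N: "N \<in> null_sets M2" "{x \<in> space M2. \<not> P x} \<subseteq> N"
    using assms by (auto simp: eventually_ae_filter)
  have "emeasure (M1 \<Otimes>\<^sub>M M2) (space M1 \<times> N) = 0"
    using N by (subst M2.emeasure_pair_measure_Times) auto
  then have "space M1 \<times> N \<in> null_sets (M1 \<Otimes>\<^sub>M M2)" using N by (auto simp: null_sets_def)
  then show ?thesis by (rule AE_I') (use N in \<open>auto simp: space_pair_measure\<close>)
qed

lemma (in pair_sigma_finite) integral_comp_fst:
  fixes f :: "'a \<Rightarrow> real"
  assumes "finite_measure M2" and f: "integrable M1 f"
  shows "integrable (M1 \<Otimes>\<^sub>M M2) (\<lambda>w. f (fst w))"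
    and "(\<integral>w. f (fst w) \<partial>(M1 \<Otimes>\<^sub>M M2)) = measure M2 (space M2) * (\<integral>x. f x \<partial>M1)" (is ?P)
proof -
  interpret M2: finite_measure M2 by fact
  have [measurable]: "f \<in> borel_measurable M1" using f by auto
  have "(\<integral>\<^sup>+w. ennreal \<bar>f (fst w)\<bar> \<partial>(M1 \<Otimes>\<^sub>M M2)) = (\<integral>\<^sup>+x. ennreal \<bar>f x\<bar> \<partial>M1) * emeasure M2 (space M2)"
    by (subst M2.nn_integral_fst[symmetric]) (simp_all add: nn_integral_multc)
  also have "\<dots> < \<infinity>" using f by (simp add: integrable_iff_bounded ennreal_mult_less_top M2.emeasure_eq_measure)
  finally show i: "integrable (M1 \<Otimes>\<^sub>M M2) (\<lambda>w. f (fst w))" by (simp add: integrable_iff_bounded)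
  show ?P
    using integral_fst'[OF i] by simp
qed

text \<open>
  Functionals \<open>\<Sum>H(x,y) - \<Sum>g(x) - c\<close>, the first sum over ordered pairs of
  distinct points. The conditions ensure a finite second moment.
\<close>

locale second_chaos = mecke_measure +
  fixes H :: "'a::euclidean_space \<times> 'a \<Rightarrow> real" and g :: "'a \<Rightarrow> real" and c :: real
  assumes H [measurable]: "H \<in> borel_measurable \<mu>2" and g [measurable]: "g \<in> borel_measurable \<mu>"
    and sym: "\<And>x y. H (x, y) = H (y, x)"
    and iH: "integrable \<mu>2 H" and iH2: "integrable \<mu>2 (\<lambda>p. (H p)\<^sup>2)"
    and iK: "(\<integral>\<^sup>+x. (\<integral>\<^sup>+y. ennreal \<bar>H (x, y)\<bar> \<partial>\<mu>) * (\<integral>\<^sup>+y. ennreal \<bar>H (x, y)\<bar> \<partial>\<mu>) \<partial>\<mu>) < \<infinity>"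
    and ig: "integrable \<mu> g" and ig2: "integrable \<mu> (\<lambda>x. (g x)\<^sup>2)"
begin

definition X where "X \<gamma> = (\<integral>p. H p \<partial>count_space (offdiag \<gamma>)) - (\<integral>x. g x \<partial>count_space \<gamma>) - c"

text \<open>The sums of H and g over a configuration; V x collects the interactions of a new point x. GG, SG
and K are the sums of absolute values.\<close>

definition U where "U \<gamma> = (\<integral>p. H p \<partial>count_space (offdiag \<gamma>))"
definition S where "S \<gamma> = (\<integral>x. g x \<partial>count_space \<gamma>)"
definition V where "V x \<gamma> = (\<integral>y. H (x, y) \<partial>count_space \<gamma>)"
definition h where "h x = (\<integral>y. H (x, y) \<partial>\<mu>)"
definition GG where "GG \<gamma> = (\<integral>\<^sup>+p. ennreal \<bar>H p\<bar> \<partial>count_space (offdiag \<gamma>))"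
definition SG where "SG \<gamma> = (\<integral>\<^sup>+x. ennreal \<bar>g x\<bar> \<partial>count_space \<gamma>)"
definition K where "K x \<gamma> = (\<integral>\<^sup>+y. ennreal \<bar>H (x, y)\<bar> \<partial>count_space \<gamma>)"
definition k where "k x = (\<integral>\<^sup>+y. ennreal \<bar>H (x, y)\<bar> \<partial>\<mu>)"
definition n where "n = measure \<nu> (space \<nu>)"

lemma XUS: "X \<gamma> = U \<gamma> - S \<gamma> - c" by (simp add: X_def U_def S_def)

lemma n_nn: "emeasure \<nu> (space \<nu>) = ennreal n" by (simp add: n_def emeasure_eq_measure)

lemma meas [measurable]:
  "U \<in> borel_measurable \<nu>" "S \<in> borel_measurable \<nu>" "X \<in> borel_measurable \<nu>"
  "GG \<in> borel_measurable \<nu>" "SG \<in> borel_measurable \<nu>" "k \<in> borel_measurable \<mu>" "h \<in> borel_measurable \<mu>"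
proof -
  have [measurable]: "(\<lambda>\<gamma>. \<gamma>) \<in> \<nu> \<rightarrow>\<^sub>M CB" by measurable
  show [measurable]: "U \<in> borel_measurable \<nu>" unfolding U_def[abs_def] by (rule measurable_real_sum_offdiag) measurable
  show [measurable]: "S \<in> borel_measurable \<nu>" unfolding S_def[abs_def] by (rule measurable_real_sum) measurable
  show "X \<in> borel_measurable \<nu>" unfolding XUS[abs_def] by measurable
  show "GG \<in> borel_measurable \<nu>" unfolding GG_def[abs_def] by (rule measurable_nn_sum_offdiag) measurable
  show "SG \<in> borel_measurable \<nu>" unfolding SG_def[abs_def] by (rule measurable_nn_sum) measurable
  show "k \<in> borel_measurable \<mu>" "h \<in> borel_measurable \<mu>" unfolding k_def[abs_def] h_def[abs_def] by measurable
qed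

lemma meas_V [measurable (raw)]:
  assumes [measurable]: "\<xi> \<in> N \<rightarrow>\<^sub>M borel" "f \<in> N \<rightarrow>\<^sub>M \<nu>"
  shows "(\<lambda>w. V (\<xi> w) (f w)) \<in> borel_measurable N" (is ?Q) "(\<lambda>w. K (\<xi> w) (f w)) \<in> borel_measurable N" (is ?P)
proof -
  have [measurable]: "f \<in> N \<rightarrow>\<^sub>M CB" using assms(2) by (simp cong: measurable_cong_sets)
  have [measurable]: "H \<in> borel_measurable (borel \<Otimes>\<^sub>M borel)" using H by (simp cong: measurable_cong_sets)
  show ?Q unfolding V_def by (rule measurable_real_sum) measurable
  show ?P unfolding K_def by (rule measurable_nn_sum) measurable
qed

lemma GG_insert: "x \<notin> \<gamma> \<Longrightarrow> GG (insert x \<gamma>) = GG \<gamma> + 2 * K x \<gamma>"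
  unfolding GG_def K_def by (rule nn_sum_offdiag_insert) (simp_all add: sym)

lemma K_insert: "y \<notin> \<gamma> \<Longrightarrow> K x (insert y \<gamma>) = ennreal \<bar>H (x, y)\<bar> + K x \<gamma>"
  unfolding K_def by (rule nn_sum_insert)

lemma SG_insert: "x \<notin> \<gamma> \<Longrightarrow> SG (insert x \<gamma>) = ennreal \<bar>g x\<bar> + SG \<gamma>"
  unfolding SG_def by (rule nn_sum_insert)

lemma nn_K: "(\<integral>\<^sup>+\<gamma>. K x \<gamma> \<partial>\<nu>) = ennreal n * k x"
proof -
  have m: "(\<lambda>w. ennreal \<bar>H (x, fst w)\<bar>) \<in> borel_measurable (\<mu> \<Otimes>\<^sub>M \<nu>)" by measurable
  have "(\<integral>\<^sup>+\<gamma>. K x \<gamma> \<partial>\<nu>) = (\<integral>\<^sup>+w. ennreal \<bar>H (x, fst w)\<bar> \<partial>(\<mu> \<Otimes>\<^sub>M \<nu>))"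
    using mecke[OF m] by (simp add: K_def case_prod_beta')
  also have "\<dots> = (\<integral>\<^sup>+y. ennreal \<bar>H (x, y)\<bar> * ennreal n \<partial>\<mu>)"
    using nn_integral_fst[OF m] n_nn by simp
  finally show ?thesis by (simp add: k_def nn_integral_multc nn_integral_cmult mult.commute)
qed

lemma nn_GG: "(\<integral>\<^sup>+\<gamma>. GG \<gamma> \<partial>\<nu>) = ennreal n * (\<integral>\<^sup>+p. ennreal \<bar>H p\<bar> \<partial>\<mu>2)"
proof -
  have m: "(\<lambda>w. ennreal \<bar>H (fst w)\<bar>) \<in> borel_measurable (\<mu>2 \<Otimes>\<^sub>M \<nu>)" by measurable
  have "(\<integral>\<^sup>+\<gamma>. GG \<gamma> \<partial>\<nu>) = (\<integral>\<^sup>+w. ennreal \<bar>H (fst w)\<bar> \<partial>(\<mu>2 \<Otimes>\<^sub>M \<nu>))"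
    using mecke2[OF m] by (simp add: GG_def case_prod_beta')
  also have "\<dots> = (\<integral>\<^sup>+p. ennreal \<bar>H p\<bar> * ennreal n \<partial>\<mu>2)"
    using nn_integral_fst[OF m] n_nn by simp
  finally show ?thesis by (simp add: nn_integral_multc nn_integral_cmult mult.commute)
qed

lemma nn_SG: "(\<integral>\<^sup>+\<gamma>. SG \<gamma> \<partial>\<nu>) = ennreal n * (\<integral>\<^sup>+x. ennreal \<bar>g x\<bar> \<partial>\<mu>)"
proof -
  have m: "(\<lambda>w. ennreal \<bar>g (fst w)\<bar>) \<in> borel_measurable (\<mu> \<Otimes>\<^sub>M \<nu>)" by measurable
  have "(\<integral>\<^sup>+\<gamma>. SG \<gamma> \<partial>\<nu>) = (\<integral>\<^sup>+w. ennreal \<bar>g (fst w)\<bar> \<partial>(\<mu> \<Otimes>\<^sub>M \<nu>))"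
    using mecke[OF m] by (simp add: SG_def case_prod_beta')
  also have "\<dots> = (\<integral>\<^sup>+y. ennreal \<bar>g y\<bar> * ennreal n \<partial>\<mu>)"
    using nn_integral_fst[OF m] n_nn by simp
  finally show ?thesis by (simp add: nn_integral_multc nn_integral_cmult mult.commute)
qed

lemma fin_H: "(\<integral>\<^sup>+p. ennreal \<bar>H p\<bar> \<partial>\<mu>2) < \<infinity>"
  using iH by (simp add: integrable_iff_bounded)

lemma fin_g: "(\<integral>\<^sup>+x. ennreal \<bar>g x\<bar> \<partial>\<mu>) < \<infinity>"
  using ig by (simp add: integrable_iff_bounded)

lemma fin_H2: "(\<integral>\<^sup>+p. ennreal \<bar>H p\<bar> * ennreal \<bar>H p\<bar> \<partial>\<mu>2) < \<infinity>"
  using iH2 by (simp add: integrable_iff_bounded ennreal_mult[symmetric] power2_eq_square abs_mult)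

lemma fin_g2: "(\<integral>\<^sup>+x. ennreal \<bar>g x\<bar> * ennreal \<bar>g x\<bar> \<partial>\<mu>) < \<infinity>"
  using ig2 by (simp add: integrable_iff_bounded ennreal_mult[symmetric] power2_eq_square abs_mult)

lemma fin_k2: "(\<integral>\<^sup>+x. k x * k x \<partial>\<mu>) < \<infinity>" using iK by (simp add: k_def)

lemma nn_Hk_fst:
  assumes [measurable]: "r \<in> borel_measurable \<mu>"
  shows "(\<integral>\<^sup>+p. ennreal \<bar>H p\<bar> * r (fst p) \<partial>\<mu>2) = (\<integral>\<^sup>+x. k x * r x \<partial>\<mu>)"
  by (subst mu.nn_integral_fst[symmetric]) (simp_all add: nn_integral_multc k_def)

lemma nn_Hk_snd:
  assumes [measurable]: "r \<in> borel_measurable \<mu>"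
  shows "(\<integral>\<^sup>+p. ennreal \<bar>H p\<bar> * r (snd p) \<partial>\<mu>2) = (\<integral>\<^sup>+x. k x * r x \<partial>\<mu>)"
  by (subst mm.nn_integral_snd[symmetric]) (simp_all add: nn_integral_multc k_def sym)

text \<open>
  Finiteness has to be known before the signed computation. Inserting the two points of one pair
  sum into the other gives again three kinds of terms, with no, one or two shared points.
\<close>

lemma fin_GG2: "(\<integral>\<^sup>+\<gamma>. GG \<gamma> * GG \<gamma> \<partial>\<nu>) < \<infinity>"
proof -
  let ?Q = "\<mu>2 \<Otimes>\<^sub>M \<nu>"
  let ?G = "\<lambda>p. ennreal \<bar>H p\<bar>"
  have m: "(\<lambda>w. ?G (fst w) * GG (snd w)) \<in> borel_measurable ?Q" by measurable
  have "(\<integral>\<^sup>+\<gamma>. GG \<gamma> * GG \<gamma> \<partial>\<nu>) = (\<integral>\<^sup>+\<gamma>. \<integral>\<^sup>+p. ?G p * GG \<gamma> \<partial>count_space (offdiag \<gamma>) \<partial>\<nu>)"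
    by (intro nn_integral_cong) (simp add: nn_integral_multc GG_def)
  also have "\<dots> = (\<integral>\<^sup>+w. ?G (fst w) * GG (insert (fst (fst w)) (insert (snd (fst w)) (snd w))) \<partial>?Q)"
    using mecke2[OF m] by (simp add: case_prod_beta')
  also have "\<dots> = (\<integral>\<^sup>+w. ?G (fst w) * (GG (snd w) + 2 * K (snd (fst w)) (snd w) + 2 * (?G (fst w) + K (fst (fst w)) (snd w))) \<partial>?Q)"
  proof (rule nn_integral_cong_AE)
    show "AE w in ?Q. ?G (fst w) * GG (insert (fst (fst w)) (insert (snd (fst w)) (snd w))) =
      ?G (fst w) * (GG (snd w) + 2 * K (snd (fst w)) (snd w) + 2 * (?G (fst w) + K (fst (fst w)) (snd w)))"
      using AE_new2 by eventually_elim (simp add: GG_insert K_insert)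
  qed
  also have "\<dots> = (\<integral>\<^sup>+p. \<integral>\<^sup>+\<gamma>. ?G p * (GG \<gamma> + 2 * K (snd p) \<gamma> + 2 * (?G p + K (fst p) \<gamma>)) \<partial>\<nu> \<partial>\<mu>2)"
  proof -
    have "(\<lambda>w. ?G (fst w) * (GG (snd w) + 2 * K (snd (fst w)) (snd w) + 2 * (?G (fst w) + K (fst (fst w)) (snd w)))) \<in> borel_measurable ?Q"
      by measurable
    from nn_integral_fst[OF this] show ?thesis by simp
  qed
  also have "\<dots> = (\<integral>\<^sup>+p. ?G p * (\<integral>\<^sup>+\<gamma>. GG \<gamma> \<partial>\<nu>) + 2 * ennreal n * (?G p * k (snd p))
      + 2 * ennreal n * (?G p * ?G p) + 2 * ennreal n * (?G p * k (fst p)) \<partial>\<mu>2)"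
  proof (rule nn_integral_cong)
    fix p
    have "(\<integral>\<^sup>+\<gamma>. ?G p * (GG \<gamma> + 2 * K (snd p) \<gamma> + 2 * (?G p + K (fst p) \<gamma>)) \<partial>\<nu>) =
       ?G p * ((\<integral>\<^sup>+\<gamma>. GG \<gamma> \<partial>\<nu>) + 2 * (ennreal n * k (snd p)) + 2 * (?G p * ennreal n + ennreal n * k (fst p)))"
      by (simp add: nn_integral_cmult nn_integral_add nn_K n_nn[simplified] distrib_left mult.assoc)
    then show "(\<integral>\<^sup>+\<gamma>. ?G p * (GG \<gamma> + 2 * K (snd p) \<gamma> + 2 * (?G p + K (fst p) \<gamma>)) \<partial>\<nu>) =
      ?G p * (\<integral>\<^sup>+\<gamma>. GG \<gamma> \<partial>\<nu>) + 2 * ennreal n * (?G p * k (snd p))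
      + 2 * ennreal n * (?G p * ?G p) + 2 * ennreal n * (?G p * k (fst p))"
      by (simp add: distrib_left mult_ac add_ac)
  qed
  also have "\<dots> = (\<integral>\<^sup>+p. ?G p \<partial>\<mu>2) * (\<integral>\<^sup>+\<gamma>. GG \<gamma> \<partial>\<nu>) + 2 * ennreal n * (\<integral>\<^sup>+x. k x * k x \<partial>\<mu>)
      + 2 * ennreal n * (\<integral>\<^sup>+p. ?G p * ?G p \<partial>\<mu>2) + 2 * ennreal n * (\<integral>\<^sup>+x. k x * k x \<partial>\<mu>)"
    by (simp add: nn_integral_add nn_integral_cmult nn_integral_multc nn_Hk_fst nn_Hk_snd)
  also have "\<dots> < \<infinity>"
    using fin_H fin_H2 fin_k2 by (simp add: nn_GG ennreal_mult_less_top ennreal_mult_eq_top_iff less_top[symmetric])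
  finally show ?thesis .
qed

lemma fin_SG2: "(\<integral>\<^sup>+\<gamma>. SG \<gamma> * SG \<gamma> \<partial>\<nu>) < \<infinity>"
proof -
  let ?g = "\<lambda>p. ennreal \<bar>g p\<bar>"
  have m: "(\<lambda>w. ?g (fst w) * SG (snd w)) \<in> borel_measurable (\<mu> \<Otimes>\<^sub>M \<nu>)" by measurable
  have "(\<integral>\<^sup>+\<gamma>. SG \<gamma> * SG \<gamma> \<partial>\<nu>) = (\<integral>\<^sup>+\<gamma>. \<integral>\<^sup>+p. ?g p * SG \<gamma> \<partial>count_space \<gamma> \<partial>\<nu>)"
    by (intro nn_integral_cong) (simp add: nn_integral_multc SG_def)
  also have "\<dots> = (\<integral>\<^sup>+w. ?g (fst w) * SG (insert (fst w) (snd w)) \<partial>(\<mu> \<Otimes>\<^sub>M \<nu>))"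
    using mecke[OF m] by (simp add: case_prod_beta')
  also have "\<dots> = (\<integral>\<^sup>+w. ?g (fst w) * (?g (fst w) + SG (snd w)) \<partial>(\<mu> \<Otimes>\<^sub>M \<nu>))"
  proof (rule nn_integral_cong_AE)
    show "AE w in \<mu> \<Otimes>\<^sub>M \<nu>. ?g (fst w) * SG (insert (fst w) (snd w)) = ?g (fst w) * (?g (fst w) + SG (snd w))"
      using AE_new1 by eventually_elim (simp add: SG_insert)
  qed
  also have "\<dots> = (\<integral>\<^sup>+x. \<integral>\<^sup>+\<gamma>. ?g x * (?g x + SG \<gamma>) \<partial>\<nu> \<partial>\<mu>)"
  proof -
    have "(\<lambda>w. ?g (fst w) * (?g (fst w) + SG (snd w))) \<in> borel_measurable (\<mu> \<Otimes>\<^sub>M \<nu>)" by measurable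
    from nn_integral_fst[OF this] show ?thesis by simp
  qed
  also have "\<dots> = (\<integral>\<^sup>+x. ennreal n * (?g x * ?g x) + ?g x * (\<integral>\<^sup>+\<gamma>. SG \<gamma> \<partial>\<nu>) \<partial>\<mu>)"
  proof (rule nn_integral_cong)
    fix x
    have "(\<integral>\<^sup>+\<gamma>. ?g x * (?g x + SG \<gamma>) \<partial>\<nu>) = ?g x * (?g x * ennreal n + (\<integral>\<^sup>+\<gamma>. SG \<gamma> \<partial>\<nu>))"
      by (simp add: nn_integral_cmult nn_integral_add n_nn[simplified])
    then show "(\<integral>\<^sup>+\<gamma>. ?g x * (?g x + SG \<gamma>) \<partial>\<nu>) = ennreal n * (?g x * ?g x) + ?g x * (\<integral>\<^sup>+\<gamma>. SG \<gamma> \<partial>\<nu>)"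
      by (simp add: distrib_left mult_ac)
  qed
  also have "\<dots> = ennreal n * (\<integral>\<^sup>+x. ?g x * ?g x \<partial>\<mu>) + (\<integral>\<^sup>+x. ?g x \<partial>\<mu>) * (\<integral>\<^sup>+\<gamma>. SG \<gamma> \<partial>\<nu>)"
    by (simp add: nn_integral_add nn_integral_cmult nn_integral_multc)
  also have "\<dots> < \<infinity>"
    using fin_g fin_g2 by (simp add: nn_SG ennreal_mult_less_top ennreal_mult_eq_top_iff less_top[symmetric])
  finally show ?thesis .
qed

lemma nn_X_bound: "ennreal \<bar>X \<gamma>\<bar> \<le> GG \<gamma> + SG \<gamma> + ennreal \<bar>c\<bar>"
proof -
  have "ennreal \<bar>X \<gamma>\<bar> \<le> ennreal (\<bar>U \<gamma>\<bar> + \<bar>S \<gamma>\<bar> + \<bar>c\<bar>)" unfolding XUS by (intro ennreal_leI) linarith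
  also have "\<dots> = ennreal \<bar>U \<gamma>\<bar> + ennreal \<bar>S \<gamma>\<bar> + ennreal \<bar>c\<bar>" by simp
  also have "\<dots> \<le> GG \<gamma> + SG \<gamma> + ennreal \<bar>c\<bar>"
    unfolding U_def S_def GG_def SG_def by (intro add_mono ennreal_abs_integral_le order_refl)
  finally show ?thesis .
qed

lemma fin_X2: "(\<integral>\<^sup>+\<gamma>. ennreal \<bar>X \<gamma>\<bar> * ennreal \<bar>X \<gamma>\<bar> \<partial>\<nu>) < \<infinity>"
proof -
  let ?c = "ennreal \<bar>c\<bar>"
  have c2: "(\<integral>\<^sup>+\<gamma>. ?c * ?c \<partial>\<nu>) < \<infinity>"
    by (simp add: n_nn[simplified] ennreal_mult_less_top)
  have "(\<integral>\<^sup>+\<gamma>. ennreal \<bar>X \<gamma>\<bar> * ennreal \<bar>X \<gamma>\<bar> \<partial>\<nu>) \<le>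
      (\<integral>\<^sup>+\<gamma>. (GG \<gamma> + SG \<gamma> + ?c) * (GG \<gamma> + SG \<gamma> + ?c) \<partial>\<nu>)"
    by (intro nn_integral_mono mult_mono nn_X_bound) auto
  also have "\<dots> < \<infinity>"
    by (intro nn_integral_add_square_finite fin_GG2 fin_SG2 c2) measurable
  finally show ?thesis .
qed

lemma integrable_X2: "integrable \<nu> (\<lambda>\<gamma>. (X \<gamma>)\<^sup>2)"
  using fin_X2 by (simp add: integrable_iff_bounded ennreal_mult[symmetric] power2_eq_square abs_mult)

lemma integrable_X: "integrable \<nu> X"
  by (rule square_integrable_imp_integrable[OF _ integrable_X2]) measurable

lemma mecke_U:
  "AE \<gamma> in \<nu>. integrable (count_space (offdiag \<gamma>)) H"
  "integrable \<nu> U" "(\<integral>\<gamma>. U \<gamma> \<partial>\<nu>) = n * (\<integral>p. H p \<partial>\<mu>2)" (is ?P)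
proof -
  let ?Q = "\<mu>2 \<Otimes>\<^sub>M \<nu>"
  have i: "integrable ?Q (\<lambda>w. H (fst w))"
    by (rule mmn.integral_comp_fst[OF _ iH]) unfold_locales
  note * = mecke2_real[of "\<lambda>w. H (fst w)"]
  show "AE \<gamma> in \<nu>. integrable (count_space (offdiag \<gamma>)) H" "integrable \<nu> U" using *(1,2) i by (simp_all add: U_def[abs_def])
  have "(\<integral>\<gamma>. U \<gamma> \<partial>\<nu>) = (\<integral>w. H (fst w) \<partial>?Q)" using *(3) i by (simp add: U_def)
  also have "\<dots> = n * (\<integral>p. H p \<partial>\<mu>2)"
    unfolding n_def by (rule mmn.integral_comp_fst[OF _ iH]) unfold_locales
  finally show ?P .
qed

lemma mecke_S:
  "AE \<gamma> in \<nu>. integrable (count_space \<gamma>) g" (is ?Q)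
  "integrable \<nu> S" "(\<integral>\<gamma>. S \<gamma> \<partial>\<nu>) = n * (\<integral>x. g x \<partial>\<mu>)" (is ?P)
proof -
  have i: "integrable (\<mu> \<Otimes>\<^sub>M \<nu>) (\<lambda>w. g (fst w))"
    by (rule mn.integral_comp_fst[OF _ ig]) unfold_locales
  note * = mecke_real[of "\<lambda>w. g (fst w)"]
  show ?Q "integrable \<nu> S" using *(1,2) i by (simp_all add: S_def[abs_def])
  have "(\<integral>\<gamma>. S \<gamma> \<partial>\<nu>) = (\<integral>w. g (fst w) \<partial>(\<mu> \<Otimes>\<^sub>M \<nu>))" using *(3) i by (simp add: S_def)
  also have "\<dots> = n * (\<integral>x. g x \<partial>\<mu>)"
    unfolding n_def by (rule mn.integral_comp_fst[OF _ ig]) unfold_locales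
  finally show ?P .
qed

lemma mecke_V:
  assumes "integrable \<mu> (\<lambda>y. H (x, y))"
  shows "AE \<gamma> in \<nu>. integrable (count_space \<gamma>) (\<lambda>y. H (x, y))" (is ?Q)
    "integrable \<nu> (V x)" "(\<integral>\<gamma>. V x \<gamma> \<partial>\<nu>) = n * h x" (is ?P)
proof -
  have i: "integrable (\<mu> \<Otimes>\<^sub>M \<nu>) (\<lambda>w. H (x, fst w))"
    by (rule mn.integral_comp_fst[OF _ assms]) unfold_locales
  note * = mecke_real[of "\<lambda>w. H (x, fst w)"]
  show ?Q "integrable \<nu> (V x)"
    using *(1,2) i by (simp_all add: V_def[abs_def])
  have "(\<integral>\<gamma>. V x \<gamma> \<partial>\<nu>) = (\<integral>w. H (x, fst w) \<partial>(\<mu> \<Otimes>\<^sub>M \<nu>))" using *(3) i by (simp add: V_def)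
  also have "\<dots> = n * h x"
    unfolding n_def h_def by (rule mn.integral_comp_fst[OF _ assms]) unfold_locales
  finally show ?P .
qed

lemma AE_section: "AE x in \<mu>. integrable \<mu> (\<lambda>y. H (x, y))"
  using mm.AE_integrable_fst'[OF iH] .

lemma h_le_k: "ennreal \<bar>h x\<bar> \<le> k x"
  unfolding h_def k_def by (rule ennreal_abs_integral_le)

lemma integral_H_fst:
  assumes [measurable]: "r \<in> borel_measurable \<mu>" and fin: "(\<integral>\<^sup>+x. ennreal \<bar>r x\<bar> * ennreal \<bar>r x\<bar> \<partial>\<mu>) < \<infinity>"
  shows "integrable \<mu>2 (\<lambda>p. H p * r (fst p))" "(\<integral>p. H p * r (fst p) \<partial>\<mu>2) = (\<integral>x. h x * r x \<partial>\<mu>)" (is ?Q)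
    "integrable \<mu>2 (\<lambda>p. H p * r (snd p))" "(\<integral>p. H p * r (snd p) \<partial>\<mu>2) = (\<integral>x. h x * r x \<partial>\<mu>)" (is ?P)
    "integrable \<mu> (\<lambda>x. h x * r x)"
proof -
  have f: "(\<integral>\<^sup>+x. k x * ennreal \<bar>r x\<bar> \<partial>\<mu>) < \<infinity>" by (rule nn_integral_mult_finite[OF _ _ fin_k2 fin]) auto
  show i1: "integrable \<mu>2 (\<lambda>p. H p * r (fst p))"
    using f nn_Hk_fst[of "\<lambda>x. ennreal \<bar>r x\<bar>"] by (simp add: integrable_iff_bounded abs_mult ennreal_mult)
  show ?Q
    using mm.integral_fst'[OF i1] by (simp add: h_def)
  show i2: "integrable \<mu>2 (\<lambda>p. H p * r (snd p))"
    using f nn_Hk_snd[of "\<lambda>x. ennreal \<bar>r x\<bar>"] by (simp add: integrable_iff_bounded abs_mult ennreal_mult)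
  have "(\<integral>p. H p * r (snd p) \<partial>\<mu>2) = (\<integral>y. \<integral>x. H (x, y) * r y \<partial>\<mu> \<partial>\<mu>)"
    using mm.integral_snd[of "\<lambda>x y. H (x, y) * r y"] i2 by (simp add: case_prod_beta')
  also have "\<dots> = (\<integral>x. h x * r x \<partial>\<mu>)" by (simp add: h_def sym)
  finally show ?P .
  have "(\<integral>\<^sup>+x. ennreal \<bar>h x * r x\<bar> \<partial>\<mu>) \<le> (\<integral>\<^sup>+x. k x * ennreal \<bar>r x\<bar> \<partial>\<mu>)"
    by (intro nn_integral_mono) (simp add: abs_mult ennreal_mult mult_right_mono h_le_k)
  then show "integrable \<mu> (\<lambda>x. h x * r x)"
    using f by (simp add: integrable_iff_bounded)
qed

lemma fin_h2: "(\<integral>\<^sup>+x. ennreal \<bar>h x\<bar> * ennreal \<bar>h x\<bar> \<partial>\<mu>) < \<infinity>"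
proof -
  have "(\<integral>\<^sup>+x. ennreal \<bar>h x\<bar> * ennreal \<bar>h x\<bar> \<partial>\<mu>) \<le> (\<integral>\<^sup>+x. k x * k x \<partial>\<mu>)"
    by (intro nn_integral_mono mult_mono h_le_k) auto
  then show ?thesis using fin_k2 by (rule order_le_less_trans)
qed

lemma X_insert:
  assumes "x \<notin> \<gamma>" "integrable (count_space (offdiag \<gamma>)) H"
    "integrable (count_space \<gamma>) (\<lambda>y. H (x, y))" "integrable (count_space \<gamma>) g"
  shows "X (insert x \<gamma>) = X \<gamma> + 2 * V x \<gamma> - g x"
  using assms real_sum_offdiag_insert(2)[of x \<gamma> H, OF assms(1) sym assms(2,3)]
    integral_count_space_insert(2)[OF assms(4,1)]
  by (simp add: X_def V_def)

text \<open>
  A point \<open>x\<close> inserted by the Mecke formula changes \<open>X\<close> by \<open>2 *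
  V x - g x\<close>.
\<close>

lemma cov_S: "integrable \<nu> (\<lambda>\<gamma>. S \<gamma> * X \<gamma>)" (is ?Q)
  "(\<integral>\<gamma>. S \<gamma> * X \<gamma> \<partial>\<nu>) = (\<integral>x. g x \<partial>\<mu>) * (\<integral>\<gamma>. X \<gamma> \<partial>\<nu>) + n * (2 * (\<integral>x. h x * g x \<partial>\<mu>) - (\<integral>x. (g x)\<^sup>2 \<partial>\<mu>))" (is ?P)
proof -
  have m: "(\<lambda>w. g (fst w) * X (snd w)) \<in> borel_measurable (\<mu> \<Otimes>\<^sub>M \<nu>)" by measurable
  have m2: "(\<lambda>w. ennreal \<bar>g (fst w)\<bar> * ennreal \<bar>X (snd w)\<bar>) \<in> borel_measurable (\<mu> \<Otimes>\<^sub>M \<nu>)" by measurable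
  have "(\<integral>\<^sup>+w. ennreal \<bar>g (fst w)\<bar> * ennreal \<bar>X (insert (fst w) (snd w))\<bar> \<partial>(\<mu> \<Otimes>\<^sub>M \<nu>)) =
      (\<integral>\<^sup>+\<gamma>. SG \<gamma> * ennreal \<bar>X \<gamma>\<bar> \<partial>\<nu>)"
    using mecke[OF m2] by (simp add: nn_integral_multc SG_def case_prod_beta')
  also have "\<dots> < \<infinity>" by (rule nn_integral_mult_finite[OF _ _ fin_SG2 fin_X2]) auto
  finally have i: "integrable (\<mu> \<Otimes>\<^sub>M \<nu>) (\<lambda>w. g (fst w) * X (insert (fst w) (snd w)))"
    by (simp add: integrable_iff_bounded abs_mult ennreal_mult)
  note * = mecke_real[OF m, simplified, OF i]
  show ?Q using *(2) by (simp add: S_def)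
  have "(\<integral>\<gamma>. S \<gamma> * X \<gamma> \<partial>\<nu>) = (\<integral>x. \<integral>\<gamma>. g x * X (insert x \<gamma>) \<partial>\<nu> \<partial>\<mu>)"
    using *(3) mn.integral_fst'[OF i] by (simp add: S_def)
  also have "\<dots> = (\<integral>x. g x * (\<integral>\<gamma>. X \<gamma> \<partial>\<nu>) + 2 * n * (h x * g x) - n * (g x)\<^sup>2 \<partial>\<mu>)"
  proof (rule integral_cong_AE)
    have "AE x in \<mu>. AE \<gamma> in \<nu>. x \<notin> \<gamma>" using mn.AE_pair[OF AE_new1] by simp
    then show "AE x in \<mu>. (\<integral>\<gamma>. g x * X (insert x \<gamma>) \<partial>\<nu>) = g x * (\<integral>\<gamma>. X \<gamma> \<partial>\<nu>) + 2 * n * (h x * g x) - n * (g x)\<^sup>2"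
      using AE_section
    proof eventually_elim
      case (elim x)
      have "(\<integral>\<gamma>. g x * X (insert x \<gamma>) \<partial>\<nu>) = (\<integral>\<gamma>. g x * (X \<gamma> + 2 * V x \<gamma> - g x) \<partial>\<nu>)"
      proof (rule integral_cong_AE)
        show "AE \<gamma> in \<nu>. g x * X (insert x \<gamma>) = g x * (X \<gamma> + 2 * V x \<gamma> - g x)"
          using elim(1) mecke_U(1) mecke_S(1) mecke_V(1)[OF elim(2)] by eventually_elim (simp add: X_insert)
      qed measurable
      also have "\<dots> = g x * ((\<integral>\<gamma>. X \<gamma> \<partial>\<nu>) + 2 * (\<integral>\<gamma>. V x \<gamma> \<partial>\<nu>) - n * g x)"
        using integrable_X mecke_V(2)[OF elim(2)] by (simp add: n_def)
      finally show ?case by (simp add: mecke_V(3)[OF elim(2)] algebra_simps power2_eq_square)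
    qed
  qed measurable
  also have "\<dots> = (\<integral>x. g x \<partial>\<mu>) * (\<integral>\<gamma>. X \<gamma> \<partial>\<nu>) + n * (2 * (\<integral>x. h x * g x \<partial>\<mu>) - (\<integral>x. (g x)\<^sup>2 \<partial>\<mu>))"
  proof -
    have "(\<integral>x. g x * (\<integral>\<gamma>. X \<gamma> \<partial>\<nu>) + 2 * n * (h x * g x) - n * (g x)\<^sup>2 \<partial>\<mu>) =
        (\<integral>x. g x \<partial>\<mu>) * (\<integral>\<gamma>. X \<gamma> \<partial>\<nu>) + 2 * n * (\<integral>x. h x * g x \<partial>\<mu>) - n * (\<integral>x. (g x)\<^sup>2 \<partial>\<mu>)"
      using ig ig2 integral_H_fst(5)[OF g fin_g2] by simp
    then show ?thesis by (simp only: algebra_simps)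
  qed
  finally show ?P .
qed

lemma cov_U: "integrable \<nu> (\<lambda>\<gamma>. U \<gamma> * X \<gamma>)" (is ?P)
  "(\<integral>\<gamma>. U \<gamma> * X \<gamma> \<partial>\<nu>) = (\<integral>p. H p \<partial>\<mu>2) * (\<integral>\<gamma>. X \<gamma> \<partial>\<nu>)
     + n * (4 * (\<integral>x. h x * h x \<partial>\<mu>) - 2 * (\<integral>x. h x * g x \<partial>\<mu>) + 2 * (\<integral>p. (H p)\<^sup>2 \<partial>\<mu>2))"
proof -
  let ?Q = "\<mu>2 \<Otimes>\<^sub>M \<nu>"
  have m: "(\<lambda>w. H (fst w) * X (snd w)) \<in> borel_measurable ?Q" by measurable
  have m2: "(\<lambda>w. ennreal \<bar>H (fst w)\<bar> * ennreal \<bar>X (snd w)\<bar>) \<in> borel_measurable ?Q" by measurable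
  have "(\<integral>\<^sup>+w. ennreal \<bar>H (fst w)\<bar> * ennreal \<bar>X (insert (fst (fst w)) (insert (snd (fst w)) (snd w)))\<bar> \<partial>?Q) =
      (\<integral>\<^sup>+\<gamma>. GG \<gamma> * ennreal \<bar>X \<gamma>\<bar> \<partial>\<nu>)"
    using mecke2[OF m2] by (simp add: nn_integral_multc GG_def case_prod_beta')
  also have "\<dots> < \<infinity>" by (rule nn_integral_mult_finite[OF _ _ fin_GG2 fin_X2]) auto
  finally have i: "integrable ?Q (\<lambda>w. H (fst w) * X (insert (fst (fst w)) (insert (snd (fst w)) (snd w))))"
    by (simp add: integrable_iff_bounded abs_mult ennreal_mult)
  note * = mecke2_real[OF m, simplified, OF i]
  show ?P using *(2) by (simp add: U_def)
  let ?eX = "\<integral>\<gamma>. X \<gamma> \<partial>\<nu>"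
  let ?R = "\<lambda>p. H p * ?eX + (2 * n * (H p * h (fst p)) + 2 * n * (H p * h (snd p)))
      - (n * (H p * g (fst p)) + n * (H p * g (snd p))) + 2 * n * (H p)\<^sup>2"
  have "(\<integral>\<gamma>. U \<gamma> * X \<gamma> \<partial>\<nu>) = (\<integral>p. \<integral>\<gamma>. H p * X (insert (fst p) (insert (snd p) \<gamma>)) \<partial>\<nu> \<partial>\<mu>2)"
    using *(3) mmn.integral_fst'[OF i] by (simp add: U_def)
  also have "\<dots> = (\<integral>p. ?R p \<partial>\<mu>2)"
  proof (rule integral_cong_AE)
    have "AE p in \<mu>2. AE \<gamma> in \<nu>. fst p \<notin> \<gamma> \<and> snd p \<notin> \<gamma> \<and> fst p \<noteq> snd p"
      using mmn.AE_pair[OF AE_new2] by simp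
    then show "AE p in \<mu>2. (\<integral>\<gamma>. H p * X (insert (fst p) (insert (snd p) \<gamma>)) \<partial>\<nu>) = ?R p"
      using mm.AE_pair_fst[OF AE_section] mm.AE_pair_snd[OF AE_section]
    proof eventually_elim
      case (elim p)
      obtain x y where p: "p = (x, y)" by fastforce
      have sx: "integrable \<mu> (\<lambda>z. H (x, z))" and sy: "integrable \<mu> (\<lambda>z. H (y, z))" using elim p by auto
      have "(\<integral>\<gamma>. H p * X (insert (fst p) (insert (snd p) \<gamma>)) \<partial>\<nu>) =
          (\<integral>\<gamma>. H p * (X \<gamma> + 2 * V x \<gamma> + 2 * V y \<gamma> + (2 * H p - g x - g y)) \<partial>\<nu>)"
      proof (rule integral_cong_AE)
        show "AE \<gamma> in \<nu>. H p * X (insert (fst p) (insert (snd p) \<gamma>)) =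
            H p * (X \<gamma> + 2 * V x \<gamma> + 2 * V y \<gamma> + (2 * H p - g x - g y))"
          using elim(1) mecke_U(1) mecke_S(1) mecke_V(1)[OF sx] mecke_V(1)[OF sy]
        proof eventually_elim
          case (elim \<gamma>)
          then have new: "x \<notin> \<gamma>" "y \<notin> \<gamma>" "x \<noteq> y" using p by auto
          have Vy: "V x (insert y \<gamma>) = H (x, y) + V x \<gamma>"
            unfolding V_def by (rule integral_count_space_insert(2)) (use elim new in auto)
          have "X (insert x (insert y \<gamma>)) = X (insert y \<gamma>) + 2 * V x (insert y \<gamma>) - g x"
            using new elim real_sum_offdiag_insert(1)[of y \<gamma> H] sym integral_count_space_insert(1)[of \<gamma> _ y]
            by (intro X_insert) auto
          then show ?case using X_insert[of y \<gamma>] new elim Vy p by simp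
        qed
      qed (use p in measurable)
      also have "\<dots> = H p * (?eX + 2 * (\<integral>\<gamma>. V x \<gamma> \<partial>\<nu>) + 2 * (\<integral>\<gamma>. V y \<gamma> \<partial>\<nu>) + n * (2 * H p - g x - g y))"
        using integrable_X mecke_V(2)[OF sx] mecke_V(2)[OF sy] by (simp add: n_def)
      finally show ?case
        by (simp add: mecke_V(3)[OF sx] mecke_V(3)[OF sy] p algebra_simps power2_eq_square)
    qed
  qed measurable
  also have "\<dots> = (\<integral>p. H p \<partial>\<mu>2) * ?eX
     + n * (4 * (\<integral>x. h x * h x \<partial>\<mu>) - 2 * (\<integral>x. h x * g x \<partial>\<mu>) + 2 * (\<integral>p. (H p)\<^sup>2 \<partial>\<mu>2))"
  proof -
    have "(\<integral>p. ?R p \<partial>\<mu>2) = (\<integral>p. H p \<partial>\<mu>2) * ?eX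
        + (2 * n * (\<integral>x. h x * h x \<partial>\<mu>) + 2 * n * (\<integral>x. h x * h x \<partial>\<mu>))
        - (n * (\<integral>x. h x * g x \<partial>\<mu>) + n * (\<integral>x. h x * g x \<partial>\<mu>)) + 2 * n * (\<integral>p. (H p)\<^sup>2 \<partial>\<mu>2)"
      using iH iH2 integral_H_fst[OF g fin_g2] integral_H_fst[OF meas(7) fin_h2] by simp
    then show ?thesis by (simp add: distrib_left right_diff_distrib)
  qed
  finally show "(\<integral>\<gamma>. U \<gamma> * X \<gamma> \<partial>\<nu>) = (\<integral>p. H p \<partial>\<mu>2) * ?eX
     + n * (4 * (\<integral>x. h x * h x \<partial>\<mu>) - 2 * (\<integral>x. h x * g x \<partial>\<mu>) + 2 * (\<integral>p. (H p)\<^sup>2 \<partial>\<mu>2))" .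
qed

text \<open>
  The three summands are the squared mean, the contribution of one shared point, with kernel
  \<open>2 * h - g\<close>, and that of a shared pair: an isometry for the chaos expansion of
  order two. Cancellation between the pair sum and the single sum is visible in the first two
  summands.
\<close>

theorem second_moment:
  "(\<integral>\<gamma>. (X \<gamma>)\<^sup>2 \<partial>\<nu>) = n * (((\<integral>p. H p \<partial>\<mu>2) - (\<integral>x. g x \<partial>\<mu>) - c)\<^sup>2
     + (\<integral>x. (2 * h x - g x)\<^sup>2 \<partial>\<mu>) + 2 * (\<integral>p. (H p)\<^sup>2 \<partial>\<mu>2))"
proof -
  have eX: "(\<integral>\<gamma>. X \<gamma> \<partial>\<nu>) = n * ((\<integral>p. H p \<partial>\<mu>2) - (\<integral>x. g x \<partial>\<mu>) - c)"
    unfolding XUS using mecke_U mecke_S by (simp add: n_def algebra_simps)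
  have X2: "(\<integral>\<gamma>. (X \<gamma>)\<^sup>2 \<partial>\<nu>) = (\<integral>\<gamma>. U \<gamma> * X \<gamma> \<partial>\<nu>) - (\<integral>\<gamma>. S \<gamma> * X \<gamma> \<partial>\<nu>) - c * (\<integral>\<gamma>. X \<gamma> \<partial>\<nu>)"
  proof -
    have "(\<integral>\<gamma>. (X \<gamma>)\<^sup>2 \<partial>\<nu>) = (\<integral>\<gamma>. U \<gamma> * X \<gamma> - S \<gamma> * X \<gamma> - c * X \<gamma> \<partial>\<nu>)"
      by (intro Bochner_Integration.integral_cong refl) (simp add: XUS power2_eq_square algebra_simps)
    also have "\<dots> = (\<integral>\<gamma>. U \<gamma> * X \<gamma> \<partial>\<nu>) - (\<integral>\<gamma>. S \<gamma> * X \<gamma> \<partial>\<nu>) - c * (\<integral>\<gamma>. X \<gamma> \<partial>\<nu>)"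
      using cov_U(1) cov_S(1) integrable_X by simp
    finally show ?thesis .
  qed
  have hg: "(\<integral>x. (2 * h x - g x)\<^sup>2 \<partial>\<mu>) = 4 * (\<integral>x. h x * h x \<partial>\<mu>) - 4 * (\<integral>x. h x * g x \<partial>\<mu>) + (\<integral>x. (g x)\<^sup>2 \<partial>\<mu>)"
  proof -
    have "(\<integral>x. (2 * h x - g x)\<^sup>2 \<partial>\<mu>) = (\<integral>x. 4 * (h x * h x) - 4 * (h x * g x) + (g x)\<^sup>2 \<partial>\<mu>)"
      by (intro Bochner_Integration.integral_cong refl) (simp add: power2_eq_square algebra_simps)
    also have "\<dots> = 4 * (\<integral>x. h x * h x \<partial>\<mu>) - 4 * (\<integral>x. h x * g x \<partial>\<mu>) + (\<integral>x. (g x)\<^sup>2 \<partial>\<mu>)"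
      using ig2 integral_H_fst(5)[OF g fin_g2] integral_H_fst(5)[OF meas(7) fin_h2] by simp
    finally show ?thesis .
  qed
  show ?thesis
    unfolding X2 hg cov_U(2) cov_S(2) eX by (simp only: algebra_simps power2_eq_square)
qed

end

section \<open>The exponential functional and the tilted Poisson measure\<close>

lemma nn_integral_shift:
  assumes [measurable]: "f \<in> borel_measurable borel"
  shows "(\<integral>\<^sup>+x. f (x + c) \<partial>lborel) = (\<integral>\<^sup>+x. f (x :: 'a::euclidean_space) \<partial>lborel)"
proof -
  have "(\<integral>\<^sup>+x. f x \<partial>lborel) = (\<integral>\<^sup>+x. f x \<partial>distr lborel borel ((+) c))" by (simp add: lborel_distr_plus)
  also have "\<dots> = (\<integral>\<^sup>+x. f (c + x) \<partial>lborel)" by (rule nn_integral_distr) auto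
  finally show ?thesis by (simp add: add.commute)
qed

lemma integral_shift:
  fixes f :: "'a::euclidean_space \<Rightarrow> real"
  assumes [measurable]: "f \<in> borel_measurable borel"
  shows "(\<integral>x. f (x + c) \<partial>lborel) = (\<integral>x. f x \<partial>lborel)" (is ?Q)
    "integrable lborel (\<lambda>x. f (x + c)) \<longleftrightarrow> integrable lborel f" (is ?P)
proof -
  have "(\<integral>x. f x \<partial>lborel) = (\<integral>x. f x \<partial>distr lborel borel ((+) c))" by (simp add: lborel_distr_plus)
  also have "\<dots> = (\<integral>x. f (c + x) \<partial>lborel)" by (rule integral_distr) auto
  finally show ?Q by (simp add: add.commute)
  have "integrable lborel f \<longleftrightarrow> integrable (distr lborel borel ((+) c)) f" by (simp add: lborel_distr_plus)
  also have "\<dots> \<longleftrightarrow> integrable lborel (\<lambda>x. f (c + x))" by (rule integrable_distr_eq) auto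
  finally show ?P by (simp add: add.commute)
qed

context poisson_configuration
begin

lemma exp_moment:
  assumes A: "A \<in> sets borel" "bounded A"
  shows "(\<integral>\<^sup>+\<gamma>. ennreal (exp (r * real (card (\<gamma> \<inter> A)))) \<partial>M) < \<infinity>"
proof -
  let ?l = "z * measure lborel A"
  have l: "?l \<ge> 0" using z_pos by simp
  have X[measurable]: "(\<lambda>\<gamma>. card (\<gamma> \<inter> A)) \<in> M \<rightarrow>\<^sub>M count_space UNIV" by (rule measurable_count[OF A])
  let ?p = "\<lambda>k::nat. ?l ^ k / fact k * exp (- ?l) * exp (r * real k)"
  have "summable (\<lambda>k. exp (- ?l) * (inverse (fact k) * (?l * exp r) ^ k))"
    by (intro summable_mult summable_exp)
  then have s: "summable ?p"
    by (simp add: field_simps power_mult_distrib exp_of_nat_mult[symmetric])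
  have "(\<integral>\<^sup>+\<gamma>. ennreal (exp (r * real (card (\<gamma> \<inter> A)))) \<partial>M) =
      (\<integral>\<^sup>+k. ennreal (exp (r * real k)) \<partial>distr M (count_space UNIV) (\<lambda>\<gamma>. card (\<gamma> \<inter> A)))"
    by (rule nn_integral_distr[symmetric]) auto
  also have "\<dots> = (\<integral>\<^sup>+k. ennreal (?p k) \<partial>count_space UNIV)"
    using l unfolding nn_integral_distr_nat[OF X] count_law[OF A]
    by (intro nn_integral_cong) (simp add: ennreal_mult[symmetric])
  also have "\<dots> = (\<Sum>k. ennreal (?p k))" by (rule nn_integral_count_space_nat)
  also have "\<dots> = ennreal (\<Sum>k. ?p k)" using l s by (intro suminf_ennreal2) auto
  finally show ?thesis by simp
qed

end

lemma compact_support_ball: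
  assumes "\<phi> \<in> continuous_compact_support"
  obtains n :: nat where "\<And>x. x \<notin> ball 0 (real n) \<Longrightarrow> \<phi> x = 0"
proof -
  obtain r where "{x. \<phi> x \<noteq> 0} \<subseteq> ball 0 r"
    using continuous_compact_support_bounded[OF assms] bounded_subset_ballD by blast
  moreover obtain n :: nat where "r \<le> real n" using real_arch_simple by blast
  ultimately show ?thesis by (intro that[of n]) force
qed

lemma compact_support_bounded_range:
  assumes "\<phi> \<in> continuous_compact_support"
  obtains s where "s \<ge> 0" "\<And>x. \<bar>\<phi> x\<bar> \<le> s"
proof -
  let ?K = "closure {x. \<phi> x \<noteq> 0}"
  have "compact (\<phi> ` ?K)"
    using assms by (intro compact_continuous_image) (auto simp: continuous_compact_support_def intro: continuous_on_subset)
  then obtain s where s: "\<And>y. y \<in> \<phi> ` ?K \<Longrightarrow> norm y \<le> s" using compact_imp_bounded bounded_iff by metis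
  have "\<bar>\<phi> x\<bar> \<le> max s 0" for x
    using s[of "\<phi> x"] closure_subset[of "{x. \<phi> x \<noteq> 0}"] by (cases "\<phi> x = 0") (auto simp: image_iff le_max_iff_disj)
  then show ?thesis by (intro that[of "max s 0"]) auto
qed

lemma pairing_insert:
  assumes "\<phi> \<in> continuous_compact_support" "\<gamma> \<in> configurations" "x \<notin> \<gamma>"
  shows "pairing \<phi> (insert x \<gamma>) = \<phi> x + pairing \<phi> \<gamma>"
proof -
  obtain n where n: "\<And>x. x \<notin> ball 0 (real n) \<Longrightarrow> \<phi> x = 0" using compact_support_ball[OF assms(1)] by blast
  have f: "finite (\<gamma> \<inter> ball 0 (real n))" using assms finite_configuration_bounded by blast
  show ?thesis
    using pairing_eq_sum[of "insert x \<gamma>" "ball 0 (real n)" \<phi>] pairing_eq_sum[of \<gamma> "ball 0 (real n)" \<phi>]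
      configuration_insert[OF assms(2), of x] assms n f
    by (cases "x \<in> ball 0 (real n)") (auto simp: Int_insert_left)
qed

lemma pairing_remove:
  assumes "\<phi> \<in> continuous_compact_support" "\<gamma> \<in> configurations" "x \<in> \<gamma>"
  shows "pairing \<phi> (\<gamma> - {x}) = pairing \<phi> \<gamma> - \<phi> x"
  using pairing_insert[OF assms(1), of "\<gamma> - {x}" x] configuration_subset[OF assms(2), of "\<gamma> - {x}"] assms(3)
  by (simp add: insert_absorb)

text \<open>
  The measure \<open>\<nu> = F\<^sup>2 M\<close> turns \<open>L\<^sup>2\<close> norms of
  \<open>F * X\<close> into second moments of \<open>X\<close>. Since a new point
  \<open>x\<close> multiplies \<open>F\<^sup>2\<close> by \<open>exp (2 * \<phi> x)\<close>, the
  tilted measure obeys a Mecke formula for the intensity \<open>w\<close>.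
\<close>

locale tilted_poisson = poisson_configuration +
  fixes \<phi> :: "'a::euclidean_space \<Rightarrow> real"
  assumes phi: "\<phi> \<in> continuous_compact_support"
begin

definition F where "F \<gamma> = exp (pairing \<phi> \<gamma>)"

lemma phi_measurable [measurable]: "\<phi> \<in> borel_measurable borel"
  using phi by (auto simp: continuous_compact_support_def intro: borel_measurable_continuous_onI)

lemma F_measurable [measurable]: "F \<in> borel_measurable CB"
  unfolding F_def[abs_def] using pairing_measurable[OF phi] by measurable

lemma F_pos: "F \<gamma> > 0" by (simp add: F_def)

lemma F_insert: "\<gamma> \<in> configurations \<Longrightarrow> x \<notin> \<gamma> \<Longrightarrow> F (insert x \<gamma>) = exp (\<phi> x) * F \<gamma>"
  by (simp add: F_def pairing_insert[OF phi] exp_add)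

lemma F_remove: "\<gamma> \<in> configurations \<Longrightarrow> x \<in> \<gamma> \<Longrightarrow> F (\<gamma> - {x}) = exp (- \<phi> x) * F \<gamma>"
  by (simp add: F_def pairing_remove[OF phi] exp_diff exp_minus field_simps)

lemma F_bound:
  obtains K r where "K \<in> sets borel" "bounded K" "r \<ge> 0"
    "\<And>\<gamma>. \<gamma> \<in> configurations \<Longrightarrow> F (\<gamma> \<inter> K) = F \<gamma>"
    "\<And>\<gamma>. \<gamma> \<in> configurations \<Longrightarrow> F \<gamma> \<le> exp (r * real (card (\<gamma> \<inter> K)))"
proof -
  obtain n where n: "\<And>x. x \<notin> ball 0 (real n) \<Longrightarrow> \<phi> x = 0" using compact_support_ball[OF phi] by blast
  obtain s where s: "s \<ge> 0" "\<And>x. \<bar>\<phi> x\<bar> \<le> s" using compact_support_bounded_range[OF phi] by blast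
  let ?K = "ball (0::'a) (real n)"
  show ?thesis
  proof (rule that[of ?K s])
    fix \<gamma> :: "'a set" assume g: "\<gamma> \<in> configurations"
    have e: "pairing \<phi> \<gamma> = (\<Sum>x\<in>\<gamma> \<inter> ?K. \<phi> x)" using pairing_eq_sum[of \<gamma> ?K \<phi>, OF g bounded_ball n] by simp
    have "pairing \<phi> (\<gamma> \<inter> ?K) = (\<Sum>x\<in>(\<gamma> \<inter> ?K) \<inter> ?K. \<phi> x)"
      by (rule pairing_eq_sum) (use configuration_subset[OF g, of "\<gamma> \<inter> ?K"] n in auto)
    then show "F (\<gamma> \<inter> ?K) = F \<gamma>" using e by (simp add: F_def Int_assoc)
    have "(\<Sum>x\<in>\<gamma> \<inter> ?K. \<phi> x) \<le> (\<Sum>x\<in>\<gamma> \<inter> ?K. s)" by (intro sum_mono) (use s abs_le_D1 in blast)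
    then show "F \<gamma> \<le> exp (s * real (card (\<gamma> \<inter> ?K)))" by (simp add: F_def e mult.commute)
  qed (use s in auto)
qed

lemma F_moment: "(\<integral>\<^sup>+\<gamma>. ennreal (F \<gamma> ^ k) \<partial>M) < \<infinity>"
proof -
  obtain K r where K: "K \<in> sets borel" "bounded K" "r \<ge> 0"
    "\<And>\<gamma>. \<gamma> \<in> configurations \<Longrightarrow> F \<gamma> \<le> exp (r * real (card (\<gamma> \<inter> K)))" using F_bound by metis
  have "(\<integral>\<^sup>+\<gamma>. ennreal (F \<gamma> ^ k) \<partial>M) \<le> (\<integral>\<^sup>+\<gamma>. ennreal (exp ((real k * r) * real (card (\<gamma> \<inter> K)))) \<partial>M)"
  proof (intro nn_integral_mono ennreal_leI)
    fix \<gamma> assume "\<gamma> \<in> space M"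
    then have "F \<gamma> ^ k \<le> exp (r * real (card (\<gamma> \<inter> K))) ^ k"
      using K(4) F_pos[of \<gamma>] by (intro power_mono) (auto simp: less_imp_le)
    then show "F \<gamma> ^ k \<le> exp ((real k * r) * real (card (\<gamma> \<inter> K)))"
      by (simp add: exp_of_nat_mult[symmetric] mult.assoc)
  qed
  then show ?thesis using exp_moment[OF K(1,2), of "real k * r"] by (rule order_le_less_trans)
qed

definition \<nu> where "\<nu> = density M (\<lambda>\<gamma>. ennreal ((F \<gamma>)\<^sup>2))"
definition w where "w x = z * exp (2 * \<phi> x)"
definition \<mu> :: "'a measure" where "\<mu> = density lborel (\<lambda>x. ennreal (w x))"

lemma w_measurable [measurable]: "w \<in> borel_measurable borel" unfolding w_def[abs_def] by measurable

lemma w_nonneg: "w x \<ge> 0" using z_pos by (simp add: w_def)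

lemma sets_nu' [measurable_cong]: "sets \<nu> = sets CB" by (simp add: \<nu>_def)
lemma sets_mu' [measurable_cong]: "sets \<mu> = sets borel" by (simp add: \<mu>_def)

sublocale tilt: mecke_measure \<nu> \<mu>
proof (intro mecke_measure.intro mecke_measure_axioms.intro)
  have "emeasure \<nu> (space \<nu>) = (\<integral>\<^sup>+\<gamma>. ennreal ((F \<gamma>)\<^sup>2) \<partial>M)"
    unfolding \<nu>_def using sets.top[of M] by (subst emeasure_density) (auto intro!: nn_integral_cong simp: indicator_def)
  also have "\<dots> < \<infinity>" by (rule F_moment)
  finally show "finite_measure \<nu>" by (intro finite_measureI) auto
  show sf: "sigma_finite_measure \<mu>"
    unfolding \<mu>_def by (subst sigma_finite_measure.sigma_finite_iff_density_finite[OF sigma_finite_lborel]) auto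
  show "sets \<nu> = sets CB" "sets \<mu> = sets borel" by (simp_all add: \<nu>_def \<mu>_def)
  show "emeasure \<mu> {x} = 0" for x
    unfolding \<mu>_def by (subst emeasure_density) (auto simp: nn_integral_indicator_singleton intro!: nn_integral_null_set)
  fix f :: "'a \<times> 'a set \<Rightarrow> ennreal"
  have s: "sets (\<mu> \<Otimes>\<^sub>M \<nu>) = sets (borel \<Otimes>\<^sub>M M)" by (intro sets_pair_measure_cong) (auto simp: \<mu>_def \<nu>_def)
  assume "f \<in> borel_measurable (\<mu> \<Otimes>\<^sub>M \<nu>)"
  then have f[measurable]: "f \<in> borel_measurable (borel \<Otimes>\<^sub>M M)" using measurable_cong_sets[OF s refl] by blast
  let ?d = "density lborel (\<lambda>_::'a. ennreal z)"
  have sd: "sets (?d \<Otimes>\<^sub>M M) = sets (borel \<Otimes>\<^sub>M M)" by (intro sets_pair_measure_cong) auto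
  have [measurable]: "(\<lambda>w. insert (fst w) (snd w)) \<in> borel \<Otimes>\<^sub>M M \<rightarrow>\<^sub>M M" by measurable
  have meas_sum: "(\<lambda>\<gamma>. \<integral>\<^sup>+x. f (x, \<gamma>) \<partial>count_space \<gamma>) \<in> borel_measurable M"
    by (rule measurable_nn_sum) measurable
  have m1: "(\<lambda>w. ennreal ((F (snd w))\<^sup>2) * f w) \<in> borel_measurable (borel \<Otimes>\<^sub>M M)" by measurable
  have m2: "(\<lambda>w. ennreal (exp (2 * \<phi> (fst w))) * (ennreal ((F (snd w))\<^sup>2) * f (fst w, insert (fst w) (snd w)))) \<in> borel_measurable (borel \<Otimes>\<^sub>M M)"
    by measurable
  have "(\<integral>\<^sup>+\<gamma>. \<integral>\<^sup>+x. f (x, \<gamma>) \<partial>count_space \<gamma> \<partial>\<nu>) = (\<integral>\<^sup>+\<gamma>. ennreal ((F \<gamma>)\<^sup>2) * (\<integral>\<^sup>+x. f (x, \<gamma>) \<partial>count_space \<gamma>) \<partial>M)"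
    unfolding \<nu>_def by (rule nn_integral_density[OF _ meas_sum]) measurable
  also have "\<dots> = (\<integral>\<^sup>+\<gamma>. \<integral>\<^sup>+x. ennreal ((F \<gamma>)\<^sup>2) * f (x, \<gamma>) \<partial>count_space \<gamma> \<partial>M)"
    by (simp add: nn_integral_cmult)
  also have "\<dots> = (\<integral>\<^sup>+w. ennreal ((F (insert (fst w) (snd w)))\<^sup>2) * f (fst w, insert (fst w) (snd w)) \<partial>(?d \<Otimes>\<^sub>M M))"
    using mecke[of "\<lambda>w. ennreal ((F (snd w))\<^sup>2) * f w"] m1 by (simp add: case_prod_beta' measurable_cong_sets[OF sd refl])
  also have "\<dots> = (\<integral>\<^sup>+w. ennreal (exp (2 * \<phi> (fst w))) * (ennreal ((F (snd w))\<^sup>2) * f (fst w, insert (fst w) (snd w))) \<partial>(?d \<Otimes>\<^sub>M M))"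
  proof (rule nn_integral_cong_AE)
    show "AE w in ?d \<Otimes>\<^sub>M M. ennreal ((F (insert (fst w) (snd w)))\<^sup>2) * f (fst w, insert (fst w) (snd w)) =
       ennreal (exp (2 * \<phi> (fst w))) * (ennreal ((F (snd w))\<^sup>2) * f (fst w, insert (fst w) (snd w)))"
      using AE_new1 AE_space
    proof eventually_elim
      case (elim w)
      then have "snd w \<in> configurations" by (auto simp: space_pair_measure)
      then have "(F (insert (fst w) (snd w)))\<^sup>2 = exp (2 * \<phi> (fst w)) * (F (snd w))\<^sup>2"
        using elim by (simp add: F_insert power_mult_distrib exp_double)
      then show ?case by (simp add: ennreal_mult mult.assoc)
    qed
  qed
  also have "\<dots> = (\<integral>\<^sup>+x. \<integral>\<^sup>+\<gamma>. ennreal (exp (2 * \<phi> x)) * (ennreal ((F \<gamma>)\<^sup>2) * f (x, insert x \<gamma>)) \<partial>M \<partial>?d)"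
    using nn_integral_fst[of "\<lambda>w. ennreal (exp (2 * \<phi> (fst w))) * (ennreal ((F (snd w))\<^sup>2) * f (fst w, insert (fst w) (snd w)))" ?d] m2
    by (simp add: measurable_cong_sets[OF sd refl])
  also have "\<dots> = (\<integral>\<^sup>+x. ennreal z * (\<integral>\<^sup>+\<gamma>. ennreal (exp (2 * \<phi> x)) * (ennreal ((F \<gamma>)\<^sup>2) * f (x, insert x \<gamma>)) \<partial>M) \<partial>lborel)"
    using borel_measurable_nn_integral_fst[OF m2] by (subst nn_integral_density) auto
  also have "\<dots> = (\<integral>\<^sup>+x. ennreal (w x) * (\<integral>\<^sup>+\<gamma>. f (x, insert x \<gamma>) \<partial>\<nu>) \<partial>lborel)"
  proof (rule nn_integral_cong)
    fix x :: 'a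
    have [measurable]: "(\<lambda>\<gamma>. f (x, insert x \<gamma>)) \<in> borel_measurable M" by measurable
    have "(\<integral>\<^sup>+\<gamma>. f (x, insert x \<gamma>) \<partial>\<nu>) = (\<integral>\<^sup>+\<gamma>. ennreal ((F \<gamma>)\<^sup>2) * f (x, insert x \<gamma>) \<partial>M)"
      unfolding \<nu>_def by (rule nn_integral_density) measurable
    moreover have "(\<integral>\<^sup>+\<gamma>. ennreal (exp (2 * \<phi> x)) * (ennreal ((F \<gamma>)\<^sup>2) * f (x, insert x \<gamma>)) \<partial>M) =
        ennreal (exp (2 * \<phi> x)) * (\<integral>\<^sup>+\<gamma>. ennreal ((F \<gamma>)\<^sup>2) * f (x, insert x \<gamma>) \<partial>M)"
      by (rule nn_integral_cmult) measurable
    ultimately show "ennreal z * (\<integral>\<^sup>+\<gamma>. ennreal (exp (2 * \<phi> x)) * (ennreal ((F \<gamma>)\<^sup>2) * f (x, insert x \<gamma>)) \<partial>M) =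
        ennreal (w x) * (\<integral>\<^sup>+\<gamma>. f (x, insert x \<gamma>) \<partial>\<nu>)"
      using z_pos by (simp add: w_def ennreal_mult mult.assoc)
  qed
  also have "\<dots> = (\<integral>\<^sup>+x. \<integral>\<^sup>+\<gamma>. f (x, insert x \<gamma>) \<partial>\<nu> \<partial>\<mu>)"
  proof -
    interpret N: finite_measure \<nu> by fact
    have sN: "sets (borel \<Otimes>\<^sub>M \<nu>) = sets (borel \<Otimes>\<^sub>M M)" by (intro sets_pair_measure_cong) (auto simp: \<nu>_def)
    have "(\<lambda>w. f (fst w, insert (fst w) (snd w))) \<in> borel_measurable (borel \<Otimes>\<^sub>M M)" by measurable
    then have "(\<lambda>w. f (fst w, insert (fst w) (snd w))) \<in> borel_measurable (borel \<Otimes>\<^sub>M \<nu>)"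
      using measurable_cong_sets[OF sN refl] by blast
    from N.borel_measurable_nn_integral_fst[OF this]
    show ?thesis unfolding \<mu>_def by (subst nn_integral_density) auto
  qed
  also have "\<dots> = (\<integral>\<^sup>+w. f (fst w, insert (fst w) (snd w)) \<partial>(\<mu> \<Otimes>\<^sub>M \<nu>))"
  proof -
    interpret N: finite_measure \<nu> by fact
    have "(\<lambda>w. f (fst w, insert (fst w) (snd w))) \<in> borel_measurable (borel \<Otimes>\<^sub>M M)" by measurable
    then have "(\<lambda>w. f (fst w, insert (fst w) (snd w))) \<in> borel_measurable (\<mu> \<Otimes>\<^sub>M \<nu>)"
      using measurable_cong_sets[OF s refl] by blast
    from N.nn_integral_fst[OF this] show ?thesis by simp
  qed
  finally show "(\<integral>\<^sup>+\<gamma>. \<integral>\<^sup>+x. f (x, \<gamma>) \<partial>count_space \<gamma> \<partial>\<nu>) = (\<integral>\<^sup>+(x, \<gamma>). f (x, insert x \<gamma>) \<partial>(\<mu> \<Otimes>\<^sub>M \<nu>))"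
    by (simp add: case_prod_beta')
qed

end

section \<open>Jump rates\<close>

lemma nn_integral_add2:
  assumes "sigma_finite_measure L"
    and f: "(\<lambda>w. f (fst w) (snd w)) \<in> borel_measurable (N \<Otimes>\<^sub>M L)"
    and g: "(\<lambda>w. g (fst w) (snd w)) \<in> borel_measurable (N \<Otimes>\<^sub>M L)"
  shows "(\<integral>\<^sup>+x. \<integral>\<^sup>+y. f x y + g x y \<partial>L \<partial>N) = (\<integral>\<^sup>+x. \<integral>\<^sup>+y. f x y \<partial>L \<partial>N) + (\<integral>\<^sup>+x. \<integral>\<^sup>+y. g x y \<partial>L \<partial>N)"
proof -
  interpret L: sigma_finite_measure L by fact
  show ?thesis
    using L.nn_integral_fst[OF f] L.nn_integral_fst[OF g] L.nn_integral_fst[OF borel_measurable_add[OF f g]]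
      nn_integral_add[OF f g] by simp
qed

lemma (in poisson_configuration) mm_density:
  "density lborel (\<lambda>_::'a. ennreal z) \<Otimes>\<^sub>M density lborel (\<lambda>_::'a. ennreal z) =
     density (lborel \<Otimes>\<^sub>M lborel) (\<lambda>_. ennreal (z * z))"
  using z_pos by (subst pair_measure_density)
    (auto simp: ennreal_mult case_prod_beta' intro!: sigma_finite_intensity sigma_finite_lborel)

abbreviation add_pair :: "'a set \<Rightarrow> 'a \<times> 'a \<Rightarrow> 'a set" where
  "add_pair \<gamma> X \<equiv> insert (fst X) (insert (snd X) \<gamma>)"

text \<open>
  Real-valued versions of the rates. Here \<open>kk X Y\<close> is the rate of a jump of the
  pair \<open>X\<close> to the pair \<open>Y\<close>; evenness of both functions makes it
  symmetric, which is the detailed balance condition.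
\<close>

locale jump_rates = poisson_configuration +
  fixes \<alpha> \<beta> :: "'a::euclidean_space \<Rightarrow> real" and b0 :: real
  assumes alpha_meas [measurable]: "\<alpha> \<in> borel_measurable borel"
    and beta_meas [measurable]: "\<beta> \<in> borel_measurable borel"
    and alpha_nonneg: "\<And>x. \<alpha> x \<ge> 0" and beta_nonneg: "\<And>x. \<beta> x \<ge> 0"
    and alpha_even: "\<And>x. \<alpha> (- x) = \<alpha> x" and beta_even: "\<And>x. \<beta> (- x) = \<beta> x"
    and alpha_int: "integrable lborel \<alpha>" and beta_int: "integrable lborel \<beta>"
    and beta_bound: "\<And>x. \<beta> x \<le> b0"
begin

abbreviation L where "L \<equiv> (lborel \<Otimes>\<^sub>M lborel :: ('a \<times> 'a) measure)"

definition A where "A = (\<integral>x. \<alpha> x \<partial>lborel)"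
definition B where "B = (\<integral>x. \<beta> x \<partial>lborel)"
definition q where "q x h1 h2 = \<alpha> h1 * \<alpha> h2 * (\<beta> x + \<beta> (x + h2 - h1))"
definition kk where "kk X Y = q (snd X - fst X) (fst Y - fst X) (snd Y - snd X)"

lemma A_nonneg: "A \<ge> 0" unfolding A_def by (intro integral_nonneg_AE) (simp add: alpha_nonneg)
lemma B_nonneg: "B \<ge> 0" unfolding B_def by (intro integral_nonneg_AE) (simp add: beta_nonneg)
lemma b0_nonneg: "b0 \<ge> 0" using beta_nonneg[of 0] beta_bound[of 0] by simp

lemma nn_A: "(\<integral>\<^sup>+x. ennreal (\<alpha> x) \<partial>lborel) = ennreal A"
  unfolding A_def using alpha_int alpha_nonneg by (intro nn_integral_eq_integral) auto
lemma nn_B: "(\<integral>\<^sup>+x. ennreal (\<beta> x) \<partial>lborel) = ennreal B"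
  unfolding B_def using beta_int beta_nonneg by (intro nn_integral_eq_integral) auto

lemma q_nonneg: "q x h1 h2 \<ge> 0" by (simp add: q_def alpha_nonneg beta_nonneg)
lemma kk_nonneg: "kk X Y \<ge> 0" by (simp add: kk_def q_nonneg)

lemma q_measurable [measurable (raw)]:
  assumes [measurable]: "f \<in> N \<rightarrow>\<^sub>M borel" "g \<in> N \<rightarrow>\<^sub>M borel" "h \<in> N \<rightarrow>\<^sub>M borel"
  shows "(\<lambda>w. q (f w) (g w) (h w)) \<in> borel_measurable N"
  unfolding q_def by measurable

lemma kk_eq: "kk X Y = \<alpha> (fst Y - fst X) * \<alpha> (snd Y - snd X) * (\<beta> (snd X - fst X) + \<beta> (snd Y - fst Y))"
  unfolding kk_def q_def by (simp add: algebra_simps)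

lemma kk_sym: "kk X Y = kk Y X"
  unfolding kk_eq using alpha_even[of "fst Y - fst X"] alpha_even[of "snd Y - snd X"] by (simp add: algebra_simps)

lemma kk_measurable [measurable (raw)]:
  assumes [measurable]: "f \<in> N \<rightarrow>\<^sub>M borel \<Otimes>\<^sub>M borel" "g \<in> N \<rightarrow>\<^sub>M borel \<Otimes>\<^sub>M borel"
  shows "(\<lambda>w. kk (f w) (g w)) \<in> borel_measurable N"
  unfolding kk_def by measurable

lemma q_swap: "q (- x) h2 h1 = q x h1 h2"
  using beta_even[of x] beta_even[of "x + h2 - h1"] by (simp add: q_def algebra_simps)

lemma nn_lborel_pair:
  assumes [measurable]: "f \<in> borel_measurable (borel \<Otimes>\<^sub>M borel)"
  shows "(\<integral>\<^sup>+p. f p \<partial>L) = (\<integral>\<^sup>+x. \<integral>\<^sup>+y. f (x::'a, y::'a) \<partial>lborel \<partial>lborel)"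
  by (subst lborel.nn_integral_fst[symmetric]) (simp_all cong: measurable_cong_sets)

lemma nn_lborel_pair_shift:
  assumes [measurable]: "f \<in> borel_measurable (borel \<Otimes>\<^sub>M borel)"
  shows "(\<integral>\<^sup>+h. f (h + X) \<partial>L) = (\<integral>\<^sup>+Y. f (Y :: 'a \<times> 'a) \<partial>L)"
  unfolding lborel_prod using assms by (intro nn_integral_shift) (simp add: borel_prod)

lemma nn_q_mass: "(\<integral>\<^sup>+h. ennreal (q x (fst h) (snd h)) \<partial>L) \<le> ennreal (2 * b0 * A * A)"
proof -
  have "(\<integral>\<^sup>+h. ennreal (q x (fst h) (snd h)) \<partial>L) \<le>
      (\<integral>\<^sup>+h. ennreal (2 * b0) * (ennreal (\<alpha> (fst h)) * ennreal (\<alpha> (snd h))) \<partial>L)"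
  proof (rule nn_integral_mono)
    fix h :: "'a \<times> 'a"
    have "q x (fst h) (snd h) \<le> \<alpha> (fst h) * \<alpha> (snd h) * (b0 + b0)"
      unfolding q_def by (intro mult_left_mono add_mono beta_bound) (simp add: alpha_nonneg)
    then show "ennreal (q x (fst h) (snd h)) \<le> ennreal (2 * b0) * (ennreal (\<alpha> (fst h)) * ennreal (\<alpha> (snd h)))"
      by (simp add: ennreal_mult[symmetric] alpha_nonneg b0_nonneg ennreal_leI algebra_simps)
  qed
  also have "\<dots> = ennreal (2 * b0) * (\<integral>\<^sup>+x. \<integral>\<^sup>+y. ennreal (\<alpha> x) * ennreal (\<alpha> y) \<partial>lborel \<partial>lborel)"
    by (subst nn_integral_cmult) (auto simp: nn_lborel_pair)
  also have "(\<integral>\<^sup>+x. \<integral>\<^sup>+y. ennreal (\<alpha> x) * ennreal (\<alpha> y) \<partial>lborel \<partial>lborel) = ennreal A * ennreal A"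
    by (simp add: nn_integral_cmult nn_integral_multc nn_A)
  finally show ?thesis using A_nonneg b0_nonneg by (simp add: ennreal_mult mult.assoc)
qed

lemma nn_kk_q:
  assumes [measurable]: "f \<in> borel_measurable (borel \<Otimes>\<^sub>M borel)"
  shows "(\<integral>\<^sup>+Y. ennreal (kk X Y) * f Y \<partial>L) =
    (\<integral>\<^sup>+h. ennreal (q (snd X - fst X) (fst h) (snd h)) * f (h + X) \<partial>L)"
  using nn_lborel_pair_shift[of "\<lambda>Y. ennreal (kk X Y) * f Y" X, symmetric] by (simp add: kk_def)

lemma nn_kk_mass: "(\<integral>\<^sup>+Y. ennreal (kk X Y) \<partial>L) \<le> ennreal (2 * b0 * A * A)"
  using nn_kk_q[of "\<lambda>_. 1" X] nn_q_mass[of "snd X - fst X"] by simp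

lemma nn_q_total: "(\<integral>\<^sup>+x. \<integral>\<^sup>+h. ennreal (q x (fst h) (snd h)) \<partial>L \<partial>lborel) = ennreal (2 * A * A * B)"
proof -
  have "(\<integral>\<^sup>+x. \<integral>\<^sup>+h. ennreal (q x (fst h) (snd h)) \<partial>L \<partial>lborel) =
      (\<integral>\<^sup>+h. \<integral>\<^sup>+x. ennreal (q x (fst h) (snd h)) \<partial>lborel \<partial>L)"
  proof -
    interpret P: pair_sigma_finite "lborel :: 'a measure" "lborel \<Otimes>\<^sub>M lborel :: ('a \<times> 'a) measure" ..
    show ?thesis by (rule P.Fubini'[symmetric]) measurable
  qed
  also have "\<dots> = (\<integral>\<^sup>+h. ennreal (2 * B) * (ennreal (\<alpha> (fst h)) * ennreal (\<alpha> (snd h))) \<partial>L)"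
  proof (rule nn_integral_cong)
    fix h :: "'a \<times> 'a"
    have "(\<integral>\<^sup>+x. ennreal (q x (fst h) (snd h)) \<partial>lborel) = ennreal (\<alpha> (fst h) * \<alpha> (snd h)) *
        ((\<integral>\<^sup>+x. ennreal (\<beta> x) \<partial>lborel) + (\<integral>\<^sup>+x. ennreal (\<beta> (x + (snd h - fst h))) \<partial>lborel))"
      by (simp add: q_def ennreal_mult alpha_nonneg beta_nonneg nn_integral_cmult nn_integral_add
          add_diff_eq flip: ennreal_plus)
         (simp add: ennreal_mult alpha_nonneg beta_nonneg nn_integral_cmult nn_integral_add)
    also have "(\<integral>\<^sup>+x. ennreal (\<beta> (x + (snd h - fst h))) \<partial>lborel) = (\<integral>\<^sup>+x. ennreal (\<beta> x) \<partial>lborel)"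
      by (rule nn_integral_shift[of "\<lambda>x. ennreal (\<beta> x)"]) measurable
    finally show "(\<integral>\<^sup>+x. ennreal (q x (fst h) (snd h)) \<partial>lborel) =
        ennreal (2 * B) * (ennreal (\<alpha> (fst h)) * ennreal (\<alpha> (snd h)))"
      using B_nonneg by (simp add: nn_B ennreal_mult[symmetric] alpha_nonneg mult_ac flip: ennreal_plus)
  qed
  also have "\<dots> = ennreal (2 * B) * (\<integral>\<^sup>+x. \<integral>\<^sup>+y. ennreal (\<alpha> x) * ennreal (\<alpha> y) \<partial>lborel \<partial>lborel)"
    by (subst nn_integral_cmult) (auto simp: nn_lborel_pair)
  also have "(\<integral>\<^sup>+x. \<integral>\<^sup>+y. ennreal (\<alpha> x) * ennreal (\<alpha> y) \<partial>lborel \<partial>lborel) = ennreal A * ennreal A"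
    by (simp add: nn_integral_cmult nn_integral_multc nn_A)
  finally show ?thesis using A_nonneg B_nonneg by (simp add: ennreal_mult[symmetric] mult_ac)
qed

lemma nn_kk_fst:
  assumes [measurable]: "f \<in> borel_measurable borel"
  shows "(\<integral>\<^sup>+X. \<integral>\<^sup>+Y. ennreal (kk X Y) * f (fst X) \<partial>L \<partial>L) =
    ennreal (2 * A * A * B) * (\<integral>\<^sup>+x. f x \<partial>lborel)"
proof -
  define Q where "Q x = (\<integral>\<^sup>+h. ennreal (q x (fst h) (snd h)) \<partial>L)" for x
  have [measurable]: "Q \<in> borel_measurable borel" unfolding Q_def by measurable
  have "(\<integral>\<^sup>+X. \<integral>\<^sup>+Y. ennreal (kk X Y) * f (fst X) \<partial>L \<partial>L) =
      (\<integral>\<^sup>+X. Q (snd X - fst X) * f (fst X) \<partial>L)"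
    by (intro nn_integral_cong) (simp add: nn_kk_q Q_def nn_integral_multc)
  also have "\<dots> = (\<integral>\<^sup>+x. \<integral>\<^sup>+y. Q (y + - x) * f x \<partial>lborel \<partial>lborel)"
    by (subst nn_lborel_pair) auto
  also have "\<dots> = (\<integral>\<^sup>+x. (\<integral>\<^sup>+y. Q y \<partial>lborel) * f x \<partial>lborel)"
  proof -
    have "(\<integral>\<^sup>+y. Q (y - x) \<partial>lborel) = (\<integral>\<^sup>+y. Q y \<partial>lborel)" for x
      using nn_integral_shift[of Q "- x"] by simp
    then show ?thesis by (simp add: nn_integral_multc)
  qed
  also have "\<dots> = (\<integral>\<^sup>+y. Q y \<partial>lborel) * (\<integral>\<^sup>+x. f x \<partial>lborel)" by (rule nn_integral_cmult) measurable
  finally show ?thesis unfolding Q_def nn_q_total .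
qed

lemma nn_kk_snd:
  assumes [measurable]: "f \<in> borel_measurable borel"
  shows "(\<integral>\<^sup>+X. \<integral>\<^sup>+Y. ennreal (kk X Y) * f (snd X) \<partial>L \<partial>L) =
    ennreal (2 * A * A * B) * (\<integral>\<^sup>+x. f x \<partial>lborel)"
proof -
  define Q where "Q x = (\<integral>\<^sup>+h. ennreal (q x (fst h) (snd h)) \<partial>L)" for x
  have [measurable]: "Q \<in> borel_measurable borel" unfolding Q_def by measurable
  have Qeven: "Q (- x) = Q x" for x
  proof -
    have "Q (- x) = (\<integral>\<^sup>+h1. \<integral>\<^sup>+h2. ennreal (q (- x) h1 h2) \<partial>lborel \<partial>lborel)" unfolding Q_def by (subst nn_lborel_pair) auto
    also have "\<dots> = (\<integral>\<^sup>+h1. \<integral>\<^sup>+h2. ennreal (q x h2 h1) \<partial>lborel \<partial>lborel)" by (simp add: q_swap)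
    also have "\<dots> = (\<integral>\<^sup>+h2. \<integral>\<^sup>+h1. ennreal (q x h2 h1) \<partial>lborel \<partial>lborel)"
      by (rule lborel_pair.Fubini') measurable
    also have "\<dots> = Q x" unfolding Q_def by (subst nn_lborel_pair) auto
    finally show ?thesis .
  qed
  have "(\<integral>\<^sup>+X. \<integral>\<^sup>+Y. ennreal (kk X Y) * f (snd X) \<partial>L \<partial>L) =
      (\<integral>\<^sup>+X. Q (snd X - fst X) * f (snd X) \<partial>L)"
    by (intro nn_integral_cong) (simp add: nn_kk_q Q_def nn_integral_multc)
  also have "\<dots> = (\<integral>\<^sup>+x. \<integral>\<^sup>+y. Q (y - x) * f y \<partial>lborel \<partial>lborel)"
    by (subst nn_lborel_pair) auto
  also have "\<dots> = (\<integral>\<^sup>+y. \<integral>\<^sup>+x. Q (y - x) * f y \<partial>lborel \<partial>lborel)"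
    by (rule lborel_pair.Fubini') measurable
  also have "\<dots> = (\<integral>\<^sup>+y. \<integral>\<^sup>+x. Q (x + - y) * f y \<partial>lborel \<partial>lborel)"
  proof -
    have "Q (y - x) = Q (x + - y)" for x y using Qeven[of "x - y"] by simp
    then show ?thesis by simp
  qed
  also have "\<dots> = (\<integral>\<^sup>+y. (\<integral>\<^sup>+x. Q x \<partial>lborel) * f y \<partial>lborel)"
  proof -
    have "(\<integral>\<^sup>+y. Q (y - x) \<partial>lborel) = (\<integral>\<^sup>+y. Q y \<partial>lborel)" for x
      using nn_integral_shift[of Q "- x"] by simp
    then show ?thesis by (simp add: nn_integral_multc)
  qed
  also have "\<dots> = (\<integral>\<^sup>+y. Q y \<partial>lborel) * (\<integral>\<^sup>+x. f x \<partial>lborel)" by (rule nn_integral_cmult) measurable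
  finally show ?thesis unfolding Q_def nn_q_total .
qed

lemma nn_kk_commute:
  assumes [measurable]: "f \<in> borel_measurable (borel \<Otimes>\<^sub>M borel)"
  shows "(\<integral>\<^sup>+X. \<integral>\<^sup>+Y. ennreal (kk X Y) * f Y \<partial>L \<partial>L) =
    (\<integral>\<^sup>+X. \<integral>\<^sup>+Y. ennreal (kk X Y) * f X \<partial>L \<partial>L)"
proof -
  interpret P: pair_sigma_finite "lborel \<Otimes>\<^sub>M lborel :: ('a \<times> 'a) measure" "lborel \<Otimes>\<^sub>M lborel :: ('a \<times> 'a) measure" ..
  have "(\<integral>\<^sup>+X. \<integral>\<^sup>+Y. ennreal (kk X Y) * f Y \<partial>L \<partial>L) =
      (\<integral>\<^sup>+Y. \<integral>\<^sup>+X. ennreal (kk X Y) * f Y \<partial>L \<partial>L)"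
    by (rule P.Fubini') measurable
  then show ?thesis by (simp add: kk_sym)
qed

text \<open>
  Jumps between pairs outside the window \<open>K\<close> do not change a functional that only
  sees \<open>K\<close>. Weighting by this function makes the total jump rate finite.
\<close>

definition hits :: "'a set \<Rightarrow> 'a \<times> 'a \<Rightarrow> 'a \<times> 'a \<Rightarrow> real" where
  "hits K X Y = indicator K (fst X) + indicator K (snd X) + indicator K (fst Y) + indicator K (snd Y)"

lemma hits_nonneg: "hits K X Y \<ge> 0" by (simp add: hits_def)

lemma nn_kk_hits:
  assumes K[measurable]: "K \<in> sets borel" and "bounded K"
  shows "(\<integral>\<^sup>+X. \<integral>\<^sup>+Y. ennreal (kk X Y * hits K X Y) \<partial>L \<partial>L) < \<infinity>"
proof -
  let ?L = "lborel \<Otimes>\<^sub>M lborel :: ('a \<times> 'a) measure"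
  let ?i = "indicator K :: 'a \<Rightarrow> ennreal"
  have "(\<integral>\<^sup>+X. \<integral>\<^sup>+Y. ennreal (kk X Y * hits K X Y) \<partial>?L \<partial>?L) =
      (\<integral>\<^sup>+X. \<integral>\<^sup>+Y. (ennreal (kk X Y) * ?i (fst X) + ennreal (kk X Y) * ?i (snd X))
         + (ennreal (kk X Y) * ?i (fst Y) + ennreal (kk X Y) * ?i (snd Y)) \<partial>?L \<partial>?L)"
    by (intro nn_integral_cong)
       (auto simp: hits_def indicator_def kk_nonneg distrib_left ennreal_plus[symmetric] simp del: ennreal_plus)
  also have "\<dots> = ((\<integral>\<^sup>+X. \<integral>\<^sup>+Y. ennreal (kk X Y) * ?i (fst X) \<partial>?L \<partial>?L) + (\<integral>\<^sup>+X. \<integral>\<^sup>+Y. ennreal (kk X Y) * ?i (snd X) \<partial>?L \<partial>?L))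
     + ((\<integral>\<^sup>+X. \<integral>\<^sup>+Y. ennreal (kk X Y) * ?i (fst Y) \<partial>?L \<partial>?L) + (\<integral>\<^sup>+X. \<integral>\<^sup>+Y. ennreal (kk X Y) * ?i (snd Y) \<partial>?L \<partial>?L))"
  proof -
    have m: "(\<lambda>w. ennreal (kk (fst w) (snd w)) * ?i (fst (fst w))) \<in> borel_measurable (?L \<Otimes>\<^sub>M ?L)"
      "(\<lambda>w. ennreal (kk (fst w) (snd w)) * ?i (snd (fst w))) \<in> borel_measurable (?L \<Otimes>\<^sub>M ?L)"
      "(\<lambda>w. ennreal (kk (fst w) (snd w)) * ?i (fst (snd w))) \<in> borel_measurable (?L \<Otimes>\<^sub>M ?L)"
      "(\<lambda>w. ennreal (kk (fst w) (snd w)) * ?i (snd (snd w))) \<in> borel_measurable (?L \<Otimes>\<^sub>M ?L)"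
      by measurable
    have sf: "sigma_finite_measure ?L" unfolding lborel_prod by (rule sigma_finite_lborel)
    note add = nn_integral_add2[OF sf]
    show ?thesis
      by (subst add) (use m borel_measurable_add[OF m(1,2)] borel_measurable_add[OF m(3,4)] add[OF m(1,2)] add[OF m(3,4)] in auto)
  qed
  also have "\<dots> < \<infinity>"
    using nn_kk_commute[of "\<lambda>Y. ?i (fst Y)"] nn_kk_commute[of "\<lambda>Y. ?i (snd Y)"] emeasure_bounded[OF assms(2)]
    by (simp add: nn_kk_fst nn_kk_snd ennreal_mult_less_top)
  finally show ?thesis .
qed

end

section \<open>The jump operator and its Dirichlet form\<close>

lemma cylinder_measurable:
  assumes "v \<in> cylinder_functions"
  shows "v \<in> borel_measurable configuration_borel"
proof -
  obtain N :: nat and \<phi> and g :: "(nat \<Rightarrow> real) \<Rightarrow> real" where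
    phi: "\<And>i. i < N \<Longrightarrow> \<phi> i \<in> continuous_compact_support" and
    g: "continuous_map (product_topology (\<lambda>_. euclideanreal) {..<N}) euclideanreal g" and
    v: "v = (\<lambda>\<gamma>. g (\<lambda>i\<in>{..<N}. pairing (\<phi> i) \<gamma>))"
    using assms unfolding cylinder_functions_def by auto
  have "continuous_map euclidean (product_topology (\<lambda>_. euclideanreal) {..<N}) (\<lambda>y :: nat \<Rightarrow> real. restrict y {..<N})"
    unfolding continuous_map_componentwise euclidean_product_topology
    by (auto simp: restrict_def extensional_def intro!: continuous_map_product_projection)
  from continuous_map_compose[OF this g] have "continuous_on UNIV (\<lambda>y. g (restrict y {..<N}))"
    by (simp add: o_def)
  then have gm: "(\<lambda>y. g (restrict y {..<N})) \<in> borel_measurable borel" by (rule borel_measurable_continuous_onI)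
  have "(\<lambda>\<gamma>. \<lambda>i. if i < N then pairing (\<phi> i) \<gamma> else 0) \<in> borel_measurable configuration_borel"
  proof (rule measurable_coordinatewise_then_product)
    show "(\<lambda>\<gamma>. if i < N then pairing (\<phi> i) \<gamma> else 0) \<in> borel_measurable configuration_borel" for i
      using pairing_measurable[OF phi] by (cases "i < N") auto
  qed
  from measurable_compose[OF this gm]
  have "(\<lambda>\<gamma>. g (restrict (\<lambda>i. if i < N then pairing (\<phi> i) \<gamma> else 0) {..<N})) \<in> borel_measurable configuration_borel" .
  moreover have "(\<lambda>i\<in>{..<N}. if i < N then pairing (\<phi> i) \<gamma> else 0) = (\<lambda>i\<in>{..<N}. pairing (\<phi> i) \<gamma>)" for \<gamma>
    by (auto simp: restrict_def)
  ultimately show ?thesis by (simp add: v)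
qed

text \<open>
  Local functionals of at most exponential growth in the number of points. This class contains
  the cylinder functions and \<open>F\<close>, so the Dirichlet form identity covers both.
\<close>

definition tame_on :: "'a::euclidean_space set \<Rightarrow> real \<Rightarrow> real \<Rightarrow> ('a set \<Rightarrow> real) \<Rightarrow> bool" where
  "tame_on K C r u \<longleftrightarrow> K \<in> sets borel \<and> bounded K \<and> C \<ge> 0 \<and> r \<ge> 0 \<and> u \<in> borel_measurable configuration_borel \<and>
     (\<forall>\<gamma>\<in>configurations. u (\<gamma> \<inter> K) = u \<gamma> \<and> \<bar>u \<gamma>\<bar> \<le> C * exp (r * real (card (\<gamma> \<inter> K))))"

lemma tame_on_mono:
  assumes u: "tame_on K C r u" and K': "K \<subseteq> K'" "K' \<in> sets borel" "bounded K'" and "C \<le> C'" "r \<le> r'"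
  shows "tame_on K' C' r' u"
  unfolding tame_on_def
proof (intro conjI ballI)
  fix \<gamma> :: "'a set" assume g: "\<gamma> \<in> configurations"
  have "u (\<gamma> \<inter> K') = u ((\<gamma> \<inter> K') \<inter> K)"
    using u configuration_subset[OF g, of "\<gamma> \<inter> K'"] by (auto simp: tame_on_def)
  also have "(\<gamma> \<inter> K') \<inter> K = \<gamma> \<inter> K" using K' by blast
  finally show "u (\<gamma> \<inter> K') = u \<gamma>" using u g by (auto simp: tame_on_def)
  have "card (\<gamma> \<inter> K) \<le> card (\<gamma> \<inter> K')"
    using K' finite_configuration_bounded[OF g K'(3)] by (intro card_mono) auto
  then have "r * real (card (\<gamma> \<inter> K)) \<le> r' * real (card (\<gamma> \<inter> K'))"
    using assms by (intro mult_mono) (auto simp: tame_on_def)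
  then have "C * exp (r * real (card (\<gamma> \<inter> K))) \<le> C' * exp (r' * real (card (\<gamma> \<inter> K')))"
    using assms by (intro mult_mono) (auto simp: tame_on_def)
  moreover have "\<bar>u \<gamma>\<bar> \<le> C * exp (r * real (card (\<gamma> \<inter> K)))" using u g by (auto simp: tame_on_def)
  ultimately show "\<bar>u \<gamma>\<bar> \<le> C' * exp (r' * real (card (\<gamma> \<inter> K')))" by simp
qed (use assms in \<open>auto simp: tame_on_def\<close>)

lemma tame_on_common:
  assumes u: "tame_on K C r u" and v: "tame_on K' C' r' v"
  obtains K'' C'' r'' where "tame_on K'' C'' r'' u" "tame_on K'' C'' r'' v"
proof (rule that)
  have *: "K \<in> sets borel" "bounded K" "K' \<in> sets borel" "bounded K'" using u v by (auto simp: tame_on_def)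
  show "tame_on (K \<union> K') (max C C') (max r r') u" by (rule tame_on_mono[OF u]) (use * in auto)
  show "tame_on (K \<union> K') (max C C') (max r r') v" by (rule tame_on_mono[OF v]) (use * in auto)
qed

lemma cylinder_tame:
  assumes "v \<in> cylinder_functions"
  obtains K C where "tame_on K C 0 v"
proof -
  obtain N :: nat and \<phi> and g :: "(nat \<Rightarrow> real) \<Rightarrow> real" where
    phi: "\<And>i. i < N \<Longrightarrow> \<phi> i \<in> continuous_compact_support" and
    bdd: "bounded (g ` ({..<N} \<rightarrow>\<^sub>E UNIV))" and
    v: "v = (\<lambda>\<gamma>. g (\<lambda>i\<in>{..<N}. pairing (\<phi> i) \<gamma>))"
    using assms unfolding cylinder_functions_def by auto
  obtain C where C: "\<And>y. y \<in> {..<N} \<rightarrow>\<^sub>E UNIV \<Longrightarrow> \<bar>g y\<bar> \<le> C"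
    using bdd by (auto simp: bounded_iff)
  have Cv: "\<bar>v \<gamma>\<bar> \<le> C" for \<gamma> unfolding v by (rule C) auto
  have "\<forall>i\<in>{..<N}. \<exists>n::nat. \<forall>x. x \<notin> ball 0 (real n) \<longrightarrow> \<phi> i x = 0"
  proof
    fix i assume "i \<in> {..<N}"
    then have "\<phi> i \<in> continuous_compact_support" using phi by auto
    from compact_support_ball[OF this] show "\<exists>n::nat. \<forall>x. x \<notin> ball 0 (real n) \<longrightarrow> \<phi> i x = 0" by blast
  qed
  then obtain n where n: "\<And>i x. i < N \<Longrightarrow> x \<notin> ball 0 (real (n i)) \<Longrightarrow> \<phi> i x = 0" by (metis lessThan_iff)
  define m where "m = Max (insert 0 (n ` {..<N}))"
  have "n i \<le> m" if "i < N" for i unfolding m_def using that by (intro Max_ge) auto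
  then have m: "\<phi> i x = 0" if "i < N" "x \<notin> ball 0 (real m)" for i x
    using n[OF that(1), of x] that by (auto simp: not_less) (meson of_nat_le_iff order_trans)
  let ?K = "ball (0::'a) (real m)"
  have "v (\<gamma> \<inter> ?K) = v \<gamma>" if g: "\<gamma> \<in> configurations" for \<gamma>
  proof -
    have "pairing (\<phi> i) (\<gamma> \<inter> ?K) = pairing (\<phi> i) \<gamma>" if i: "i < N" for i
      using pairing_eq_sum[of "\<gamma> \<inter> ?K" ?K "\<phi> i"] pairing_eq_sum[of \<gamma> ?K "\<phi> i"]
        configuration_subset[OF g, of "\<gamma> \<inter> ?K"] g m[OF i] by (simp add: Int_assoc)
    then have "(\<lambda>i\<in>{..<N}. pairing (\<phi> i) (\<gamma> \<inter> ?K)) = (\<lambda>i\<in>{..<N}. pairing (\<phi> i) \<gamma>)"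
      by (auto simp: restrict_def)
    then show ?thesis by (simp add: v)
  qed
  moreover have "C \<ge> 0" using Cv[of "{}"] by linarith
  ultimately have "tame_on ?K C 0 v"
    using cylinder_measurable[OF assms] Cv by (auto simp: tame_on_def)
  then show ?thesis by (rule that)
qed

context jump_rates
begin

lemma sets_LL [measurable_cong]: "sets L = sets (borel \<Otimes>\<^sub>M borel)"
  by (intro sets_pair_measure_cong) auto

lemma sigma_finite_L: "sigma_finite_measure L" unfolding lborel_prod by (rule sigma_finite_lborel)

sublocale LL: pair_sigma_finite L L
  by (intro pair_sigma_finite.intro sigma_finite_L)

definition J where "J v p \<gamma> = (\<integral>h1. (\<integral>h2. q (snd p - fst p) h1 h2 *
   (v (\<gamma> - {fst p, snd p} \<union> {fst p + h1, snd p + h2}) - v \<gamma>) \<partial>lborel) \<partial>lborel)"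
definition Lop where "Lop v \<gamma> = 1/2 * (\<integral>p. J v p \<gamma> \<partial>count_space (offdiag \<gamma>))"

lemma move_eq: "\<gamma> - {x, y} \<union> {a, b} = insert a (insert b ((\<gamma> - {x}) - {y}))" by auto

lemma measurable_move [measurable (raw)]:
  assumes "g \<in> N \<rightarrow>\<^sub>M CB" "f1 \<in> N \<rightarrow>\<^sub>M borel" "f2 \<in> N \<rightarrow>\<^sub>M borel" "f3 \<in> N \<rightarrow>\<^sub>M borel" "f4 \<in> N \<rightarrow>\<^sub>M borel"
  shows "(\<lambda>w. g w - {f1 w, f2 w} \<union> {f3 w, f4 w}) \<in> N \<rightarrow>\<^sub>M CB"
  unfolding move_eq using assms by (intro measurable_insert_configuration measurable_remove_configuration)

lemma measurable_insert_CB [measurable (raw)]: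
  "g \<in> N \<rightarrow>\<^sub>M CB \<Longrightarrow> h \<in> N \<rightarrow>\<^sub>M borel \<Longrightarrow> (\<lambda>w. insert (h w) (g w)) \<in> N \<rightarrow>\<^sub>M CB"
  by (rule measurable_insert_configuration)

lemma J_measurable:
  assumes [measurable]: "v \<in> borel_measurable CB"
  shows "(\<lambda>w. J v (fst w) (snd w)) \<in> borel_measurable ((borel \<Otimes>\<^sub>M borel) \<Otimes>\<^sub>M CB)"
  unfolding J_def by measurable

lemma Lop_measurable:
  assumes [measurable]: "v \<in> borel_measurable CB"
  shows "Lop v \<in> borel_measurable CB"
proof -
  have 1: "(\<lambda>\<gamma>::'a set. \<gamma>) \<in> CB \<rightarrow>\<^sub>M CB" by measurable
  have "(\<lambda>(\<gamma>, p). J v p \<gamma>) \<in> borel_measurable (CB \<Otimes>\<^sub>M (borel \<Otimes>\<^sub>M borel))"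
    using measurable_compose[OF measurable_pair_swap' J_measurable[OF assms]] by (simp add: case_prod_beta')
  from measurable_real_sum_offdiag[OF 1 this] show ?thesis unfolding Lop_def[abs_def] by measurable
qed

lemma q_integrable: "integrable L (\<lambda>h. q x (fst h) (snd h))" "(\<integral>h. q x (fst h) (snd h) \<partial>L) \<le> 2 * b0 * A * A" (is ?P)
proof -
  have b: "0 \<le> 2 * b0 * A * A" using b0_nonneg A_nonneg by simp
  have m: "(\<lambda>h. q x (fst h) (snd h)) \<in> borel_measurable L" by measurable
  show i: "integrable L (\<lambda>h. q x (fst h) (snd h))"
    using nn_q_mass[of x] by (intro integrableI_bounded m) (simp add: q_nonneg, metis ennreal_less_top order_le_less_trans)
  show ?P
    using nn_q_mass[of x] b i by (subst (asm) nn_integral_eq_integral) (auto simp: q_nonneg)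
qed

lemma kk_integrable: "integrable L (\<lambda>Y. kk X Y)" "(\<integral>Y. kk X Y \<partial>L) \<le> 2 * b0 * A * A" (is ?P)
proof -
  have b: "0 \<le> 2 * b0 * A * A" using b0_nonneg A_nonneg by simp
  have m: "(\<lambda>Y. kk X Y) \<in> borel_measurable L" unfolding kk_def by measurable
  show i: "integrable L (\<lambda>Y. kk X Y)"
    using nn_kk_mass[of X] by (intro integrableI_bounded m) (simp add: kk_nonneg, metis ennreal_less_top order_le_less_trans)
  show ?P
    using nn_kk_mass[of X] b i by (subst (asm) nn_integral_eq_integral) (auto simp: kk_nonneg)
qed

lemma integral_L_shift:
  fixes f :: "'a \<times> 'a \<Rightarrow> real"
  assumes "f \<in> borel_measurable (borel \<Otimes>\<^sub>M borel)"
  shows "(\<integral>h. f (h + X) \<partial>L) = (\<integral>Y. f Y \<partial>L)"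
  unfolding lborel_prod using assms by (intro integral_shift) (simp add: borel_prod)

lemma kk_integral_q:
  fixes f :: "'a \<times> 'a \<Rightarrow> real"
  assumes [measurable]: "f \<in> borel_measurable (borel \<Otimes>\<^sub>M borel)"
  shows "(\<integral>h. q (snd X - fst X) (fst h) (snd h) * f (h + X) \<partial>L) = (\<integral>Y. kk X Y * f Y \<partial>L)"
  using integral_L_shift[of "\<lambda>Y. kk X Y * f Y" X] by (simp add: kk_def)

text \<open>
  The bound for a functional that is tame on \<open>K\<close>, after two more points have been
  added.
\<close>

definition bnd :: "'a set \<Rightarrow> real \<Rightarrow> real \<Rightarrow> 'a set \<Rightarrow> real" where
  "bnd K C r \<gamma> = C * exp (r * (real (card (\<gamma> \<inter> K)) + 2))"

lemma card_add_pair_le: "\<gamma> \<in> configurations \<Longrightarrow> bounded K \<Longrightarrow> card (insert a (insert b \<gamma>) \<inter> K) \<le> card (\<gamma> \<inter> K) + 2"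
proof -
  assume g: "\<gamma> \<in> configurations" "bounded K"
  have "card (insert a (insert b \<gamma>) \<inter> K) \<le> card (insert a (insert b (\<gamma> \<inter> K)))"
    using finite_configuration_bounded[OF g] by (intro card_mono) auto
  also have "\<dots> \<le> card (\<gamma> \<inter> K) + 2"
    using finite_configuration_bounded[OF g] by (simp add: card_insert_if)
  finally show ?thesis .
qed

lemma tame_bound:
  assumes v: "tame_on K C r v" and g: "\<gamma> \<in> configurations"
  shows "\<bar>v (insert a (insert b \<gamma>))\<bar> \<le> bnd K C r \<gamma>"
proof -
  have c: "insert a (insert b \<gamma>) \<in> configurations" by (intro configuration_insert g)
  have "real (card (insert a (insert b \<gamma>) \<inter> K)) \<le> real (card (\<gamma> \<inter> K)) + 2"
    using card_add_pair_le[OF g, of K a b] v by (simp add: tame_on_def)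
  then have "r * real (card (insert a (insert b \<gamma>) \<inter> K)) \<le> r * (real (card (\<gamma> \<inter> K)) + 2)"
    using v by (intro mult_left_mono) (auto simp: tame_on_def)
  then have "C * exp (r * real (card (insert a (insert b \<gamma>) \<inter> K))) \<le> bnd K C r \<gamma>"
    unfolding bnd_def using v by (intro mult_left_mono) (auto simp: tame_on_def)
  moreover have "\<bar>v (insert a (insert b \<gamma>))\<bar> \<le> C * exp (r * real (card (insert a (insert b \<gamma>) \<inter> K)))"
    using v c by (auto simp: tame_on_def)
  ultimately show ?thesis by simp
qed

lemma bnd_nonneg: "tame_on K C r v \<Longrightarrow> bnd K C r \<gamma> \<ge> 0" by (simp add: bnd_def tame_on_def)

lemma tame_bound0:
  assumes v: "tame_on K C r v" and g: "\<gamma> \<in> configurations"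
  shows "\<bar>v \<gamma>\<bar> \<le> bnd K C r \<gamma>"
proof -
  have "\<bar>v \<gamma>\<bar> \<le> C * exp (r * real (card (\<gamma> \<inter> K)))" using v g by (auto simp: tame_on_def)
  also have "\<dots> \<le> bnd K C r \<gamma>"
    unfolding bnd_def using v by (intro mult_left_mono) (auto simp: tame_on_def intro!: mult_left_mono)
  finally show ?thesis .
qed

lemma hits_eq_0: "hits K X Y = 0 \<Longrightarrow> fst X \<notin> K \<and> snd X \<notin> K \<and> fst Y \<notin> K \<and> snd Y \<notin> K"
  by (auto simp: hits_def indicator_def of_bool_def split: if_splits)

lemma hits_ge_1: "hits K X Y \<noteq> 0 \<Longrightarrow> hits K X Y \<ge> 1"
  by (auto simp: hits_def indicator_def split: if_splits)

lemma tame_diff: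
  assumes v: "tame_on K C r v" and g: "\<gamma> \<in> configurations"
  shows "\<bar>v (add_pair \<gamma> Y) - v (add_pair \<gamma> X)\<bar> \<le> 2 * bnd K C r \<gamma> * hits K X Y"
proof (cases "hits K X Y = 0")
  case True
  have "v (add_pair \<gamma> Y) = v (add_pair \<gamma> Y \<inter> K)" "v (add_pair \<gamma> X) = v (add_pair \<gamma> X \<inter> K)"
    using v configuration_insert[OF configuration_insert[OF g]] by (auto simp: tame_on_def)
  moreover have "add_pair \<gamma> Y \<inter> K = \<gamma> \<inter> K" "add_pair \<gamma> X \<inter> K = \<gamma> \<inter> K" using hits_eq_0[OF True] by auto
  ultimately show ?thesis using True by simp
next
  case False
  have "\<bar>v (add_pair \<gamma> Y) - v (add_pair \<gamma> X)\<bar> \<le> 2 * bnd K C r \<gamma> * 1"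
    using tame_bound[OF v g, of "fst Y" "snd Y"] tame_bound[OF v g, of "fst X" "snd X"] by linarith
  also have "\<dots> \<le> 2 * bnd K C r \<gamma> * hits K X Y"
    using hits_ge_1[OF False] bnd_nonneg[OF v, of \<gamma>] by (intro mult_left_mono) auto
  finally show ?thesis .
qed

lemma J_eq:
  assumes v: "tame_on K C r v" and g: "\<gamma> \<in> configurations"
  shows "J v p \<gamma> = (\<integral>h. q (snd p - fst p) (fst h) (snd h) *
   (v (\<gamma> - {fst p, snd p} \<union> {fst p + fst h, snd p + snd h}) - v \<gamma>) \<partial>L)"
    and "integrable L (\<lambda>h. q (snd p - fst p) (fst h) (snd h) *
   (v (\<gamma> - {fst p, snd p} \<union> {fst p + fst h, snd p + snd h}) - v \<gamma>))"
proof -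
  let ?f = "\<lambda>h. q (snd p - fst p) (fst h) (snd h) *
   (v (\<gamma> - {fst p, snd p} \<union> {fst p + fst h, snd p + snd h}) - v \<gamma>)"
  have [measurable]: "v \<in> borel_measurable CB" using v by (simp add: tame_on_def)
  have [measurable]: "(\<lambda>h. v (\<gamma> - {fst p, snd p} \<union> {fst p + fst h, snd p + snd h})) \<in> borel_measurable (borel \<Otimes>\<^sub>M borel)"
  proof -
    have "(\<lambda>h :: 'a \<times> 'a. \<gamma> - {fst p, snd p} \<union> {fst p + fst h, snd p + snd h}) \<in> borel \<Otimes>\<^sub>M borel \<rightarrow>\<^sub>M CB"
      using g by (intro measurable_move) auto
    from measurable_compose[OF this, of v] show ?thesis by simp
  qed
  let ?D = "2 * bnd K C r \<gamma>"
  have gsub: "\<gamma> - {fst p, snd p} \<in> configurations" by (rule configuration_subset[OF g]) auto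
  have bsub: "bnd K C r (\<gamma> - {fst p, snd p}) \<le> bnd K C r \<gamma>"
  proof -
    have "card ((\<gamma> - {fst p, snd p}) \<inter> K) \<le> card (\<gamma> \<inter> K)"
      using finite_configuration_bounded[OF g, of K] v by (intro card_mono) (auto simp: tame_on_def)
    then show ?thesis unfolding bnd_def using v by (intro mult_left_mono) (auto simp: tame_on_def intro!: mult_left_mono)
  qed
  have bd: "\<bar>?f h\<bar> \<le> ?D * q (snd p - fst p) (fst h) (snd h)" for h
  proof -
    have "\<bar>v (\<gamma> - {fst p, snd p} \<union> {fst p + fst h, snd p + snd h})\<bar> \<le> bnd K C r \<gamma>"
      using tame_bound[OF v gsub, of "fst p + fst h" "snd p + snd h"] bsub by simp
    then have "\<bar>v (\<gamma> - {fst p, snd p} \<union> {fst p + fst h, snd p + snd h}) - v \<gamma>\<bar> \<le> ?D"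
      using tame_bound0[OF v g] by linarith
    from mult_left_mono[OF this q_nonneg[of "snd p - fst p" "fst h" "snd h"]]
    show ?thesis unfolding abs_mult abs_of_nonneg[OF q_nonneg] by (simp only: mult.commute)
  qed
  show i: "integrable L ?f"
  proof (rule Bochner_Integration.integrable_bound)
    show "integrable L (\<lambda>h. ?D * q (snd p - fst p) (fst h) (snd h))"
      using q_integrable(1) by (rule integrable_mult_right)
    show "AE h in L. norm (?f h) \<le> norm (?D * q (snd p - fst p) (fst h) (snd h))"
      by (rule AE_I2) (simp only: real_norm_def, rule order_trans[OF bd abs_ge_self])
  qed measurable
  show "J v p \<gamma> = (\<integral>h. ?f h \<partial>L)"
    using lborel_pair.integral_fst'[OF i] by (simp add: J_def)
qed

lemma J_add_pair:
  assumes v: "tame_on K C r v" and g: "\<gamma> \<in> configurations"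
    and new: "fst X \<notin> \<gamma>" "snd X \<notin> \<gamma>"
  shows "J v X (add_pair \<gamma> X) = (\<integral>Y. kk X Y * (v (add_pair \<gamma> Y) - v (add_pair \<gamma> X)) \<partial>L)"
proof -
  have [measurable]: "v \<in> borel_measurable CB" using v by (simp add: tame_on_def)
  have c: "add_pair \<gamma> X \<in> configurations" by (intro configuration_insert g)
  have e: "add_pair \<gamma> X - {fst X, snd X} = \<gamma>" using new by auto
  have "(\<lambda>Y :: 'a \<times> 'a. add_pair \<gamma> Y) \<in> borel \<Otimes>\<^sub>M borel \<rightarrow>\<^sub>M CB"
    using g by (intro measurable_insert_configuration) auto
  from measurable_compose[OF this, of v]
  have [measurable]: "(\<lambda>Y. v (add_pair \<gamma> Y)) \<in> borel_measurable (borel \<Otimes>\<^sub>M borel)" by simp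
  have "J v X (add_pair \<gamma> X) = (\<integral>h. q (snd X - fst X) (fst h) (snd h) *
     (v (add_pair \<gamma> (h + X)) - v (add_pair \<gamma> X)) \<partial>L)"
    unfolding J_eq(1)[OF v c] e by (simp add: add.commute insert_commute)
  also have "\<dots> = (\<integral>Y. kk X Y * (v (add_pair \<gamma> Y) - v (add_pair \<gamma> X)) \<partial>L)"
    by (rule kk_integral_q) measurable
  finally show ?thesis .
qed

definition \<kappa> where "\<kappa> K = (\<integral>w. kk (fst w) (snd w) * hits K (fst w) (snd w) \<partial>(L \<Otimes>\<^sub>M L))"

lemma hits_measurable [measurable (raw)]:
  assumes [measurable]: "K \<in> sets borel" "f \<in> N \<rightarrow>\<^sub>M borel \<Otimes>\<^sub>M borel" "g \<in> N \<rightarrow>\<^sub>M borel \<Otimes>\<^sub>M borel"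
  shows "(\<lambda>w. hits K (f w) (g w)) \<in> borel_measurable N"
  unfolding hits_def by measurable

lemma kk_hits_integrable:
  assumes K[measurable]: "K \<in> sets borel" and "bounded K"
  shows "integrable (L \<Otimes>\<^sub>M L) (\<lambda>w. kk (fst w) (snd w) * hits K (fst w) (snd w))"
proof (rule integrableI_bounded)
  have m: "(\<lambda>w. ennreal (kk (fst w) (snd w) * hits K (fst w) (snd w))) \<in> borel_measurable (L \<Otimes>\<^sub>M L)" by measurable
  show "(\<integral>\<^sup>+w. ennreal (norm (kk (fst w) (snd w) * hits K (fst w) (snd w))) \<partial>(L \<Otimes>\<^sub>M L)) < \<infinity>"
    using nn_kk_hits[OF assms] sigma_finite_measure.nn_integral_fst[OF sigma_finite_L m]
    by (simp add: kk_nonneg hits_nonneg)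
qed measurable

lemma \<kappa>_nonneg: "\<kappa> K \<ge> 0" unfolding \<kappa>_def by (intro integral_nonneg_AE) (simp add: kk_nonneg hits_nonneg)

lemma measurable_add_pair [measurable (raw)]:
  assumes "g \<in> N \<rightarrow>\<^sub>M CB" and [measurable]: "f \<in> N \<rightarrow>\<^sub>M borel \<Otimes>\<^sub>M borel"
  shows "(\<lambda>w. add_pair (g w) (f w)) \<in> N \<rightarrow>\<^sub>M CB"
  by (intro measurable_insert_configuration assms(1)) measurable

lemma form_integrable:
  assumes g: "\<gamma> \<in> configurations" and K: "K \<in> sets borel" "bounded K"
    and [measurable]: "f \<in> borel_measurable (L \<Otimes>\<^sub>M L)"
    and bd: "\<And>w. \<bar>f w\<bar> \<le> D * hits K (fst w) (snd w)"
  shows "integrable (L \<Otimes>\<^sub>M L) (\<lambda>w. kk (fst w) (snd w) * f w)"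
    and "\<bar>\<integral>w. kk (fst w) (snd w) * f w \<partial>(L \<Otimes>\<^sub>M L)\<bar> \<le> D * \<kappa> K" (is ?P)
proof -
  have b: "\<bar>kk (fst w) (snd w) * f w\<bar> \<le> D * (kk (fst w) (snd w) * hits K (fst w) (snd w))" for w
    using mult_left_mono[OF bd[of w] kk_nonneg[of "fst w" "snd w"]] by (simp add: abs_mult kk_nonneg mult.left_commute)
  have i: "integrable (L \<Otimes>\<^sub>M L) (\<lambda>w. D * (kk (fst w) (snd w) * hits K (fst w) (snd w)))"
    using kk_hits_integrable[OF K] by (rule integrable_mult_right)
  show i2: "integrable (L \<Otimes>\<^sub>M L) (\<lambda>w. kk (fst w) (snd w) * f w)"
    by (rule Bochner_Integration.integrable_bound[OF i])
       (measurable, rule AE_I2, simp only: real_norm_def, rule order_trans[OF b abs_ge_self])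
  have "\<bar>\<integral>w. kk (fst w) (snd w) * f w \<partial>(L \<Otimes>\<^sub>M L)\<bar> \<le> (\<integral>w. \<bar>kk (fst w) (snd w) * f w\<bar> \<partial>(L \<Otimes>\<^sub>M L))"
    using integral_norm_bound[of "L \<Otimes>\<^sub>M L" "\<lambda>w. kk (fst w) (snd w) * f w"] by simp
  also have "\<dots> \<le> (\<integral>w. D * (kk (fst w) (snd w) * hits K (fst w) (snd w)) \<partial>(L \<Otimes>\<^sub>M L))"
    using b i i2 by (intro integral_mono) auto
  also have "\<dots> = D * \<kappa> K" by (simp add: \<kappa>_def)
  finally show ?P .
qed

definition form where "form u v \<gamma> = (\<integral>w. kk (fst w) (snd w) *
   ((u (add_pair \<gamma> (snd w)) - u (add_pair \<gamma> (fst w))) * (v (add_pair \<gamma> (snd w)) - v (add_pair \<gamma> (fst w)))) \<partial>(L \<Otimes>\<^sub>M L))"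

lemma measurable_fixed_conf:
  assumes "\<gamma> \<in> configurations" "v \<in> borel_measurable CB"
  shows "(\<lambda>Y. v (add_pair \<gamma> Y)) \<in> borel_measurable (borel \<Otimes>\<^sub>M borel)"
  using measurable_compose[OF measurable_add_pair[of "\<lambda>_. \<gamma>" _ "\<lambda>Y. Y"] assms(2)] assms(1) by simp

text \<open>
  Exchanging \<open>X\<close> and \<open>Y\<close> and averaging, by symmetry of
  \<open>kk\<close>.
\<close>

lemma half_form:
  assumes u: "tame_on K C r u" and v: "tame_on K C r v" and g: "\<gamma> \<in> configurations"
  shows "integrable (L \<Otimes>\<^sub>M L) (\<lambda>w. kk (fst w) (snd w) *
      (u (add_pair \<gamma> (fst w)) * (v (add_pair \<gamma> (snd w)) - v (add_pair \<gamma> (fst w)))))"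
    and "(\<integral>w. kk (fst w) (snd w) *
      (u (add_pair \<gamma> (fst w)) * (v (add_pair \<gamma> (snd w)) - v (add_pair \<gamma> (fst w)))) \<partial>(L \<Otimes>\<^sub>M L)) = - (1/2) * form u v \<gamma>"
proof -
  have K: "K \<in> sets borel" "bounded K" using u by (auto simp: tame_on_def)
  have [measurable]: "u \<in> borel_measurable CB" "v \<in> borel_measurable CB" using u v by (auto simp: tame_on_def)
  note [measurable] = measurable_fixed_conf[OF g, of u] measurable_fixed_conf[OF g, of v]
  let ?f = "\<lambda>w. u (add_pair \<gamma> (fst w)) * (v (add_pair \<gamma> (snd w)) - v (add_pair \<gamma> (fst w)))"
  have bd: "\<bar>?f w\<bar> \<le> (2 * bnd K C r \<gamma> * bnd K C r \<gamma>) * hits K (fst w) (snd w)" for w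
  proof -
    have "\<bar>?f w\<bar> \<le> bnd K C r \<gamma> * (2 * bnd K C r \<gamma> * hits K (fst w) (snd w))"
      unfolding abs_mult by (intro mult_mono tame_bound[OF u g] tame_diff[OF v g]) (auto simp: bnd_nonneg[OF u])
    then show ?thesis by (simp add: algebra_simps)
  qed
  show i: "integrable (L \<Otimes>\<^sub>M L) (\<lambda>w. kk (fst w) (snd w) * ?f w)"
    by (rule form_integrable(1)[OF g K _ bd]) measurable
  have i': "integrable (L \<Otimes>\<^sub>M L) (\<lambda>w. kk (snd w) (fst w) * ?f (snd w, fst w))"
    using LL.integrable_product_swap[OF i] by (simp add: case_prod_beta')
  have "(\<integral>w. kk (snd w) (fst w) * ?f (snd w, fst w) \<partial>(L \<Otimes>\<^sub>M L)) = (\<integral>w. kk (fst w) (snd w) * ?f w \<partial>(L \<Otimes>\<^sub>M L))"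
    using LL.integral_product_swap[of "\<lambda>w. kk (fst w) (snd w) * ?f w"] i by (simp add: case_prod_beta')
  then have "2 * (\<integral>w. kk (fst w) (snd w) * ?f w \<partial>(L \<Otimes>\<^sub>M L)) =
     (\<integral>w. kk (fst w) (snd w) * ?f w + kk (snd w) (fst w) * ?f (snd w, fst w) \<partial>(L \<Otimes>\<^sub>M L))"
    using i i' by simp
  also have "\<dots> = (\<integral>w. - (kk (fst w) (snd w) * ((u (add_pair \<gamma> (snd w)) - u (add_pair \<gamma> (fst w)))
      * (v (add_pair \<gamma> (snd w)) - v (add_pair \<gamma> (fst w))))) \<partial>(L \<Otimes>\<^sub>M L))"
  proof (rule Bochner_Integration.integral_cong[OF refl])
    fix w :: "('a \<times> 'a) \<times> 'a \<times> 'a"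
    show "kk (fst w) (snd w) * ?f w + kk (snd w) (fst w) * ?f (snd w, fst w) =
      - (kk (fst w) (snd w) * ((u (add_pair \<gamma> (snd w)) - u (add_pair \<gamma> (fst w)))
      * (v (add_pair \<gamma> (snd w)) - v (add_pair \<gamma> (fst w)))))"
      unfolding kk_sym[of "snd w" "fst w"] by (simp add: algebra_simps)
  qed
  also have "\<dots> = - form u v \<gamma>" by (simp add: form_def)
  finally show "(\<integral>w. kk (fst w) (snd w) * ?f w \<partial>(L \<Otimes>\<^sub>M L)) = - (1/2) * form u v \<gamma>" by simp
qed

lemma bnd_moment:
  assumes K: "K \<in> sets borel" "bounded K" and "C \<ge> 0"
  shows "(\<integral>\<^sup>+\<gamma>. ennreal (bnd K C r \<gamma> ^ k) \<partial>M) < \<infinity>"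
proof -
  have "bnd K C r \<gamma> ^ k = (C ^ k * exp (2 * real k * r)) * exp (real k * r * real (card (\<gamma> \<inter> K)))" for \<gamma>
    by (simp add: bnd_def power_mult_distrib exp_of_nat_mult[symmetric] exp_add[symmetric] algebra_simps)
  then have "(\<integral>\<^sup>+\<gamma>. ennreal (bnd K C r \<gamma> ^ k) \<partial>M) =
     (\<integral>\<^sup>+\<gamma>. ennreal (C ^ k * exp (2 * real k * r)) * ennreal (exp (real k * r * real (card (\<gamma> \<inter> K)))) \<partial>M)"
    using \<open>C \<ge> 0\<close> by (simp add: ennreal_mult)
  also have "\<dots> = ennreal (C ^ k * exp (2 * real k * r)) * (\<integral>\<^sup>+\<gamma>. ennreal (exp (real k * r * real (card (\<gamma> \<inter> K)))) \<partial>M)"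
  proof (rule nn_integral_cmult)
    have [measurable]: "(\<lambda>\<gamma>. card (\<gamma> \<inter> K)) \<in> M \<rightarrow>\<^sub>M count_space UNIV" by (rule measurable_count[OF K])
    have "(\<lambda>\<gamma>. ennreal (exp (real k * r * real (card (\<gamma> \<inter> K))))) \<in> borel_measurable M"
      by (rule measurable_compose[OF measurable_count[OF K]]) simp
    then show "(\<lambda>\<gamma>. ennreal (exp (real k * r * real (card (\<gamma> \<inter> K))))) \<in> borel_measurable M" .
  qed
  also have "\<dots> < \<infinity>" using exp_moment[OF K, of "real k * r"] by (simp add: ennreal_mult_less_top)
  finally show ?thesis .
qed

lemma bnd_measurable:
  assumes K: "K \<in> sets borel" "bounded K"
  shows "bnd K C r \<in> borel_measurable M"
  unfolding bnd_def[abs_def] by (rule measurable_compose[OF measurable_count[OF K]]) simp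

text \<open>
  The Mecke formula for pairs turns the sum over pairs of points into an integral over added
  pairs, and detailed balance symmetrizes the integrand. In particular the operator is symmetric
  and non-positive on tame functionals.
\<close>

theorem dirichlet_form:
  assumes u: "tame_on K C r u" and v: "tame_on K C r v"
  shows "integrable M (\<lambda>\<gamma>. u \<gamma> * Lop v \<gamma>)" (is ?Q)
    and "(\<integral>\<gamma>. u \<gamma> * Lop v \<gamma> \<partial>M) = - (z * z / 4) * (\<integral>\<gamma>. form u v \<gamma> \<partial>M)" (is ?P)
proof -
  let ?d = "density lborel (\<lambda>_::'a. ennreal z)"
  have K: "K \<in> sets borel" "bounded K" and C: "C \<ge> 0" using u by (auto simp: tame_on_def)
  have [measurable]: "u \<in> borel_measurable CB" "v \<in> borel_measurable CB" using u v by (auto simp: tame_on_def)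
  have sM: "sets ((?d \<Otimes>\<^sub>M ?d) \<Otimes>\<^sub>M M) = sets ((borel \<Otimes>\<^sub>M borel) \<Otimes>\<^sub>M CB)"
    by (intro sets_pair_measure_cong) auto
  note [measurable] = J_measurable[of v]
  let ?f = "\<lambda>w. u (snd w) * J v (fst w) (snd w)"
  let ?g = "\<lambda>w. u (add_pair (snd w) (fst w)) * J v (fst w) (add_pair (snd w) (fst w))"
  have f: "?f \<in> borel_measurable ((?d \<Otimes>\<^sub>M ?d) \<Otimes>\<^sub>M M)" unfolding measurable_cong_sets[OF sM refl] by measurable
  have Jadd: "(\<lambda>w. J v (fst w) (add_pair (snd w) (fst w))) \<in> borel_measurable ((borel \<Otimes>\<^sub>M borel) \<Otimes>\<^sub>M CB)"
  proof -
    have "(\<lambda>w. (fst w, add_pair (snd w) (fst w))) \<in> (borel \<Otimes>\<^sub>M borel) \<Otimes>\<^sub>M CB \<rightarrow>\<^sub>M ((borel \<Otimes>\<^sub>M borel) \<Otimes>\<^sub>M (CB :: 'a set measure))"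
      by measurable
    from measurable_compose[OF this J_measurable[of v]] show ?thesis by simp
  qed
  have g: "?g \<in> borel_measurable ((?d \<Otimes>\<^sub>M ?d) \<Otimes>\<^sub>M M)"
    unfolding measurable_cong_sets[OF sM refl] using Jadd by measurable
  have newL: "AE X in L. fst X \<notin> \<gamma> \<and> snd X \<notin> \<gamma>" if "\<gamma> \<in> configurations" for \<gamma>
  proof -
    have c: "countable \<gamma>" using that by (rule countable_configuration)
    have 0: "AE x in lborel. x \<notin> \<gamma>" by (rule AE_I'[OF countable_imp_null_set_lborel[OF c]]) auto
    show ?thesis using lborel_pair.AE_pair_fst[OF 0] lborel_pair.AE_pair_snd[OF 0] by eventually_elim auto
  qed
  have Jabs: "AE X in L. ?g (X, \<gamma>) = (\<integral>Y. kk X Y * (u (add_pair \<gamma> X) * (v (add_pair \<gamma> Y) - v (add_pair \<gamma> X))) \<partial>L)"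
    if "\<gamma> \<in> configurations" for \<gamma>
    using newL[OF that]
  proof eventually_elim
    case (elim X)
    then have "?g (X, \<gamma>) = u (add_pair \<gamma> X) * (\<integral>Y. kk X Y * (v (add_pair \<gamma> Y) - v (add_pair \<gamma> X)) \<partial>L)"
      using J_add_pair[OF v that] by simp
    also have "\<dots> = (\<integral>Y. u (add_pair \<gamma> X) * (kk X Y * (v (add_pair \<gamma> Y) - v (add_pair \<gamma> X))) \<partial>L)"
      by (rule integral_mult_right_zero[symmetric])
    finally show ?case by (simp add: mult.left_commute)
  qed
  let ?D = "\<lambda>\<gamma>. 2 * bnd K C r \<gamma> * bnd K C r \<gamma>"
  have nn: "(\<integral>\<^sup>+X. ennreal \<bar>?g (X, \<gamma>)\<bar> \<partial>L) \<le> ennreal (?D \<gamma> * \<kappa> K)" if g: "\<gamma> \<in> configurations" for \<gamma>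
  proof -
    have "(\<integral>\<^sup>+X. ennreal \<bar>?g (X, \<gamma>)\<bar> \<partial>L) \<le>
        (\<integral>\<^sup>+X. \<integral>\<^sup>+Y. ennreal (?D \<gamma> * (kk X Y * hits K X Y)) \<partial>L \<partial>L)"
    proof (rule nn_integral_mono_AE)
      show "AE X in L. ennreal \<bar>?g (X, \<gamma>)\<bar> \<le> (\<integral>\<^sup>+Y. ennreal (?D \<gamma> * (kk X Y * hits K X Y)) \<partial>L)"
        using Jabs[OF g]
      proof eventually_elim
        case (elim X)
        have "ennreal \<bar>?g (X, \<gamma>)\<bar> \<le> (\<integral>\<^sup>+Y. ennreal \<bar>kk X Y * (u (add_pair \<gamma> X) * (v (add_pair \<gamma> Y) - v (add_pair \<gamma> X)))\<bar> \<partial>L)"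
          unfolding elim by (rule ennreal_abs_integral_le)
        also have "\<dots> \<le> (\<integral>\<^sup>+Y. ennreal (?D \<gamma> * (kk X Y * hits K X Y)) \<partial>L)"
        proof (intro nn_integral_mono ennreal_leI)
          fix Y
          have "\<bar>u (add_pair \<gamma> X) * (v (add_pair \<gamma> Y) - v (add_pair \<gamma> X))\<bar> \<le> bnd K C r \<gamma> * (2 * bnd K C r \<gamma> * hits K X Y)"
            unfolding abs_mult by (intro mult_mono tame_bound[OF u g] tame_diff[OF v g]) (auto simp: bnd_nonneg[OF u])
          from mult_left_mono[OF this kk_nonneg[of X Y]]
          show "\<bar>kk X Y * (u (add_pair \<gamma> X) * (v (add_pair \<gamma> Y) - v (add_pair \<gamma> X)))\<bar> \<le> ?D \<gamma> * (kk X Y * hits K X Y)"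
            by (simp only: abs_mult abs_of_nonneg[OF kk_nonneg] mult_ac)
        qed
        finally show ?case .
      qed
    qed
    also have "\<dots> = (\<integral>\<^sup>+w. ennreal (?D \<gamma> * (kk (fst w) (snd w) * hits K (fst w) (snd w))) \<partial>(L \<Otimes>\<^sub>M L))"
    proof -
      have "(\<lambda>w. ennreal (?D \<gamma> * (kk (fst w) (snd w) * hits K (fst w) (snd w)))) \<in> borel_measurable (L \<Otimes>\<^sub>M L)"
        using K by measurable
      from sigma_finite_measure.nn_integral_fst[OF sigma_finite_L this] show ?thesis by simp
    qed
    also have "\<dots> = ennreal (\<integral>w. ?D \<gamma> * (kk (fst w) (snd w) * hits K (fst w) (snd w)) \<partial>(L \<Otimes>\<^sub>M L))"
      using kk_hits_integrable[OF K] bnd_nonneg[OF u, of \<gamma>]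
      by (intro nn_integral_eq_integral) (auto simp: kk_nonneg hits_nonneg)
    finally show ?thesis by (simp add: \<kappa>_def)
  qed
  have gi: "integrable ((?d \<Otimes>\<^sub>M ?d) \<Otimes>\<^sub>M M) ?g"
  proof (rule integrableI_bounded[OF g])
    have "(\<integral>\<^sup>+w. ennreal \<bar>?g w\<bar> \<partial>((?d \<Otimes>\<^sub>M ?d) \<Otimes>\<^sub>M M)) = (\<integral>\<^sup>+\<gamma>. \<integral>\<^sup>+X. ennreal \<bar>?g (X, \<gamma>)\<bar> \<partial>(?d \<Otimes>\<^sub>M ?d) \<partial>M)"
      by (rule mmn.nn_integral_snd[symmetric]) (use g in measurable)
    also have "\<dots> \<le> (\<integral>\<^sup>+\<gamma>. ennreal (z * z) * ennreal (?D \<gamma> * \<kappa> K) \<partial>M)"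
    proof (rule nn_integral_mono)
      fix \<gamma> assume "\<gamma> \<in> space M"
      then have gc: "\<gamma> \<in> configurations" by simp
      have "(\<lambda>X. ?g (X, \<gamma>)) \<in> borel_measurable (?d \<Otimes>\<^sub>M ?d)"
        using measurable_Pair1[OF g, of \<gamma>] gc by simp
      then have gm: "(\<lambda>X. ennreal \<bar>?g (X, \<gamma>)\<bar>) \<in> borel_measurable L" by (simp cong: measurable_cong_sets)
      have "(\<integral>\<^sup>+X. ennreal \<bar>?g (X, \<gamma>)\<bar> \<partial>(?d \<Otimes>\<^sub>M ?d)) = ennreal (z * z) * (\<integral>\<^sup>+X. ennreal \<bar>?g (X, \<gamma>)\<bar> \<partial>L)"
        unfolding mm_density using gm by (simp add: nn_integral_density nn_integral_cmult)
      then show "(\<integral>\<^sup>+X. ennreal \<bar>?g (X, \<gamma>)\<bar> \<partial>(?d \<Otimes>\<^sub>M ?d)) \<le> ennreal (z * z) * ennreal (?D \<gamma> * \<kappa> K)"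
        using nn[OF gc] by (simp add: mult_left_mono)
    qed
    also have "\<dots> = (\<integral>\<^sup>+\<gamma>. ennreal (z * z * 2 * \<kappa> K) * ennreal (bnd K C r \<gamma> ^ 2) \<partial>M)"
      using z_pos \<kappa>_nonneg[of K] by (intro nn_integral_cong) (simp add: ennreal_mult[symmetric] power2_eq_square mult_ac)
    also have "\<dots> = ennreal (z * z * 2 * \<kappa> K) * (\<integral>\<^sup>+\<gamma>. ennreal (bnd K C r \<gamma> ^ 2) \<partial>M)"
    proof (rule nn_integral_cmult)
      show "(\<lambda>\<gamma>. ennreal (bnd K C r \<gamma> ^ 2)) \<in> borel_measurable M"
        by (rule measurable_compose[OF bnd_measurable[OF K]]) measurable
    qed
    also have "\<dots> < \<infinity>" using bnd_moment[OF K C, of r 2] by (simp add: ennreal_mult_less_top)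
    finally show "(\<integral>\<^sup>+w. ennreal (norm (?g w)) \<partial>((?d \<Otimes>\<^sub>M ?d) \<Otimes>\<^sub>M M)) < \<infinity>" by simp
  qed
  note mk = mecke2_real[OF f]
  have gi': "integrable ((?d \<Otimes>\<^sub>M ?d) \<Otimes>\<^sub>M M) (\<lambda>w. ?f (fst w, add_pair (snd w) (fst w)))" using gi by simp
  have eqL: "u \<gamma> * Lop v \<gamma> = 1/2 * (\<integral>p. ?f (p, \<gamma>) \<partial>count_space (offdiag \<gamma>))" for \<gamma>
    by (simp add: Lop_def)
  show ?Q
    unfolding eqL by (rule integrable_mult_right[OF mk(2)[OF gi']])
  have "(\<integral>\<gamma>. u \<gamma> * Lop v \<gamma> \<partial>M) = 1/2 * (\<integral>w. ?g w \<partial>((?d \<Otimes>\<^sub>M ?d) \<Otimes>\<^sub>M M))"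
    unfolding eqL using mk(3)[OF gi'] by simp
  also have "(\<integral>w. ?g w \<partial>((?d \<Otimes>\<^sub>M ?d) \<Otimes>\<^sub>M M)) = (\<integral>\<gamma>. \<integral>X. ?g (X, \<gamma>) \<partial>(?d \<Otimes>\<^sub>M ?d) \<partial>M)"
    using mmn.integral_snd[of "\<lambda>X \<gamma>. ?g (X, \<gamma>)"] gi by (simp add: case_prod_beta')
  also have "\<dots> = (\<integral>\<gamma>. - (z * z / 2) * form u v \<gamma> \<partial>M)"
  proof (rule Bochner_Integration.integral_cong[OF refl])
    fix \<gamma> assume "\<gamma> \<in> space M"
    then have gc: "\<gamma> \<in> configurations" by simp
    have "(\<lambda>X. ?g (X, \<gamma>)) \<in> borel_measurable (?d \<Otimes>\<^sub>M ?d)"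
      using measurable_Pair1[OF g, of \<gamma>] gc by simp
    then have gm: "(\<lambda>X. ?g (X, \<gamma>)) \<in> borel_measurable L" by (simp cong: measurable_cong_sets)
    note hf = half_form[OF u v gc]
    have "(\<integral>X. ?g (X, \<gamma>) \<partial>(?d \<Otimes>\<^sub>M ?d)) = z * z * (\<integral>X. ?g (X, \<gamma>) \<partial>L)"
      unfolding mm_density using gm z_pos by (subst integral_density) auto
    also have "(\<integral>X. ?g (X, \<gamma>) \<partial>L) = (\<integral>X. \<integral>Y. kk X Y * (u (add_pair \<gamma> X) * (v (add_pair \<gamma> Y) - v (add_pair \<gamma> X))) \<partial>L \<partial>L)"
    proof (rule integral_cong_AE[OF gm _ Jabs[OF gc]])
      show "(\<lambda>X. \<integral>Y. kk X Y * (u (add_pair \<gamma> X) * (v (add_pair \<gamma> Y) - v (add_pair \<gamma> X))) \<partial>L) \<in> borel_measurable L"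
        using borel_measurable_integrable[OF LL.integrable_fst'[OF hf(1)]] by simp
    qed
    also have "\<dots> = - (1/2) * form u v \<gamma>" using LL.integral_fst'[OF hf(1)] hf(2) by simp
    finally show "(\<integral>X. ?g (X, \<gamma>) \<partial>(?d \<Otimes>\<^sub>M ?d)) = - (z * z / 2) * form u v \<gamma>" by simp
  qed
  finally show ?P by simp
qed

lemma form_commute: "form u v \<gamma> = form v u \<gamma>" by (simp add: form_def mult.commute)

end

section \<open>The exponential functional in the Friedrichs extension\<close>

lemma cylinder_of_pairing:
  assumes "\<phi> \<in> continuous_compact_support" and h: "continuous_on UNIV h" "\<And>y. \<bar>h y\<bar> \<le> (C::real)"
  shows "(\<lambda>\<gamma>. h (pairing \<phi> \<gamma>)) \<in> cylinder_functions"
  unfolding cylinder_functions_def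
proof (intro CollectI exI[of _ "1::nat"] exI[of _ "\<lambda>_. \<phi>"] exI[of _ "\<lambda>y. h (y 0)"] conjI)
  have "continuous_map (product_topology (\<lambda>_. euclideanreal) {..<1::nat}) euclideanreal (\<lambda>y. y 0)"
    by (rule continuous_map_product_projection) simp
  from continuous_map_compose[OF this, of euclideanreal h] h(1)
  show "continuous_map (product_topology (\<lambda>_. euclideanreal) {..<1::nat}) euclideanreal (\<lambda>y. h (y 0))"
    by (simp add: o_def)
  show "bounded ((\<lambda>y. h (y 0)) ` ({..<1::nat} \<rightarrow>\<^sub>E UNIV))" using h(2) by (intro boundedI[of _ C]) auto
qed (use assms in auto)

context tilted_poisson
begin

lemma F_tame: obtains K r where "tame_on K 1 r F"
proof -
  obtain K r where K: "K \<in> sets borel" "bounded K" "r \<ge> 0"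
    "\<And>\<gamma>. \<gamma> \<in> configurations \<Longrightarrow> F (\<gamma> \<inter> K) = F \<gamma>"
    "\<And>\<gamma>. \<gamma> \<in> configurations \<Longrightarrow> F \<gamma> \<le> exp (r * real (card (\<gamma> \<inter> K)))" by (rule F_bound) blast
  have "tame_on K 1 r F" using K F_pos by (auto simp: tame_on_def abs_of_pos)
  then show ?thesis by (rule that)
qed

lemma in_L2_F: "in_L2 M F"
proof -
  have "F \<in> borel_measurable M" by measurable
  moreover have "integrable M (\<lambda>\<gamma>. (F \<gamma>)\<^sup>2)"
    using F_moment[of 2] by (intro integrableI_bounded) auto
  ultimately show ?thesis by (simp add: in_L2_def)
qed

definition trunc where "trunc n \<gamma> = min (F \<gamma>) (real n)"

lemma trunc_cylinder: "trunc n \<in> cylinder_functions"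
proof -
  have "(\<lambda>\<gamma>. min (exp (pairing \<phi> \<gamma>)) (real n)) \<in> cylinder_functions"
    by (rule cylinder_of_pairing[OF phi, of "\<lambda>y. min (exp y) (real n)" "real n"]) (auto intro!: continuous_intros)
  then show ?thesis by (simp add: trunc_def[abs_def] F_def)
qed

lemma trunc_diff_cylinder: "(\<lambda>\<gamma>. trunc m \<gamma> - trunc n \<gamma>) \<in> cylinder_functions"
proof -
  have "(\<lambda>\<gamma>. min (exp (pairing \<phi> \<gamma>)) (real m) - min (exp (pairing \<phi> \<gamma>)) (real n)) \<in> cylinder_functions"
    by (rule cylinder_of_pairing[OF phi, of "\<lambda>y. min (exp y) (real m) - min (exp y) (real n)" "real m + real n"])
       (intro continuous_intros, auto simp: abs_le_iff min_def)
  then show ?thesis by (simp add: trunc_def[abs_def] F_def)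
qed

lemma trunc_tendsto: "(\<lambda>n. L2_norm M (\<lambda>\<gamma>. trunc n \<gamma> - F \<gamma>)) \<longlonglongrightarrow> 0"
proof -
  have i4: "integrable M (\<lambda>\<gamma>. (F \<gamma>) ^ 4)"
    using F_moment[of 4] by (intro integrableI_bounded) auto
  let ?c = "\<integral>\<gamma>. (F \<gamma>) ^ 4 \<partial>M"
  have c: "?c \<ge> 0" by (intro integral_nonneg_AE) simp
  have bd: "L2_norm M (\<lambda>\<gamma>. trunc n \<gamma> - F \<gamma>) \<le> sqrt ?c * inverse (real n)" if n: "n \<ge> 1" for n
  proof -
    have "(\<integral>\<gamma>. (trunc n \<gamma> - F \<gamma>)\<^sup>2 \<partial>M) \<le> (\<integral>\<gamma>. (inverse (real n))\<^sup>2 * (F \<gamma>) ^ 4 \<partial>M)"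
    proof (rule integral_mono')
      fix \<gamma>
      show "(trunc n \<gamma> - F \<gamma>)\<^sup>2 \<le> (inverse (real n))\<^sup>2 * (F \<gamma>) ^ 4"
      proof (cases "F \<gamma> \<le> real n")
        case True then show ?thesis by (simp add: trunc_def)
      next
        case False
        have "\<bar>trunc n \<gamma> - F \<gamma>\<bar> \<le> F \<gamma>" using False n by (simp add: trunc_def)
        also have "F \<gamma> * 1 \<le> F \<gamma> * (F \<gamma> * inverse (real n))"
          using False n F_pos[of \<gamma>] by (intro mult_left_mono) (auto simp: field_simps)
        finally have "\<bar>trunc n \<gamma> - F \<gamma>\<bar> \<le> inverse (real n) * (F \<gamma>)\<^sup>2" by (simp add: power2_eq_square mult_ac)
        then have "(trunc n \<gamma> - F \<gamma>)\<^sup>2 \<le> (inverse (real n) * (F \<gamma>)\<^sup>2)\<^sup>2"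
          by (intro abs_le_square_iff[THEN iffD1]) simp
        then show ?thesis by (simp add: power_mult_distrib)
      qed
    qed (use i4 in auto)
    also have "\<dots> = (inverse (real n))\<^sup>2 * ?c" by simp
    finally have "L2_norm M (\<lambda>\<gamma>. trunc n \<gamma> - F \<gamma>) \<le> sqrt ((inverse (real n))\<^sup>2 * ?c)"
      unfolding L2_norm_def by (rule real_sqrt_le_mono)
    also have "\<dots> = sqrt ?c * inverse (real n)" by (simp add: real_sqrt_mult)
    finally show ?thesis .
  qed
  have "(\<lambda>n. sqrt ?c * inverse (real n)) \<longlonglongrightarrow> 0"
    using tendsto_mult_right_zero[OF lim_inverse_n, of "sqrt ?c"] by simp
  then show ?thesis
    by (rule tendsto_sandwich[OF _ _ tendsto_const, rotated 2])
       (auto simp: L2_norm_def eventually_sequentially intro!: exI[of _ 1] bd[unfolded L2_norm_def])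
qed

end

locale jump_tilt = jump_rates + tilted_poisson
begin

text \<open>
  The two truncations differ only where \<open>F\<close> exceeds \<open>N\<close>, and there one
  more factor \<open>F / N\<close> may be inserted. All moments of \<open>F\<close> are finite,
  so this makes the truncations a Cauchy sequence for the form.
\<close>

lemma trunc_form_bound:
  assumes F: "tame_on K 1 r F" and g: "\<gamma> \<in> configurations" and N: "N \<ge> 1" "N \<le> m" "N \<le> n"
  defines "d \<equiv> \<lambda>\<gamma>. trunc m \<gamma> - trunc n \<gamma>"
  shows "form d d \<gamma> \<le> inverse (real N) * (32 * \<kappa> K) * bnd K 1 r \<gamma> ^ 3"
proof -
  have K: "K \<in> sets borel" "bounded K" using F by (auto simp: tame_on_def)
  let ?b = "bnd K 1 r \<gamma>"
  have b0: "?b \<ge> 0" by (rule bnd_nonneg[OF F])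
  have [measurable]: "d \<in> borel_measurable CB" unfolding d_def trunc_def by measurable
  note [measurable] = measurable_fixed_conf[OF g, of d]
  have bd: "\<bar>(d (add_pair \<gamma> (snd w)) - d (add_pair \<gamma> (fst w))) * (d (add_pair \<gamma> (snd w)) - d (add_pair \<gamma> (fst w)))\<bar>
      \<le> (inverse (real N) * (32 * ?b ^ 3)) * hits K (fst w) (snd w)" for w
  proof -
    define s where "s = F (add_pair \<gamma> (snd w))"
    define t where "t = F (add_pair \<gamma> (fst w))"
    let ?d = "d (add_pair \<gamma> (snd w)) - d (add_pair \<gamma> (fst w))"
    have st: "0 < s" "0 < t" "s \<le> ?b" "t \<le> ?b" "\<bar>s - t\<bar> \<le> 2 * ?b * hits K (fst w) (snd w)"
      using tame_bound[OF F g, of "fst (snd w)" "snd (snd w)"] tame_bound[OF F g, of "fst (fst w)" "snd (fst w)"]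
        tame_diff[OF F g, of "snd w" "fst w"] F_pos
      unfolding s_def t_def by (auto simp: abs_le_iff)
    have dd: "?d = (min s (real m) - min s (real n)) - (min t (real m) - min t (real n))"
      by (simp add: d_def trunc_def s_def t_def)
    have dst: "\<bar>?d\<bar> \<le> \<bar>s - t\<bar>" unfolding dd by (auto simp: min_def)
    have "?d * ?d \<le> (s - t) * (s - t) * ((s + t) * inverse (real N))"
    proof (cases "s \<le> real N \<and> t \<le> real N")
      case True
      then have "?d = 0" unfolding dd using N by (simp add: min_def)
      then show ?thesis using st by simp
    next
      case False
      then have "1 \<le> (s + t) * inverse (real N)" using N st by (auto simp: field_simps)
      then have "(s - t) * (s - t) * 1 \<le> (s - t) * (s - t) * ((s + t) * inverse (real N))"
        by (intro mult_left_mono) auto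
      moreover have "?d * ?d \<le> (s - t) * (s - t)" using dst abs_le_square_iff[of ?d "s - t"] by (simp add: power2_eq_square)
      ultimately show ?thesis by linarith
    qed
    also have "\<dots> \<le> (4 * ?b * ?b * (4 * hits K (fst w) (snd w))) * ((?b + ?b) * inverse (real N))"
    proof (rule mult_mono[OF _ mult_right_mono[OF add_mono[OF st(3,4)]]])
      have h4: "hits K (fst w) (snd w) \<le> 4" by (auto simp: hits_def indicator_def)
      have "\<bar>s - t\<bar> * \<bar>s - t\<bar> \<le> (2 * ?b * hits K (fst w) (snd w)) * (2 * ?b * hits K (fst w) (snd w))"
        using st(5) by (intro mult_mono) (auto simp: b0 hits_nonneg)
      also have "\<dots> = 4 * ?b * ?b * (hits K (fst w) (snd w) * hits K (fst w) (snd w))" by simp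
      also have "\<dots> \<le> 4 * ?b * ?b * (4 * hits K (fst w) (snd w))"
        using b0 h4 hits_nonneg[of K "fst w" "snd w"] by (intro mult_left_mono mult_right_mono) auto
      finally show "(s - t) * (s - t) \<le> 4 * ?b * ?b * (4 * hits K (fst w) (snd w))" by (simp add: abs_mult_self_eq)
    qed (use st b0 hits_nonneg in auto)
    also have "\<dots> = (inverse (real N) * (32 * ?b ^ 3)) * hits K (fst w) (snd w)" by (simp add: power3_eq_cube)
    finally show ?thesis by simp
  qed
  have "form d d \<gamma> \<le> (inverse (real N) * (32 * ?b ^ 3)) * \<kappa> K"
    using form_integrable(2)[OF g K _ bd] by (simp add: form_def abs_le_iff)
  then show ?thesis by (simp add: mult_ac)
qed

text \<open>
  Symmetry of the Dirichlet form shows that \<open>F\<close> lies in the domain of the adjoint,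
  and the truncations show that it lies in the form domain. Two values of the adjoint at
  \<open>F\<close> have the same integrals against all cylinder functions.
\<close>

theorem exp_in_friedrichs:
  assumes T: "\<And>v. v \<in> cylinder_functions \<Longrightarrow> T v \<in> borel_measurable M \<and> (AE \<gamma> in M. T v \<gamma> = - Lop v \<gamma>)"
    and L2: "in_L2 M (Lop F)"
  shows "(F, \<lambda>\<gamma>. - Lop F \<gamma>) \<in> friedrichs_extension M cylinder_functions T" (is ?P)
    and "\<And>w. (F, w) \<in> friedrichs_extension M cylinder_functions T \<Longrightarrow> AE \<gamma> in M. w \<gamma> = - Lop F \<gamma>"
proof -
  have [measurable]: "Lop v \<in> borel_measurable M" if "v \<in> borel_measurable CB" for v
    using Lop_measurable[OF that] by simp
  have Tint: "(\<integral>\<gamma>. u \<gamma> * T v \<gamma> \<partial>M) = z * z / 4 * (\<integral>\<gamma>. form u v \<gamma> \<partial>M)"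
    if v: "v \<in> cylinder_functions" and u: "tame_on K' C' r' u" for u v K' C' r'
  proof -
    obtain K C where vt: "tame_on K C 0 v" using cylinder_tame[OF v] .
    obtain K'' C'' r'' where t: "tame_on K'' C'' r'' u" "tame_on K'' C'' r'' v" using tame_on_common[OF u vt] .
    have [measurable]: "u \<in> borel_measurable CB" "v \<in> borel_measurable CB" using t by (auto simp: tame_on_def)
    have [measurable]: "T v \<in> borel_measurable M" using T[OF v] by simp
    have "(\<integral>\<gamma>. u \<gamma> * T v \<gamma> \<partial>M) = (\<integral>\<gamma>. - (u \<gamma> * Lop v \<gamma>) \<partial>M)"
      by (rule integral_cong_AE) (use T[OF v] in \<open>auto elim: eventually_mono\<close>)
    then show ?thesis using dirichlet_form(2)[OF t] by simp
  qed
  obtain K r where Ft: "tame_on K 1 r F" by (rule F_tame)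
  have K: "K \<in> sets borel" "bounded K" using Ft by (auto simp: tame_on_def)
  have sym: "(\<integral>\<gamma>. F \<gamma> * T v \<gamma> \<partial>M) = (\<integral>\<gamma>. - Lop F \<gamma> * v \<gamma> \<partial>M)" if v: "v \<in> cylinder_functions" for v
  proof -
    obtain K' C where vt: "tame_on K' C 0 v" using cylinder_tame[OF v] .
    obtain K'' C'' r'' where t: "tame_on K'' C'' r'' F" "tame_on K'' C'' r'' v" using tame_on_common[OF Ft vt] .
    have "(\<integral>\<gamma>. - Lop F \<gamma> * v \<gamma> \<partial>M) = - (\<integral>\<gamma>. v \<gamma> * Lop F \<gamma> \<partial>M)" by (simp add: mult.commute)
    also have "\<dots> = z * z / 4 * (\<integral>\<gamma>. form v F \<gamma> \<partial>M)" using dirichlet_form(2)[OF t(2,1)] by simp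
    finally show ?thesis using Tint[OF v Ft] by (simp add: form_commute)
  qed
  have Lneg: "in_L2 M (\<lambda>\<gamma>. - Lop F \<gamma>)" using L2 by (simp add: in_L2_def)
  have cauchy: "\<exists>N. \<forall>m\<ge>N. \<forall>n\<ge>N. (\<integral>\<gamma>. T (\<lambda>y. trunc m y - trunc n y) \<gamma> * (trunc m \<gamma> - trunc n \<gamma>) \<partial>M) < e"
    if e: "e > 0" for e :: real
  proof -
    have i3: "integrable M (\<lambda>\<gamma>. bnd K 1 r \<gamma> ^ 3)"
      using bnd_moment[OF K, of 1 r 3] bnd_measurable[OF K, of 1 r] bnd_nonneg[OF Ft] by (intro integrableI_bounded) auto
    define c where "c = z * z / 4 * (32 * \<kappa> K * (\<integral>\<gamma>. bnd K 1 r \<gamma> ^ 3 \<partial>M))"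
    have c: "c \<ge> 0" unfolding c_def using z_pos \<kappa>_nonneg[of K] bnd_nonneg[OF Ft] by (auto intro!: mult_nonneg_nonneg integral_nonneg_AE)
    obtain N :: nat where N': "max 1 (c / e) < real N" using reals_Archimedean2 by blast
    then have N: "c / e < real N" "N \<ge> 1" by simp_all
    show ?thesis
    proof (intro exI[of _ N] allI impI)
      fix m n assume mn: "N \<le> m" "N \<le> n"
      let ?d = "\<lambda>\<gamma>. trunc m \<gamma> - trunc n \<gamma>"
      have dc: "?d \<in> cylinder_functions" by (rule trunc_diff_cylinder)
      obtain K' C where dt: "tame_on K' C 0 ?d" using cylinder_tame[OF dc] .
      have "(\<integral>\<gamma>. T ?d \<gamma> * ?d \<gamma> \<partial>M) = z * z / 4 * (\<integral>\<gamma>. form ?d ?d \<gamma> \<partial>M)"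
        using Tint[OF dc dt] by (simp add: mult.commute)
      also have "\<dots> \<le> z * z / 4 * (\<integral>\<gamma>. inverse (real N) * (32 * \<kappa> K) * bnd K 1 r \<gamma> ^ 3 \<partial>M)"
      proof (intro mult_left_mono integral_mono')
        show "integrable M (\<lambda>\<gamma>. inverse (real N) * (32 * \<kappa> K) * bnd K 1 r \<gamma> ^ 3)" using i3 by simp
        show "form ?d ?d \<gamma> \<le> inverse (real N) * (32 * \<kappa> K) * bnd K 1 r \<gamma> ^ 3" if "\<gamma> \<in> space M" for \<gamma>
          using trunc_form_bound[OF Ft _ N(2) mn] that by simp
        show "0 \<le> inverse (real N) * (32 * \<kappa> K) * bnd K 1 r \<gamma> ^ 3" for \<gamma>
          using \<kappa>_nonneg[of K] bnd_nonneg[OF Ft, of \<gamma>] by simp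
      qed (use z_pos in auto)
      also have "\<dots> = c / real N"
        unfolding c_def divide_inverse integral_mult_right_zero by (simp only: mult_ac)
      also have "\<dots> < e" using N e by (simp add: field_simps)
      finally show "(\<integral>\<gamma>. T ?d \<gamma> * ?d \<gamma> \<partial>M) < e" .
    qed
  qed
  show ?P
    unfolding friedrichs_extension_def
    using in_L2_F Lneg sym trunc_tendsto trunc_cylinder cauchy
    by (intro CollectI case_prodI conjI ballI exI[of _ trunc]) auto
  fix w assume "(F, w) \<in> friedrichs_extension M cylinder_functions T"
  then have wL2: "in_L2 M w" and orth: "\<And>v. v \<in> cylinder_functions \<Longrightarrow> (\<integral>\<gamma>. F \<gamma> * T v \<gamma> \<partial>M) = (\<integral>\<gamma>. w \<gamma> * v \<gamma> \<partial>M)"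
    by (auto simp: friedrichs_extension_def)
  have iw: "integrable M w" "integrable M (Lop F)"
    using wL2 L2 by (auto simp: in_L2_def intro: square_integrable_imp_integrable)
  have "AE \<gamma> in M. w \<gamma> + Lop F \<gamma> = 0"
  proof (rule cylinder_functions_separate[OF sets_M])
    show "integrable M (\<lambda>\<gamma>. w \<gamma> + Lop F \<gamma>)" using iw by simp
    fix v :: "'a set \<Rightarrow> real" assume v: "v \<in> cylinder_functions"
    obtain K' C where vt: "tame_on K' C 0 v" using cylinder_tame[OF v] .
    have vb: "\<bar>v \<gamma>\<bar> \<le> C" if "\<gamma> \<in> configurations" for \<gamma> using vt that by (auto simp: tame_on_def)
    have [measurable]: "v \<in> borel_measurable CB" using v by (rule cylinder_measurable)
    have iv: "integrable M (\<lambda>\<gamma>. f \<gamma> * v \<gamma>)" if f: "integrable M f" for f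
    proof (rule Bochner_Integration.integrable_bound)
      show "integrable M (\<lambda>\<gamma>. C * f \<gamma>)" using f by simp
      show "AE \<gamma> in M. norm (f \<gamma> * v \<gamma>) \<le> norm (C * f \<gamma>)"
      proof (rule AE_I2)
        fix \<gamma> assume "\<gamma> \<in> space M"
        then have "\<bar>v \<gamma>\<bar> \<le> \<bar>C\<bar>" using vb[of \<gamma>] by simp
        then show "norm (f \<gamma> * v \<gamma>) \<le> norm (C * f \<gamma>)" using mult_left_mono[of "\<bar>v \<gamma>\<bar>" "\<bar>C\<bar>" "\<bar>f \<gamma>\<bar>"]
            by (simp add: abs_mult mult.commute)
      qed
      have "f \<in> borel_measurable M" using f by simp
      then show "(\<lambda>\<gamma>. f \<gamma> * v \<gamma>) \<in> borel_measurable M" by measurable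
    qed
    have "(\<integral>\<gamma>. (w \<gamma> + Lop F \<gamma>) * v \<gamma> \<partial>M) = (\<integral>\<gamma>. w \<gamma> * v \<gamma> \<partial>M) + (\<integral>\<gamma>. Lop F \<gamma> * v \<gamma> \<partial>M)"
      using iv[OF iw(1)] iv[OF iw(2)] by (simp add: distrib_right)
    also have "(\<integral>\<gamma>. w \<gamma> * v \<gamma> \<partial>M) = - (\<integral>\<gamma>. Lop F \<gamma> * v \<gamma> \<partial>M)"
      using orth[OF v] sym[OF v] by simp
    finally show "(\<integral>\<gamma>. (w \<gamma> + Lop F \<gamma>) * v \<gamma> \<partial>M) = 0" by simp
  qed
  then show "AE \<gamma> in M. w \<gamma> = - Lop F \<gamma>" by eventually_elim simp
qed

end

section \<open>Pair kernels of the jump operator\<close>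

lemma integrable_nonneg_from_nn:
  fixes f :: "'b \<Rightarrow> real"
  assumes "f \<in> borel_measurable N" "\<And>x. f x \<ge> 0" "(\<integral>\<^sup>+x. ennreal (f x) \<partial>N) = ennreal c" "c \<ge> 0"
  shows "integrable N f" "(\<integral>x. f x \<partial>N) = c"
proof -
  show "integrable N f" using assms by (intro integrableI_bounded) auto
  show "(\<integral>x. f x \<partial>N) = c" using assms by (subst integral_eq_nn_integral) auto
qed

context tilted_poisson
begin

lemma mm_mu: "\<mu> \<Otimes>\<^sub>M \<mu> = density (lborel \<Otimes>\<^sub>M lborel) (\<lambda>X. ennreal (w (fst X) * w (snd X)))"
proof -
  have sf: "sigma_finite_measure (density lborel (\<lambda>x. ennreal (w x)))"
    by (subst sigma_finite_measure.sigma_finite_iff_density_finite[OF sigma_finite_lborel]) auto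
  show ?thesis unfolding \<mu>_def
    using sf sigma_finite_lborel by (subst pair_measure_density) (auto simp: ennreal_mult w_nonneg case_prod_beta')
qed

lemma w_bound: obtains wm where "wm \<ge> 0" "\<And>x. w x \<le> wm"
proof -
  obtain s where s: "s \<ge> 0" "\<And>x. \<bar>\<phi> x\<bar> \<le> s" using compact_support_bounded_range[OF phi] by blast
  have "w x \<le> z * exp (2 * s)" for x
    unfolding w_def using s(2)[of x] z_pos by (intro mult_left_mono) auto
  then show ?thesis using z_pos by (intro that[of "z * exp (2 * s)"]) auto
qed

lemma nn_mu_le:
  assumes [measurable]: "f \<in> borel_measurable borel" and "\<And>x. w x \<le> wm"
  shows "(\<integral>\<^sup>+x. f x \<partial>\<mu>) \<le> ennreal wm * (\<integral>\<^sup>+x. f x \<partial>lborel)"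
proof -
  have "(\<integral>\<^sup>+x. f x \<partial>\<mu>) = (\<integral>\<^sup>+x. ennreal (w x) * f x \<partial>lborel)"
    unfolding \<mu>_def by (rule nn_integral_density) auto
  also have "\<dots> \<le> (\<integral>\<^sup>+x. ennreal wm * f x \<partial>lborel)"
    using assms(2) by (intro nn_integral_mono mult_right_mono ennreal_leI) auto
  finally show ?thesis by (simp add: nn_integral_cmult)
qed

lemma nn_mm_le:
  assumes [measurable]: "f \<in> borel_measurable (borel \<Otimes>\<^sub>M borel)" and wm: "\<And>x. w x \<le> wm"
  shows "(\<integral>\<^sup>+X. f X \<partial>(\<mu> \<Otimes>\<^sub>M \<mu>)) \<le> ennreal (wm * wm) * (\<integral>\<^sup>+X. f X \<partial>(lborel \<Otimes>\<^sub>M lborel))"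
proof -
  have 0: "wm \<ge> 0" using wm[of 0] w_nonneg[of 0] by simp
  have "(\<integral>\<^sup>+X. f X \<partial>(\<mu> \<Otimes>\<^sub>M \<mu>)) = (\<integral>\<^sup>+X. ennreal (w (fst X) * w (snd X)) * f X \<partial>(lborel \<Otimes>\<^sub>M lborel))"
    unfolding mm_mu by (rule nn_integral_density) measurable
  also have "\<dots> \<le> (\<integral>\<^sup>+X. ennreal (wm * wm) * f X \<partial>(lborel \<Otimes>\<^sub>M lborel))"
    using wm 0 w_nonneg by (intro nn_integral_mono mult_right_mono ennreal_leI mult_mono) auto
  also have "\<dots> = ennreal (wm * wm) * (\<integral>\<^sup>+X. f X \<partial>(lborel \<Otimes>\<^sub>M lborel))"
    by (rule nn_integral_cmult) measurable
  finally show ?thesis .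
qed

lemma second_chaos_tilted:
  assumes H[measurable]: "H \<in> borel_measurable (borel \<Otimes>\<^sub>M borel)" and sym: "\<And>x y. H (x, y) = H (y, x)"
    and s: "\<And>X. \<bar>H X\<bar> \<le> s" and t: "(\<integral>\<^sup>+X. ennreal \<bar>H X\<bar> \<partial>(lborel \<Otimes>\<^sub>M lborel)) < \<infinity>"
    and s': "\<And>x. (\<integral>\<^sup>+y. ennreal \<bar>H (x, y)\<bar> \<partial>lborel) \<le> ennreal s'"
    and g: "integrable lborel g" and gs: "\<And>x. \<bar>g x\<bar> \<le> s"
  shows "second_chaos \<nu> \<mu> H g"
proof -
  obtain wm where wm: "wm \<ge> 0" "\<And>x. w x \<le> wm" using w_bound by blast
  have [measurable]: "g \<in> borel_measurable borel" using g by auto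
  have s0: "s \<ge> 0" using gs[of 0] by linarith
  have Hmm: "H \<in> borel_measurable (\<mu> \<Otimes>\<^sub>M \<mu>)" by measurable
  have fin: "(\<integral>\<^sup>+X. ennreal \<bar>H X\<bar> \<partial>(\<mu> \<Otimes>\<^sub>M \<mu>)) < \<infinity>"
  proof -
    have "(\<integral>\<^sup>+X. ennreal \<bar>H X\<bar> \<partial>(\<mu> \<Otimes>\<^sub>M \<mu>)) \<le> ennreal (wm * wm) * (\<integral>\<^sup>+X. ennreal \<bar>H X\<bar> \<partial>(lborel \<Otimes>\<^sub>M lborel))"
      by (rule nn_mm_le[OF _ wm(2)]) measurable
    also have "\<dots> < \<infinity>" using t by (simp add: ennreal_mult_less_top)
    finally show ?thesis .
  qed
  have iH: "integrable (\<mu> \<Otimes>\<^sub>M \<mu>) H" using fin Hmm by (intro integrableI_bounded) auto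
  have iH2: "integrable (\<mu> \<Otimes>\<^sub>M \<mu>) (\<lambda>p. (H p)\<^sup>2)"
  proof (rule Bochner_Integration.integrable_bound)
    show "integrable (\<mu> \<Otimes>\<^sub>M \<mu>) (\<lambda>p. s * H p)" using iH by simp
    show "AE p in \<mu> \<Otimes>\<^sub>M \<mu>. norm ((H p)\<^sup>2) \<le> norm (s * H p)"
    proof (rule AE_I2)
      fix p show "norm ((H p)\<^sup>2) \<le> norm (s * H p)"
        using mult_right_mono[OF s[of p], of "\<bar>H p\<bar>"] s0 by (simp add: power2_eq_square abs_mult)
    qed
  qed measurable
  have fing: "(\<integral>\<^sup>+x. ennreal \<bar>g x\<bar> \<partial>\<mu>) < \<infinity>"
  proof -
    have "(\<integral>\<^sup>+x. ennreal \<bar>g x\<bar> \<partial>\<mu>) \<le> ennreal wm * (\<integral>\<^sup>+x. ennreal \<bar>g x\<bar> \<partial>lborel)" by (rule nn_mu_le[OF _ wm(2)]) measurable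
    also have "\<dots> < \<infinity>" using g by (simp add: integrable_iff_bounded ennreal_mult_less_top)
    finally show ?thesis .
  qed
  have ig: "integrable \<mu> g" using fing by (intro integrableI_bounded) auto
  have ig2: "integrable \<mu> (\<lambda>x. (g x)\<^sup>2)"
  proof (rule Bochner_Integration.integrable_bound)
    show "integrable \<mu> (\<lambda>x. s * g x)" using ig by simp
    show "AE x in \<mu>. norm ((g x)\<^sup>2) \<le> norm (s * g x)"
    proof (rule AE_I2)
      fix x show "norm ((g x)\<^sup>2) \<le> norm (s * g x)"
        using mult_right_mono[OF gs[of x], of "\<bar>g x\<bar>"] s0 by (simp add: power2_eq_square abs_mult)
    qed
  qed measurable
  let ?k = "\<lambda>x. \<integral>\<^sup>+y. ennreal \<bar>H (x, y)\<bar> \<partial>\<mu>"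
  have kb: "?k x \<le> ennreal wm * ennreal s'" for x
    by (rule order_trans[OF nn_mu_le[OF _ wm(2)] mult_left_mono[OF s']]) auto
  have km: "?k \<in> borel_measurable \<mu>" by measurable
  have "(\<integral>\<^sup>+x. ?k x * ?k x \<partial>\<mu>) \<le> (\<integral>\<^sup>+x. (ennreal wm * ennreal s') * ?k x \<partial>\<mu>)"
    by (intro nn_integral_mono mult_right_mono kb) simp
  also have "\<dots> = (ennreal wm * ennreal s') * (\<integral>\<^sup>+x. ?k x \<partial>\<mu>)" by (rule nn_integral_cmult[OF km])
  also have "(\<integral>\<^sup>+x. ?k x \<partial>\<mu>) = (\<integral>\<^sup>+X. ennreal \<bar>H X\<bar> \<partial>(\<mu> \<Otimes>\<^sub>M \<mu>))"
    using tilt.mu.nn_integral_fst[of "\<lambda>X. ennreal \<bar>H X\<bar>" \<mu>] Hmm by simp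
  also have "(ennreal wm * ennreal s') * \<dots> < \<infinity>" using fin by (simp add: ennreal_mult_less_top)
  finally have iK: "(\<integral>\<^sup>+x. ?k x * ?k x \<partial>\<mu>) < \<infinity>" .
  have gm: "g \<in> borel_measurable \<mu>" by measurable
  show ?thesis
    by (rule second_chaos.intro[OF tilt.mecke_measure_axioms
          second_chaos_axioms.intro[OF Hmm gm sym iH iH2 iK ig ig2]])
qed

lemma in_L2_F_times:
  assumes X[measurable]: "X \<in> borel_measurable CB" and i: "integrable \<nu> (\<lambda>\<gamma>. (X \<gamma>)\<^sup>2)"
  shows "integrable M (\<lambda>\<gamma>. (F \<gamma> * X \<gamma>)\<^sup>2)" (is ?Q) "(\<integral>\<gamma>. (F \<gamma> * X \<gamma>)\<^sup>2 \<partial>M) = (\<integral>\<gamma>. (X \<gamma>)\<^sup>2 \<partial>\<nu>)" (is ?P)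
proof -
  have [measurable]: "X \<in> borel_measurable M" by measurable
  show ?Q
    using i unfolding \<nu>_def by (subst (asm) integrable_density) (auto simp: power_mult_distrib)
  show ?P
    unfolding \<nu>_def by (subst integral_density) (auto simp: power_mult_distrib)
qed

end

context jump_rates
begin

lemma diff_kernel:
  fixes f k :: "'a \<Rightarrow> real"
  assumes k: "integrable lborel k" "\<And>x. k (- x) = k x" and f: "integrable lborel f"
  shows "integrable L (\<lambda>X. k (snd X - fst X) * f (fst X))"
    "(\<integral>X. k (snd X - fst X) * f (fst X) \<partial>L) = (\<integral>x. k x \<partial>lborel) * (\<integral>x. f x \<partial>lborel)"
    "integrable L (\<lambda>X. k (snd X - fst X) * f (snd X))" (is ?Q)
    "(\<integral>X. k (snd X - fst X) * f (snd X) \<partial>L) = (\<integral>x. k x \<partial>lborel) * (\<integral>x. f x \<partial>lborel)" (is ?P)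
proof -
  have [measurable]: "k \<in> borel_measurable borel" "f \<in> borel_measurable borel" using k f by auto
  have sh: "(\<integral>y. k (y - x) \<partial>lborel) = (\<integral>y. k y \<partial>lborel)" for x using integral_shift(1)[of k "- x"] by simp
  have nsh: "(\<integral>\<^sup>+y. ennreal \<bar>k (y - x)\<bar> \<partial>lborel) = (\<integral>\<^sup>+y. ennreal \<bar>k y\<bar> \<partial>lborel)" for x
    using nn_integral_shift[of "\<lambda>y. ennreal \<bar>k y\<bar>" "- x"] by simp
  have "(\<integral>\<^sup>+X. ennreal \<bar>k (snd X - fst X) * f (fst X)\<bar> \<partial>L) =
      (\<integral>\<^sup>+x. \<integral>\<^sup>+y. ennreal \<bar>k (y - x)\<bar> * ennreal \<bar>f x\<bar> \<partial>lborel \<partial>lborel)"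
    by (subst nn_lborel_pair) (auto simp: abs_mult ennreal_mult)
  also have "\<dots> = (\<integral>\<^sup>+y. ennreal \<bar>k y\<bar> \<partial>lborel) * (\<integral>\<^sup>+x. ennreal \<bar>f x\<bar> \<partial>lborel)"
    by (simp add: nn_integral_multc nsh nn_integral_cmult)
  also have "\<dots> < \<infinity>" using k f by (simp add: integrable_iff_bounded ennreal_mult_less_top)
  finally show i: "integrable L (\<lambda>X. k (snd X - fst X) * f (fst X))"
    by (intro integrableI_bounded) auto
  show e: "(\<integral>X. k (snd X - fst X) * f (fst X) \<partial>L) = (\<integral>x. k x \<partial>lborel) * (\<integral>x. f x \<partial>lborel)"
    using lborel_pair.integral_fst'[OF i] by (simp add: sh)
  have sw: "(\<lambda>X. k (snd X - fst X) * f (snd X)) = (\<lambda>(x, y). k (x - y) * f y)"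
    using k(2)[of "_ - _"] by (auto simp: fun_eq_iff)
  show ?Q
    unfolding sw using lborel_pair.integrable_product_swap[OF i] by simp
  show ?P
    unfolding sw e[symmetric] using lborel_pair.integral_product_swap[of "\<lambda>X. k (snd X - fst X) * f (fst X)"] i by simp
qed

lemma diff_kernel_bounded:
  fixes f1 f2 k :: "'a \<Rightarrow> real"
  assumes [measurable]: "k \<in> borel_measurable borel" and k: "\<And>x. \<bar>k x\<bar> \<le> s"
    and f: "integrable lborel f1" "integrable lborel f2"
  shows "integrable L (\<lambda>X. k (snd X - fst X) * (f1 (fst X) * f2 (snd X)))"
    "\<bar>\<integral>X. k (snd X - fst X) * (f1 (fst X) * f2 (snd X)) \<partial>L\<bar> \<le> s * ((\<integral>x. \<bar>f1 x\<bar> \<partial>lborel) * (\<integral>x. \<bar>f2 x\<bar> \<partial>lborel))" (is ?P)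
proof -
  have [measurable]: "f1 \<in> borel_measurable borel" "f2 \<in> borel_measurable borel" using f by auto
  have s0: "s \<ge> 0" using k[of 0] by linarith
  have 1: "integrable L (\<lambda>X. \<bar>f1 (fst X)\<bar> * \<bar>f2 (snd X)\<bar>)"
  proof (rule integrableI_bounded)
    have "(\<integral>\<^sup>+X. ennreal (norm (\<bar>f1 (fst X)\<bar> * \<bar>f2 (snd X)\<bar>)) \<partial>L) =
        (\<integral>\<^sup>+x. \<integral>\<^sup>+y. ennreal \<bar>f1 x\<bar> * ennreal \<bar>f2 y\<bar> \<partial>lborel \<partial>lborel)"
      by (subst nn_lborel_pair) (auto simp: abs_mult ennreal_mult)
    also have "\<dots> < \<infinity>" using f by (simp add: nn_integral_cmult nn_integral_multc integrable_iff_bounded ennreal_mult_less_top)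
    finally show "(\<integral>\<^sup>+X. ennreal (norm (\<bar>f1 (fst X)\<bar> * \<bar>f2 (snd X)\<bar>)) \<partial>L) < \<infinity>" .
  qed measurable
  have e1: "(\<integral>X. \<bar>f1 (fst X)\<bar> * \<bar>f2 (snd X)\<bar> \<partial>L) = (\<integral>x. \<bar>f1 x\<bar> \<partial>lborel) * (\<integral>x. \<bar>f2 x\<bar> \<partial>lborel)"
    using lborel_pair.integral_fst'[OF 1] by simp
  have b: "\<bar>k (snd X - fst X) * (f1 (fst X) * f2 (snd X))\<bar> \<le> s * (\<bar>f1 (fst X)\<bar> * \<bar>f2 (snd X)\<bar>)" for X
    unfolding abs_mult by (intro mult_right_mono k) auto
  have 2: "integrable L (\<lambda>X. s * (\<bar>f1 (fst X)\<bar> * \<bar>f2 (snd X)\<bar>))" using 1 by simp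
  show i: "integrable L (\<lambda>X. k (snd X - fst X) * (f1 (fst X) * f2 (snd X)))"
    by (rule Bochner_Integration.integrable_bound[OF 2])
       (measurable, rule AE_I2, simp only: real_norm_def, rule order_trans[OF b abs_ge_self])
  have "\<bar>\<integral>X. k (snd X - fst X) * (f1 (fst X) * f2 (snd X)) \<partial>L\<bar> \<le> (\<integral>X. \<bar>k (snd X - fst X) * (f1 (fst X) * f2 (snd X))\<bar> \<partial>L)"
    using integral_norm_bound[of L "\<lambda>X. k (snd X - fst X) * (f1 (fst X) * f2 (snd X))"] by simp
  also have "\<dots> \<le> (\<integral>X. s * (\<bar>f1 (fst X)\<bar> * \<bar>f2 (snd X)\<bar>) \<partial>L)"
    using i 2 b by (intro integral_mono) auto
  finally show ?P
    by (simp add: e1)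
qed

text \<open>
  The function \<open>\<beta>\<close> smeared out by two independent jumps. It has mass \<open>A
  * A * B\<close> for all rates but becomes uniformly small when the jumps are spread out.
\<close>

definition be where "be x = (\<integral>h. \<alpha> (fst h) * \<alpha> (snd h) * \<beta> (x + snd h - fst h) \<partial>L)"

lemma nn_AA: "(\<integral>\<^sup>+h. ennreal (\<alpha> (fst h) * \<alpha> (snd h)) \<partial>L) = ennreal (A * A)"
proof -
  have "(\<integral>\<^sup>+h. ennreal (\<alpha> (fst h) * \<alpha> (snd h)) \<partial>L) = (\<integral>\<^sup>+x. \<integral>\<^sup>+y. ennreal (\<alpha> x) * ennreal (\<alpha> y) \<partial>lborel \<partial>lborel)"
    by (subst nn_lborel_pair) (auto simp: ennreal_mult alpha_nonneg)
  then show ?thesis by (simp add: nn_integral_cmult nn_integral_multc nn_A ennreal_mult A_nonneg)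
qed

lemma integral_AA: "integrable L (\<lambda>h. \<alpha> (fst h) * \<alpha> (snd h))" (is ?P) "(\<integral>h. \<alpha> (fst h) * \<alpha> (snd h) \<partial>L) = A * A"
proof -
  have m: "(\<lambda>h. \<alpha> (fst h) * \<alpha> (snd h)) \<in> borel_measurable L" by measurable
  show ?P "(\<integral>h. \<alpha> (fst h) * \<alpha> (snd h) \<partial>L) = A * A"
    by (rule integrable_nonneg_from_nn[OF m _ nn_AA]; simp add: alpha_nonneg A_nonneg)+
qed

lemma be_measurable [measurable]: "be \<in> borel_measurable borel"
  unfolding be_def[abs_def] by measurable

lemma be_integrable: "integrable L (\<lambda>h. \<alpha> (fst h) * \<alpha> (snd h) * \<beta> (x + snd h - fst h))"
proof (rule Bochner_Integration.integrable_bound)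
  show "integrable L (\<lambda>h. \<alpha> (fst h) * \<alpha> (snd h) * b0)" using integral_AA(1) by simp
  show "AE h in L. norm (\<alpha> (fst h) * \<alpha> (snd h) * \<beta> (x + snd h - fst h)) \<le> norm (\<alpha> (fst h) * \<alpha> (snd h) * b0)"
    using beta_bound b0_nonneg by (intro AE_I2) (auto simp: abs_mult alpha_nonneg beta_nonneg intro!: mult_left_mono)
qed measurable

lemma be_nonneg: "be x \<ge> 0"
  unfolding be_def by (intro integral_nonneg_AE) (simp add: alpha_nonneg beta_nonneg)

lemma nn_be: "(\<integral>\<^sup>+h. ennreal (\<alpha> (fst h) * \<alpha> (snd h) * \<beta> (x + snd h - fst h)) \<partial>L) = ennreal (be x)"
  unfolding be_def using be_integrable by (intro nn_integral_eq_integral) (auto simp: alpha_nonneg beta_nonneg)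

lemma integral_q: "(\<integral>h. q x (fst h) (snd h) \<partial>L) = A * A * \<beta> x + be x"
proof -
  have "(\<integral>h. q x (fst h) (snd h) \<partial>L) = (\<integral>h. \<alpha> (fst h) * \<alpha> (snd h) * \<beta> x + \<alpha> (fst h) * \<alpha> (snd h) * \<beta> (x + snd h - fst h) \<partial>L)"
    by (simp add: q_def distrib_left)
  then show ?thesis using integral_AA be_integrable[of x] by (simp add: be_def)
qed

lemma integral_kk: "(\<integral>Y. kk X Y \<partial>L) = A * A * \<beta> (snd X - fst X) + be (snd X - fst X)"
  using kk_integral_q[of "\<lambda>_. 1" X] by (simp add: integral_q)

lemma be_even: "be (- x) = be x"
proof -
  have "be (- x) = (\<integral>h. \<alpha> (snd h) * \<alpha> (fst h) * \<beta> (x + fst h - snd h) \<partial>L)"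
    unfolding be_def
  proof (rule Bochner_Integration.integral_cong[OF refl])
    fix h :: "'a \<times> 'a"
    have "\<beta> (- x + snd h - fst h) = \<beta> (x + fst h - snd h)"
      using beta_even[of "x + fst h - snd h"] by (simp add: algebra_simps)
    then show "\<alpha> (fst h) * \<alpha> (snd h) * \<beta> (- x + snd h - fst h) = \<alpha> (snd h) * \<alpha> (fst h) * \<beta> (x + fst h - snd h)" by simp
  qed
  also have "\<dots> = be x"
    unfolding be_def using lborel_pair.integral_product_swap[of "\<lambda>h. \<alpha> (fst h) * \<alpha> (snd h) * \<beta> (x + snd h - fst h)"] be_integrable[of x]
    by (simp add: case_prod_beta')
  finally show ?thesis .
qed

lemma be_mass: "integrable lborel be" "(\<integral>x. be x \<partial>lborel) = A * A * B"
proof -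
  have Qx: "(\<integral>\<^sup>+h. ennreal (q x (fst h) (snd h)) \<partial>L) = ennreal (A * A * \<beta> x) + ennreal (be x)" for x
    using q_integrable(1)[of x] integral_q[of x] A_nonneg beta_nonneg[of x] be_nonneg[of x]
    by (subst nn_integral_eq_integral) (auto simp: q_nonneg)
  have "ennreal (2 * A * A * B) = (\<integral>\<^sup>+x. ennreal (A * A * \<beta> x) + ennreal (be x) \<partial>lborel)"
    using nn_q_total by (simp only: Qx)
  also have "\<dots> = (\<integral>\<^sup>+x. ennreal (A * A) * ennreal (\<beta> x) \<partial>lborel) + (\<integral>\<^sup>+x. ennreal (be x) \<partial>lborel)"
    using A_nonneg by (subst nn_integral_add) (auto simp: ennreal_mult beta_nonneg)
  also have "\<dots> = ennreal (A * A * B) + (\<integral>\<^sup>+x. ennreal (be x) \<partial>lborel)"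
    using A_nonneg B_nonneg by (simp add: nn_integral_cmult nn_B ennreal_mult)
  finally have 1: "ennreal (2 * A * A * B) = ennreal (A * A * B) + (\<integral>\<^sup>+x. ennreal (be x) \<partial>lborel)" .
  have 2: "ennreal (2 * A * A * B) = ennreal (A * A * B) + ennreal (A * A * B)"
    using A_nonneg B_nonneg by (simp flip: ennreal_plus)
  have e: "(\<integral>\<^sup>+x. ennreal (be x) \<partial>lborel) = ennreal (A * A * B)"
    using 1 unfolding 2 by (simp add: ennreal_add_left_cancel)
  show "integrable lborel be" "(\<integral>x. be x \<partial>lborel) = A * A * B"
    by (rule integrable_nonneg_from_nn[OF _ be_nonneg e]; simp add: A_nonneg B_nonneg)+
qed

lemma nn_q_x: "(\<integral>\<^sup>+x. ennreal (q x h1 h2) \<partial>lborel) = ennreal (2 * B * (\<alpha> h1 * \<alpha> h2))"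
proof -
  have "(\<integral>\<^sup>+x. ennreal (q x h1 h2) \<partial>lborel) =
      (\<integral>\<^sup>+x. ennreal (\<alpha> h1 * \<alpha> h2) * (ennreal (\<beta> x) + ennreal (\<beta> (x + (h2 - h1)))) \<partial>lborel)"
    by (intro nn_integral_cong)
       (simp add: q_def ennreal_mult[symmetric] alpha_nonneg beta_nonneg add_diff_eq flip: ennreal_plus)
  also have "\<dots> = ennreal (\<alpha> h1 * \<alpha> h2) * ((\<integral>\<^sup>+x. ennreal (\<beta> x) \<partial>lborel) + (\<integral>\<^sup>+x. ennreal (\<beta> (x + (h2 - h1))) \<partial>lborel))"
    by (simp add: nn_integral_cmult nn_integral_add)
  also have "(\<integral>\<^sup>+x. ennreal (\<beta> (x + (h2 - h1))) \<partial>lborel) = (\<integral>\<^sup>+x. ennreal (\<beta> x) \<partial>lborel)"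
    by (rule nn_integral_shift[of "\<lambda>x. ennreal (\<beta> x)"]) measurable
  also have "ennreal (\<alpha> h1 * \<alpha> h2) * ((\<integral>\<^sup>+x. ennreal (\<beta> x) \<partial>lborel) + (\<integral>\<^sup>+x. ennreal (\<beta> x) \<partial>lborel)) = ennreal (2 * B * (\<alpha> h1 * \<alpha> h2))"
    using B_nonneg by (simp add: nn_B ennreal_mult[symmetric] alpha_nonneg flip: ennreal_plus)
  finally show ?thesis .
qed

end

context tilted_poisson
begin

definition E where "E x = exp (\<phi> x) - 1"
definition m where "m x = exp (- \<phi> x) - 1"
definition D where "D x = exp (2 * \<phi> x) - 1"
definition mm where "mm X = exp (- \<phi> (fst X) - \<phi> (snd X)) - 1"
definition pp where "pp X = exp (\<phi> (fst X) + \<phi> (snd X)) - 1"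

lemma EmD_measurable [measurable]: "E \<in> borel_measurable borel" "m \<in> borel_measurable borel" "D \<in> borel_measurable borel"
  "mm \<in> borel_measurable (borel \<Otimes>\<^sub>M borel)" "pp \<in> borel_measurable (borel \<Otimes>\<^sub>M borel)"
  unfolding E_def[abs_def] m_def[abs_def] D_def[abs_def] mm_def[abs_def] pp_def[abs_def] by measurable

lemma mm_eq: "mm X = m (fst X) + m (snd X) + m (fst X) * m (snd X)"
  by (simp add: mm_def m_def exp_diff exp_minus field_simps)

lemma pp_eq: "pp X = E (fst X) + E (snd X) + E (fst X) * E (snd X)"
  by (simp add: pp_def E_def exp_add algebra_simps)

lemma integrable_of_phi:
  assumes h: "continuous_on UNIV h" "h 0 = (0::real)"
  shows "integrable lborel (\<lambda>x. h (\<phi> x))"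
proof -
  obtain n where n: "\<And>x. x \<notin> ball 0 (real n) \<Longrightarrow> \<phi> x = 0" using compact_support_ball[OF phi] by blast
  obtain s where s: "s \<ge> 0" "\<And>x. \<bar>\<phi> x\<bar> \<le> s" using compact_support_bounded_range[OF phi] by blast
  have "compact (h ` {-s..s})" using h(1) by (intro compact_continuous_image) (auto intro: continuous_on_subset)
  then obtain c where c: "\<And>y. y \<in> h ` {-s..s} \<Longrightarrow> norm y \<le> c" using compact_imp_bounded bounded_iff by metis
  have cb: "\<bar>h (\<phi> x)\<bar> \<le> c" for x using c[of "h (\<phi> x)"] s(2)[of x] by (auto simp: abs_le_iff)
  have "integrable lborel (\<lambda>x. c * indicator (ball (0::'a) (real n)) x)"
    using emeasure_bounded[of "ball (0::'a) (real n)"] by simp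
  then show ?thesis
  proof (rule Bochner_Integration.integrable_bound)
    have "h \<in> borel_measurable borel" using h(1) by (rule borel_measurable_continuous_onI)
    then show "(\<lambda>x. h (\<phi> x)) \<in> borel_measurable lborel" by measurable
    have "norm (h (\<phi> x)) \<le> norm (c * indicator (ball (0::'a) (real n)) x)" for x
      using cb[of x] n[of x] h(2) by (cases "x \<in> ball 0 (real n)") auto
    then show "AE x in lborel. norm (h (\<phi> x)) \<le> norm (c * indicator (ball (0::'a) (real n)) x)" by simp
  qed
qed

lemma EmD_integrable [simp]: "integrable lborel E" "integrable lborel m" "integrable lborel D"
proof -
  have "continuous_on UNIV (\<lambda>y::real. exp y - 1)" "continuous_on UNIV (\<lambda>y::real. exp (- y) - 1)"
    "continuous_on UNIV (\<lambda>y::real. exp (2 * y) - 1)" by (intro continuous_intros)+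
  then show "integrable lborel E" "integrable lborel m" "integrable lborel D"
    unfolding E_def[abs_def] m_def[abs_def] D_def[abs_def]
    using integrable_of_phi[of "\<lambda>y. exp y - 1"] integrable_of_phi[of "\<lambda>y. exp (- y) - 1"] integrable_of_phi[of "\<lambda>y. exp (2 * y) - 1"]
    by simp_all
qed

text \<open>
  A single constant for the sizes of all functions of \<open>\<phi>\<close> that occur; it does
  not involve the jumps.
\<close>

definition size_bound where "size_bound S \<longleftrightarrow> S \<ge> 1 \<and>
  (\<forall>x. \<bar>E x\<bar> \<le> S \<and> \<bar>m x\<bar> \<le> S \<and> \<bar>D x\<bar> \<le> S \<and> exp (\<phi> x) \<le> S \<and> exp (- \<phi> x) \<le> S) \<and>
  (\<integral>x. \<bar>E x\<bar> \<partial>lborel) \<le> S \<and> (\<integral>x. \<bar>m x\<bar> \<partial>lborel) \<le> S \<and> (\<integral>x. \<bar>D x\<bar> \<partial>lborel) \<le> S"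

lemma size_bound_exists: "\<exists>S. size_bound S"
proof -
  obtain s where s: "s \<ge> 0" "\<And>x. \<bar>\<phi> x\<bar> \<le> s" using compact_support_bounded_range[OF phi] by blast
  let ?i = "(\<integral>x. \<bar>E x\<bar> \<partial>lborel) + (\<integral>x. \<bar>m x\<bar> \<partial>lborel) + (\<integral>x. \<bar>D x\<bar> \<partial>lborel)"
  have nn: "(\<integral>x. \<bar>E x\<bar> \<partial>lborel) \<ge> 0" "(\<integral>x. \<bar>m x\<bar> \<partial>lborel) \<ge> 0" "(\<integral>x. \<bar>D x\<bar> \<partial>lborel) \<ge> 0" by simp_all
  have "exp (\<phi> x) \<le> exp (2 * s)" "exp (- \<phi> x) \<le> exp (2 * s)" "exp (2 * \<phi> x) \<le> exp (2 * s)" for x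
    using s(1) s(2)[of x] by auto
  moreover have "\<bar>exp y - 1\<bar> \<le> 1 + exp (2 * s)" if "exp y \<le> exp (2 * s)" for y
    using that exp_gt_zero[of y] by linarith
  moreover have "1 + exp (2 * s) \<ge> 1" using exp_gt_zero[of "2 * s"] by linarith
  ultimately have "size_bound (1 + exp (2 * s) + ?i)"
    unfolding size_bound_def E_def m_def D_def using nn[unfolded E_def m_def D_def]
    by (intro conjI allI; (smt (verit))?)
  then show ?thesis by blast
qed

end

context jump_tilt
begin

text \<open>
  As a jump multiplies \<open>F\<close> by \<open>(1 + mm X) * (1 + pp Y)\<close>, the kernel
  \<open>G\<close> of the jump operator is governed by the integral \<open>Q\<close> of
  \<open>pp\<close> over the target, which is controlled by \<open>R\<close>.
\<close>

definition Q where "Q X = (\<integral>Y. kk X Y * pp Y \<partial>L)"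
definition R where "R X = (\<integral>Y. kk X Y * (\<bar>E (fst Y)\<bar> + \<bar>E (snd Y)\<bar>) \<partial>L)"
definition G where "G X = (\<integral>Y. kk X Y * (exp (\<phi> (fst Y) + \<phi> (snd Y) - \<phi> (fst X) - \<phi> (snd X)) - 1) \<partial>L)"

lemma kk_bounded_integrable:
  assumes [measurable]: "f \<in> borel_measurable (borel \<Otimes>\<^sub>M borel)" and "\<And>Y. \<bar>f Y\<bar> \<le> c"
  shows "integrable L (\<lambda>Y. kk X Y * f Y)"
proof (rule Bochner_Integration.integrable_bound)
  show "integrable L (\<lambda>Y. kk X Y * c)" using kk_integrable(1)[of X] by simp
  have "norm (kk X Y * f Y) \<le> norm (kk X Y * c)" for Y
    using assms(2)[of Y] by (auto simp: abs_mult intro!: mult_left_mono)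
  then show "AE Y in L. norm (kk X Y * f Y) \<le> norm (kk X Y * c)" by simp
  show "(\<lambda>Y. kk X Y * f Y) \<in> borel_measurable L" unfolding kk_def by measurable
qed

lemma QRG_measurable [measurable]: "Q \<in> borel_measurable (borel \<Otimes>\<^sub>M borel)" "R \<in> borel_measurable (borel \<Otimes>\<^sub>M borel)"
  "G \<in> borel_measurable (borel \<Otimes>\<^sub>M borel)"
  unfolding Q_def[abs_def] R_def[abs_def] G_def[abs_def] by measurable

lemma pp_bounded: "\<exists>c. \<forall>Y. \<bar>pp Y\<bar> \<le> c"
proof -
  obtain S where S: "size_bound S" using size_bound_exists by blast
  have "\<bar>pp Y\<bar> \<le> S + S + S * S" for Y
  proof -
    have "\<bar>pp Y\<bar> \<le> \<bar>E (fst Y)\<bar> + \<bar>E (snd Y)\<bar> + \<bar>E (fst Y)\<bar> * \<bar>E (snd Y)\<bar>"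
      unfolding pp_eq using abs_triangle_ineq[of "E (fst Y) + E (snd Y)" "E (fst Y) * E (snd Y)"]
        abs_triangle_ineq[of "E (fst Y)" "E (snd Y)"] by (simp add: abs_mult)
    also have "\<dots> \<le> S + S + S * S" using S by (intro add_mono mult_mono) (auto simp: size_bound_def)
    finally show ?thesis .
  qed
  then show ?thesis by blast
qed

lemma G_eq: "G X = mm X * (A * A * \<beta> (snd X - fst X) + be (snd X - fst X)) + (1 + mm X) * Q X"
proof -
  obtain c where c: "\<And>Y. \<bar>pp Y\<bar> \<le> c" using pp_bounded by blast
  have e: "exp (\<phi> (fst Y) + \<phi> (snd Y) - \<phi> (fst X) - \<phi> (snd X)) - 1 = mm X + (1 + mm X) * pp Y" for Y
    by (simp add: mm_def pp_def exp_add exp_diff exp_minus field_simps)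
  have "G X = (\<integral>Y. mm X * kk X Y + (1 + mm X) * (kk X Y * pp Y) \<partial>L)"
    unfolding G_def e by (intro Bochner_Integration.integral_cong refl) (simp add: algebra_simps)
  also have "\<dots> = mm X * (\<integral>Y. kk X Y \<partial>L) + (1 + mm X) * Q X"
    using kk_integrable(1)[of X] kk_bounded_integrable[of pp c X] c by (simp add: Q_def)
  finally show ?thesis by (simp add: integral_kk)
qed

lemma kk_swap: "kk (y, x) (b, a) = kk (x, y) (a, b)"
  unfolding kk_eq using beta_even[of "y - x"] beta_even[of "b - a"] by simp

lemma Q_sym: "Q (x, y) = Q (y, x)"
proof -
  obtain c where c: "\<And>Y. \<bar>pp Y\<bar> \<le> c" using pp_bounded by blast
  have i: "integrable L (\<lambda>Y. kk (x, y) Y * pp Y)" by (rule kk_bounded_integrable[OF _ c]) measurable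
  have "Q (x, y) = (\<integral>(a, b). kk (x, y) (b, a) * pp (b, a) \<partial>L)"
    unfolding Q_def using lborel_pair.integral_product_swap[of "\<lambda>Y. kk (x, y) Y * pp Y"] i by simp
  also have "\<dots> = Q (y, x)"
    unfolding Q_def by (intro Bochner_Integration.integral_cong refl) (auto simp: kk_swap pp_def add.commute)
  finally show ?thesis .
qed

lemma R_nonneg: "R X \<ge> 0" unfolding R_def by (intro integral_nonneg_AE) (simp add: kk_nonneg)

lemma nn_R: "ennreal (R X) = (\<integral>\<^sup>+Y. ennreal (kk X Y) * ennreal \<bar>E (fst Y)\<bar> + ennreal (kk X Y) * ennreal \<bar>E (snd Y)\<bar> \<partial>L)"
proof -
  obtain S where S: "size_bound S" using size_bound_exists by blast
  have i: "integrable L (\<lambda>Y. kk X Y * (\<bar>E (fst Y)\<bar> + \<bar>E (snd Y)\<bar>))"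
  proof (rule kk_bounded_integrable)
    show "\<bar>\<bar>E (fst Y)\<bar> + \<bar>E (snd Y)\<bar>\<bar> \<le> S + S" for Y
    proof -
      have "\<bar>E (fst Y)\<bar> \<le> S" "\<bar>E (snd Y)\<bar> \<le> S" using S by (auto simp: size_bound_def)
      then show ?thesis by linarith
    qed
  qed measurable
  have "ennreal (R X) = (\<integral>\<^sup>+Y. ennreal (kk X Y * (\<bar>E (fst Y)\<bar> + \<bar>E (snd Y)\<bar>)) \<partial>L)"
    unfolding R_def by (rule nn_integral_eq_integral[symmetric, OF i]) (simp add: kk_nonneg)
  then show ?thesis by (simp add: ennreal_mult kk_nonneg distrib_left)
qed

lemma R_swap: "R (x, y) = R (y, x)"
proof -
  have "ennreal (R (x, y)) = ennreal (R (y, x))"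
  proof -
    have "ennreal (R (x, y)) = (\<integral>\<^sup>+a. \<integral>\<^sup>+b. ennreal (kk (x, y) (a, b)) * ennreal \<bar>E a\<bar> + ennreal (kk (x, y) (a, b)) * ennreal \<bar>E b\<bar> \<partial>lborel \<partial>lborel)"
      unfolding nn_R kk_def by (subst nn_lborel_pair) auto
    also have "\<dots> = (\<integral>\<^sup>+b. \<integral>\<^sup>+a. ennreal (kk (x, y) (a, b)) * ennreal \<bar>E a\<bar> + ennreal (kk (x, y) (a, b)) * ennreal \<bar>E b\<bar> \<partial>lborel \<partial>lborel)"
      unfolding kk_def by (rule lborel_pair.Fubini') measurable
    also have "\<dots> = (\<integral>\<^sup>+b. \<integral>\<^sup>+a. ennreal (kk (y, x) (b, a)) * ennreal \<bar>E b\<bar> + ennreal (kk (y, x) (b, a)) * ennreal \<bar>E a\<bar> \<partial>lborel \<partial>lborel)"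
      by (simp add: kk_swap add.commute)
    also have "\<dots> = ennreal (R (y, x))"
      unfolding nn_R kk_def by (subst nn_lborel_pair) auto
    finally show ?thesis .
  qed
  then show ?thesis using R_nonneg by simp
qed

end

section \<open>Estimates for widely spread jumps\<close>

text \<open>
  The parameter \<open>\<delta>\<close> measures how thinly the jumps are spread: it bounds the
  weight of the jumps that end where \<open>\<beta>\<close> or \<open>exp \<phi> - 1\<close>
  lives. The estimates depend on the jumps only through \<open>\<delta>\<close> and their total
  mass.
\<close>

locale jump_limit = jump_tilt +
  fixes S \<delta> :: real
  assumes S: "size_bound S" and delta_nonneg: "\<delta> \<ge> 0"
    and delta_beta: "\<And>x. (\<integral>\<^sup>+h. ennreal (\<alpha> h * \<beta> (x + h)) \<partial>lborel) \<le> ennreal \<delta>"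
    and delta_E: "\<And>x. (\<integral>\<^sup>+h. ennreal (\<alpha> h * \<bar>E (x + h)\<bar>) \<partial>lborel) \<le> ennreal \<delta>"
begin

lemma S1: "S \<ge> 1" using S by (simp add: size_bound_def)
lemma S0: "S \<ge> 0" using S1 by simp

lemma bounds: "\<bar>E x\<bar> \<le> S" "\<bar>m x\<bar> \<le> S" "\<bar>D x\<bar> \<le> S" "exp (\<phi> x) \<le> S" "exp (- \<phi> x) \<le> S"
  using S by (auto simp: size_bound_def)

lemma masses: "(\<integral>x. \<bar>E x\<bar> \<partial>lborel) \<le> S" "(\<integral>x. \<bar>m x\<bar> \<partial>lborel) \<le> S" "(\<integral>x. \<bar>D x\<bar> \<partial>lborel) \<le> S"
  using S by (auto simp: size_bound_def)

lemma nn_masses: "(\<integral>\<^sup>+x. ennreal \<bar>E x\<bar> \<partial>lborel) \<le> ennreal S" "(\<integral>\<^sup>+x. ennreal \<bar>m x\<bar> \<partial>lborel) \<le> ennreal S"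
  "(\<integral>\<^sup>+x. ennreal \<bar>D x\<bar> \<partial>lborel) \<le> ennreal S"
  using masses by (auto simp: nn_integral_eq_integral ennreal_leI)

lemma mm_abs: "\<bar>mm X\<bar> \<le> (1 + S) * (\<bar>m (fst X)\<bar> + \<bar>m (snd X)\<bar>)"
proof -
  have "\<bar>mm X\<bar> \<le> \<bar>m (fst X)\<bar> + \<bar>m (snd X)\<bar> + \<bar>m (fst X)\<bar> * \<bar>m (snd X)\<bar>"
    unfolding mm_eq using abs_triangle_ineq[of "m (fst X) + m (snd X)" "m (fst X) * m (snd X)"]
      abs_triangle_ineq[of "m (fst X)" "m (snd X)"] by (simp add: abs_mult)
  also have "\<dots> \<le> \<bar>m (fst X)\<bar> + \<bar>m (snd X)\<bar> + S * \<bar>m (snd X)\<bar>"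
    using bounds by (intro add_left_mono mult_right_mono) auto
  also have "\<dots> \<le> (1 + S) * (\<bar>m (fst X)\<bar> + \<bar>m (snd X)\<bar>)" using S0 by (simp add: algebra_simps)
  finally show ?thesis .
qed

lemma pp_abs: "\<bar>pp X\<bar> \<le> (1 + S) * (\<bar>E (fst X)\<bar> + \<bar>E (snd X)\<bar>)"
proof -
  have "\<bar>pp X\<bar> \<le> \<bar>E (fst X)\<bar> + \<bar>E (snd X)\<bar> + \<bar>E (fst X)\<bar> * \<bar>E (snd X)\<bar>"
    unfolding pp_eq using abs_triangle_ineq[of "E (fst X) + E (snd X)" "E (fst X) * E (snd X)"]
      abs_triangle_ineq[of "E (fst X)" "E (snd X)"] by (simp add: abs_mult)
  also have "\<dots> \<le> \<bar>E (fst X)\<bar> + \<bar>E (snd X)\<bar> + S * \<bar>E (snd X)\<bar>"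
    using bounds by (intro add_left_mono mult_right_mono) auto
  also have "\<dots> \<le> (1 + S) * (\<bar>E (fst X)\<bar> + \<bar>E (snd X)\<bar>)" using S0 by (simp add: algebra_simps)
  finally show ?thesis .
qed

lemma one_mm: "0 \<le> 1 + mm X" "1 + mm X \<le> S * S"
proof -
  have e: "1 + mm X = exp (- \<phi> (fst X)) * exp (- \<phi> (snd X))" by (simp add: mm_def exp_add[symmetric])
  show "0 \<le> 1 + mm X" unfolding e by simp
  show "1 + mm X \<le> S * S" unfolding e using bounds S0 by (intro mult_mono) auto
qed

lemma pp_bound: "\<bar>pp X\<bar> \<le> (1 + S) * (S + S)"
  by (rule order_trans[OF pp_abs mult_left_mono[OF add_mono[OF bounds(1) bounds(1)]]]) (use S0 in simp)

lemma mm_bound: "\<bar>mm X\<bar> \<le> (1 + S) * (S + S)"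
  by (rule order_trans[OF mm_abs mult_left_mono[OF add_mono[OF bounds(2) bounds(2)]]]) (use S0 in simp)

lemma Q_abs: "\<bar>Q X\<bar> \<le> (1 + S) * R X"
proof -
  have i1: "integrable L (\<lambda>Y. kk X Y * pp Y)" by (rule kk_bounded_integrable[OF _ pp_bound]) measurable
  have i2: "integrable L (\<lambda>Y. kk X Y * (\<bar>E (fst Y)\<bar> + \<bar>E (snd Y)\<bar>))"
  proof (rule kk_bounded_integrable)
    show "\<bar>\<bar>E (fst Y)\<bar> + \<bar>E (snd Y)\<bar>\<bar> \<le> S + S" for Y
      using bounds(1)[of "fst Y"] bounds(1)[of "snd Y"] by linarith
  qed measurable
  have "\<bar>Q X\<bar> \<le> (\<integral>Y. \<bar>kk X Y * pp Y\<bar> \<partial>L)"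
    unfolding Q_def using integral_norm_bound[of L "\<lambda>Y. kk X Y * pp Y"] by simp
  also have "\<dots> \<le> (\<integral>Y. (1 + S) * (kk X Y * (\<bar>E (fst Y)\<bar> + \<bar>E (snd Y)\<bar>)) \<partial>L)"
  proof (rule integral_mono)
    fix Y
    show "\<bar>kk X Y * pp Y\<bar> \<le> (1 + S) * (kk X Y * (\<bar>E (fst Y)\<bar> + \<bar>E (snd Y)\<bar>))"
      using mult_left_mono[OF pp_abs[of Y] kk_nonneg[of X Y]] by (simp add: abs_mult kk_nonneg mult.left_commute)
  qed (use i1 i2 in auto)
  also have "\<dots> = (1 + S) * R X" by (simp add: R_def)
  finally show ?thesis .
qed

lemma nn_alpha_E: "(\<integral>\<^sup>+h. ennreal (\<alpha> (fst h) * \<alpha> (snd h)) * ennreal \<bar>E (x + fst h)\<bar> \<partial>L) \<le> ennreal (A * \<delta>)" (is ?Q)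
  "(\<integral>\<^sup>+h. ennreal (\<alpha> (fst h) * \<alpha> (snd h)) * ennreal \<bar>E (x + snd h)\<bar> \<partial>L) \<le> ennreal (A * \<delta>)" (is ?P)
proof -
  have d: "(\<integral>\<^sup>+h. ennreal (\<alpha> h) * ennreal \<bar>E (x + h)\<bar> \<partial>lborel) \<le> ennreal \<delta>"
    using delta_E[of x] by (simp add: ennreal_mult alpha_nonneg)
  have "(\<integral>\<^sup>+h. ennreal (\<alpha> (fst h) * \<alpha> (snd h)) * ennreal \<bar>E (x + fst h)\<bar> \<partial>L) =
      (\<integral>\<^sup>+a. \<integral>\<^sup>+b. (ennreal (\<alpha> a) * ennreal \<bar>E (x + a)\<bar>) * ennreal (\<alpha> b) \<partial>lborel \<partial>lborel)"
    by (subst nn_lborel_pair) (auto simp: ennreal_mult alpha_nonneg mult_ac)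
  also have "\<dots> = ennreal A * (\<integral>\<^sup>+h. ennreal (\<alpha> h) * ennreal \<bar>E (x + h)\<bar> \<partial>lborel)"
    by (simp add: nn_integral_cmult nn_integral_multc nn_A mult.commute)
  also have "\<dots> \<le> ennreal A * ennreal \<delta>" by (intro mult_left_mono d) simp
  finally show ?Q
    by (simp add: ennreal_mult A_nonneg delta_nonneg)
  have "(\<integral>\<^sup>+h. ennreal (\<alpha> (fst h) * \<alpha> (snd h)) * ennreal \<bar>E (x + snd h)\<bar> \<partial>L) =
      (\<integral>\<^sup>+a. \<integral>\<^sup>+b. ennreal (\<alpha> a) * (ennreal (\<alpha> b) * ennreal \<bar>E (x + b)\<bar>) \<partial>lborel \<partial>lborel)"
    by (subst nn_lborel_pair) (auto simp: ennreal_mult alpha_nonneg mult_ac)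
  also have "\<dots> = ennreal A * (\<integral>\<^sup>+h. ennreal (\<alpha> h) * ennreal \<bar>E (x + h)\<bar> \<partial>lborel)"
    by (simp add: nn_integral_cmult nn_integral_multc nn_A mult.commute)
  also have "\<dots> \<le> ennreal A * ennreal \<delta>" by (intro mult_left_mono d) simp
  finally show ?P
    by (simp add: ennreal_mult A_nonneg delta_nonneg)
qed

lemma q_le: "q x h1 h2 \<le> 2 * b0 * (\<alpha> h1 * \<alpha> h2)"
proof -
  have "q x h1 h2 \<le> \<alpha> h1 * \<alpha> h2 * (b0 + b0)"
    unfolding q_def by (intro mult_left_mono add_mono beta_bound) (simp add: alpha_nonneg)
  then show ?thesis by (simp add: algebra_simps)
qed

lemma R_le: "R X \<le> 4 * b0 * A * \<delta>"
proof -
  have one: "(\<integral>\<^sup>+Y. ennreal (kk X Y) * f Y \<partial>L) \<le> ennreal (2 * b0) * ennreal (A * \<delta>)"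
    if [measurable]: "f \<in> borel_measurable (borel \<Otimes>\<^sub>M borel)"
      and b: "(\<integral>\<^sup>+h. ennreal (\<alpha> (fst h) * \<alpha> (snd h)) * f (h + X) \<partial>L) \<le> ennreal (A * \<delta>)" for f
  proof -
    have "(\<integral>\<^sup>+Y. ennreal (kk X Y) * f Y \<partial>L) = (\<integral>\<^sup>+h. ennreal (q (snd X - fst X) (fst h) (snd h)) * f (h + X) \<partial>L)"
      by (rule nn_kk_q) measurable
    also have "\<dots> \<le> (\<integral>\<^sup>+h. ennreal (2 * b0) * (ennreal (\<alpha> (fst h) * \<alpha> (snd h)) * f (h + X)) \<partial>L)"
    proof (rule nn_integral_mono)
      fix h :: "'a \<times> 'a"
      have "ennreal (q (snd X - fst X) (fst h) (snd h)) \<le> ennreal (2 * b0) * ennreal (\<alpha> (fst h) * \<alpha> (snd h))"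
        using q_le[of "snd X - fst X" "fst h" "snd h"] b0_nonneg
        by (simp add: ennreal_mult[symmetric] alpha_nonneg ennreal_leI)
      from mult_right_mono[OF this, of "f (h + X)"]
      show "ennreal (q (snd X - fst X) (fst h) (snd h)) * f (h + X) \<le> ennreal (2 * b0) * (ennreal (\<alpha> (fst h) * \<alpha> (snd h)) * f (h + X))"
        by (simp add: mult.assoc)
    qed
    also have "\<dots> = ennreal (2 * b0) * (\<integral>\<^sup>+h. ennreal (\<alpha> (fst h) * \<alpha> (snd h)) * f (h + X) \<partial>L)"
    proof (rule nn_integral_cmult)
      have "(\<lambda>h. (fst h + fst X, snd h + snd X)) \<in> borel \<Otimes>\<^sub>M borel \<rightarrow>\<^sub>M (borel \<Otimes>\<^sub>M borel :: ('a \<times> 'a) measure)" by measurable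
      moreover have "(\<lambda>h. (fst h + fst X, snd h + snd X)) = (\<lambda>h. h + X)" by (auto simp: prod_eq_iff)
      ultimately have "(\<lambda>h. f (h + X)) \<in> borel_measurable (borel \<Otimes>\<^sub>M borel)" by (simp add: measurable_compose[OF _ that(1)])
      then show "(\<lambda>h. ennreal (\<alpha> (fst h) * \<alpha> (snd h)) * f (h + X)) \<in> borel_measurable L" by measurable
    qed
    also have "\<dots> \<le> ennreal (2 * b0) * ennreal (A * \<delta>)" by (intro mult_left_mono b) simp
    finally show ?thesis .
  qed
  have "ennreal (R X) = (\<integral>\<^sup>+Y. ennreal (kk X Y) * ennreal \<bar>E (fst Y)\<bar> \<partial>L) + (\<integral>\<^sup>+Y. ennreal (kk X Y) * ennreal \<bar>E (snd Y)\<bar> \<partial>L)"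
    unfolding nn_R kk_def by (rule nn_integral_add) measurable
  also have "\<dots> \<le> ennreal (2 * b0) * ennreal (A * \<delta>) + ennreal (2 * b0) * ennreal (A * \<delta>)"
    using nn_alpha_E(1)[of "fst X"] nn_alpha_E(2)[of "snd X"] by (intro add_mono one) (simp_all add: add.commute)
  also have "\<dots> = ennreal (4 * b0 * A * \<delta>)"
    using b0_nonneg A_nonneg delta_nonneg by (simp add: ennreal_mult[symmetric] flip: ennreal_plus)
  finally show ?thesis using b0_nonneg A_nonneg delta_nonneg by simp
qed

lemma R_total: "(\<integral>\<^sup>+X. ennreal (R X) \<partial>L) \<le> ennreal (4 * A * A * B * S)"
proof -
  have m1: "(\<lambda>w. ennreal (kk (fst w) (snd w)) * ennreal \<bar>E (fst (snd w))\<bar>) \<in> borel_measurable (L \<Otimes>\<^sub>M L)" by measurable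
  have m2: "(\<lambda>w. ennreal (kk (fst w) (snd w)) * ennreal \<bar>E (snd (snd w))\<bar>) \<in> borel_measurable (L \<Otimes>\<^sub>M L)" by measurable
  have "(\<integral>\<^sup>+X. ennreal (R X) \<partial>L) =
      (\<integral>\<^sup>+X. \<integral>\<^sup>+Y. ennreal (kk X Y) * ennreal \<bar>E (fst Y)\<bar> \<partial>L \<partial>L) + (\<integral>\<^sup>+X. \<integral>\<^sup>+Y. ennreal (kk X Y) * ennreal \<bar>E (snd Y)\<bar> \<partial>L \<partial>L)"
    unfolding nn_R by (rule nn_integral_add2[OF sigma_finite_L m1 m2])
  also have "\<dots> = ennreal (2 * A * A * B) * (\<integral>\<^sup>+x. ennreal \<bar>E x\<bar> \<partial>lborel) + ennreal (2 * A * A * B) * (\<integral>\<^sup>+x. ennreal \<bar>E x\<bar> \<partial>lborel)"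
    using nn_kk_commute[of "\<lambda>Y. ennreal \<bar>E (fst Y)\<bar>"] nn_kk_commute[of "\<lambda>Y. ennreal \<bar>E (snd Y)\<bar>"]
      nn_kk_fst[of "\<lambda>x. ennreal \<bar>E x\<bar>"] nn_kk_snd[of "\<lambda>x. ennreal \<bar>E x\<bar>"] by simp
  also have "\<dots> \<le> ennreal (2 * A * A * B) * ennreal S + ennreal (2 * A * A * B) * ennreal S"
    by (intro add_mono mult_left_mono nn_masses) auto
  also have "\<dots> = ennreal (4 * A * A * B * S)"
    using A_nonneg B_nonneg S0 by (simp add: ennreal_mult[symmetric] flip: ennreal_plus)
  finally show ?thesis .
qed

lemma nn_L_swap: "(\<integral>\<^sup>+y. \<integral>\<^sup>+h. f y h \<partial>L \<partial>lborel) = (\<integral>\<^sup>+h. \<integral>\<^sup>+y. f y h \<partial>lborel \<partial>L)"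
  if "(\<lambda>(y, h). f y h) \<in> borel_measurable (lborel \<Otimes>\<^sub>M L)" for f :: "'a \<Rightarrow> 'a \<times> 'a \<Rightarrow> ennreal"
proof -
  interpret P: pair_sigma_finite "lborel :: 'a measure" L by (intro pair_sigma_finite.intro sigma_finite_lborel sigma_finite_L)
  show ?thesis by (rule P.Fubini'[OF that, symmetric])
qed

lemma R_section_fst: "(\<integral>\<^sup>+y. \<integral>\<^sup>+Y. ennreal (kk (x, y) Y) * ennreal \<bar>E (fst Y)\<bar> \<partial>L \<partial>lborel) \<le> ennreal (2 * A * B * \<delta>)"
proof -
  have "(\<integral>\<^sup>+y. \<integral>\<^sup>+Y. ennreal (kk (x, y) Y) * ennreal \<bar>E (fst Y)\<bar> \<partial>L \<partial>lborel) =
      (\<integral>\<^sup>+y. \<integral>\<^sup>+h. ennreal (q (y - x) (fst h) (snd h)) * ennreal \<bar>E (x + fst h)\<bar> \<partial>L \<partial>lborel)"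
    using nn_kk_q[of "\<lambda>Y. ennreal \<bar>E (fst Y)\<bar>"] by (simp add: add.commute)
  also have "\<dots> = (\<integral>\<^sup>+h. \<integral>\<^sup>+y. ennreal (q (y - x) (fst h) (snd h)) * ennreal \<bar>E (x + fst h)\<bar> \<partial>lborel \<partial>L)"
    by (rule nn_L_swap) measurable
  also have "\<dots> = (\<integral>\<^sup>+h. ennreal (2 * B) * (ennreal (\<alpha> (fst h) * \<alpha> (snd h)) * ennreal \<bar>E (x + fst h)\<bar>) \<partial>L)"
  proof (rule nn_integral_cong)
    fix h :: "'a \<times> 'a"
    have "(\<integral>\<^sup>+y. ennreal (q (y - x) (fst h) (snd h)) \<partial>lborel) = ennreal (2 * B) * ennreal (\<alpha> (fst h) * \<alpha> (snd h))"
      using nn_integral_shift[of "\<lambda>y. ennreal (q y (fst h) (snd h))" "- x"] nn_q_x B_nonneg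
      by (simp add: ennreal_mult alpha_nonneg)
    then show "(\<integral>\<^sup>+y. ennreal (q (y - x) (fst h) (snd h)) * ennreal \<bar>E (x + fst h)\<bar> \<partial>lborel) =
        ennreal (2 * B) * (ennreal (\<alpha> (fst h) * \<alpha> (snd h)) * ennreal \<bar>E (x + fst h)\<bar>)"
      by (simp add: nn_integral_multc mult.assoc)
  qed
  also have "\<dots> = ennreal (2 * B) * (\<integral>\<^sup>+h. ennreal (\<alpha> (fst h) * \<alpha> (snd h)) * ennreal \<bar>E (x + fst h)\<bar> \<partial>L)"
    by (rule nn_integral_cmult) measurable
  also have "\<dots> \<le> ennreal (2 * B) * ennreal (A * \<delta>)" by (intro mult_left_mono nn_alpha_E) simp
  also have "\<dots> = ennreal (2 * A * B * \<delta>)" using A_nonneg B_nonneg delta_nonneg by (simp add: ennreal_mult[symmetric] mult_ac)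
  finally show ?thesis .
qed

lemma nn_beta_back: "(\<integral>\<^sup>+h. ennreal (\<alpha> (fst h) * \<alpha> (snd h)) * ennreal (\<beta> (y - (x + fst h))) \<partial>L) \<le> ennreal (A * \<delta>)"
proof -
  have "(\<integral>\<^sup>+h. ennreal (\<alpha> (fst h) * \<alpha> (snd h)) * ennreal (\<beta> (y - (x + fst h))) \<partial>L) =
      (\<integral>\<^sup>+a. \<integral>\<^sup>+b. (ennreal (\<alpha> a * \<beta> ((x - y) + a))) * ennreal (\<alpha> b) \<partial>lborel \<partial>lborel)"
  proof -
    have "\<beta> (y - (x + a)) = \<beta> ((x - y) + a)" for a using beta_even[of "(x - y) + a"] by (simp add: algebra_simps)
    then show ?thesis by (subst nn_lborel_pair) (auto simp: ennreal_mult alpha_nonneg beta_nonneg mult_ac)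
  qed
  also have "\<dots> = ennreal A * (\<integral>\<^sup>+a. ennreal (\<alpha> a * \<beta> ((x - y) + a)) \<partial>lborel)"
    by (simp add: nn_integral_cmult nn_integral_multc nn_A mult.commute)
  also have "\<dots> \<le> ennreal A * ennreal \<delta>" by (intro mult_left_mono delta_beta) simp
  finally show ?thesis by (simp add: ennreal_mult A_nonneg delta_nonneg)
qed

text \<open>
  For the part of the rate that depends on the starting positions, a long jump rarely ends in
  the support of \<open>\<phi>\<close>; for the part that depends on the target positions, the
  first point rarely ends close to the target of the second.
\<close>

lemma R_section_snd: "(\<integral>\<^sup>+y. \<integral>\<^sup>+Y. ennreal (kk (x, y) Y) * ennreal \<bar>E (snd Y)\<bar> \<partial>L \<partial>lborel) \<le> ennreal ((A * B + A * S) * \<delta>)"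
proof -
  let ?a = "\<lambda>h. ennreal (\<alpha> (fst h) * \<alpha> (snd h))"
  have m1: "(\<lambda>w. ennreal (\<beta> (fst w - x)) * (?a (snd w) * ennreal \<bar>E (fst w + snd (snd w))\<bar>)) \<in> borel_measurable (lborel \<Otimes>\<^sub>M L)" by measurable
  have m2: "(\<lambda>w. ?a (snd w) * ennreal (\<beta> (fst w + snd (snd w) - (x + fst (snd w)))) * ennreal \<bar>E (fst w + snd (snd w))\<bar>)
    \<in> borel_measurable (lborel \<Otimes>\<^sub>M L)" by measurable
  have "(\<integral>\<^sup>+y. \<integral>\<^sup>+Y. ennreal (kk (x, y) Y) * ennreal \<bar>E (snd Y)\<bar> \<partial>L \<partial>lborel) =
      (\<integral>\<^sup>+y. \<integral>\<^sup>+h. ennreal (q (y - x) (fst h) (snd h)) * ennreal \<bar>E (y + snd h)\<bar> \<partial>L \<partial>lborel)"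
    using nn_kk_q[of "\<lambda>Y. ennreal \<bar>E (snd Y)\<bar>"] by (simp add: add.commute)
  also have "\<dots> = (\<integral>\<^sup>+y. \<integral>\<^sup>+h. ennreal (\<beta> (y - x)) * (?a h * ennreal \<bar>E (y + snd h)\<bar>) +
      ?a h * ennreal (\<beta> (y + snd h - (x + fst h))) * ennreal \<bar>E (y + snd h)\<bar> \<partial>L \<partial>lborel)"
  proof (intro nn_integral_cong)
    fix y and h :: "'a \<times> 'a"
    have "q (y - x) (fst h) (snd h) = \<beta> (y - x) * (\<alpha> (fst h) * \<alpha> (snd h)) + \<alpha> (fst h) * \<alpha> (snd h) * \<beta> (y + snd h - (x + fst h))"
      by (simp add: q_def algebra_simps)
    then have "ennreal (q (y - x) (fst h) (snd h)) = ennreal (\<beta> (y - x)) * ?a h + ?a h * ennreal (\<beta> (y + snd h - (x + fst h)))"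
      by (simp add: ennreal_mult alpha_nonneg beta_nonneg)
    then show "ennreal (q (y - x) (fst h) (snd h)) * ennreal \<bar>E (y + snd h)\<bar> =
       ennreal (\<beta> (y - x)) * (?a h * ennreal \<bar>E (y + snd h)\<bar>) + ?a h * ennreal (\<beta> (y + snd h - (x + fst h))) * ennreal \<bar>E (y + snd h)\<bar>"
      by (simp add: distrib_right mult.assoc)
  qed
  also have "\<dots> = (\<integral>\<^sup>+y. \<integral>\<^sup>+h. ennreal (\<beta> (y - x)) * (?a h * ennreal \<bar>E (y + snd h)\<bar>) \<partial>L \<partial>lborel) +
      (\<integral>\<^sup>+y. \<integral>\<^sup>+h. ?a h * ennreal (\<beta> (y + snd h - (x + fst h))) * ennreal \<bar>E (y + snd h)\<bar> \<partial>L \<partial>lborel)"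
    by (rule nn_integral_add2[OF sigma_finite_L m1 m2])
  also have "\<dots> \<le> ennreal (A * B * \<delta>) + ennreal (A * S * \<delta>)"
  proof (rule add_mono)
    have "(\<integral>\<^sup>+y. \<integral>\<^sup>+h. ennreal (\<beta> (y - x)) * (?a h * ennreal \<bar>E (y + snd h)\<bar>) \<partial>L \<partial>lborel) \<le>
        (\<integral>\<^sup>+y. ennreal (\<beta> (y - x)) * ennreal (A * \<delta>) \<partial>lborel)"
    proof (rule nn_integral_mono)
      fix y
      have "(\<integral>\<^sup>+h. ennreal (\<beta> (y - x)) * (?a h * ennreal \<bar>E (y + snd h)\<bar>) \<partial>L) =
          ennreal (\<beta> (y - x)) * (\<integral>\<^sup>+h. ?a h * ennreal \<bar>E (y + snd h)\<bar> \<partial>L)" by (rule nn_integral_cmult) measurable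
      also have "\<dots> \<le> ennreal (\<beta> (y - x)) * ennreal (A * \<delta>)" by (intro mult_left_mono nn_alpha_E) simp
      finally show "(\<integral>\<^sup>+h. ennreal (\<beta> (y - x)) * (?a h * ennreal \<bar>E (y + snd h)\<bar>) \<partial>L) \<le> ennreal (\<beta> (y - x)) * ennreal (A * \<delta>)" .
    qed
    also have "\<dots> = ennreal B * ennreal (A * \<delta>)"
      using nn_integral_shift[of "\<lambda>y. ennreal (\<beta> y)" "- x"] by (simp add: nn_integral_multc nn_B)
    also have "\<dots> = ennreal (A * B * \<delta>)" using A_nonneg B_nonneg delta_nonneg by (simp add: ennreal_mult[symmetric] mult_ac)
    finally show "(\<integral>\<^sup>+y. \<integral>\<^sup>+h. ennreal (\<beta> (y - x)) * (?a h * ennreal \<bar>E (y + snd h)\<bar>) \<partial>L \<partial>lborel) \<le> ennreal (A * B * \<delta>)" .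
    have "(\<integral>\<^sup>+y. \<integral>\<^sup>+h. ?a h * ennreal (\<beta> (y + snd h - (x + fst h))) * ennreal \<bar>E (y + snd h)\<bar> \<partial>L \<partial>lborel) =
        (\<integral>\<^sup>+h. \<integral>\<^sup>+y. ?a h * ennreal (\<beta> (y + snd h - (x + fst h))) * ennreal \<bar>E (y + snd h)\<bar> \<partial>lborel \<partial>L)"
      by (rule nn_L_swap) measurable
    also have "\<dots> = (\<integral>\<^sup>+h. \<integral>\<^sup>+y. ?a h * ennreal (\<beta> (y - (x + fst h))) * ennreal \<bar>E y\<bar> \<partial>lborel \<partial>L)"
    proof (rule nn_integral_cong)
      fix h :: "'a \<times> 'a"
      show "(\<integral>\<^sup>+y. ?a h * ennreal (\<beta> (y + snd h - (x + fst h))) * ennreal \<bar>E (y + snd h)\<bar> \<partial>lborel) =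
          (\<integral>\<^sup>+y. ?a h * ennreal (\<beta> (y - (x + fst h))) * ennreal \<bar>E y\<bar> \<partial>lborel)"
        by (rule nn_integral_shift[of "\<lambda>y. ?a h * ennreal (\<beta> (y - (x + fst h))) * ennreal \<bar>E y\<bar>"]) measurable
    qed
    also have "\<dots> = (\<integral>\<^sup>+y. \<integral>\<^sup>+h. ?a h * ennreal (\<beta> (y - (x + fst h))) * ennreal \<bar>E y\<bar> \<partial>L \<partial>lborel)"
      by (rule nn_L_swap[symmetric]) measurable
    also have "\<dots> \<le> (\<integral>\<^sup>+y. ennreal (A * \<delta>) * ennreal \<bar>E y\<bar> \<partial>lborel)"
    proof (rule nn_integral_mono)
      fix y
      have "(\<integral>\<^sup>+h. ?a h * ennreal (\<beta> (y - (x + fst h))) * ennreal \<bar>E y\<bar> \<partial>L) =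
          (\<integral>\<^sup>+h. ?a h * ennreal (\<beta> (y - (x + fst h))) \<partial>L) * ennreal \<bar>E y\<bar>" by (rule nn_integral_multc) measurable
      then show "(\<integral>\<^sup>+h. ?a h * ennreal (\<beta> (y - (x + fst h))) * ennreal \<bar>E y\<bar> \<partial>L) \<le> ennreal (A * \<delta>) * ennreal \<bar>E y\<bar>"
        using nn_beta_back[of y x] by (simp add: mult_right_mono)
    qed
    also have "\<dots> \<le> ennreal (A * \<delta>) * ennreal S" by (simp add: nn_integral_cmult mult_left_mono nn_masses)
    also have "\<dots> = ennreal (A * S * \<delta>)" using A_nonneg S0 delta_nonneg by (simp add: ennreal_mult[symmetric] mult_ac)
    finally show "(\<integral>\<^sup>+y. \<integral>\<^sup>+h. ?a h * ennreal (\<beta> (y + snd h - (x + fst h))) * ennreal \<bar>E (y + snd h)\<bar> \<partial>L \<partial>lborel) \<le> ennreal (A * S * \<delta>)" .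
  qed
  also have "\<dots> = ennreal ((A * B + A * S) * \<delta>)"
    using A_nonneg B_nonneg S0 delta_nonneg by (simp add: distrib_right flip: ennreal_plus)
  finally show ?thesis .
qed

definition cR where "cR = (3 * A * B + A * S) * \<delta>"

lemma R_section: "(\<integral>\<^sup>+y. ennreal (R (x, y)) \<partial>lborel) \<le> ennreal cR"
proof -
  have m1: "(\<lambda>w. ennreal (kk (x, fst w) (snd w)) * ennreal \<bar>E (fst (snd w))\<bar>) \<in> borel_measurable (lborel \<Otimes>\<^sub>M L)" unfolding kk_def fst_conv snd_conv by measurable
  have m2: "(\<lambda>w. ennreal (kk (x, fst w) (snd w)) * ennreal \<bar>E (snd (snd w))\<bar>) \<in> borel_measurable (lborel \<Otimes>\<^sub>M L)" unfolding kk_def fst_conv snd_conv by measurable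
  have "(\<integral>\<^sup>+y. ennreal (R (x, y)) \<partial>lborel) = (\<integral>\<^sup>+y. \<integral>\<^sup>+Y. ennreal (kk (x, y) Y) * ennreal \<bar>E (fst Y)\<bar> \<partial>L \<partial>lborel) +
      (\<integral>\<^sup>+y. \<integral>\<^sup>+Y. ennreal (kk (x, y) Y) * ennreal \<bar>E (snd Y)\<bar> \<partial>L \<partial>lborel)"
    unfolding nn_R by (rule nn_integral_add2[OF sigma_finite_L m1 m2])
  also have "\<dots> \<le> ennreal (2 * A * B * \<delta>) + ennreal ((A * B + A * S) * \<delta>)"
    by (intro add_mono R_section_fst R_section_snd)
  also have "\<dots> = ennreal cR" unfolding cR_def
    using A_nonneg B_nonneg S0 delta_nonneg by (simp add: algebra_simps flip: ennreal_plus)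
  finally show ?thesis .
qed

lemma cR_nonneg: "cR \<ge> 0" using A_nonneg B_nonneg S0 delta_nonneg by (simp add: cR_def)

lemma be_le: "be x \<le> A * \<delta>"
proof -
  have "ennreal (be x) = (\<integral>\<^sup>+a. \<integral>\<^sup>+b. ennreal (\<alpha> a) * ennreal (\<alpha> b * \<beta> ((x - a) + b)) \<partial>lborel \<partial>lborel)"
    unfolding nn_be[symmetric]
    by (subst nn_lborel_pair) (auto simp: ennreal_mult[symmetric] alpha_nonneg beta_nonneg algebra_simps)
  also have "\<dots> \<le> (\<integral>\<^sup>+a. ennreal (\<alpha> a) * ennreal \<delta> \<partial>lborel)"
    by (intro nn_integral_mono) (simp add: nn_integral_cmult mult_left_mono delta_beta)
  also have "\<dots> = ennreal (A * \<delta>)" by (simp add: nn_integral_multc nn_A ennreal_mult A_nonneg delta_nonneg)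
  finally show ?thesis using A_nonneg delta_nonneg by simp
qed

text \<open>
  The part of \<open>G\<close> that remains after splitting off the term \<open>A\<^sup>2 *
  \<beta> * mm\<close>, which does not change with the scaling.
\<close>

definition K2 where "K2 X = mm X * be (snd X - fst X) + (1 + mm X) * Q X"
definition wm where "wm = z * S * S"

lemma wm: "w x \<le> wm" "wm \<ge> 0"
proof -
  have "w x = z * (exp (\<phi> x) * exp (\<phi> x))" by (simp add: w_def exp_add[symmetric])
  also have "\<dots> \<le> z * (S * S)" using bounds(4)[of x] S0 z_pos by (intro mult_left_mono mult_mono) auto
  finally show "w x \<le> wm" by (simp add: wm_def mult.assoc)
  show "wm \<ge> 0" using z_pos S0 by (simp add: wm_def)
qed

lemma K2_measurable [measurable]: "K2 \<in> borel_measurable (borel \<Otimes>\<^sub>M borel)"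
  unfolding K2_def[abs_def] by measurable

lemma K2_eq: "G X = A * A * (\<beta> (snd X - fst X) * mm X) + K2 X"
  by (simp add: G_eq K2_def algebra_simps)

lemma K2_sym: "K2 (x, y) = K2 (y, x)"
proof -
  have "mm (x, y) = mm (y, x)" by (simp add: mm_def diff_diff_eq add.commute)
  moreover have "be (y - x) = be (x - y)" using be_even[of "x - y"] by simp
  ultimately show ?thesis using Q_sym[of x y] by (simp add: K2_def)
qed

lemma K2_abs: "\<bar>K2 X\<bar> \<le> (1 + S) * (be (snd X - fst X) * \<bar>m (fst X)\<bar> + be (snd X - fst X) * \<bar>m (snd X)\<bar>) + S * S * (1 + S) * R X"
proof -
  have "\<bar>K2 X\<bar> \<le> \<bar>mm X\<bar> * be (snd X - fst X) + (1 + mm X) * \<bar>Q X\<bar>"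
    unfolding K2_def using abs_triangle_ineq[of "mm X * be (snd X - fst X)" "(1 + mm X) * Q X"] one_mm(1)[of X] be_nonneg
    by (simp add: abs_mult)
  also have "\<dots> \<le> (1 + S) * (\<bar>m (fst X)\<bar> + \<bar>m (snd X)\<bar>) * be (snd X - fst X) + S * S * ((1 + S) * R X)"
    using S0 R_nonneg[of X] by (intro add_mono mult_right_mono mm_abs be_nonneg mult_mono one_mm Q_abs) auto
  finally show ?thesis by (simp add: algebra_simps)
qed

text \<open>
  Bounds for \<open>K2\<close>: pointwise, for its total mass, and for its mass in one variable.
  The first is small and the second bounded, so that the \<open>L\<^sup>2\<close> norm is small
  as well.
\<close>

definition csup where "csup = ((1 + S) * (A * S + A * S) + S * S * (1 + S) * (4 * b0 * A)) * \<delta>"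
definition ctot where "ctot = (1 + S) * (2 * (A * A * B) * S) + S * S * (1 + S) * (4 * A * A * B * S)"
definition csec where "csec = (1 + S) * (A * A * B * S + A * \<delta> * S) + S * S * (1 + S) * cR"

lemma K2_sup: "\<bar>K2 X\<bar> \<le> csup"
proof -
  have "be (snd X - fst X) * \<bar>m y\<bar> \<le> A * \<delta> * S" for y
    using be_le bounds(2) be_nonneg A_nonneg delta_nonneg by (intro mult_mono) auto
  then have "\<bar>K2 X\<bar> \<le> (1 + S) * (A * \<delta> * S + A * \<delta> * S) + S * S * (1 + S) * (4 * b0 * A * \<delta>)"
    using S0 by (intro order_trans[OF K2_abs] add_mono mult_left_mono R_le) auto
  then show ?thesis by (simp add: csup_def algebra_simps)
qed

lemma nn_be_m: "(\<integral>\<^sup>+X. ennreal (be (snd X - fst X) * \<bar>m (fst X)\<bar>) \<partial>L) \<le> ennreal (A * A * B * S)" (is ?Q)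
  "(\<integral>\<^sup>+X. ennreal (be (snd X - fst X) * \<bar>m (snd X)\<bar>) \<partial>L) \<le> ennreal (A * A * B * S)" (is ?P)
proof -
  have im: "integrable lborel (\<lambda>x. \<bar>m x\<bar>)" by simp
  have AB: "A * A * B * (\<integral>x. \<bar>m x\<bar> \<partial>lborel) \<le> A * A * B * S" using masses A_nonneg B_nonneg by (intro mult_left_mono) auto
  note d = diff_kernel[OF be_mass(1) be_even im, unfolded be_mass(2)]
  show ?Q
    using AB by (subst nn_integral_eq_integral[OF d(1)]) (auto simp: be_nonneg d(2) intro: ennreal_leI)
  show ?P
    using AB by (subst nn_integral_eq_integral[OF d(3)]) (auto simp: be_nonneg d(4) intro: ennreal_leI)
qed

lemma nn_be_section: "(\<integral>\<^sup>+y. ennreal (be (y - x)) \<partial>lborel) = ennreal (A * A * B)" (is ?R)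
  "(\<integral>\<^sup>+y. ennreal (be (y - x) * \<bar>m y\<bar>) \<partial>lborel) \<le> ennreal (A * \<delta> * S)" (is ?Q)
  "(\<integral>\<^sup>+y. ennreal (be (y - x) * \<bar>D y\<bar>) \<partial>lborel) \<le> ennreal (A * \<delta> * S)" (is ?P)
proof -
  have "(\<integral>\<^sup>+y. ennreal (be (y - x)) \<partial>lborel) = (\<integral>\<^sup>+y. ennreal (be y) \<partial>lborel)"
    using nn_integral_shift[of "\<lambda>y. ennreal (be y)" "- x"] by simp
  also have "\<dots> = ennreal (A * A * B)" using be_mass by (subst nn_integral_eq_integral) (auto simp: be_nonneg)
  finally show ?R .
  have *: "(\<integral>\<^sup>+y. ennreal (be (y - x) * \<bar>f y\<bar>) \<partial>lborel) \<le> ennreal (A * \<delta> * S)"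
    if [measurable]: "f \<in> borel_measurable borel" and f: "(\<integral>\<^sup>+y. ennreal \<bar>f y\<bar> \<partial>lborel) \<le> ennreal S" for f :: "'a \<Rightarrow> real"
  proof -
    have "(\<integral>\<^sup>+y. ennreal (be (y - x) * \<bar>f y\<bar>) \<partial>lborel) \<le> (\<integral>\<^sup>+y. ennreal (A * \<delta>) * ennreal \<bar>f y\<bar> \<partial>lborel)"
    proof (rule nn_integral_mono)
      fix y
      have "be (y - x) * \<bar>f y\<bar> \<le> (A * \<delta>) * \<bar>f y\<bar>" by (intro mult_right_mono be_le) simp
      then show "ennreal (be (y - x) * \<bar>f y\<bar>) \<le> ennreal (A * \<delta>) * ennreal \<bar>f y\<bar>"
        using A_nonneg delta_nonneg by (simp add: ennreal_mult[symmetric] ennreal_leI)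
    qed
    also have "\<dots> = ennreal (A * \<delta>) * (\<integral>\<^sup>+y. ennreal \<bar>f y\<bar> \<partial>lborel)" by (rule nn_integral_cmult) measurable
    also have "\<dots> \<le> ennreal (A * \<delta>) * ennreal S" by (intro mult_left_mono f) simp
    finally show ?thesis using A_nonneg delta_nonneg S0 by (simp add: ennreal_mult)
  qed
  show ?Q by (rule *[OF _ nn_masses(2)]) measurable
  show ?P by (rule *[OF _ nn_masses(3)]) measurable
qed

lemma K2_nn_abs: "ennreal \<bar>K2 X\<bar> \<le> ennreal (1 + S) * (ennreal (be (snd X - fst X) * \<bar>m (fst X)\<bar>) + ennreal (be (snd X - fst X) * \<bar>m (snd X)\<bar>))
   + ennreal (S * S * (1 + S)) * ennreal (R X)"
proof -
  have "ennreal \<bar>K2 X\<bar> \<le> ennreal ((1 + S) * (be (snd X - fst X) * \<bar>m (fst X)\<bar> + be (snd X - fst X) * \<bar>m (snd X)\<bar>) + S * S * (1 + S) * R X)"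
    by (intro ennreal_leI K2_abs)
  also have "\<dots> = ennreal (1 + S) * ennreal (be (snd X - fst X) * \<bar>m (fst X)\<bar> + be (snd X - fst X) * \<bar>m (snd X)\<bar>)
      + ennreal (S * S * (1 + S)) * ennreal (R X)"
    using S0 R_nonneg[of X] be_nonneg by (subst ennreal_plus) (auto simp: ennreal_mult simp del: ennreal_plus)
  finally show ?thesis using be_nonneg by simp
qed

lemma K2_total: "(\<integral>\<^sup>+X. ennreal \<bar>K2 X\<bar> \<partial>L) \<le> ennreal ctot"
proof -
  let ?a = "\<lambda>X. ennreal (be (snd X - fst X) * \<bar>m (fst X)\<bar>)"
  let ?b = "\<lambda>X. ennreal (be (snd X - fst X) * \<bar>m (snd X)\<bar>)"
  have m: "?a \<in> borel_measurable L" "?b \<in> borel_measurable L" "(\<lambda>X. ennreal (R X)) \<in> borel_measurable L" by measurable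
  have "(\<integral>\<^sup>+X. ennreal \<bar>K2 X\<bar> \<partial>L) \<le> (\<integral>\<^sup>+X. ennreal (1 + S) * (?a X + ?b X) + ennreal (S * S * (1 + S)) * ennreal (R X) \<partial>L)"
    by (intro nn_integral_mono K2_nn_abs)
  also have "\<dots> = ennreal (1 + S) * ((\<integral>\<^sup>+X. ?a X \<partial>L) + (\<integral>\<^sup>+X. ?b X \<partial>L)) + ennreal (S * S * (1 + S)) * (\<integral>\<^sup>+X. ennreal (R X) \<partial>L)"
    using m by (simp add: nn_integral_add nn_integral_cmult)
  also have "\<dots> \<le> ennreal (1 + S) * (ennreal (A * A * B * S) + ennreal (A * A * B * S)) + ennreal (S * S * (1 + S)) * ennreal (4 * A * A * B * S)"
    by (intro add_mono mult_left_mono nn_be_m R_total) auto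
  also have "\<dots> = ennreal ctot"
    using S0 A_nonneg B_nonneg by (simp add: ctot_def ennreal_mult[symmetric] flip: ennreal_plus)
  finally show ?thesis .
qed

lemma K2_section: "(\<integral>\<^sup>+y. ennreal \<bar>K2 (x, y)\<bar> \<partial>lborel) \<le> ennreal csec"
proof -
  let ?a = "\<lambda>y. ennreal (be (y - x)) * ennreal \<bar>m x\<bar>"
  let ?b = "\<lambda>y. ennreal (be (y - x) * \<bar>m y\<bar>)"
  have m: "?a \<in> borel_measurable borel" "?b \<in> borel_measurable borel" "(\<lambda>y. ennreal (R (x, y))) \<in> borel_measurable borel" by measurable
  have "(\<integral>\<^sup>+y. ennreal \<bar>K2 (x, y)\<bar> \<partial>lborel) \<le> (\<integral>\<^sup>+y. ennreal (1 + S) * (?a y + ?b y) + ennreal (S * S * (1 + S)) * ennreal (R (x, y)) \<partial>lborel)"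
    using K2_nn_abs[of "(x, y)" for y] be_nonneg by (intro nn_integral_mono) (simp add: ennreal_mult)
  also have "\<dots> = ennreal (1 + S) * ((\<integral>\<^sup>+y. ?a y \<partial>lborel) + (\<integral>\<^sup>+y. ?b y \<partial>lborel)) + ennreal (S * S * (1 + S)) * (\<integral>\<^sup>+y. ennreal (R (x, y)) \<partial>lborel)"
    using m by (simp add: nn_integral_add nn_integral_cmult)
  also have "\<dots> \<le> ennreal (1 + S) * (ennreal (A * A * B) * ennreal S + ennreal (A * \<delta> * S)) + ennreal (S * S * (1 + S)) * ennreal cR"
    by (intro add_mono mult_left_mono nn_be_section R_section) (auto simp: nn_integral_multc nn_be_section intro!: mult_left_mono ennreal_leI bounds)
  also have "\<dots> = ennreal csec"
    using S0 A_nonneg B_nonneg delta_nonneg cR_nonneg by (simp add: csec_def ennreal_mult[symmetric] flip: ennreal_plus)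
  finally show ?thesis .
qed

text \<open>
  The kernel \<open>2 * h - g\<close> of the second moment formula. The first integral does not
  vanish in the limit: its leading part is \<open>z * m x\<close> times the mass of
  \<open>be\<close>, and this is what \<open>g\<close> compensates. It is the origin of the
  single-point deaths in the limit operator.
\<close>

definition hK where "hK x = (\<integral>y. K2 (x, y) * w y \<partial>lborel) - z * (A * A * B) * m x"
definition chs where "chs = z * S * (A * \<delta> * S) + S * wm * (A * \<delta> * S) + S * S * (1 + S) * wm * cR"
definition cht where "cht = z * S * (A * A * B * S) + S * wm * (A * A * B * S) + S * S * (1 + S) * wm * (4 * A * A * B * S)"

text \<open>Dominates what is left of \<open>hK\<close> after the compensation.\<close>

definition V where "V X = ennreal (z) * ennreal (be (snd X - fst X) * \<bar>D (snd X)\<bar>) * ennreal \<bar>m (fst X)\<bar>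
  + ennreal (S * wm) * ennreal (be (snd X - fst X) * \<bar>m (snd X)\<bar>) + ennreal (S * S * (1 + S) * wm) * ennreal (R X)"

lemma V_measurable [measurable]: "V \<in> borel_measurable (borel \<Otimes>\<^sub>M borel)"
  unfolding V_def[abs_def] by measurable

lemma hK_measurable [measurable]: "hK \<in> borel_measurable borel"
  unfolding hK_def[abs_def] by measurable

lemma hK_le: "ennreal \<bar>hK x\<bar> \<le> (\<integral>\<^sup>+y. V (x, y) \<partial>lborel)"
proof -
  let ?b = "\<lambda>y. m x * z * (be (y - x) * D y) + (1 + m x) * (be (y - x) * m y * w y) + (1 + mm (x, y)) * Q (x, y) * w y"
  have eq: "K2 (x, y) * w y = z * m x * be (y - x) + ?b y" for y
  proof -
    have wD: "w y = z * (1 + D y)" by (simp add: w_def D_def)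
    have "mm (x, y) = m x + (1 + m x) * m y" unfolding mm_eq by (simp add: algebra_simps)
    then have "K2 (x, y) * w y = m x * be (y - x) * w y + (1 + m x) * (be (y - x) * m y * w y) + (1 + mm (x, y)) * Q (x, y) * w y"
      by (simp add: K2_def algebra_simps)
    also have "m x * be (y - x) * w y = z * m x * be (y - x) + m x * z * (be (y - x) * D y)"
      unfolding wD by (simp add: algebra_simps)
    finally show ?thesis by simp
  qed
  have i1: "integrable lborel (\<lambda>y. K2 (x, y) * w y)"
  proof (rule integrableI_bounded)
    have "(\<integral>\<^sup>+y. ennreal (norm (K2 (x, y) * w y)) \<partial>lborel) \<le> (\<integral>\<^sup>+y. ennreal wm * ennreal \<bar>K2 (x, y)\<bar> \<partial>lborel)"
    proof (rule nn_integral_mono)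
      fix y
      have "norm (K2 (x, y) * w y) \<le> wm * \<bar>K2 (x, y)\<bar>"
        using mult_right_mono[OF wm(1)[of y], of "\<bar>K2 (x, y)\<bar>"] w_nonneg[of y] by (simp add: abs_mult mult.commute)
      then show "ennreal (norm (K2 (x, y) * w y)) \<le> ennreal wm * ennreal \<bar>K2 (x, y)\<bar>"
        using wm(2) by (simp add: ennreal_mult[symmetric] ennreal_leI)
    qed
    also have "\<dots> = ennreal wm * (\<integral>\<^sup>+y. ennreal \<bar>K2 (x, y)\<bar> \<partial>lborel)" by (rule nn_integral_cmult) measurable
    also have "\<dots> < \<infinity>" using K2_section[of x] by (simp add: ennreal_mult_less_top) (metis ennreal_less_top order_le_less_trans)
    finally show "(\<integral>\<^sup>+y. ennreal (norm (K2 (x, y) * w y)) \<partial>lborel) < \<infinity>" .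
  qed measurable
  have i2: "integrable lborel (\<lambda>y. be (y - x))" "(\<integral>y. be (y - x) \<partial>lborel) = A * A * B"
    using integral_shift(1)[of be "- x"] integral_shift(2)[of be "- x"] be_mass by simp_all
  have "(\<integral>y. ?b y \<partial>lborel) = (\<integral>y. K2 (x, y) * w y - z * m x * be (y - x) \<partial>lborel)"
  proof (rule Bochner_Integration.integral_cong[OF refl])
    fix y show "?b y = K2 (x, y) * w y - z * m x * be (y - x)" using eq[of y] by linarith
  qed
  also have "\<dots> = hK x" using i1 i2 by (simp add: hK_def)
  finally have "hK x = (\<integral>y. ?b y \<partial>lborel)" ..
  then have "ennreal \<bar>hK x\<bar> \<le> (\<integral>\<^sup>+y. ennreal \<bar>?b y\<bar> \<partial>lborel)" using ennreal_abs_integral_le[of lborel ?b] by simp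
  also have "\<dots> \<le> (\<integral>\<^sup>+y. V (x, y) \<partial>lborel)"
  proof (rule nn_integral_mono)
    fix y
    have e1: "1 + m x = exp (- \<phi> x)" by (simp add: m_def)
    have t1: "\<bar>m x * z * (be (y - x) * D y)\<bar> = z * (be (y - x) * \<bar>D y\<bar>) * \<bar>m x\<bar>"
      using z_pos be_nonneg[of "y - x"] by (simp add: abs_mult)
    have "\<bar>(1 + m x) * (be (y - x) * m y * w y)\<bar> = exp (- \<phi> x) * w y * (be (y - x) * \<bar>m y\<bar>)"
      unfolding e1 using be_nonneg[of "y - x"] w_nonneg[of y] by (simp add: abs_mult)
    also have "\<dots> \<le> S * wm * (be (y - x) * \<bar>m y\<bar>)"
      using bounds(5)[of x] wm w_nonneg[of y] be_nonneg S0 by (intro mult_right_mono mult_mono) auto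
    finally have t2: "\<bar>(1 + m x) * (be (y - x) * m y * w y)\<bar> \<le> S * wm * (be (y - x) * \<bar>m y\<bar>)" .
    have "\<bar>(1 + mm (x, y)) * Q (x, y) * w y\<bar> = (1 + mm (x, y)) * \<bar>Q (x, y)\<bar> * w y"
      using one_mm(1)[of "(x, y)"] w_nonneg[of y] by (simp add: abs_mult)
    also have "\<dots> \<le> (S * S) * ((1 + S) * R (x, y)) * wm"
      using one_mm[of "(x, y)"] Q_abs[of "(x, y)"] wm w_nonneg[of y] S0 R_nonneg[of "(x, y)"]
      by (intro mult_mono) auto
    finally have t3: "\<bar>(1 + mm (x, y)) * Q (x, y) * w y\<bar> \<le> S * S * (1 + S) * wm * R (x, y)" by (simp add: mult_ac)
    have "\<bar>?b y\<bar> \<le> z * (be (y - x) * \<bar>D y\<bar>) * \<bar>m x\<bar> + S * wm * (be (y - x) * \<bar>m y\<bar>) + S * S * (1 + S) * wm * R (x, y)"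
      using t1 t2 t3 by linarith
    then have "ennreal \<bar>?b y\<bar> \<le> ennreal (z * (be (y - x) * \<bar>D y\<bar>) * \<bar>m x\<bar> + S * wm * (be (y - x) * \<bar>m y\<bar>) + S * S * (1 + S) * wm * R (x, y))"
      by (rule ennreal_leI)
    also have "\<dots> = V (x, y)"
      using z_pos be_nonneg[of "y - x"] S0 wm(2) R_nonneg[of "(x, y)"]
      by (simp add: V_def ennreal_mult[symmetric] flip: ennreal_plus)
    finally show "ennreal \<bar>?b y\<bar> \<le> V (x, y)" .
  qed
  finally show ?thesis .
qed

lemma V_section: "(\<integral>\<^sup>+y. V (x, y) \<partial>lborel) \<le> ennreal chs"
proof -
  have m: "(\<lambda>y. ennreal (be (y - x) * \<bar>D y\<bar>)) \<in> borel_measurable borel" "(\<lambda>y. ennreal (be (y - x) * \<bar>m y\<bar>)) \<in> borel_measurable borel"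
    "(\<lambda>y. ennreal (R (x, y))) \<in> borel_measurable borel" by measurable
  have "(\<integral>\<^sup>+y. V (x, y) \<partial>lborel) = ennreal z * (\<integral>\<^sup>+y. ennreal (be (y - x) * \<bar>D y\<bar>) \<partial>lborel) * ennreal \<bar>m x\<bar>
      + ennreal (S * wm) * (\<integral>\<^sup>+y. ennreal (be (y - x) * \<bar>m y\<bar>) \<partial>lborel) + ennreal (S * S * (1 + S) * wm) * (\<integral>\<^sup>+y. ennreal (R (x, y)) \<partial>lborel)"
    using m by (simp add: V_def nn_integral_add nn_integral_cmult nn_integral_multc)
  also have "\<dots> \<le> ennreal z * ennreal (A * \<delta> * S) * ennreal S + ennreal (S * wm) * ennreal (A * \<delta> * S) + ennreal (S * S * (1 + S) * wm) * ennreal cR"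
    by (intro add_mono mult_mono mult_left_mono nn_be_section R_section ennreal_leI bounds) auto
  also have "\<dots> = ennreal chs"
    using z_pos S0 A_nonneg delta_nonneg wm(2) cR_nonneg
    by (simp add: chs_def ennreal_mult[symmetric] mult_ac flip: ennreal_plus)
  finally show ?thesis .
qed

lemma V_total: "(\<integral>\<^sup>+x. \<integral>\<^sup>+y. V (x, y) \<partial>lborel \<partial>lborel) \<le> ennreal cht"
proof -
  let ?a = "\<lambda>X. ennreal (be (snd X - fst X) * \<bar>m (fst X)\<bar>)"
  let ?b = "\<lambda>X. ennreal (be (snd X - fst X) * \<bar>m (snd X)\<bar>)"
  have m: "?a \<in> borel_measurable L" "?b \<in> borel_measurable L" "(\<lambda>X. ennreal (R X)) \<in> borel_measurable L" by measurable
  have "(\<integral>\<^sup>+x. \<integral>\<^sup>+y. V (x, y) \<partial>lborel \<partial>lborel) = (\<integral>\<^sup>+X. V X \<partial>L)" by (rule nn_lborel_pair[symmetric]) measurable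
  also have "\<dots> \<le> (\<integral>\<^sup>+X. ennreal (z * S) * ?a X + ennreal (S * wm) * ?b X + ennreal (S * S * (1 + S) * wm) * ennreal (R X) \<partial>L)"
  proof (rule nn_integral_mono)
    fix X :: "'a \<times> 'a"
    have "z * (be (snd X - fst X) * \<bar>D (snd X)\<bar>) * \<bar>m (fst X)\<bar> \<le> z * (be (snd X - fst X) * S) * \<bar>m (fst X)\<bar>"
      using z_pos be_nonneg bounds(3)[of "snd X"] by (intro mult_right_mono mult_left_mono) auto
    then have "ennreal (z * (be (snd X - fst X) * \<bar>D (snd X)\<bar>) * \<bar>m (fst X)\<bar>) \<le> ennreal (z * S * (be (snd X - fst X) * \<bar>m (fst X)\<bar>))"
      by (intro ennreal_leI) (simp add: mult_ac)
    then have "ennreal z * ennreal (be (snd X - fst X) * \<bar>D (snd X)\<bar>) * ennreal \<bar>m (fst X)\<bar> \<le> ennreal (z * S) * ?a X"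
      using z_pos S0 be_nonneg[of "snd X - fst X"] by (simp add: ennreal_mult[symmetric])
    then show "V X \<le> ennreal (z * S) * ?a X + ennreal (S * wm) * ?b X + ennreal (S * S * (1 + S) * wm) * ennreal (R X)"
      unfolding V_def by (intro add_mono) auto
  qed
  also have "\<dots> = ennreal (z * S) * (\<integral>\<^sup>+X. ?a X \<partial>L) + ennreal (S * wm) * (\<integral>\<^sup>+X. ?b X \<partial>L) + ennreal (S * S * (1 + S) * wm) * (\<integral>\<^sup>+X. ennreal (R X) \<partial>L)"
    using m by (simp add: nn_integral_add nn_integral_cmult)
  also have "\<dots> \<le> ennreal (z * S) * ennreal (A * A * B * S) + ennreal (S * wm) * ennreal (A * A * B * S) + ennreal (S * S * (1 + S) * wm) * ennreal (4 * A * A * B * S)"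
    by (intro add_mono mult_left_mono nn_be_m R_total) auto
  also have "\<dots> = ennreal cht"
    using z_pos S0 A_nonneg B_nonneg wm(2) by (simp add: cht_def ennreal_mult[symmetric] flip: ennreal_plus)
  finally show ?thesis .
qed

lemma const_nonneg: "csup \<ge> 0" "ctot \<ge> 0" "csec \<ge> 0" "chs \<ge> 0" "cht \<ge> 0"
  using S0 A_nonneg B_nonneg b0_nonneg delta_nonneg cR_nonneg z_pos wm(2)
  by (simp_all add: csup_def ctot_def csec_def chs_def cht_def)

lemma hK_square: "(\<integral>x. (hK x)\<^sup>2 \<partial>\<mu>) \<le> chs * wm * cht"
proof (rule integral_real_bounded)
  show "0 \<le> chs * wm * cht" using const_nonneg wm(2) by simp
  have V: "(\<lambda>x. \<integral>\<^sup>+y. V (x, y) \<partial>lborel) \<in> borel_measurable borel" by measurable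
  have "(\<integral>\<^sup>+x. ennreal ((hK x)\<^sup>2) \<partial>\<mu>) \<le> (\<integral>\<^sup>+x. ennreal chs * (\<integral>\<^sup>+y. V (x, y) \<partial>lborel) \<partial>\<mu>)"
  proof (rule nn_integral_mono)
    fix x
    have "ennreal ((hK x)\<^sup>2) = ennreal \<bar>hK x\<bar> * ennreal \<bar>hK x\<bar>" by (simp add: ennreal_mult[symmetric] power2_eq_square)
    also have "\<dots> \<le> ennreal chs * (\<integral>\<^sup>+y. V (x, y) \<partial>lborel)"
      by (intro mult_mono hK_le order_trans[OF hK_le V_section]) auto
    finally show "ennreal ((hK x)\<^sup>2) \<le> ennreal chs * (\<integral>\<^sup>+y. V (x, y) \<partial>lborel)" .
  qed
  also have "\<dots> \<le> ennreal wm * (\<integral>\<^sup>+x. ennreal chs * (\<integral>\<^sup>+y. V (x, y) \<partial>lborel) \<partial>lborel)"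
    by (rule nn_mu_le[OF _ wm(1)]) measurable
  also have "\<dots> = ennreal wm * (ennreal chs * (\<integral>\<^sup>+x. \<integral>\<^sup>+y. V (x, y) \<partial>lborel \<partial>lborel))"
    using V by (simp add: nn_integral_cmult)
  also have "\<dots> \<le> ennreal wm * (ennreal chs * ennreal cht)" by (intro mult_left_mono V_total) auto
  also have "\<dots> = ennreal (chs * wm * cht)" using const_nonneg wm(2) by (simp add: ennreal_mult[symmetric] mult_ac)
  finally show "(\<integral>\<^sup>+x. ennreal ((hK x)\<^sup>2) \<partial>\<mu>) \<le> ennreal (chs * wm * cht)" .
qed

lemma K2_square: "(\<integral>X. (1/2 * K2 X)\<^sup>2 \<partial>(\<mu> \<Otimes>\<^sub>M \<mu>)) \<le> csup * (wm * wm) * ctot"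
proof (rule integral_real_bounded)
  show "0 \<le> csup * (wm * wm) * ctot" using const_nonneg wm(2) by simp
  have "(\<integral>\<^sup>+X. ennreal ((1/2 * K2 X)\<^sup>2) \<partial>(\<mu> \<Otimes>\<^sub>M \<mu>)) \<le> (\<integral>\<^sup>+X. ennreal csup * ennreal \<bar>K2 X\<bar> \<partial>(\<mu> \<Otimes>\<^sub>M \<mu>))"
  proof (rule nn_integral_mono)
    fix X
    have "(1/2 * K2 X)\<^sup>2 \<le> \<bar>K2 X\<bar> * \<bar>K2 X\<bar>" by (simp add: power2_eq_square)
    also have "\<dots> \<le> csup * \<bar>K2 X\<bar>" by (intro mult_right_mono K2_sup) simp
    finally show "ennreal ((1/2 * K2 X)\<^sup>2) \<le> ennreal csup * ennreal \<bar>K2 X\<bar>"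
      using const_nonneg by (simp add: ennreal_mult[symmetric] ennreal_leI)
  qed
  also have "\<dots> \<le> ennreal (wm * wm) * (\<integral>\<^sup>+X. ennreal csup * ennreal \<bar>K2 X\<bar> \<partial>L)"
    by (rule nn_mm_le[OF _ wm(1)]) measurable
  also have "\<dots> = ennreal (wm * wm) * (ennreal csup * (\<integral>\<^sup>+X. ennreal \<bar>K2 X\<bar> \<partial>L))"
    by (subst nn_integral_cmult) auto
  also have "\<dots> \<le> ennreal (wm * wm) * (ennreal csup * ennreal ctot)" by (intro mult_left_mono K2_total) auto
  also have "\<dots> = ennreal (csup * (wm * wm) * ctot)" using const_nonneg wm(2) by (simp add: ennreal_mult[symmetric] mult_ac)
  finally show "(\<integral>\<^sup>+X. ennreal ((1/2 * K2 X)\<^sup>2) \<partial>(\<mu> \<Otimes>\<^sub>M \<mu>)) \<le> ennreal (csup * (wm * wm) * ctot)" .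
qed

text \<open>
  The constants that the creation terms of the limit operator contribute: \<open>Ip\<close> from
  pairs and \<open>IE\<close> from single points.
\<close>

definition Ip where "Ip = (\<integral>X. \<beta> (snd X - fst X) * pp X \<partial>L)"
definition IE where "IE = (\<integral>x. E x \<partial>lborel)"
definition c0 where "c0 = A * A * (1/2 * z * z * Ip + z * z * B * IE)"
definition cc where "cc = z * z / 2 * (2 * (A * \<delta> * (S * S)) + A * \<delta> * (S * S) + (1 + S) * (1 + S) * (2 * S * cR))"

lemma integrable_kernel_pp:
  assumes k: "integrable lborel k" "\<And>x. k (- x) = k x" and kb: "\<And>x. \<bar>k x\<bar> \<le> s" and [measurable]: "k \<in> borel_measurable borel"
  shows "integrable L (\<lambda>X. k (snd X - fst X) * pp X)" (is ?Q)
    "(\<integral>X. k (snd X - fst X) * pp X \<partial>L) = 2 * ((\<integral>x. k x \<partial>lborel) * IE) + (\<integral>X. k (snd X - fst X) * (E (fst X) * E (snd X)) \<partial>L)" (is ?P)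
proof -
  have e: "k (snd X - fst X) * pp X = (k (snd X - fst X) * E (fst X) + k (snd X - fst X) * E (snd X)) + k (snd X - fst X) * (E (fst X) * E (snd X))" for X
    by (simp add: pp_eq algebra_simps)
  note d = diff_kernel[OF k EmD_integrable(1)]
  note d2 = diff_kernel_bounded[of k s E E, OF _ kb]
  show ?Q unfolding e using d d2 by simp
  show ?P
    unfolding e using d d2 by (simp add: IE_def)
qed

lemma beta_abs: "\<bar>\<beta> x\<bar> \<le> b0" using beta_bound[of x] beta_nonneg[of x] by simp
lemma be_abs: "\<bar>be x\<bar> \<le> A * \<delta>" using be_le[of x] be_nonneg[of x] by simp

text \<open>
  By symmetry of the rate the starting pair can be integrated out. The integral over the target
  survives the limit and produces the creation terms.
\<close>

lemma Q_integral: "integrable L Q"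
  "(\<integral>X. Q X \<partial>L) = A * A * Ip + (\<integral>X. be (snd X - fst X) * pp X \<partial>L)" (is ?P)
proof -
  have i: "integrable (L \<Otimes>\<^sub>M L) (\<lambda>W. kk (fst W) (snd W) * pp (snd W))"
  proof (rule integrableI_bounded)
    have m: "(\<lambda>W. ennreal (norm (kk (fst W) (snd W) * pp (snd W)))) \<in> borel_measurable (L \<Otimes>\<^sub>M L)" by measurable
    have "(\<integral>\<^sup>+W. ennreal (norm (kk (fst W) (snd W) * pp (snd W))) \<partial>(L \<Otimes>\<^sub>M L)) = (\<integral>\<^sup>+X. \<integral>\<^sup>+Y. ennreal (norm (kk X Y * pp Y)) \<partial>L \<partial>L)"
      using sigma_finite_measure.nn_integral_fst[OF sigma_finite_L m] by simp
    also have "\<dots> \<le> (\<integral>\<^sup>+X. ennreal (1 + S) * ennreal (R X) \<partial>L)"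
    proof (rule nn_integral_mono)
      fix X :: "'a \<times> 'a"
      have "(\<integral>\<^sup>+Y. ennreal (norm (kk X Y * pp Y)) \<partial>L) \<le> (\<integral>\<^sup>+Y. ennreal (1 + S) * (ennreal (kk X Y) * ennreal \<bar>E (fst Y)\<bar> + ennreal (kk X Y) * ennreal \<bar>E (snd Y)\<bar>) \<partial>L)"
      proof (rule nn_integral_mono)
        fix Y
        have "norm (kk X Y * pp Y) \<le> (1 + S) * (kk X Y * \<bar>E (fst Y)\<bar> + kk X Y * \<bar>E (snd Y)\<bar>)"
          using mult_left_mono[OF pp_abs[of Y] kk_nonneg[of X Y]] by (simp add: abs_mult kk_nonneg algebra_simps)
        then have "ennreal (norm (kk X Y * pp Y)) \<le> ennreal ((1 + S) * (kk X Y * \<bar>E (fst Y)\<bar> + kk X Y * \<bar>E (snd Y)\<bar>))" by (rule ennreal_leI)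
        then show "ennreal (norm (kk X Y * pp Y)) \<le> ennreal (1 + S) * (ennreal (kk X Y) * ennreal \<bar>E (fst Y)\<bar> + ennreal (kk X Y) * ennreal \<bar>E (snd Y)\<bar>)"
          using S0 kk_nonneg[of X Y] by (simp add: ennreal_mult)
      qed
      also have "\<dots> = ennreal (1 + S) * ennreal (R X)"
        unfolding nn_R kk_def by (rule nn_integral_cmult) measurable
      finally show "(\<integral>\<^sup>+Y. ennreal (norm (kk X Y * pp Y)) \<partial>L) \<le> ennreal (1 + S) * ennreal (R X)" .
    qed
    also have "\<dots> = ennreal (1 + S) * (\<integral>\<^sup>+X. ennreal (R X) \<partial>L)" by (rule nn_integral_cmult) measurable
    also have "\<dots> \<le> ennreal (1 + S) * ennreal (4 * A * A * B * S)" by (intro mult_left_mono R_total) simp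
    also have "\<dots> < \<infinity>" by (simp add: ennreal_mult_less_top)
    finally show "(\<integral>\<^sup>+W. ennreal (norm (kk (fst W) (snd W) * pp (snd W))) \<partial>(L \<Otimes>\<^sub>M L)) < \<infinity>" .
  qed measurable
  show "integrable L Q" using LL.integrable_fst'[OF i] by (simp add: Q_def[abs_def])
  have "(\<integral>X. Q X \<partial>L) = (\<integral>Y. \<integral>X. kk X Y * pp Y \<partial>L \<partial>L)"
    using LL.integral_fst'[OF i] LL.integral_snd[of "\<lambda>X Y. kk X Y * pp Y"] i by (simp add: Q_def case_prod_beta')
  also have "\<dots> = (\<integral>Y. A * A * (\<beta> (snd Y - fst Y) * pp Y) + be (snd Y - fst Y) * pp Y \<partial>L)"
  proof (rule Bochner_Integration.integral_cong[OF refl])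
    fix Y :: "'a \<times> 'a"
    have "(\<integral>X. kk X Y * pp Y \<partial>L) = (\<integral>X. kk Y X \<partial>L) * pp Y" by (simp add: kk_sym[of _ Y])
    then show "(\<integral>X. kk X Y * pp Y \<partial>L) = A * A * (\<beta> (snd Y - fst Y) * pp Y) + be (snd Y - fst Y) * pp Y"
      by (simp add: integral_kk algebra_simps)
  qed
  also have "\<dots> = A * A * Ip + (\<integral>X. be (snd X - fst X) * pp X \<partial>L)"
    using integrable_kernel_pp(1)[OF beta_int beta_even beta_abs beta_meas] integrable_kernel_pp(1)[OF be_mass(1) be_even be_abs be_measurable]
    by (simp add: Ip_def)
  finally show ?P .
qed

lemma ppQ: "integrable L (\<lambda>X. pp X * Q X)" "\<bar>\<integral>X. pp X * Q X \<partial>L\<bar> \<le> (1 + S) * (1 + S) * (2 * S * cR)" (is ?P)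
proof -
  have nn: "(\<integral>\<^sup>+X. ennreal \<bar>pp X * Q X\<bar> \<partial>L) \<le> ennreal ((1 + S) * (1 + S) * (2 * S * cR))"
  proof -
    let ?a = "\<lambda>X. ennreal \<bar>E (fst X)\<bar> * ennreal (R X)"
    let ?b = "\<lambda>X. ennreal \<bar>E (snd X)\<bar> * ennreal (R X)"
    have m: "?a \<in> borel_measurable L" "?b \<in> borel_measurable L" by measurable
    have "(\<integral>\<^sup>+X. ennreal \<bar>pp X * Q X\<bar> \<partial>L) \<le> (\<integral>\<^sup>+X. ennreal ((1 + S) * (1 + S)) * (?a X + ?b X) \<partial>L)"
    proof (rule nn_integral_mono)
      fix X :: "'a \<times> 'a"
      have "\<bar>pp X * Q X\<bar> \<le> ((1 + S) * (\<bar>E (fst X)\<bar> + \<bar>E (snd X)\<bar>)) * ((1 + S) * R X)"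
        unfolding abs_mult using S0 by (intro mult_mono pp_abs Q_abs) auto
      also have "\<dots> = (1 + S) * (1 + S) * (\<bar>E (fst X)\<bar> * R X + \<bar>E (snd X)\<bar> * R X)" by (simp add: algebra_simps)
      finally have "ennreal \<bar>pp X * Q X\<bar> \<le> ennreal ((1 + S) * (1 + S) * (\<bar>E (fst X)\<bar> * R X + \<bar>E (snd X)\<bar> * R X))" by (rule ennreal_leI)
      also have "\<dots> = ennreal ((1 + S) * (1 + S)) * ennreal (\<bar>E (fst X)\<bar> * R X + \<bar>E (snd X)\<bar> * R X)"
        using S0 R_nonneg[of X] by (intro ennreal_mult) auto
      finally show "ennreal \<bar>pp X * Q X\<bar> \<le> ennreal ((1 + S) * (1 + S)) * (?a X + ?b X)"
        using R_nonneg[of X] by (simp add: ennreal_mult)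
    qed
    also have "\<dots> = ennreal ((1 + S) * (1 + S)) * ((\<integral>\<^sup>+X. ?a X \<partial>L) + (\<integral>\<^sup>+X. ?b X \<partial>L))"
      using m by (simp add: nn_integral_add nn_integral_cmult)
    also have "\<dots> \<le> ennreal ((1 + S) * (1 + S)) * (ennreal (S * cR) + ennreal (S * cR))"
    proof (intro mult_left_mono add_mono)
      have *: "(\<integral>\<^sup>+x. ennreal \<bar>E x\<bar> * (\<integral>\<^sup>+y. ennreal (R (x, y)) \<partial>lborel) \<partial>lborel) \<le> ennreal (S * cR)"
      proof -
        have "(\<integral>\<^sup>+x. ennreal \<bar>E x\<bar> * (\<integral>\<^sup>+y. ennreal (R (x, y)) \<partial>lborel) \<partial>lborel) \<le> (\<integral>\<^sup>+x. ennreal \<bar>E x\<bar> * ennreal cR \<partial>lborel)"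
          by (intro nn_integral_mono mult_left_mono R_section) simp
        also have "\<dots> \<le> ennreal S * ennreal cR" by (simp add: nn_integral_multc mult_right_mono nn_masses)
        finally show ?thesis using S0 cR_nonneg by (simp add: ennreal_mult)
      qed
      have "(\<integral>\<^sup>+X. ?a X \<partial>L) = (\<integral>\<^sup>+x. ennreal \<bar>E x\<bar> * (\<integral>\<^sup>+y. ennreal (R (x, y)) \<partial>lborel) \<partial>lborel)"
        by (subst nn_lborel_pair) (auto simp: nn_integral_cmult)
      then show "(\<integral>\<^sup>+X. ?a X \<partial>L) \<le> ennreal (S * cR)" using * by simp
      have "(\<integral>\<^sup>+X. ?b X \<partial>L) = (\<integral>\<^sup>+x. \<integral>\<^sup>+y. ennreal \<bar>E y\<bar> * ennreal (R (x, y)) \<partial>lborel \<partial>lborel)"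
        by (subst nn_lborel_pair) auto
      also have "\<dots> = (\<integral>\<^sup>+y. \<integral>\<^sup>+x. ennreal \<bar>E y\<bar> * ennreal (R (x, y)) \<partial>lborel \<partial>lborel)"
        by (rule lborel_pair.Fubini') measurable
      also have "\<dots> = (\<integral>\<^sup>+y. ennreal \<bar>E y\<bar> * (\<integral>\<^sup>+x. ennreal (R (y, x)) \<partial>lborel) \<partial>lborel)"
        by (simp add: R_swap[of _ "_ :: 'a"] nn_integral_cmult)
      finally show "(\<integral>\<^sup>+X. ?b X \<partial>L) \<le> ennreal (S * cR)" using * by simp
    qed auto
    also have "\<dots> = ennreal ((1 + S) * (1 + S) * (2 * S * cR))"
      using S0 cR_nonneg by (simp add: ennreal_mult[symmetric] flip: ennreal_plus)
    finally show ?thesis .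
  qed
  have fin: "(\<integral>\<^sup>+X. ennreal \<bar>pp X * Q X\<bar> \<partial>L) < \<infinity>" by (rule order_le_less_trans[OF nn]) simp
  have m: "(\<lambda>X. pp X * Q X) \<in> borel_measurable L" by measurable
  show "integrable L (\<lambda>X. pp X * Q X)" using fin m by (intro integrableI_bounded) auto
  have "ennreal \<bar>\<integral>X. pp X * Q X \<partial>L\<bar> \<le> ennreal ((1 + S) * (1 + S) * (2 * S * cR))"
    using ennreal_abs_integral_le[of L "\<lambda>X. pp X * Q X"] nn by (rule order_trans)
  then show ?P
    using S0 cR_nonneg by (simp add: ennreal_le_iff)
qed

text \<open>
  The mean of the error. Where \<open>be\<close> is paired with a single localized function,
  only its mass matters, and these contributions cancel exactly against \<open>g\<close> and
  \<open>c0\<close>. What remains pairs \<open>be\<close> with two localized functions or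
  \<open>Q\<close> with \<open>pp\<close>.
\<close>

lemma constant_term:
  "\<bar>(\<integral>X. 1/2 * K2 X \<partial>(\<mu> \<Otimes>\<^sub>M \<mu>)) - (\<integral>x. z * (A * A * B) * m x \<partial>\<mu>) - c0\<bar> \<le> cc"
proof -
  let ?b = "\<lambda>X. be (snd X - fst X)"
  have uE: "exp (\<phi> x) = 1 + E x" and uD: "exp (2 * \<phi> x) = 1 + D x" for x by (simp_all add: E_def D_def)
  have "(\<integral>X. 1/2 * K2 X \<partial>(\<mu> \<Otimes>\<^sub>M \<mu>)) = (\<integral>X. w (fst X) * w (snd X) * (1/2 * K2 X) \<partial>L)"
    unfolding mm_mu using w_nonneg by (subst integral_density) auto
  also have "\<dots> = (\<integral>X. z * z / 2 * ((?b X * (E (fst X) - D (fst X)) + ?b X * (E (snd X) - D (snd X)))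
      + (?b X * (E (fst X) * E (snd X)) - ?b X * (D (fst X) * D (snd X))) + (Q X + pp X * Q X)) \<partial>L)"
  proof (rule Bochner_Integration.integral_cong[OF refl])
    fix X :: "'a \<times> 'a"
    obtain x y where X: "X = (x, y)" by fastforce
    let ?u = "exp (\<phi> x)" and ?v = "exp (\<phi> y)"
    have ww: "w x * w y = z * z * ((?u * ?v) * (?u * ?v))" by (simp add: w_def exp_add[symmetric])
    have inv: "(?u * ?v) * (1 + mm X) = 1" by (simp add: X mm_def exp_add[symmetric])
    have P: "?u * ?v = 1 + pp X" by (simp add: X pp_def exp_add)
    have "(?u * ?v) * (?u * ?v) * K2 X = ((?u * ?v) * ((?u * ?v) * (1 + mm X)) - (?u * ?v) * (?u * ?v)) * ?b X + (?u * ?v) * ((?u * ?v) * (1 + mm X)) * Q X"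
      by (simp add: K2_def algebra_simps)
    also have "\<dots> = (?u * ?v - (?u * ?u) * (?v * ?v)) * ?b X + (1 + pp X) * Q X" unfolding inv by (simp add: P algebra_simps)
    also have "\<dots> = ((1 + E x) * (1 + E y) - (1 + D x) * (1 + D y)) * ?b X + (1 + pp X) * Q X"
    proof -
      have "?u * ?u = 1 + D x" "?v * ?v = 1 + D y" by (simp_all add: uD[symmetric] exp_add[symmetric])
      then show ?thesis by (simp add: uE)
    qed
    finally have e: "(?u * ?v) * (?u * ?v) * K2 X = ((1 + E x) * (1 + E y) - (1 + D x) * (1 + D y)) * ?b X + (1 + pp X) * Q X" .
    have "w (fst X) * w (snd X) * (1/2 * K2 X) = z * z / 2 * ((?u * ?v) * (?u * ?v) * K2 X)"
      using ww by (simp add: X)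
    then show "w (fst X) * w (snd X) * (1/2 * K2 X) = z * z / 2 * ((?b X * (E (fst X) - D (fst X)) + ?b X * (E (snd X) - D (snd X)))
      + (?b X * (E (fst X) * E (snd X)) - ?b X * (D (fst X) * D (snd X))) + (Q X + pp X * Q X))"
      unfolding e by (simp add: X algebra_simps)
  qed
  also have "\<dots> = z * z / 2 * ((A * A * B * (\<integral>x. E x - D x \<partial>lborel) + A * A * B * (\<integral>x. E x - D x \<partial>lborel))
      + ((\<integral>X. ?b X * (E (fst X) * E (snd X)) \<partial>L) - (\<integral>X. ?b X * (D (fst X) * D (snd X)) \<partial>L))
      + ((\<integral>X. Q X \<partial>L) + (\<integral>X. pp X * Q X \<partial>L)))"
  proof -
    have iED: "integrable lborel (\<lambda>x. E x - D x)" by simp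
    note d = diff_kernel[OF be_mass(1) be_even iED, unfolded be_mass(2)]
    note dE = diff_kernel_bounded(1)[OF be_measurable be_abs EmD_integrable(1) EmD_integrable(1)]
    note dD = diff_kernel_bounded(1)[OF be_measurable be_abs EmD_integrable(3) EmD_integrable(3)]
    show ?thesis using d dE dD Q_integral(1) ppQ(1) by (simp del: Bochner_Integration.integral_diff EmD_integrable add: Bochner_Integration.integral_diff[OF dE dD])
  qed
  finally have I1: "(\<integral>X. 1/2 * K2 X \<partial>(\<mu> \<Otimes>\<^sub>M \<mu>)) = z * z / 2 * ((A * A * B * (\<integral>x. E x - D x \<partial>lborel) + A * A * B * (\<integral>x. E x - D x \<partial>lborel))
      + ((\<integral>X. ?b X * (E (fst X) * E (snd X)) \<partial>L) - (\<integral>X. ?b X * (D (fst X) * D (snd X)) \<partial>L))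
      + ((\<integral>X. Q X \<partial>L) + (\<integral>X. pp X * Q X \<partial>L)))" .
  have "(\<integral>x. z * (A * A * B) * m x \<partial>\<mu>) = (\<integral>x. w x * (z * (A * A * B) * m x) \<partial>lborel)"
    unfolding \<mu>_def using w_nonneg by (subst integral_density) auto
  also have "\<dots> = (\<integral>x. z * z * (A * A * B) * (E x - D x) \<partial>lborel)"
  proof (rule Bochner_Integration.integral_cong[OF refl])
    fix x
    have "exp (2 * \<phi> x) * m x = exp (\<phi> x) - exp (2 * \<phi> x)" by (simp add: m_def right_diff_distrib exp_add[symmetric])
    then show "w x * (z * (A * A * B) * m x) = z * z * (A * A * B) * (E x - D x)"
      by (simp add: w_def uE uD mult.assoc mult.left_commute)
  qed
  finally have I2: "(\<integral>x. z * (A * A * B) * m x \<partial>\<mu>) = z * z * (A * A * B) * (\<integral>x. E x - D x \<partial>lborel)" by simp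
  let ?e = "\<integral>X. ?b X * (E (fst X) * E (snd X)) \<partial>L" and ?d = "\<integral>X. ?b X * (D (fst X) * D (snd X)) \<partial>L" and ?p = "\<integral>X. pp X * Q X \<partial>L"
  have I3: "(\<integral>X. Q X \<partial>L) = A * A * Ip + (2 * (A * A * B * IE) + ?e)"
    unfolding Q_integral(2) integrable_kernel_pp(2)[OF be_mass(1) be_even be_abs be_measurable] be_mass(2) ..
  have eq: "(\<integral>X. 1/2 * K2 X \<partial>(\<mu> \<Otimes>\<^sub>M \<mu>)) - (\<integral>x. z * (A * A * B) * m x \<partial>\<mu>) - c0 = z * z / 2 * (2 * ?e - ?d + ?p)"
    unfolding I1 I2 I3 c0_def by (simp add: field_simps)
  have be: "\<bar>?e\<bar> \<le> A * \<delta> * (S * S)" "\<bar>?d\<bar> \<le> A * \<delta> * (S * S)"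
  proof -
    have s: "A * \<delta> * ((\<integral>x. \<bar>f x\<bar> \<partial>lborel) * (\<integral>x. \<bar>f x\<bar> \<partial>lborel)) \<le> A * \<delta> * (S * S)"
      if "(\<integral>x. \<bar>f x\<bar> \<partial>lborel) \<le> S" for f :: "'a \<Rightarrow> real"
      using that A_nonneg delta_nonneg S0 by (intro mult_left_mono mult_mono) auto
    show "\<bar>?e\<bar> \<le> A * \<delta> * (S * S)"
      by (rule order_trans[OF diff_kernel_bounded(2)[OF be_measurable be_abs EmD_integrable(1) EmD_integrable(1)] s[OF masses(1)]])
    show "\<bar>?d\<bar> \<le> A * \<delta> * (S * S)"
      by (rule order_trans[OF diff_kernel_bounded(2)[OF be_measurable be_abs EmD_integrable(3) EmD_integrable(3)] s[OF masses(3)]])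
  qed
  have "\<bar>z * z / 2 * (2 * ?e - ?d + ?p)\<bar> = z * z / 2 * \<bar>2 * ?e - ?d + ?p\<bar>" using z_pos by (simp add: abs_mult)
  also have "\<dots> \<le> z * z / 2 * (2 * (A * \<delta> * (S * S)) + A * \<delta> * (S * S) + (1 + S) * (1 + S) * (2 * S * cR))"
  proof (rule mult_left_mono)
    show "\<bar>2 * ?e - ?d + ?p\<bar> \<le> 2 * (A * \<delta> * (S * S)) + A * \<delta> * (S * S) + (1 + S) * (1 + S) * (2 * S * cR)"
      using be ppQ(2) by linarith
  qed (use z_pos in simp)
  also have "\<dots> = cc" by (simp add: cc_def)
  finally show ?thesis unfolding eq .
qed

end

section \<open>Error functional and limit functional\<close>

context jump_limit
begin

text \<open>
  On the tilted space \<open>X0\<close> is the limit operator and \<open>X1\<close> the error,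
  both divided by \<open>F\<close>.
\<close>

definition g where "g x = z * (A * A * B) * m x"
definition H0 where "H0 X = 1/2 * (A * A * (\<beta> (snd X - fst X) * mm X))"
definition X1 where "X1 \<gamma> = (\<integral>p. 1/2 * K2 p \<partial>count_space (offdiag \<gamma>)) - (\<integral>x. g x \<partial>count_space \<gamma>) - c0"
definition X0 where "X0 \<gamma> = (\<integral>p. H0 p \<partial>count_space (offdiag \<gamma>)) - (\<integral>x. - g x \<partial>count_space \<gamma>) - (- c0)"

lemma g_props: "integrable lborel g" "\<bar>g x\<bar> \<le> z * (A * A * B) * S"
proof -
  show "integrable lborel g" unfolding g_def[abs_def] by simp
  show "\<bar>g x\<bar> \<le> z * (A * A * B) * S"
    unfolding g_def abs_mult using z_pos A_nonneg B_nonneg bounds(2)[of x] by (simp add: mult_left_mono)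
qed

lemma g_bound_nonneg: "z * (A * A * B) * S \<ge> 0" using z_pos A_nonneg B_nonneg S0 by simp

lemma second_chaos_error: "second_chaos \<nu> \<mu> (\<lambda>X. 1/2 * K2 X) g"
proof (rule second_chaos_tilted)
  let ?s = "csup + z * (A * A * B) * S"
  have half: "ennreal \<bar>1/2 * K2 X\<bar> \<le> ennreal \<bar>K2 X\<bar>" for X by (intro ennreal_leI) simp
  show "\<bar>1/2 * K2 X\<bar> \<le> ?s" for X using K2_sup[of X] g_bound_nonneg by (simp add: abs_mult)
  show "\<bar>g x\<bar> \<le> ?s" for x using g_props(2)[of x] const_nonneg(1) by simp
  show "(\<integral>\<^sup>+X. ennreal \<bar>1/2 * K2 X\<bar> \<partial>L) < \<infinity>"
    using order_trans[OF nn_integral_mono[OF half] K2_total] by (rule order_le_less_trans) simp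
  show "(\<integral>\<^sup>+y. ennreal \<bar>1/2 * K2 (x, y)\<bar> \<partial>lborel) \<le> ennreal csec" for x
    by (rule order_trans[OF nn_integral_mono[OF half] K2_section])
qed (auto simp: K2_sym g_props(1))

lemma second_chaos_limit: "second_chaos \<nu> \<mu> H0 (\<lambda>x. - g x)"
proof (rule second_chaos_tilted)
  let ?t = "A * A * (1 + S) * (S + S)"
  have t0: "?t \<ge> 0" using A_nonneg S0 by simp
  have H: "\<bar>H0 X\<bar> \<le> ?t * \<beta> (snd X - fst X)" for X
  proof -
    have "\<bar>H0 X\<bar> \<le> A * A * \<beta> (snd X - fst X) * \<bar>mm X\<bar>"
      using A_nonneg beta_nonneg[of "snd X - fst X"] by (simp add: H0_def abs_mult)
    also have "\<dots> \<le> A * A * \<beta> (snd X - fst X) * ((1 + S) * (S + S))"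
      using A_nonneg beta_nonneg[of "snd X - fst X"] by (intro mult_left_mono mm_bound) auto
    finally show ?thesis by (simp add: mult_ac)
  qed
  show "\<bar>H0 X\<bar> \<le> ?t * b0 + z * (A * A * B) * S" for X
    using H[of X] mult_left_mono[OF beta_bound[of "snd X - fst X"] t0] g_bound_nonneg by linarith
  show "\<bar>- g x\<bar> \<le> ?t * b0 + z * (A * A * B) * S" for x
    using g_props(2)[of x] mult_nonneg_nonneg[OF t0 b0_nonneg] abs_minus_cancel[of "g x"] by linarith
  have "integrable L (\<lambda>X. (\<beta> (snd X - fst X) * m (fst X) + \<beta> (snd X - fst X) * m (snd X)) + \<beta> (snd X - fst X) * (m (fst X) * m (snd X)))"
    using diff_kernel[OF beta_int beta_even EmD_integrable(2)]
      diff_kernel_bounded(1)[OF beta_meas beta_abs EmD_integrable(2) EmD_integrable(2)] by simp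
  also have "(\<lambda>X. (\<beta> (snd X - fst X) * m (fst X) + \<beta> (snd X - fst X) * m (snd X)) + \<beta> (snd X - fst X) * (m (fst X) * m (snd X)))
      = (\<lambda>X. \<beta> (snd X - fst X) * mm X)" by (simp add: mm_eq algebra_simps)
  finally have "integrable L H0" unfolding H0_def[abs_def] by simp
  then show "(\<integral>\<^sup>+X. ennreal \<bar>H0 X\<bar> \<partial>L) < \<infinity>" by (simp add: integrable_iff_bounded)
  show "(\<integral>\<^sup>+y. ennreal \<bar>H0 (x, y)\<bar> \<partial>lborel) \<le> ennreal (?t * B)" for x
  proof -
    have "ennreal \<bar>H0 (x, y)\<bar> \<le> ennreal ?t * ennreal (\<beta> (y + - x))" for y
      using ennreal_leI[OF H[of "(x, y)"]] t0 beta_nonneg[of "y - x"] by (simp add: ennreal_mult[symmetric])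
    then have "(\<integral>\<^sup>+y. ennreal \<bar>H0 (x, y)\<bar> \<partial>lborel) \<le> (\<integral>\<^sup>+y. ennreal ?t * ennreal (\<beta> (y + - x)) \<partial>lborel)"
      by (intro nn_integral_mono)
    also have "\<dots> = ennreal ?t * ennreal B"
      using nn_integral_shift[of "\<lambda>y. ennreal (\<beta> y)" "- x"] by (simp add: nn_integral_cmult nn_B)
    finally show ?thesis using t0 B_nonneg by (simp add: ennreal_mult)
  qed
  show "H0 (x, y) = H0 (y, x)" for x y using beta_even[of "x - y"] by (simp add: H0_def mm_def add.commute)
qed (auto simp: g_props(1) H0_def[abs_def])

sublocale error: second_chaos \<nu> \<mu> "\<lambda>X. 1/2 * K2 X" g c0
  rewrites "error.X = X1"
proof -
  show "second_chaos \<nu> \<mu> (\<lambda>X. 1/2 * K2 X) g" by (rule second_chaos_error)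
  then interpret e: second_chaos \<nu> \<mu> "\<lambda>X. 1/2 * K2 X" g c0 .
  show "e.X = X1" by (rule ext) (simp only: e.X_def X1_def)
qed

sublocale limit: second_chaos \<nu> \<mu> H0 "\<lambda>x. - g x" "- c0"
  rewrites "limit.X = X0"
proof -
  show "second_chaos \<nu> \<mu> H0 (\<lambda>x. - g x)" by (rule second_chaos_limit)
  then interpret e: second_chaos \<nu> \<mu> H0 "\<lambda>x. - g x" "- c0" .
  show "e.X = X0" by (rule ext) (simp only: e.X_def X0_def)
qed

lemma error_second_moment:
  "(\<integral>\<gamma>. (X1 \<gamma>)\<^sup>2 \<partial>\<nu>) \<le> measure \<nu> (space \<nu>) * (cc\<^sup>2 + chs * wm * cht + 2 * (csup * (wm * wm) * ctot))"
proof -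
  have h: "2 * error.h x - g x = hK x" for x
  proof -
    have "error.h x = (\<integral>y. 1/2 * K2 (x, y) \<partial>\<mu>)" by (rule error.h_def)
    also have "\<dots> = 1/2 * (\<integral>y. w y * K2 (x, y) \<partial>lborel)"
      unfolding \<mu>_def using w_nonneg by (subst integral_density) auto
    finally show ?thesis by (simp add: hK_def g_def mult.commute)
  qed
  have "\<bar>(\<integral>X. 1/2 * K2 X \<partial>(\<mu> \<Otimes>\<^sub>M \<mu>)) - (\<integral>x. g x \<partial>\<mu>) - c0\<bar> \<le> cc"
    using constant_term by (simp only: g_def)
  from power_mono[OF this, of 2] have c: "((\<integral>X. 1/2 * K2 X \<partial>(\<mu> \<Otimes>\<^sub>M \<mu>)) - (\<integral>x. g x \<partial>\<mu>) - c0)\<^sup>2 \<le> cc\<^sup>2" by simp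
  show ?thesis
    unfolding error.second_moment h error.n_def
    by (intro mult_left_mono add_mono c hK_square K2_square) simp_all
qed

text \<open>
  The points of a configuration form a null set, so the target positions are almost surely new
  and each jump multiplies \<open>F\<close> by an exponential factor.
\<close>

lemma J_F:
  assumes c: "\<gamma> \<in> configurations" and p: "p \<in> offdiag \<gamma>"
  shows "J F p \<gamma> = F \<gamma> * G p"
proof -
  obtain K r where t: "tame_on K 1 r F" by (rule F_tame)
  obtain x y where xy: "p = (x, y)" "x \<in> \<gamma>" "y \<in> \<gamma>" "x \<noteq> y" using p by (auto simp: offdiag_def)
  define \<Gamma> where "\<Gamma> = \<gamma> - {x, y}"
  have c': "\<Gamma> \<in> configurations" by (rule configuration_subset[OF c]) (auto simp: \<Gamma>_def)
  have "F \<Gamma> = exp (- \<phi> y) * (exp (- \<phi> x) * F \<gamma>)"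
    using F_remove[OF c xy(2)] F_remove[of "\<gamma> - {x}" y] configuration_subset[OF c, of "\<gamma> - {x}"] xy
    by (auto simp: \<Gamma>_def Diff_insert2[of \<gamma> x "{y}", symmetric] insert_commute)
  then have e: "F \<Gamma> = exp (- \<phi> x - \<phi> y) * F \<gamma>" by (simp add: exp_diff exp_minus field_simps)
  have cnt: "countable \<Gamma>" by (rule countable_configuration[OF c'])
  have [measurable]: "\<Gamma> \<in> sets borel" by (rule sets.countable[OF _ cnt]) simp
  have nul: "AE h in lborel. s + h \<notin> D" if "countable D" for s :: 'a and D :: "'a set"
  proof -
    have "countable ((+) (- s) ` D)" using that by simp
    from Measure_Space.AE_not_in[OF countable_imp_null_set_lborel[OF this]] show ?thesis
      by eventually_elim (metis add_minus_cancel image_eqI minus_add_cancel)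
  qed
  have ae: "AE h in L. x + fst h \<notin> \<Gamma> \<and> y + snd h \<noteq> x + fst h \<and> y + snd h \<notin> \<Gamma>"
  proof (rule lborel_pair.AE_pair_measure)
    show "{h \<in> space L. x + fst h \<notin> \<Gamma> \<and> y + snd h \<noteq> x + fst h \<and> y + snd h \<notin> \<Gamma>} \<in> sets L" by measurable
    show "AE h1 in lborel. AE h2 in lborel. x + fst (h1, h2) \<notin> \<Gamma> \<and> y + snd (h1, h2) \<noteq> x + fst (h1, h2) \<and> y + snd (h1, h2) \<notin> \<Gamma>"
      using nul[OF cnt, of x]
    proof eventually_elim
      fix h1 assume "x + h1 \<notin> \<Gamma>"
      then show "AE h2 in lborel. x + fst (h1, h2) \<notin> \<Gamma> \<and> y + snd (h1, h2) \<noteq> x + fst (h1, h2) \<and> y + snd (h1, h2) \<notin> \<Gamma>"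
        using nul[OF countable_insert[OF cnt], of y "x + h1"] by (auto elim: eventually_mono)
    qed
  qed
  have "J F p \<gamma> = (\<integral>h. q (y - x) (fst h) (snd h) * (F \<gamma> * (exp (\<phi> (x + fst h) + \<phi> (y + snd h) - \<phi> x - \<phi> y) - 1)) \<partial>L)"
    unfolding J_eq(1)[OF t c] xy(1) fst_conv snd_conv \<Gamma>_def[symmetric]
  proof (rule integral_cong_AE)
    show "(\<lambda>h. q (y - x) (fst h) (snd h) * (F (\<Gamma> \<union> {x + fst h, y + snd h}) - F \<gamma>)) \<in> borel_measurable L"
      using J_eq(2)[OF t c, of p] by (simp add: xy(1) \<Gamma>_def)
    show "AE h in L. q (y - x) (fst h) (snd h) * (F (\<Gamma> \<union> {x + fst h, y + snd h}) - F \<gamma>) =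
        q (y - x) (fst h) (snd h) * (F \<gamma> * (exp (\<phi> (x + fst h) + \<phi> (y + snd h) - \<phi> x - \<phi> y) - 1))"
      using ae
    proof eventually_elim
      fix h assume h: "x + fst h \<notin> \<Gamma> \<and> y + snd h \<noteq> x + fst h \<and> y + snd h \<notin> \<Gamma>"
      have "F (\<Gamma> \<union> {x + fst h, y + snd h}) = exp (\<phi> (y + snd h)) * (exp (\<phi> (x + fst h)) * F \<Gamma>)"
        using F_insert[OF c', of "x + fst h"] F_insert[OF configuration_insert[OF c'], of "y + snd h" "x + fst h"] h
        by (simp add: insert_commute)
      then show "q (y - x) (fst h) (snd h) * (F (\<Gamma> \<union> {x + fst h, y + snd h}) - F \<gamma>) =
        q (y - x) (fst h) (snd h) * (F \<gamma> * (exp (\<phi> (x + fst h) + \<phi> (y + snd h) - \<phi> x - \<phi> y) - 1))"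
        by (simp add: e exp_add exp_diff exp_minus field_simps)
    qed
  qed measurable
  also have "\<dots> = (\<integral>Y. kk p Y * (F \<gamma> * (exp (\<phi> (fst Y) + \<phi> (snd Y) - \<phi> x - \<phi> y) - 1)) \<partial>L)"
    using kk_integral_q[of "\<lambda>Y. F \<gamma> * (exp (\<phi> (fst Y) + \<phi> (snd Y) - \<phi> x - \<phi> y) - 1)" p] by (simp add: xy(1) add.commute)
  finally show ?thesis by (simp add: G_def xy(1) mult.left_commute)
qed

lemma AE_nu: "(AE \<gamma> in \<nu>. P \<gamma>) \<Longrightarrow> AE \<gamma> in M. P \<gamma>"
  unfolding \<nu>_def using F_pos by (subst (asm) AE_density) (auto simp: less_le)

text \<open>
  Compensators cancel in the sum: \<open>g\<close> and \<open>c0\<close> are subtracted in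
  \<open>X1\<close> and added in \<open>X0\<close>.
\<close>

lemma Lop_decomposition: "AE \<gamma> in M. Lop F \<gamma> = F \<gamma> * (X1 \<gamma> + X0 \<gamma>)"
  using AE_nu[OF error.mecke_U(1)] AE_nu[OF limit.mecke_U(1)] AE_space
proof eventually_elim
  fix \<gamma> assume i: "integrable (count_space (offdiag \<gamma>)) (\<lambda>p. 1/2 * K2 p)" "integrable (count_space (offdiag \<gamma>)) H0"
    and "\<gamma> \<in> space M"
  then have c: "\<gamma> \<in> configurations" by simp
  have "(\<integral>p. J F p \<gamma> \<partial>count_space (offdiag \<gamma>)) = (\<integral>p. F \<gamma> * G p \<partial>count_space (offdiag \<gamma>))"
    by (rule Bochner_Integration.integral_cong[OF refl]) (simp add: J_F[OF c])
  then have "Lop F \<gamma> = 1/2 * (\<integral>p. F \<gamma> * G p \<partial>count_space (offdiag \<gamma>))" by (simp add: Lop_def)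
  also have "(\<integral>p. F \<gamma> * G p \<partial>count_space (offdiag \<gamma>)) = (\<integral>p. 2 * F \<gamma> * (1/2 * K2 p + H0 p) \<partial>count_space (offdiag \<gamma>))"
    by (intro Bochner_Integration.integral_cong refl) (simp add: K2_eq H0_def algebra_simps)
  also have "1/2 * \<dots> = F \<gamma> * (\<integral>p. 1/2 * K2 p + H0 p \<partial>count_space (offdiag \<gamma>))"
    by (simp only: integral_mult_right_zero)
  finally show "Lop F \<gamma> = F \<gamma> * (X1 \<gamma> + X0 \<gamma>)" using i by (simp add: X1_def X0_def)
qed

lemma X_measurable [measurable]: "X0 \<in> borel_measurable CB" "X1 \<in> borel_measurable CB"
  using limit.meas(3) error.meas(3) by (simp_all cong: measurable_cong_sets)

lemma F_X0_square: "integrable M (\<lambda>\<gamma>. (F \<gamma> * X0 \<gamma>)\<^sup>2)"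
  by (rule in_L2_F_times(1)[OF X_measurable(1) limit.integrable_X2])

lemma in_L2_Lop_F: "in_L2 M (Lop F)"
proof -
  have [measurable]: "Lop F \<in> borel_measurable M" using Lop_measurable[OF F_measurable] by (simp cong: measurable_cong_sets)
  have "integrable \<nu> (\<lambda>\<gamma>. (X1 \<gamma> + X0 \<gamma>)\<^sup>2)"
  proof (rule Bochner_Integration.integrable_bound)
    show "integrable \<nu> (\<lambda>\<gamma>. 2 * (X1 \<gamma>)\<^sup>2 + 2 * (X0 \<gamma>)\<^sup>2)" using error.integrable_X2 limit.integrable_X2 by simp
    have "(s + t)\<^sup>2 \<le> 2 * s\<^sup>2 + 2 * t\<^sup>2" for s t :: real
      using zero_le_power2[of "s - t"] by (simp add: power2_eq_square algebra_simps)
    then show "AE \<gamma> in \<nu>. norm ((X1 \<gamma> + X0 \<gamma>)\<^sup>2) \<le> norm (2 * (X1 \<gamma>)\<^sup>2 + 2 * (X0 \<gamma>)\<^sup>2)" by simp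
  qed measurable
  from in_L2_F_times(1)[OF _ this] have i: "integrable M (\<lambda>\<gamma>. (F \<gamma> * (X1 \<gamma> + X0 \<gamma>))\<^sup>2)" by simp
  have "integrable M (\<lambda>\<gamma>. (Lop F \<gamma>)\<^sup>2)"
    by (rule iffD2[OF integrable_cong_AE i]) (use Lop_decomposition in \<open>auto elim: eventually_mono\<close>)
  then show ?thesis by (simp add: in_L2_def)
qed

lemma L2_error:
  assumes u: "AE \<gamma> in M. u \<gamma> = Lop F \<gamma>" and v: "AE \<gamma> in M. v \<gamma> = F \<gamma> * X0 \<gamma>"
    and m: "u \<in> borel_measurable M" "v \<in> borel_measurable M"
  shows "L2_norm M (\<lambda>\<gamma>. u \<gamma> - v \<gamma>) \<le> sqrt (measure \<nu> (space \<nu>) * (cc\<^sup>2 + chs * wm * cht + 2 * (csup * (wm * wm) * ctot)))"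
proof -
  have "(\<integral>\<gamma>. (u \<gamma> - v \<gamma>)\<^sup>2 \<partial>M) = (\<integral>\<gamma>. (F \<gamma> * X1 \<gamma>)\<^sup>2 \<partial>M)"
  proof (rule integral_cong_AE)
    show "AE \<gamma> in M. (u \<gamma> - v \<gamma>)\<^sup>2 = (F \<gamma> * X1 \<gamma>)\<^sup>2"
      using u v Lop_decomposition by eventually_elim (simp add: algebra_simps)
  qed (use m in measurable)
  also have "\<dots> = (\<integral>\<gamma>. (X1 \<gamma>)\<^sup>2 \<partial>\<nu>)" by (rule in_L2_F_times(2)[OF X_measurable(2) error.integrable_X2])
  finally show ?thesis unfolding L2_norm_def using error_second_moment by simp
qed

end

section \<open>From real rates to extended rates\<close>

text \<open>
  Changing \<open>b\<close> on a null set, in particular where it is infinite or above its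
  essential supremum, affects only a null set of configurations.
\<close>

lemma (in poisson_configuration) AE_differences:
  assumes N: "N \<in> null_sets lborel"
  shows "AE \<gamma> in M. \<forall>p\<in>offdiag \<gamma>. snd p - fst p \<notin> N"
proof -
  let ?\<mu> = "density lborel (\<lambda>_::'a. ennreal z)"
  have [measurable]: "N \<in> sets borel" using N by (auto simp: null_sets_def)
  have tr: "AE y in lborel. y - x \<notin> N" for x :: 'a
  proof -
    have "(\<integral>\<^sup>+y. indicator N (y - x) \<partial>lborel) = (\<integral>\<^sup>+y. indicator N y \<partial>lborel)"
      using nn_integral_shift[of "indicator N" "- x"] by simp
    then have "(\<integral>\<^sup>+y. indicator N (y - x) \<partial>lborel) = 0" using N by (simp add: null_setsD1)
    then show ?thesis by (subst (asm) nn_integral_0_iff_AE) (auto simp: indicator_def split: if_splits elim: eventually_mono)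
  qed
  have 1: "AE X in ?\<mu> \<Otimes>\<^sub>M ?\<mu>. snd X - fst X \<notin> N"
  proof (rule mm.AE_pair_measure)
    show "{X \<in> space (?\<mu> \<Otimes>\<^sub>M ?\<mu>). snd X - fst X \<notin> N} \<in> sets (?\<mu> \<Otimes>\<^sub>M ?\<mu>)" by measurable
    show "AE x in ?\<mu>. AE y in ?\<mu>. snd (x, y) - fst (x, y) \<notin> N" using tr by (simp add: AE_density)
  qed
  have "(\<integral>\<^sup>+\<gamma>. \<integral>\<^sup>+p. indicator N (snd p - fst p) \<partial>count_space (offdiag \<gamma>) \<partial>M) =
      (\<integral>\<^sup>+w. indicator N (snd (fst w) - fst (fst w)) \<partial>((?\<mu> \<Otimes>\<^sub>M ?\<mu>) \<Otimes>\<^sub>M M))"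
    using mecke2[of "\<lambda>w. indicator N (snd (fst w) - fst (fst w))"] by (simp add: case_prod_beta')
  also have "\<dots> = 0" using mmn.AE_pair_fst[OF 1] by (subst nn_integral_0_iff_AE) (auto elim: eventually_mono)
  finally have "AE \<gamma> in M. (\<integral>\<^sup>+p. indicator N (snd p - fst p) \<partial>count_space (offdiag \<gamma>)) = 0"
    by (subst (asm) nn_integral_0_iff_AE) (auto intro!: measurable_nn_sum_offdiag)
  then show ?thesis
    by eventually_elim (auto simp: nn_integral_0_iff_AE AE_count_space indicator_def split: if_splits)
qed

lemma scaled_rate_measurable [measurable (raw)]:
  assumes [measurable]: "a \<in> borel_measurable borel" "b \<in> borel_measurable borel"
    "f \<in> N \<rightarrow>\<^sub>M borel" "g \<in> N \<rightarrow>\<^sub>M borel" "h \<in> N \<rightarrow>\<^sub>M borel"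
  shows "(\<lambda>w. scaled_rate a b \<epsilon> (f w) (g w) (h w)) \<in> borel_measurable N"
  unfolding scaled_rate_def by measurable

lemma pair_sum_alt: "pair_sum \<gamma> f = 1/2 * (\<integral>p. f (fst p) (snd p) \<partial>count_space (offdiag \<gamma>))"
  unfolding pair_sum_def offdiag_def infsum_eq_integral_count_space by (simp add: case_prod_beta')

lemma binary_jump_operator_alt:
  "binary_jump_operator r v \<gamma> = 1/2 * (\<integral>p. (\<integral>h1. (\<integral>h2. enn2real (r (snd p - fst p) h1 h2) *
     (v (\<gamma> - {fst p, snd p} \<union> {fst p + h1, snd p + h2}) - v \<gamma>) \<partial>lborel) \<partial>lborel) \<partial>count_space (offdiag \<gamma>))"
  unfolding binary_jump_operator_def pair_sum_alt ..

lemma (in jump_rates) binary_jump_operator_eq: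
  assumes ab [measurable]: "a \<in> borel_measurable borel" "b \<in> borel_measurable borel" and \<epsilon>: "\<epsilon> > 0"
    and a: "\<And>h. \<alpha> h = \<epsilon> ^ DIM('a) * enn2real (a (\<epsilon> *\<^sub>R h))" and b: "AE x in lborel. b x = ennreal (\<beta> x)"
    and v [measurable]: "v \<in> borel_measurable CB"
  shows "binary_jump_operator (scaled_rate a b \<epsilon>) v \<in> borel_measurable CB" (is ?Q)
    and "AE \<gamma> in M. binary_jump_operator (scaled_rate a b \<epsilon>) v \<gamma> = Lop v \<gamma>" (is ?P)
proof -
  have 1: "(\<lambda>\<gamma>::'a set. \<gamma>) \<in> CB \<rightarrow>\<^sub>M CB" by measurable
  show ?Q
    unfolding binary_jump_operator_alt[abs_def]
    by (intro borel_measurable_times borel_measurable_const measurable_real_sum_offdiag 1) measurable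
  obtain N where N: "N \<in> null_sets lborel" "{x. b x \<noteq> ennreal (\<beta> x)} \<subseteq> N"
    using b by (auto simp: eventually_ae_filter)
  have rate: "enn2real (scaled_rate a b \<epsilon> x h1 h2) = q x h1 h2" if "x \<notin> N" "x + h2 - h1 \<notin> N" for x h1 h2
  proof -
    have "b x + b (x + h2 - h1) = ennreal (\<beta> x + \<beta> (x + h2 - h1))"
    proof -
      have "b x = ennreal (\<beta> x)" "b (x + h2 - h1) = ennreal (\<beta> (x + h2 - h1))" using that N(2) by auto
      then show ?thesis using beta_nonneg by simp
    qed
    then show ?thesis
      using \<epsilon> beta_nonneg by (simp add: scaled_rate_def enn2real_mult q_def a power_mult power2_eq_square power_mult_distrib mult_ac
        mult_2 power_add flip: ennreal_plus)
  qed
  show ?P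
    using AE_differences[OF N(1)] AE_space
  proof eventually_elim
    fix \<gamma> assume no: "\<forall>p\<in>offdiag \<gamma>. snd p - fst p \<notin> N" and "\<gamma> \<in> space M"
    then have c: "\<gamma> \<in> space CB" by (simp add: space_configuration_borel)
    have mv [measurable]: "(\<lambda>h2. v (\<gamma> - {x, y} \<union> {x + h1, y + h2})) \<in> borel_measurable borel" for x y h1
    proof -
      have "(\<lambda>h2. \<gamma> - {x, y} \<union> {x + h1, y + h2}) \<in> borel \<rightarrow>\<^sub>M CB" using c by (intro measurable_move) auto
      from measurable_compose[OF this v] show ?thesis .
    qed
    have "(\<integral>h2. enn2real (scaled_rate a b \<epsilon> (snd p - fst p) h1 h2) * (v (\<gamma> - {fst p, snd p} \<union> {fst p + h1, snd p + h2}) - v \<gamma>) \<partial>lborel)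
        = (\<integral>h2. q (snd p - fst p) h1 h2 * (v (\<gamma> - {fst p, snd p} \<union> {fst p + h1, snd p + h2}) - v \<gamma>) \<partial>lborel)"
      if p: "p \<in> offdiag \<gamma>" for p h1
    proof (rule integral_cong_AE)
      have [measurable]: "N \<in> sets borel" using N by (auto simp: null_sets_def)
      have "(\<integral>\<^sup>+h2. indicator N (h2 + (snd p - fst p - h1)) \<partial>lborel) = 0"
        using nn_integral_shift[of "indicator N" "snd p - fst p - h1"] N by (simp add: null_setsD1)
      then have "AE h2 in lborel. h2 + (snd p - fst p - h1) \<notin> N"
        by (subst (asm) nn_integral_0_iff_AE) (auto simp: indicator_def split: if_splits elim: eventually_mono)
      then show "AE h2 in lborel. enn2real (scaled_rate a b \<epsilon> (snd p - fst p) h1 h2) * (v (\<gamma> - {fst p, snd p} \<union> {fst p + h1, snd p + h2}) - v \<gamma>)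
        = q (snd p - fst p) h1 h2 * (v (\<gamma> - {fst p, snd p} \<union> {fst p + h1, snd p + h2}) - v \<gamma>)"
        by eventually_elim (use no p in \<open>simp add: rate algebra_simps\<close>)
    qed measurable
    note inner = this
    show "binary_jump_operator (scaled_rate a b \<epsilon>) v \<gamma> = Lop v \<gamma>"
      unfolding binary_jump_operator_alt Lop_def J_def
      by (rule arg_cong[of _ _ "\<lambda>s. 1/2 * s"], rule Bochner_Integration.integral_cong[OF refl]) (simp only: space_count_space inner)
  qed
qed

context jump_limit
begin

lemma limit_operator_measurable:
  assumes [measurable]: "b \<in> borel_measurable borel"
  shows "limit_operator z a b F \<in> borel_measurable CB"
proof -
  have 1: "(\<lambda>\<gamma>::'a set. \<gamma>) \<in> CB \<rightarrow>\<^sub>M CB" by measurable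
  have e: "\<gamma> - {x, y} = (\<gamma> - {x}) - {y}" "\<gamma> \<union> {x, y} = insert x (insert y \<gamma>)" "\<gamma> \<union> {x} = insert x \<gamma>" for \<gamma> and x y :: 'a by auto
  have [measurable (raw)]: "(\<lambda>w. g w - {h w}) \<in> N \<rightarrow>\<^sub>M CB" if "g \<in> N \<rightarrow>\<^sub>M CB" "h \<in> N \<rightarrow>\<^sub>M borel" for g h and N :: "'z measure"
    by (rule measurable_remove_configuration[OF that])
  have [measurable (raw)]: "(\<lambda>w. F (insert (h w) (g w))) \<in> borel_measurable N" if "g \<in> N \<rightarrow>\<^sub>M CB" "h \<in> N \<rightarrow>\<^sub>M borel" for g h and N :: "'z measure"
    by (rule measurable_compose[OF measurable_insert_configuration[OF that] F_measurable])
  have [measurable]: "(\<lambda>\<gamma>. \<integral>x. \<integral>y. enn2real (b (y - x)) * (F (insert x (insert y \<gamma>)) - F \<gamma>) \<partial>lborel \<partial>lborel) \<in> borel_measurable CB"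
    "(\<lambda>\<gamma>. \<integral>x. F (insert x \<gamma>) - F \<gamma> \<partial>lborel) \<in> borel_measurable CB"
    by measurable
  have [measurable]: "(\<lambda>\<gamma>. pair_sum \<gamma> (\<lambda>x y. enn2real (b (y - x)) * (F (\<gamma> - {x} - {y}) - F \<gamma>))) \<in> borel_measurable CB"
    unfolding pair_sum_alt e
    by (intro borel_measurable_times borel_measurable_const measurable_real_sum_offdiag 1) measurable
  have [measurable]: "(\<lambda>\<gamma>. \<Sum>\<^sub>\<infinity>x\<in>\<gamma>. F (\<gamma> - {x}) - F \<gamma>) \<in> borel_measurable CB"
    unfolding infsum_eq_integral_count_space by (intro measurable_real_sum 1) measurable
  show ?thesis unfolding limit_operator_def[abs_def] e integral_mult_right_zero by measurable
qed

text \<open>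
  Deaths of pairs, deaths of single points, and the two creation terms correspond in this order
  to \<open>H0\<close>, \<open>g\<close> and the two parts of \<open>c0\<close>.
\<close>

lemma limit_operator_eq:
  assumes [measurable]: "b \<in> borel_measurable borel" and ab: "total_mass a = A" "total_mass b = B"
    and b: "AE x in lborel. b x = ennreal (\<beta> x)"
  shows "AE \<gamma> in M. limit_operator z a b F \<gamma> = F \<gamma> * X0 \<gamma>"
proof -
  obtain N where N: "N \<in> null_sets lborel" "{x. b x \<noteq> ennreal (\<beta> x)} \<subseteq> N"
    using b by (auto simp: eventually_ae_filter)
  have [measurable]: "N \<in> sets borel" using N by (auto simp: null_sets_def)
  have bN: "enn2real (b x) = \<beta> x" if "x \<notin> N" for x
  proof -
    have "b x = ennreal (\<beta> x)" using that N(2) by auto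
    then show ?thesis using beta_nonneg by simp
  qed
  show ?thesis using AE_differences[OF N(1)] AE_space
  proof eventually_elim
    fix \<gamma> assume no: "\<forall>p\<in>offdiag \<gamma>. snd p - fst p \<notin> N" and "\<gamma> \<in> space M"
    then have c: "\<gamma> \<in> configurations" by simp
    then have cs: "\<gamma> \<in> space CB" by (simp add: space_configuration_borel)
    have r1: "F (\<gamma> - {x}) - F \<gamma> = F \<gamma> * m x" if "x \<in> \<gamma>" for x using F_remove[OF c that] by (simp add: m_def algebra_simps)
    have r2: "F (\<gamma> - {x, y}) - F \<gamma> = F \<gamma> * mm (x, y)" if "x \<in> \<gamma>" "y \<in> \<gamma>" "x \<noteq> y" for x y
    proof -
      have "\<gamma> - {x, y} = (\<gamma> - {x}) - {y}" by auto
      then show ?thesis using F_remove[OF c that(1)] F_remove[of "\<gamma> - {x}" y] configuration_subset[OF c, of "\<gamma> - {x}"] that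
        by (auto simp: mm_def exp_diff exp_minus field_simps)
    qed
    have nul: "AE x in lborel. x \<notin> D" if "countable D" for D :: "'a set"
      by (rule Measure_Space.AE_not_in[OF countable_imp_null_set_lborel[OF that]])
    have cnt: "countable \<gamma>" by (rule countable_configuration[OF c])
    have [measurable]: "(\<lambda>y. F (insert y \<gamma>')) \<in> borel_measurable borel" if "\<gamma>' \<in> configurations" for \<gamma>'
    proof -
      have "(\<lambda>y. insert y \<gamma>') \<in> borel \<rightarrow>\<^sub>M CB" using that by (intro measurable_insert_configuration) (auto simp: space_configuration_borel)
      from measurable_compose[OF this F_measurable] show ?thesis .
    qed
    have t1: "pair_sum \<gamma> (\<lambda>x y. enn2real (b (y - x)) * (F (\<gamma> - {x, y}) - F \<gamma>)) =
        F \<gamma> * (1/2 * (\<integral>p. \<beta> (snd p - fst p) * mm p \<partial>count_space (offdiag \<gamma>)))"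
    proof -
      have "(\<integral>p. enn2real (b (snd p - fst p)) * (F (\<gamma> - {fst p, snd p}) - F \<gamma>) \<partial>count_space (offdiag \<gamma>)) =
          (\<integral>p. F \<gamma> * (\<beta> (snd p - fst p) * mm p) \<partial>count_space (offdiag \<gamma>))"
      proof (rule Bochner_Integration.integral_cong[OF refl])
        fix p assume "p \<in> space (count_space (offdiag \<gamma>))"
        then have p: "p \<in> offdiag \<gamma>" by simp
        then show "enn2real (b (snd p - fst p)) * (F (\<gamma> - {fst p, snd p}) - F \<gamma>) = F \<gamma> * (\<beta> (snd p - fst p) * mm p)"
          using bN[of "snd p - fst p"] no r2[of "fst p" "snd p"] by (auto simp: offdiag_def)
      qed
      then show ?thesis
        unfolding pair_sum_alt by simp
    qed
    have t2: "(\<Sum>\<^sub>\<infinity>x\<in>\<gamma>. F (\<gamma> - {x}) - F \<gamma>) = F \<gamma> * (\<integral>x. m x \<partial>count_space \<gamma>)"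
    proof -
      have "(\<integral>x. F (\<gamma> - {x}) - F \<gamma> \<partial>count_space \<gamma>) = (\<integral>x. F \<gamma> * m x \<partial>count_space \<gamma>)"
        by (rule Bochner_Integration.integral_cong[OF refl]) (simp add: r1)
      then show ?thesis by (simp add: infsum_eq_integral_count_space)
    qed
    have t3: "(\<integral>x. z * (F (\<gamma> \<union> {x}) - F \<gamma>) \<partial>lborel) = F \<gamma> * (z * IE)"
    proof -
      have "(\<integral>x. z * (F (\<gamma> \<union> {x}) - F \<gamma>) \<partial>lborel) = (\<integral>x. F \<gamma> * z * E x \<partial>lborel)"
      proof (rule integral_cong_AE)
        show "AE x in lborel. z * (F (\<gamma> \<union> {x}) - F \<gamma>) = F \<gamma> * z * E x"
          using nul[OF cnt] by eventually_elim (simp add: F_insert[OF c] E_def algebra_simps)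
      qed (use c in \<open>simp_all\<close>)
      then show ?thesis by (simp add: IE_def)
    qed
    have "(\<integral>x1. z * (\<integral>x2. z * (enn2real (b (x2 - x1)) * (F (\<gamma> \<union> {x1, x2}) - F \<gamma>)) \<partial>lborel) \<partial>lborel)
        = (\<integral>x1. F \<gamma> * z * z * (\<integral>x2. \<beta> (x2 - x1) * pp (x1, x2) \<partial>lborel) \<partial>lborel)"
    proof (rule integral_cong_AE)
      have [measurable]: "(\<lambda>w. F (\<gamma> \<union> {fst w, snd w})) \<in> borel_measurable (borel \<Otimes>\<^sub>M borel)"
      proof -
        have "(\<lambda>w::'a \<times> 'a. insert (fst w) (insert (snd w) \<gamma>)) \<in> borel \<Otimes>\<^sub>M borel \<rightarrow>\<^sub>M CB"
          using cs by (intro measurable_insert_configuration) auto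
        from measurable_compose[OF this F_measurable] show ?thesis by (simp add: insert_commute)
      qed
      show "(\<lambda>x1. z * (\<integral>x2. z * (enn2real (b (x2 - x1)) * (F (\<gamma> \<union> {x1, x2}) - F \<gamma>)) \<partial>lborel)) \<in> borel_measurable lborel"
      proof -
        have "(\<lambda>(x1, x2). z * (enn2real (b (x2 - x1)) * (F (\<gamma> \<union> {fst (x1, x2), snd (x1, x2)}) - F \<gamma>))) \<in> borel_measurable (borel \<Otimes>\<^sub>M lborel)"
          by measurable
        from lborel.borel_measurable_lebesgue_integral[OF this] show ?thesis by simp
      qed
      show "AE x1 in lborel. z * (\<integral>x2. z * (enn2real (b (x2 - x1)) * (F (\<gamma> \<union> {x1, x2}) - F \<gamma>)) \<partial>lborel) =
          F \<gamma> * z * z * (\<integral>x2. \<beta> (x2 - x1) * pp (x1, x2) \<partial>lborel)"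
        using nul[OF cnt]
      proof eventually_elim
        fix x1 assume x1: "x1 \<notin> \<gamma>"
        have c1: "insert x1 \<gamma> \<in> configurations" by (rule configuration_insert[OF c])
        have ins: "\<gamma> \<union> {x1, x2} = insert x2 (insert x1 \<gamma>)" for x2 by auto
        have "(\<integral>x2. z * (enn2real (b (x2 - x1)) * (F (\<gamma> \<union> {x1, x2}) - F \<gamma>)) \<partial>lborel) =
            (\<integral>x2. F \<gamma> * z * (\<beta> (x2 - x1) * pp (x1, x2)) \<partial>lborel)"
        proof (rule integral_cong_AE)
          have "(\<integral>\<^sup>+x2. indicator N (x2 + - x1) \<partial>lborel) = 0"
            using nn_integral_shift[of "indicator N" "- x1"] N by (simp add: null_setsD1)
          then have nN: "AE x2 in lborel. x2 - x1 \<notin> N"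
            by (subst (asm) nn_integral_0_iff_AE) (auto simp: indicator_def split: if_splits elim: eventually_mono)
          have Fpp: "F (\<gamma> \<union> {x1, x2}) - F \<gamma> = F \<gamma> * pp (x1, x2)" if "x2 \<notin> insert x1 \<gamma>" for x2
            unfolding ins F_insert[OF c1 that] F_insert[OF c x1] by (simp add: pp_def exp_add algebra_simps)
          show "AE x2 in lborel. z * (enn2real (b (x2 - x1)) * (F (\<gamma> \<union> {x1, x2}) - F \<gamma>)) = F \<gamma> * z * (\<beta> (x2 - x1) * pp (x1, x2))"
            using nN nul[OF countable_insert[OF cnt], of x1] by eventually_elim (simp only: Fpp bN mult_ac not_False_eq_True)
        qed (unfold ins, use c1 in measurable)
        then show "z * (\<integral>x2. z * (enn2real (b (x2 - x1)) * (F (\<gamma> \<union> {x1, x2}) - F \<gamma>)) \<partial>lborel) =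
          F \<gamma> * z * z * (\<integral>x2. \<beta> (x2 - x1) * pp (x1, x2) \<partial>lborel)" by simp
      qed
    qed measurable
    also have "\<dots> = F \<gamma> * (z * z * Ip)"
      using lborel_pair.integral_fst'[OF integrable_kernel_pp(1)[OF beta_int beta_even beta_abs beta_meas]] by (simp add: Ip_def)
    finally have t4: "(\<integral>x1. z * (\<integral>x2. z * (enn2real (b (x2 - x1)) * (F (\<gamma> \<union> {x1, x2}) - F \<gamma>)) \<partial>lborel) \<partial>lborel) = F \<gamma> * (z * z * Ip)" .
    have h0: "(\<integral>p. H0 p \<partial>count_space (offdiag \<gamma>)) = A * A * (1/2 * (\<integral>p. \<beta> (snd p - fst p) * mm p \<partial>count_space (offdiag \<gamma>)))"
      and g0: "(\<integral>x. - g x \<partial>count_space \<gamma>) = - (z * (A * A * B) * (\<integral>x. m x \<partial>count_space \<gamma>))"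
      unfolding H0_def g_def by simp_all
    show "limit_operator z a b F \<gamma> = F \<gamma> * X0 \<gamma>"
      unfolding limit_operator_def t1 t2 t3 t4 X0_def h0 g0 c0_def ab by (simp add: power2_eq_square algebra_simps)
  qed
qed

end

section \<open>The scaling limit\<close>

text \<open>
  The bound for the second moment of the error, per unit mass of the tilted measure, as a
  function of the spread \<open>\<delta>\<close>. The arguments stay the same along the scaling,
  except for \<open>\<delta>\<close>.
\<close>

definition chaos_error :: "real \<Rightarrow> real \<Rightarrow> real \<Rightarrow> real \<Rightarrow> real \<Rightarrow> real \<Rightarrow> real" where
  "chaos_error z A B b0 S \<delta> =
     (z * z / 2 * (2 * (A * \<delta> * (S * S)) + A * \<delta> * (S * S) + (1 + S) * (1 + S) * (2 * S * ((3 * A * B + A * S) * \<delta>))))\<^sup>2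
     + (z * S * (A * \<delta> * S) + S * (z * S * S) * (A * \<delta> * S) + S * S * (1 + S) * (z * S * S) * ((3 * A * B + A * S) * \<delta>))
       * (z * S * S) * (z * S * (A * A * B * S) + S * (z * S * S) * (A * A * B * S) + S * S * (1 + S) * (z * S * S) * (4 * A * A * B * S))
     + 2 * (((1 + S) * (A * S + A * S) + S * S * (1 + S) * (4 * b0 * A)) * \<delta> * (z * S * S * (z * S * S))
       * ((1 + S) * (2 * (A * A * B) * S) + S * S * (1 + S) * (4 * A * A * B * S)))"

lemma chaos_error_tendsto: "((\<lambda>\<delta>. chaos_error z A B b0 S \<delta>) \<longlongrightarrow> 0) (at_right 0)"
proof -
  have "isCont (\<lambda>\<delta>. chaos_error z A B b0 S \<delta>) 0" unfolding chaos_error_def by (intro continuous_intros)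
  moreover have "chaos_error z A B b0 S 0 = 0" by (simp add: chaos_error_def)
  ultimately show ?thesis by (metis at_within_le_at continuous_at tendsto_mono isCont_def)
qed

lemma (in jump_limit) chaos_error_eq:
  "cc\<^sup>2 + chs * wm * cht + 2 * (csup * (wm * wm) * ctot) = chaos_error z A B b0 S \<delta>"
  by (simp only: cc_def chs_def cht_def csup_def ctot_def wm_def cR_def chaos_error_def)

theorem (in jump_limit) generator_exp:
  assumes a [measurable]: "a \<in> borel_measurable borel" and b [measurable]: "b \<in> borel_measurable borel" and \<epsilon>: "\<epsilon> > 0"
    and al: "\<And>h. \<alpha> h = \<epsilon> ^ DIM('a) * enn2real (a (\<epsilon> *\<^sub>R h))" and be: "AE x in lborel. b x = ennreal (\<beta> x)"
    and ab: "total_mass a = A" "total_mass b = B"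
  shows "F \<in> Domain (binary_jump_generator M (scaled_rate a b \<epsilon>))" (is ?P)
    and "in_L2 M (limit_operator z a b F)"
    and "\<And>w. (F, w) \<in> binary_jump_generator M (scaled_rate a b \<epsilon>) \<Longrightarrow>
      L2_norm M (\<lambda>\<gamma>. w \<gamma> - limit_operator z a b F \<gamma>) \<le> sqrt (measure \<nu> (space \<nu>) * chaos_error z A B b0 S \<delta>)"
proof -
  let ?T = "\<lambda>v \<gamma>. - binary_jump_operator (scaled_rate a b \<epsilon>) v \<gamma>"
  have T: "?T v \<in> borel_measurable M \<and> (AE \<gamma> in M. ?T v \<gamma> = - Lop v \<gamma>)" if "v \<in> cylinder_functions" for v
    using binary_jump_operator_eq[OF a b \<epsilon> al be cylinder_measurable[OF that]] by (simp cong: measurable_cong_sets)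
  have "(F, \<lambda>\<gamma>. - Lop F \<gamma>) \<in> friedrichs_extension M cylinder_functions ?T"
    by (rule exp_in_friedrichs(1)[OF _ in_L2_Lop_F]) (rule T)
  then have "(F, Lop F) \<in> binary_jump_generator M (scaled_rate a b \<epsilon>)" by (simp add: binary_jump_generator_def)
  then show ?P by blast
  have lm: "limit_operator z a b F \<in> borel_measurable M" using limit_operator_measurable[OF b] by (simp cong: measurable_cong_sets)
  note le = limit_operator_eq[OF b ab be]
  have "integrable M (\<lambda>\<gamma>. (limit_operator z a b F \<gamma>)\<^sup>2)"
    by (rule iffD2[OF integrable_cong_AE F_X0_square]) (use lm le in \<open>auto elim: eventually_mono\<close>)
  then show "in_L2 M (limit_operator z a b F)" using lm by (simp add: in_L2_def)
  fix w assume "(F, w) \<in> binary_jump_generator M (scaled_rate a b \<epsilon>)"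
  then have w: "(F, \<lambda>\<gamma>. - w \<gamma>) \<in> friedrichs_extension M cylinder_functions ?T" by (simp add: binary_jump_generator_def)
  have ae: "AE \<gamma> in M. - w \<gamma> = - Lop F \<gamma>"
    by (rule exp_in_friedrichs(2)[OF _ in_L2_Lop_F w]) (rule T)
  from w have "in_L2 M (\<lambda>\<gamma>. - w \<gamma>)" by (simp add: friedrichs_extension_def)
  then have "w \<in> borel_measurable M" by (simp add: in_L2_def)
  then show "L2_norm M (\<lambda>\<gamma>. w \<gamma> - limit_operator z a b F \<gamma>) \<le> sqrt (measure \<nu> (space \<nu>) * chaos_error z A B b0 S \<delta>)"
    using L2_error[OF _ le _ lm, of w] ae unfolding chaos_error_eq by (auto elim: eventually_mono)
qed

lemma nn_integral_scale:
  fixes f :: "'a::euclidean_space \<Rightarrow> ennreal"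
  assumes [measurable]: "f \<in> borel_measurable borel" and \<epsilon>: "\<epsilon> > 0"
  shows "(\<integral>\<^sup>+x. ennreal (\<epsilon> ^ DIM('a)) * f (\<epsilon> *\<^sub>R x) \<partial>lborel) = (\<integral>\<^sup>+x. f x \<partial>lborel)"
proof -
  have "(\<integral>\<^sup>+x. f x \<partial>lborel) = (\<integral>\<^sup>+x. f x \<partial>density (distr lborel borel (\<lambda>x. 0 + \<epsilon> *\<^sub>R x)) (\<lambda>_. ennreal (\<bar>\<epsilon>\<bar> ^ DIM('a))))"
    using lborel_affine[of \<epsilon> "0::'a"] \<epsilon> by simp
  also have "\<dots> = (\<integral>\<^sup>+x. ennreal (\<epsilon> ^ DIM('a)) * f (\<epsilon> *\<^sub>R x) \<partial>lborel)"
    using \<epsilon> by (simp add: nn_integral_density nn_integral_distr)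
  finally show ?thesis ..
qed

text \<open>
  Cut \<open>p\<close> at height \<open>n\<close>. The excess has small mass, and scaling
  preserves mass; the bounded part is at most \<open>\<epsilon>^d * n\<close> after scaling and
  is integrated against an integrable function.
\<close>

lemma dilated_convolution_small:
  fixes p f :: "'a::euclidean_space \<Rightarrow> real"
  assumes p: "integrable lborel p" "\<And>x. p x \<ge> 0" and f: "integrable lborel f" "\<And>x. f x \<ge> 0" "\<And>x. f x \<le> s" and \<delta>: "\<delta> > 0"
  shows "\<forall>\<^sub>F \<epsilon> in at_right 0. \<forall>x. (\<integral>\<^sup>+h. ennreal (\<epsilon> ^ DIM('a) * p (\<epsilon> *\<^sub>R h) * f (x + h)) \<partial>lborel) \<le> ennreal \<delta>"
proof -
  have [measurable]: "p \<in> borel_measurable borel" "f \<in> borel_measurable borel" using p(1) f(1) by auto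
  have s: "s \<ge> 0" using f(2,3)[of 0] by linarith
  define t where "t n x = p x - min (p x) (real n)" for n x
  have t: "0 \<le> t n x" "t n x \<le> p x" for n x using p(2)[of x] by (auto simp: t_def)
  have [measurable]: "t n \<in> borel_measurable borel" for n unfolding t_def by measurable
  have it: "integrable lborel (t n)" for n
    using p(1) by (rule Bochner_Integration.integrable_bound) (use t p(2) in \<open>auto intro!: AE_I2\<close>)
  have "(\<lambda>n. \<integral>x. t n x \<partial>lborel) \<longlonglongrightarrow> (\<integral>x. 0 \<partial>(lborel :: 'a measure))"
  proof (rule integral_dominated_convergence[OF _ _ p(1)])
    have "(\<lambda>n. t n x) \<longlonglongrightarrow> 0" for x
      by (rule tendsto_eventually, rule eventually_mono[OF eventually_ge_at_top[of "nat \<lceil>p x\<rceil>"]])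
         (simp add: t_def)
    then show "AE x in lborel. (\<lambda>n. t n x) \<longlonglongrightarrow> 0" by simp
    show "AE x in lborel. norm (t n x) \<le> p x" for n using t by simp
  qed auto
  then have "(\<lambda>n. s * (\<integral>x. t n x \<partial>lborel)) \<longlonglongrightarrow> s * 0" by (intro tendsto_intros) simp
  then have "\<forall>\<^sub>F n in sequentially. s * (\<integral>x. t n x \<partial>lborel) < \<delta> / 2" using \<delta> by (intro order_tendstoD(2)) auto
  then obtain n where n: "s * (\<integral>x. t n x \<partial>lborel) < \<delta> / 2" using eventually_happens by force
  let ?I = "\<integral>x. f x \<partial>lborel"
  have I: "?I \<ge> 0" using f(2) by simp
  \<comment> \<open>The dimension is positive, so that the volume factor tends to zero.\<close>
  have "((\<lambda>\<epsilon>::real. \<epsilon> ^ DIM('a) * (real n * ?I)) \<longlongrightarrow> 0) (at_right 0)" by (rule tendsto_eq_intros | simp)+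
  then have "\<forall>\<^sub>F \<epsilon>::real in at_right 0. \<epsilon> ^ DIM('a) * (real n * ?I) < \<delta> / 2" using \<delta> by (intro order_tendstoD(2)) auto
  moreover have "\<forall>\<^sub>F \<epsilon>::real in at_right 0. \<epsilon> > 0" by (rule eventually_at_right_less)
  ultimately show ?thesis
  proof eventually_elim
    fix \<epsilon> :: real assume e: "\<epsilon> ^ DIM('a) * (real n * ?I) < \<delta> / 2" "\<epsilon> > 0"
    let ?c = "\<epsilon> ^ DIM('a)"
    have c: "?c \<ge> 0" using e(2) by simp
    show "\<forall>x. (\<integral>\<^sup>+h. ennreal (?c * p (\<epsilon> *\<^sub>R h) * f (x + h)) \<partial>lborel) \<le> ennreal \<delta>"
    proof
      fix x
      have b: "ennreal (?c * p (\<epsilon> *\<^sub>R h) * f (x + h)) \<le>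
          ennreal s * (ennreal ?c * ennreal (t n (\<epsilon> *\<^sub>R h))) + ennreal (?c * real n) * ennreal (f (h + x))" for h
      proof -
        have "p (\<epsilon> *\<^sub>R h) * f (x + h) = t n (\<epsilon> *\<^sub>R h) * f (x + h) + min (p (\<epsilon> *\<^sub>R h)) (real n) * f (x + h)"
          by (simp add: t_def algebra_simps)
        also have "\<dots> \<le> t n (\<epsilon> *\<^sub>R h) * s + real n * f (x + h)"
          using t f by (intro add_mono mult_mono) auto
        finally have "?c * (p (\<epsilon> *\<^sub>R h) * f (x + h)) \<le> ?c * (t n (\<epsilon> *\<^sub>R h) * s + real n * f (x + h))"
          using c by (rule mult_left_mono)
        also have "\<dots> = s * (?c * t n (\<epsilon> *\<^sub>R h)) + ?c * real n * f (h + x)" by (simp add: algebra_simps)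
        finally show ?thesis
          using s c t(1) f(2) by (simp add: ennreal_mult[symmetric] mult.assoc ennreal_leI flip: ennreal_plus)
      qed
      have "(\<integral>\<^sup>+h. ennreal (?c * p (\<epsilon> *\<^sub>R h) * f (x + h)) \<partial>lborel) \<le>
          (\<integral>\<^sup>+h. ennreal s * (ennreal ?c * ennreal (t n (\<epsilon> *\<^sub>R h))) + ennreal (?c * real n) * ennreal (f (h + x)) \<partial>lborel)"
        by (rule nn_integral_mono[OF b])
      also have "\<dots> = ennreal s * ennreal (\<integral>x. t n x \<partial>lborel) + ennreal (?c * real n) * ennreal ?I"
        using nn_integral_scale[of "\<lambda>x. ennreal (t n x)" \<epsilon>] e(2) nn_integral_shift[of "\<lambda>x. ennreal (f x)" x]
          nn_integral_eq_integral[OF it[of n]] nn_integral_eq_integral[OF f(1)] t(1) f(2)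
        by (simp add: nn_integral_add nn_integral_cmult)
      also have "\<dots> = ennreal (s * (\<integral>x. t n x \<partial>lborel) + ?c * (real n * ?I))"
        using s c I t(1) by (simp add: ennreal_mult[symmetric] mult.assoc flip: ennreal_plus)
      also have "\<dots> \<le> ennreal \<delta>" using n e(1) by (intro ennreal_leI) linarith
      finally show "(\<integral>\<^sup>+h. ennreal (?c * p (\<epsilon> *\<^sub>R h) * f (x + h)) \<partial>lborel) \<le> ennreal \<delta>" .
    qed
  qed
qed

theorem theorem4:
  fixes a b :: "real ^ 'd \<Rightarrow> ennreal"
    and z :: real
    and \<pi>\<^sub>z :: "(real ^ 'd) set measure"
    and \<phi> :: "real ^ 'd \<Rightarrow> real"
    and F :: "(real ^ 'd) set \<Rightarrow> real"
  assumes "z > 0"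
    and "a \<in> borel_measurable borel" and "b \<in> borel_measurable borel"
    and "\<forall>x. a (- x) = a x" and "\<forall>x. b (- x) = b x"
    and "(\<integral>\<^sup>+x. a x \<partial>lborel) < \<infinity>" and "(\<integral>\<^sup>+x. b x \<partial>lborel) < \<infinity>"
    and "esssup lborel b < \<infinity>"
    and "(b \<longlongrightarrow> 0) at_infinity"
    and "is_poisson_measure z \<pi>\<^sub>z"
    and "\<phi> \<in> continuous_compact_support"
    and "F = (\<lambda>\<gamma>. exp (pairing \<phi> \<gamma>))"
  shows "(\<forall>\<epsilon>>0. F \<in> Domain (binary_jump_generator \<pi>\<^sub>z (scaled_rate a b \<epsilon>))) \<and>
    in_L2 \<pi>\<^sub>z (limit_operator z a b F) \<and>
    (\<forall>L\<^sub>\<epsilon>F. (\<forall>\<epsilon>>0. (F, L\<^sub>\<epsilon>F \<epsilon>) \<in> binary_jump_generator \<pi>\<^sub>z (scaled_rate a b \<epsilon>)) \<longrightarrow>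
      ((\<lambda>\<epsilon>. L2_norm \<pi>\<^sub>z (\<lambda>\<gamma>. L\<^sub>\<epsilon>F \<epsilon> \<gamma> - limit_operator z a b F \<gamma>)) \<longlongrightarrow> 0) (at_right 0))"
proof -
  note [measurable] = assms(2,3)
  interpret tp: tilted_poisson z \<pi>\<^sub>z \<phi> by unfold_locales (fact assms)+
  have F: "tp.F = F" by (simp add: fun_eq_iff tp.F_def assms(12))
  define p where "p x = enn2real (a x)" for x
  \<comment> \<open>A version of b that is bounded everywhere.\<close>
  define \<beta> where "\<beta> x = (if b x \<le> esssup lborel b then enn2real (b x) else 0)" for x
  define C where "C = enn2real (esssup lborel b)"
  define \<alpha> where "\<alpha> \<epsilon> h = \<epsilon> ^ DIM(real ^ 'd) * enn2real (a (\<epsilon> *\<^sub>R h))" for \<epsilon> h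
  have [measurable]: "p \<in> borel_measurable borel" "\<beta> \<in> borel_measurable borel" "\<alpha> \<epsilon> \<in> borel_measurable borel" for \<epsilon>
    unfolding p_def[abs_def] \<beta>_def[abs_def] \<alpha>_def[abs_def] by measurable
  have \<beta>: "\<beta> x \<ge> 0" "\<beta> x \<le> C" "\<beta> (- x) = \<beta> x" for x
    using assms(5,8) by (auto simp: \<beta>_def C_def less_top intro!: enn2real_mono)
  have b\<beta>: "AE x in lborel. b x = ennreal (\<beta> x)"
    using esssup_AE[of b lborel]
  proof eventually_elim
    fix x assume "b x \<le> esssup lborel b"
    then show "b x = ennreal (\<beta> x)" using assms(8) by (auto simp: \<beta>_def ennreal_enn2real_if less_top[symmetric] top_unique)
  qed
  have nn\<beta>: "(\<integral>\<^sup>+x. ennreal (\<beta> x) \<partial>lborel) = (\<integral>\<^sup>+x. b x \<partial>lborel)"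
    by (rule nn_integral_cong_AE) (use b\<beta> in \<open>auto elim: eventually_mono\<close>)
  have i\<beta>: "integrable lborel \<beta>" using nn\<beta> assms(7) \<beta>(1) by (intro integrableI_bounded) auto
  have B: "total_mass b = (\<integral>x. \<beta> x \<partial>lborel)"
    using \<beta>(1) by (simp add: total_mass_def nn\<beta>[symmetric] integral_eq_nn_integral)
  have ip: "integrable lborel p" "(\<integral>x. p x \<partial>lborel) = total_mass a"
    using integral_enn2real[of a lborel] assms(6) by (simp_all add: p_def[abs_def] total_mass_def)
  have nn\<alpha>: "(\<integral>\<^sup>+h. ennreal (\<alpha> \<epsilon> h) \<partial>lborel) = ennreal (total_mass a)" if "\<epsilon> > 0" for \<epsilon>
    using nn_integral_scale[of "\<lambda>x. ennreal (p x)" \<epsilon>] that nn_integral_eq_integral[OF ip(1)] ip(2)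
    by (simp add: \<alpha>_def p_def ennreal_mult)
  have i\<alpha>: "integrable lborel (\<alpha> \<epsilon>)" "(\<integral>h. \<alpha> \<epsilon> h \<partial>lborel) = total_mass a" if "\<epsilon> > 0" for \<epsilon>
  proof -
    show "integrable lborel (\<alpha> \<epsilon>)" using nn\<alpha>[OF that] that by (intro integrableI_bounded) (auto simp: \<alpha>_def)
    show "(\<integral>h. \<alpha> \<epsilon> h \<partial>lborel) = total_mass a"
      using nn\<alpha>[OF that] that by (subst integral_eq_nn_integral) (auto simp: \<alpha>_def total_mass_def)
  qed
  have jt: "jump_tilt z \<pi>\<^sub>z (\<alpha> \<epsilon>) \<beta> C \<phi>" if "\<epsilon> > 0" for \<epsilon>
  proof unfold_locales
    show "\<alpha> \<epsilon> (- h) = \<alpha> \<epsilon> h" for h using assms(4) by (simp add: \<alpha>_def)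
    show "0 \<le> \<alpha> \<epsilon> h" for h using that by (simp add: \<alpha>_def)
  qed (use \<beta> i\<beta> i\<alpha>(1)[OF that] in auto)
  obtain S where S: "tp.size_bound S" using tp.size_bound_exists by blast
  then have E: "\<bar>tp.E x\<bar> \<le> S" for x by (simp add: tp.size_bound_def)
  have C0: "C \<ge> 0" and S0: "S \<ge> 0" using \<beta>(1,2)[of 0] E[of 0] by linarith+
  define err where "err \<delta> = sqrt (measure tp.\<nu> (space tp.\<nu>) * chaos_error z (total_mass a) (total_mass b) C S \<delta>)" for \<delta>
  have main: "F \<in> Domain (binary_jump_generator \<pi>\<^sub>z (scaled_rate a b \<epsilon>))" "in_L2 \<pi>\<^sub>z (limit_operator z a b F)"
      "(F, w) \<in> binary_jump_generator \<pi>\<^sub>z (scaled_rate a b \<epsilon>) \<Longrightarrow> L2_norm \<pi>\<^sub>z (\<lambda>\<gamma>. w \<gamma> - limit_operator z a b F \<gamma>) \<le> err \<delta>"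
    if "\<epsilon> > 0" and d: "\<delta> \<ge> 0" "\<forall>x. (\<integral>\<^sup>+h. ennreal (\<alpha> \<epsilon> h * \<beta> (x + h)) \<partial>lborel) \<le> ennreal \<delta>"
      "\<forall>x. (\<integral>\<^sup>+h. ennreal (\<alpha> \<epsilon> h * \<bar>tp.E (x + h)\<bar>) \<partial>lborel) \<le> ennreal \<delta>" for \<epsilon> \<delta> w
  proof -
    interpret J: jump_limit z \<pi>\<^sub>z "\<alpha> \<epsilon>" \<beta> C \<phi> S \<delta>
      using jt[OF that(1)] S d by (simp add: jump_limit_def jump_limit_axioms_def)
    have A: "J.A = total_mass a" and B': "J.B = total_mass b" using i\<alpha>(2)[OF that(1)] B by (simp_all add: J.A_def J.B_def)
    note * = J.generator_exp[OF assms(2,3) that(1) \<alpha>_def b\<beta> A[symmetric] B'[symmetric], unfolded F A B']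
    show "F \<in> Domain (binary_jump_generator \<pi>\<^sub>z (scaled_rate a b \<epsilon>))" by (rule *(1))
    show "in_L2 \<pi>\<^sub>z (limit_operator z a b F)" by (rule *(2))
    show "L2_norm \<pi>\<^sub>z (\<lambda>\<gamma>. w \<gamma> - limit_operator z a b F \<gamma>) \<le> err \<delta>"
      if "(F, w) \<in> binary_jump_generator \<pi>\<^sub>z (scaled_rate a b \<epsilon>)" using *(3)[OF that] by (simp add: err_def)
  qed
  \<comment> \<open>For a fixed scaling any spread will do to obtain the domain statement.\<close>
  have triv: "(\<integral>\<^sup>+h. ennreal (\<alpha> \<epsilon> h * f (x + h)) \<partial>lborel) \<le> ennreal ((C + S) * total_mass a)"
    if "\<epsilon> > 0" "\<And>x. f x \<ge> 0" "\<And>x. f x \<le> C + S" for \<epsilon> f and x :: "real ^ 'd"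
  proof -
    have "(\<integral>\<^sup>+h. ennreal (\<alpha> \<epsilon> h * f (x + h)) \<partial>lborel) \<le> (\<integral>\<^sup>+h. ennreal (C + S) * ennreal (\<alpha> \<epsilon> h) \<partial>lborel)"
    proof (rule nn_integral_mono)
      fix h
      have a0: "\<alpha> \<epsilon> h \<ge> 0" using that(1) by (simp add: \<alpha>_def)
      have "\<alpha> \<epsilon> h * f (x + h) \<le> (C + S) * \<alpha> \<epsilon> h"
        using mult_left_mono[OF that(3)[of "x + h"] a0] by (simp add: mult.commute)
      then show "ennreal (\<alpha> \<epsilon> h * f (x + h)) \<le> ennreal (C + S) * ennreal (\<alpha> \<epsilon> h)"
        using C0 S0 a0 by (subst ennreal_mult[symmetric]) (auto intro: ennreal_leI)
    qed
    then show ?thesis using nn\<alpha>[OF that(1)] C0 S0 by (simp add: nn_integral_cmult ennreal_mult total_mass_def)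
  qed
  have rough: "F \<in> Domain (binary_jump_generator \<pi>\<^sub>z (scaled_rate a b \<epsilon>))" "in_L2 \<pi>\<^sub>z (limit_operator z a b F)" if "\<epsilon> > 0" for \<epsilon>
  proof -
    have 0: "(C + S) * total_mass a \<ge> 0" using C0 S0 by (simp add: total_mass_def)
    have 1: "\<forall>x. (\<integral>\<^sup>+h. ennreal (\<alpha> \<epsilon> h * \<beta> (x + h)) \<partial>lborel) \<le> ennreal ((C + S) * total_mass a)"
      using triv[OF that, of \<beta>] \<beta>(1,2) S0 by (simp add: add_increasing2)
    have 2: "\<forall>x. (\<integral>\<^sup>+h. ennreal (\<alpha> \<epsilon> h * \<bar>tp.E (x + h)\<bar>) \<partial>lborel) \<le> ennreal ((C + S) * total_mass a)"
      using triv[OF that, of "\<lambda>x. \<bar>tp.E x\<bar>"] E C0 by (simp add: add_increasing)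
    show "F \<in> Domain (binary_jump_generator \<pi>\<^sub>z (scaled_rate a b \<epsilon>))" "in_L2 \<pi>\<^sub>z (limit_operator z a b F)"
      by (rule main(1,2)[OF that 0 1 2])+
  qed
  have lim: "((\<lambda>\<epsilon>. L2_norm \<pi>\<^sub>z (\<lambda>\<gamma>. w \<epsilon> \<gamma> - limit_operator z a b F \<gamma>)) \<longlongrightarrow> 0) (at_right 0)"
    if w: "\<forall>\<epsilon>>0. (F, w \<epsilon>) \<in> binary_jump_generator \<pi>\<^sub>z (scaled_rate a b \<epsilon>)" for w
  proof (rule tendstoI)
    fix r :: real assume r: "r > 0"
    have "(err \<longlongrightarrow> sqrt (measure tp.\<nu> (space tp.\<nu>) * 0)) (at_right 0)"
      unfolding err_def[abs_def] by (intro tendsto_intros chaos_error_tendsto)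
    then have "\<forall>\<^sub>F \<delta> in at_right 0. err \<delta> < r" using r by (intro order_tendstoD(2)) auto
    then have "\<forall>\<^sub>F \<delta> in at_right 0. err \<delta> < r \<and> \<delta> > 0" using eventually_at_right_less by (rule eventually_conj)
    then obtain \<delta> where \<delta>: "err \<delta> < r" "\<delta> > 0" using eventually_happens by force
    have iE: "integrable lborel (\<lambda>x. \<bar>tp.E x\<bar>)" by simp
    have p0: "p x \<ge> 0" for x by (simp add: p_def)
    have "\<forall>\<^sub>F \<epsilon>::real in at_right 0. \<epsilon> > 0" by (rule eventually_at_right_less)
    then show "\<forall>\<^sub>F \<epsilon> in at_right 0. dist (L2_norm \<pi>\<^sub>z (\<lambda>\<gamma>. w \<epsilon> \<gamma> - limit_operator z a b F \<gamma>)) 0 < r"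
      using dilated_convolution_small[OF ip(1) p0 i\<beta> \<beta>(1,2) \<delta>(2)] dilated_convolution_small[OF ip(1) p0 iE abs_ge_zero E \<delta>(2)]
    proof eventually_elim
      case (elim \<epsilon>)
      have "L2_norm \<pi>\<^sub>z (\<lambda>\<gamma>. w \<epsilon> \<gamma> - limit_operator z a b F \<gamma>) \<le> err \<delta>"
        by (rule main(3)) (use elim \<delta>(2) w in \<open>auto simp: \<alpha>_def p_def\<close>)
      then show ?case using \<delta>(1) by (simp add: L2_norm_def)
    qed
  qed
  show ?thesis using rough zero_less_one lim by blast
qed

end
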